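(* Let $d\ge4$, let $T$ be a fixed closed $C^1$ subdomain of the unit ball $B_1\subset\mathbb{R}^d$, and for $\varepsilon\in(0,1)$ set $\Omega_\varepsilon:=B_1\setminus\varepsilon T$. Let $d'=d/(d-1)$. For every $p$ with $d'<p<d$ there is a constant $C=C(p,d)$, independent of $\varepsilon$, such that for every $\varepsilon\in(0,1)$ and every $f\in L^p(\Omega_\varepsilon;\mathbb{R}^d)$, the unique solution $u\in W^{1,p}_0(\Omega_\varepsilon)$ of $$-\Delta u=\operatorname{div} f\ \text{ in }\Omega_\varepsilon,\qquad u=0\ \text{ on }\partial\Omega_\varepsilon=\partial B_1\cup\varepsilon\,\partial T$$ satisfies $$\|\nabla u\|_{L^p(\Omega_\varepsilon)}\le C\,\|f\|_{L^p(\Omega_\varepsilon)}.$$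
   Context: $B_1:=\{x\in\mathbb{R}^d:|x|<1\}$. $T\subset B_1$ is a closed subdomain with $C^1$ boundary, fixed and independent of $\varepsilon$; constants may depend on $T$. $\varepsilon T:=\{\varepsilon x: x\in T\}$. Solutions are weak solutions: $u\in W^{1,p}_0(\Omega_\varepsilon)$ and $\int_{\Omega_\varepsilon}\nabla u\cdot\nabla\phi\,dx=-\int_{\Omega_\varepsilon}f\cdot\nabla\phi\,dx$ for all $\phi\in C_c^\infty(\Omega_\varepsilon)$. For each fixed $\varepsilon$ and $1<p<\infty$, existence and uniqueness in $W^{1,p}_0(\Omega_\varepsilon)$ is a known result of Jerison and Kenig. *)

theory Defs
  imports "HOL-Analysis.Analysis"
begin

section \<open>Smooth functions and test functions\<close>

primrec Ck :: "nat \<Rightarrow> ('a::euclidean_space \<Rightarrow> real) \<Rightarrow> bool" where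
  "Ck 0 f \<longleftrightarrow> continuous_on UNIV f"
| "Ck (Suc k) f \<longleftrightarrow> (\<forall>x. f differentiable at x) \<and>
     (\<forall>b\<in>Basis. Ck k (\<lambda>x. frechet_derivative f (at x) b))"

definition grad :: "('a::euclidean_space \<Rightarrow> real) \<Rightarrow> 'a \<Rightarrow> 'a" where
  "grad f x = (\<Sum>b\<in>Basis. frechet_derivative f (at x) b *\<^sub>R b)"

text \<open>Elements of \<open>C\<^sub>c\<^sup>\<infinity>(\<Omega>)\<close> are represented by their extension by zero to the whole space.\<close>

definition test_functions :: "'a::euclidean_space set \<Rightarrow> ('a \<Rightarrow> real) set" where
  "test_functions \<Omega> =
     {\<phi>. (\<forall>k. Ck k \<phi>) \<and> compact (closure {x. \<phi> x \<noteq> 0}) \<and> closure {x. \<phi> x \<noteq> 0} \<subseteq> \<Omega>}"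


section \<open>Lebesgue and Sobolev spaces\<close>

text \<open>Members of these spaces are functions on the whole space of which only the values on \<open>\<Omega>\<close>,
  up to Lebesgue null sets, matter.\<close>

definition Lp :: "'a::euclidean_space set \<Rightarrow> real \<Rightarrow> ('a \<Rightarrow> 'b::euclidean_space) set" where
  "Lp \<Omega> p = {f. f \<in> borel_measurable (lebesgue_on \<Omega>) \<and>
                 integrable (lebesgue_on \<Omega>) (\<lambda>x. norm (f x) powr p)}"

definition Lp_norm :: "'a::euclidean_space set \<Rightarrow> real \<Rightarrow> ('a \<Rightarrow> 'b::euclidean_space) \<Rightarrow> real" where
  "Lp_norm \<Omega> p f = (LINT x|lebesgue_on \<Omega>. norm (f x) powr p) powr (1 / p)"

definition locally_integrable :: "'a::euclidean_space set \<Rightarrow> ('a \<Rightarrow> 'b::euclidean_space) \<Rightarrow> bool" where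
  "locally_integrable \<Omega> f \<longleftrightarrow> (\<forall>K. compact K \<and> K \<subseteq> \<Omega> \<longrightarrow> f absolutely_integrable_on K)"

definition has_weak_gradient :: "'a::euclidean_space set \<Rightarrow> ('a \<Rightarrow> real) \<Rightarrow> ('a \<Rightarrow> 'a) \<Rightarrow> bool" where
  "has_weak_gradient \<Omega> u g \<longleftrightarrow> locally_integrable \<Omega> u \<and> locally_integrable \<Omega> g \<and>
     (\<forall>\<phi>\<in>test_functions \<Omega>.
        (LINT x|lebesgue_on \<Omega>. u x *\<^sub>R grad \<phi> x) = - (LINT x|lebesgue_on \<Omega>. \<phi> x *\<^sub>R g x))"

text \<open>On an open set a weak gradient is unique up to null sets, so the choice below does not affect
  any integral.\<close>

definition weak_gradient :: "'a::euclidean_space set \<Rightarrow> ('a \<Rightarrow> real) \<Rightarrow> 'a \<Rightarrow> 'a" where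
  "weak_gradient \<Omega> u = (SOME g. has_weak_gradient \<Omega> u g)"

definition W1p :: "'a::euclidean_space set \<Rightarrow> real \<Rightarrow> ('a \<Rightarrow> real) set" where
  "W1p \<Omega> p = {u. u \<in> Lp \<Omega> p \<and> (\<exists>g. has_weak_gradient \<Omega> u g) \<and> weak_gradient \<Omega> u \<in> Lp \<Omega> p}"

text \<open>The closure of \<open>C\<^sub>c\<^sup>\<infinity>(\<Omega>)\<close> in \<open>W\<^sup>1\<^sup>,\<^sup>p(\<Omega>)\<close>.\<close>

definition W1p_0 :: "'a::euclidean_space set \<Rightarrow> real \<Rightarrow> ('a \<Rightarrow> real) set" where
  "W1p_0 \<Omega> p = {u \<in> W1p \<Omega> p. \<exists>\<phi>. (\<forall>n::nat. \<phi> n \<in> test_functions \<Omega>) \<and>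
     (\<lambda>n. Lp_norm \<Omega> p (\<lambda>x. \<phi> n x - u x)) \<longlonglongrightarrow> 0 \<and>
     (\<lambda>n. Lp_norm \<Omega> p (\<lambda>x. grad (\<phi> n) x - weak_gradient \<Omega> u x)) \<longlonglongrightarrow> 0}"


section \<open>The Dirichlet problem\<close>

text \<open>Weak solutions in \<open>W\<^sub>0\<^sup>1\<^sup>,\<^sup>p(\<Omega>)\<close> of \<open>- \<Delta>u = div f\<close> in \<open>\<Omega>\<close>, \<open>u = 0\<close> on \<open>\<partial>\<Omega>\<close>;
  the boundary condition is membership in \<open>W\<^sub>0\<^sup>1\<^sup>,\<^sup>p(\<Omega>)\<close>.\<close>

definition weak_solution ::
    "'a::euclidean_space set \<Rightarrow> real \<Rightarrow> ('a \<Rightarrow> 'a) \<Rightarrow> ('a \<Rightarrow> real) \<Rightarrow> bool" where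
  "weak_solution \<Omega> p f u \<longleftrightarrow> u \<in> W1p_0 \<Omega> p \<and>
     (\<forall>\<phi>\<in>test_functions \<Omega>.
        (LINT x|lebesgue_on \<Omega>. weak_gradient \<Omega> u x \<bullet> grad \<phi> x) =
        - (LINT x|lebesgue_on \<Omega>. f x \<bullet> grad \<phi> x))"


section \<open>Perforated balls\<close>

text \<open>Near each boundary point, \<open>T\<close> is the region below the graph of a \<open>C\<^sup>1\<close> function \<open>\<psi>\<close> over the
  hyperplane orthogonal to a unit vector \<open>e\<close>. Only the values of \<open>\<psi>\<close> on that hyperplane matter.\<close>

definition C1_boundary :: "'a::euclidean_space set \<Rightarrow> bool" where
  "C1_boundary T \<longleftrightarrow> (\<forall>x\<in>frontier T. \<exists>U e \<psi>. open U \<and> x \<in> U \<and> norm e = 1 \<and> Ck 1 \<psi> \<and>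
     T \<inter> U = {y \<in> U. y \<bullet> e \<le> \<psi> (y - (y \<bullet> e) *\<^sub>R e)})"

definition closed_C1_domain :: "'a::euclidean_space set \<Rightarrow> bool" where
  "closed_C1_domain T \<longleftrightarrow> interior T \<noteq> {} \<and> connected (interior T) \<and>
     T = closure (interior T) \<and> C1_boundary T"

definition perforated_ball :: "'a::euclidean_space set \<Rightarrow> real \<Rightarrow> 'a set" where
  "perforated_ball T \<epsilon> = ball 0 1 - (\<lambda>x. \<epsilon> *\<^sub>R x) ` T"

end

theory Submission
  imports Defs
begin

text \<open>Write \<open>Dl l u = (grad u, l u)\<close>. A domain satisfies an inf-sup inequality if the \<open>L\<^sup>p\<close> norm of \<open>Dl l u\<close> is at most
  \<open>K N\<close> whenever its pairing with \<open>Dl l v\<close> is at most \<open>N\<close> times the \<open>L\<^sup>q\<close> norm of \<open>Dl l v\<close> for all \<open>v\<close>, where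
  \<open>1/p + 1/q = 1\<close>. On the whole space such an inequality comes from the monotonicity of a Bellman function along the heat
  flow. Reflection and perturbation carry it to domains above graphs of small slope, and cutoffs to neighbourhoods of boundary
  points. The terms produced by the cutoffs are controlled by Hardy's inequality, for \<open>p\<close> and for \<open>q\<close>: this is where
  \<open>d' < p < d\<close> enters. For \<open>p \<ge> 2\<close> the remaining lower-order term is removed by a weighted energy estimate whose constants do
  not depend on the domain; for \<open>p < 2\<close> one dualizes, solving the dual problem by continuation in \<open>l\<close>. Rescaling by \<open>1/\<epsilon>\<close>
  fixes the hole and lets the outer ball grow, so that uniformity in the domain is uniformity in \<open>\<epsilon>\<close>.\<close>

text \<open>A weak solution lies in the closure of the test functions, and the inf-sup inequality is
  applied to the approximants. The obstacle is uniformity: after rescaling, the domains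
  \<open>ball 0 (1/ep) - T\<close> grow without bound, so the lower-order term left by localization
  cannot be removed by compactness on a single domain. That term lives on a fixed ball, however,
  where the Hardy and weighted energy estimates see only the dimension, the exponents and the radius
  of this ball. The parameter \<open>l\<close> serves two purposes. For large \<open>l\<close> the
  lower-order term can be absorbed, which starts the continuation for p < 2; and the family of all
  \<open>l >= 0\<close> is invariant under dilations, so that the unit ball yields the estimate for
  every ball. Duality asks for solvability of the dual problem; it is replaced by near solvability,
  from an approximate minimax argument in a uniformly convex L^q with q >= 2. The constant obtained
  is the one of the dual exponent, so that repeating the continuation step does not degrade
  it.\<close>

hide_fact (open) Henstock_Kurzweil_Integration.integrable_add
  Henstock_Kurzweil_Integration.integrable_bound
  Henstock_Kurzweil_Integration.integrable_diff
  Henstock_Kurzweil_Integration.integrable_sum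
  Henstock_Kurzweil_Integration.integral_add
  Henstock_Kurzweil_Integration.integral_cong
  Henstock_Kurzweil_Integration.integral_diff
  Henstock_Kurzweil_Integration.integral_norm_bound_integral
  Henstock_Kurzweil_Integration.integral_sum

notation inner (infix "*." 70) and scaleR (infixr "*:" 75) and LIMSEQ (infix "---->" 60) and has_real_derivative (infix "hrd" 50)

abbreviation "cont \<equiv> continuous_on"
abbreviation "bmeas \<equiv> borel_measurable"
abbreviation "lborel2 \<equiv> lborel \<Otimes>\<^sub>M lborel"
abbreviation "integ \<equiv> integrable lborel"
abbreviation "jcont F \<equiv> continuous_on ({0<..} \<times> UNIV) (%p. F (fst p) (snd p))"

lemmas mul_l = mult_left_mono
  and mul_r = mult_right_mono
  and cintro = continuous_intros
  and asimps = algebra_simps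
  and pow2 = power2_eq_square
  and cont_comp2 = continuous_on_compose2
  and cont_bmeas = borel_measurable_continuous_onI

section \<open>Lebesgue norms over a measure space: the inequalities of Hoelder and
  Minkowski\<close>

definition pn :: "'a measure => real => ('a => 'b::real_normed_vector) => real" where
"pn M p f = (LINT x|M. norm (f x) powr p) powr (1/p)"

definition conj_exp :: "real => real => bool" where
"conj_exp p q \<longleftrightarrow> p > 1 & q > 1 & 1/p + 1/q = 1"

lemma conj_exp_sym: "conj_exp p q ==> conj_exp q p"
by (auto simp: conj_exp_def)

lemma conj_expD:
assumes "conj_exp p q"
shows "p > 1" "q > 1" "(p-1)*q = p" "(q-1)*p = q" "p + q = p*q" "(p-1)*(q-1) = 1" (is ?A)
proof -
show p: "p > 1" and q: "q > 1" using assms by (auto simp: conj_exp_def)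
from assms p q show "p + q = p*q" by (auto simp: conj_exp_def field_simps)
thus "(p-1)*q = p" "(q-1)*p = q" ?A by (auto simp: asimps)
qed

lemma conj_exp_conv: "p > 1 ==> conj_exp p (p/(p-1))"
by (auto simp: conj_exp_def field_simps)

lemma pn_nonneg [simp]: "pn M p f >= 0"
by (simp add: pn_def)

lemma pn_powr: "p > 0 ==> pn M p f powr p = (LINT x|M. norm (f x) powr p)"
by (simp add: pn_def powr_powr integral_nonneg_AE)

lemma pn_cong: "(!!x. x : space M ==> norm (f x) = norm (g x)) ==> pn M p f = pn M p g"
unfolding pn_def by (metis (mono_tags, lifting) integral_cong)

lemma pn_norm: "pn M p (%x. norm (f x)) = pn M p f"
by (simp add: pn_def)

lemma pn_mono:
assumes "p > 0" "integrable M (%x. norm (g x) powr p)" "!!x. x : space M ==> norm (f x) <= norm (g x)"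
shows "pn M p f <= pn M p g"
proof -
have "(LINT x|M. norm (f x) powr p) <= (LINT x|M. norm (g x) powr p)"
 by (rule integral_mono') (use assms in \<open>auto intro!: powr_mono2\<close>)
thus ?thesis
 unfolding pn_def by (intro powr_mono2) (use assms in \<open>auto intro!: integral_nonneg_AE\<close>)
qed

lemma pn_scaleR: "p > 0 ==> pn M p (%x. c *: f x) = abs c * pn M p f"
by (simp add: pn_def powr_mult powr_powr integral_nonneg_AE)

lemma pn_minus: "pn M p (%x. - f x) = pn M p f"
by (simp add: pn_def)

lemma pn_eq_0D:
assumes "pn M p f = 0" "p > 0" "integrable M (%x. norm (f x) powr p)"
shows "AE x in M. f x = 0"
proof -
have "(LINT x|M. norm (f x) powr p) = 0"
 using assms by (simp add: pn_def)
hence "AE x in M. norm (f x) powr p = 0"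
 using assms by (subst (asm) integral_nonneg_eq_0_iff_AE) auto
thus ?thesis by auto
qed

lemma holder_norm:
fixes f :: "'a => 'b::{banach,second_countable_topology}" and g :: "'a => 'c::{banach,second_countable_topology}"
assumes pq: "conj_exp p q"
 and [measurable]: "f : bmeas M" "g : bmeas M"
 and f: "integrable M (%x. norm (f x) powr p)" and g: "integrable M (%x. norm (g x) powr q)"
shows "integrable M (%x. norm (f x) * norm (g x))"
 and "(LINT x|M. norm (f x) * norm (g x)) <= pn M p f * pn M q g" (is ?A)
proof -
note pq' = conj_expD(1,2)[OF pq]
have young: "a * b <= a powr p / p + b powr q / q" if "a >= 0" "b >= 0" for a b
 using Youngs_inequality[of p q a b] pq that by (auto simp: conj_exp_def)
show int: "integrable M (%x. norm (f x) * norm (g x))"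
proof (rule integrable_bound)
 show "integrable M (%x. norm (f x) powr p / p + norm (g x) powr q / q)"
  using f g by auto
 show "AE x in M. norm (norm (f x) * norm (g x)) <= norm (norm (f x) powr p / p + norm (g x) powr q / q)"
 proof (rule AE_I2)
  fix x
  have "norm (f x) * norm (g x) <= abs (norm (f x) powr p / p + norm (g x) powr q / q)"
   by (rule order_trans[OF young abs_ge_self]) auto
  thus "norm (norm (f x) * norm (g x)) <= norm (norm (f x) powr p / p + norm (g x) powr q / q)"
   by (simp only: real_norm_def abs_mult abs_norm_cancel)
 qed
qed auto
define A where "A = pn M p f"
define B where "B = pn M q g"
show ?A
proof (cases "A = 0 | B = 0")
 case True
 hence "AE x in M. norm (f x) * norm (g x) = 0"
 proof
  assume "A = 0"
  hence "AE x in M. f x = 0" using pn_eq_0D[OF _ _ f] pq'(1) by (simp add: A_def)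
  thus ?thesis by auto
 next
  assume "B = 0"
  hence "AE x in M. g x = 0" using pn_eq_0D[OF _ _ g] pq'(2) by (simp add: B_def)
  thus ?thesis by auto
 qed
 hence "(LINT x|M. norm (f x) * norm (g x)) = 0"
  by (subst integral_nonneg_eq_0_iff_AE[OF int]) auto
 thus ?thesis by simp
next
 case False
 hence AB: "A > 0" "B > 0" by (auto simp: A_def B_def less_le)
 have Ap: "A powr p = (LINT x|M. norm (f x) powr p)" "B powr q = (LINT x|M. norm (g x) powr q)"
  using pq' by (simp_all add: A_def B_def pn_powr)
 have "(LINT x|M. norm (f x) * norm (g x)) / (A*B) = (LINT x|M. (norm (f x)/A) * (norm (g x)/B))"
  by simp
 also have "... <= (LINT x|M. norm (f x) powr p / (p * A powr p) + norm (g x) powr q / (q * B powr q))"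
 proof (rule integral_mono)
  show "integrable M (%x. norm (f x) / A * (norm (g x) / B))" using int by simp
  show "integrable M (%x. norm (f x) powr p / (p * A powr p) + norm (g x) powr q / (q * B powr q))"
   using f g by auto
  show "norm (f x) / A * (norm (g x) / B) <= norm (f x) powr p / (p * A powr p) + norm (g x) powr q / (q * B powr q)" for x
   using young[of "norm (f x)/A" "norm (g x)/B"] AB by (simp add: powr_divide field_simps)
 qed
 also have "... = A powr p / (p * A powr p) + B powr q / (q * B powr q)"
  using f g unfolding Ap by (subst integral_add) auto
 also have "... = 1/p + 1/q" using AB by simp
 also have "... = 1" using pq by (simp add: conj_exp_def)
 finally show ?thesis using AB unfolding A_def B_def by (simp add: field_simps)
qed
qed

lemma holder_inner:
fixes f :: "'a => 'b::euclidean_space"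
assumes pq: "conj_exp p q"
 and [measurable]: "f : bmeas M" "g : bmeas M"
 and f: "integrable M (%x. norm (f x) powr p)" and g: "integrable M (%x. norm (g x) powr q)"
shows "integrable M (%x. f x *. g x)"
 and "abs (LINT x|M. f x *. g x) <= pn M p f * pn M q g" (is ?A)
proof -
note h = holder_norm[OF pq _ _ f g]
show i: "integrable M (%x. f x *. g x)"
 by (rule integrable_bound[OF h(1)]) (auto simp: Cauchy_Schwarz_ineq2)
have "abs (LINT x|M. f x *. g x) <= (LINT x|M. abs (f x *. g x))"
 by (rule integral_abs_bound)
also have "... <= (LINT x|M. norm (f x) * norm (g x))"
 by (rule integral_mono') (use h(1) in \<open>auto simp: Cauchy_Schwarz_ineq2\<close>)
also have "... <= pn M p f * pn M q g" by (rule h(2)) auto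
finally show ?A .
qed

lemma powr_add_le:
fixes a b p :: real assumes "a >= 0" "b >= 0" "p > 0"
shows "(a + b) powr p <= 2 powr p * (a powr p + b powr p)"
proof -
have "(a + b) powr p <= (2 * max a b) powr p"
 using assms by (intro powr_mono2) auto
also have "... = 2 powr p * max a b powr p" using assms by (simp add: powr_mult)
also have "max a b powr p <= a powr p + b powr p" by (simp add: max_def)
finally show ?thesis by (simp add: mul_l)
qed

lemma powr_convex_comb:
fixes a b t p :: real
assumes "p >= 1" "a >= 0" "b >= 0" "t >= 0" "t <= 1"
shows "(t * a + (1-t) * b) powr p <= t * a powr p + (1-t) * b powr p"
proof -
\<comment> \<open>This settles the cases where \<open>a\<close> or \<open>b\<close> is 0; the
  convexity of the power is invoked only at positive arguments.\<close>
have *: "s powr p <= s" if "0 <= s" "s <= 1" for s :: real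
 using powr_le_one_le[of s p] that assms by (cases "s = 0") auto
consider "a = 0" | "b = 0" | "a > 0" "b > 0" using assms by linarith
thus ?thesis
proof cases
 case 1
 thus ?thesis using *[of "1-t"] assms by (simp add: powr_mult mul_r)
next
 case 2
 thus ?thesis using *[of t] assms by (simp add: powr_mult mul_r)
next
 case 3
 thus ?thesis using convex_onD[OF powr_convex[OF assms(1)], of t b a] assms
  by (simp add: asimps)
qed
qed

lemma integrable_powr_add:
fixes f g :: "'a => 'b::euclidean_space"
assumes "p > 0" and [measurable]: "f : bmeas M" "g : bmeas M"
 and f: "integrable M (%x. norm (f x) powr p)" and g: "integrable M (%x. norm (g x) powr p)"
shows "integrable M (%x. norm (f x + g x) powr p)"
proof (rule integrable_bound)
show "integrable M (%x. 2 powr p * (norm (f x) powr p + norm (g x) powr p))" using f g by auto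
show "AE x in M. norm (norm (f x + g x) powr p) <= norm (2 powr p * (norm (f x) powr p + norm (g x) powr p))"
proof (rule AE_I2)
 fix x
 have "norm (f x + g x) powr p <= (norm (f x) + norm (g x)) powr p"
  using assms(1) by (intro powr_mono2 norm_triangle_ineq) auto
 also have "... <= 2 powr p * (norm (f x) powr p + norm (g x) powr p)"
  by (rule powr_add_le) (use assms(1) in auto)
 finally show "norm (norm (f x + g x) powr p) <= norm (2 powr p * (norm (f x) powr p + norm (g x) powr p))"
  by simp
qed
qed auto

lemma pn_triangle:
fixes f g :: "'a => 'b::euclidean_space"
assumes p: "p >= 1" and [measurable]: "f : bmeas M" "g : bmeas M"
 and f: "integrable M (%x. norm (f x) powr p)" and g: "integrable M (%x. norm (g x) powr p)"
shows "pn M p (%x. f x + g x) <= pn M p f + pn M p g"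
proof -
define A where "A = pn M p f"
define B where "B = pn M p g"
have fg: "integrable M (%x. norm (f x + g x) powr p)"
 by (rule integrable_powr_add[OF _ _ _ f g]) (use p in auto)
have "A >= 0" "B >= 0" by (simp_all add: A_def B_def)
then consider "A = 0" | "B = 0" | "A > 0" "B > 0" by (cases "A = 0"; cases "B = 0") (auto simp: less_le)
thus ?thesis
proof cases
 case 1
 hence "AE x in M. f x = 0" using pn_eq_0D[OF _ _ f] p by (simp add: A_def)
 hence "(LINT x|M. norm (f x + g x) powr p) = (LINT x|M. norm (g x) powr p)"
  by (intro integral_cong_AE) auto
 thus ?thesis by (simp add: pn_def)
next
 case 2
 hence "AE x in M. g x = 0" using pn_eq_0D[OF _ _ g] p by (simp add: B_def)
 hence "(LINT x|M. norm (f x + g x) powr p) = (LINT x|M. norm (f x) powr p)"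
  by (intro integral_cong_AE) auto
 thus ?thesis by (simp add: pn_def)
next
 case 3
 \<comment> \<open>With this weight, f + g is A + B times a convex combination of the normalized
   functions f/A and g/B, and the triangle inequality becomes convexity of the p-th power.\<close>
 define t where "t = A/(A+B)"
 have t: "t >= 0" "t <= 1" "1 - t = B/(A+B)" using 3 by (auto simp: t_def field_simps)
 have Ap: "A powr p = (LINT x|M. norm (f x) powr p)" "B powr p = (LINT x|M. norm (g x) powr p)"
  using p by (simp_all add: A_def B_def pn_powr)
 have "(LINT x|M. norm (f x + g x) powr p) <= (LINT x|M. (A+B) powr p * (t * (norm (f x) powr p / A powr p) + (1-t) * (norm (g x) powr p / B powr p)))"
 proof (rule integral_mono[OF fg])
  show "integrable M (%x. (A+B) powr p * (t * (norm (f x) powr p / A powr p) + (1-t) * (norm (g x) powr p / B powr p)))"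
   using f g by auto
  fix x
  have "(A+B) * t = A" "(A+B) * (1-t) = B" unfolding t(3) using 3 by (simp_all add: t_def)
  hence "(A+B) * (t * (norm (f x)/A) + (1-t) * (norm (g x)/B)) = A * (norm (f x)/A) + B * (norm (g x)/B)"
   by (simp only: distrib_left mult.assoc[symmetric])
  hence "norm (f x + g x) <= (A+B) * (t * (norm (f x)/A) + (1-t) * (norm (g x)/B))"
   using 3 norm_triangle_ineq[of "f x" "g x"] by simp
  hence "norm (f x + g x) powr p <= ((A+B) * (t * (norm (f x)/A) + (1-t) * (norm (g x)/B))) powr p"
   using p by (intro powr_mono2) auto
  also have "... = (A+B) powr p * (t * (norm (f x)/A) + (1-t) * (norm (g x)/B)) powr p"
   using 3 t by (subst powr_mult) auto
  also have "... <= (A+B) powr p * (t * (norm (f x)/A) powr p + (1-t) * (norm (g x)/B) powr p)"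
   using 3 t p by (intro mul_l powr_convex_comb) auto
  finally show "norm (f x + g x) powr p <= (A+B) powr p * (t * (norm (f x) powr p / A powr p) + (1-t) * (norm (g x) powr p / B powr p))"
   using 3 by (simp add: powr_divide)
 qed
 also have "... = (A+B) powr p * (t * (A powr p / A powr p) + (1-t) * (B powr p / B powr p))"
  using f g unfolding Ap by simp
 also have "... = (A+B) powr p" using 3 by simp
 finally have "pn M p (%x. f x + g x) <= ((A+B) powr p) powr (1/p)"
  unfolding pn_def using p by (intro powr_mono2) (auto intro: integral_nonneg_AE)
 also have "... = A + B" using 3 p by (simp add: powr_powr)
 finally show ?thesis by (simp add: A_def B_def)
qed
qed

section \<open>Continuous functions with compact support\<close>

text \<open>All hard estimates are made inside this class, where integrability of products and
  powers is automatic. Sobolev functions enter only at the end, through their approximating test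
  functions.\<close>

definition Cc :: "('a::euclidean_space => 'b::euclidean_space) set" where
"Cc = {f. cont UNIV f & (EX K. compact K & (ALL x. x ~: K --> f x = 0))}"

abbreviation nrm :: "real => ('a::euclidean_space => 'b::euclidean_space) => real" where
"nrm p f == pn lborel p f"

lemma CcI: "cont UNIV f ==> compact K ==> (!!x. x ~: K ==> f x = 0) ==> f : Cc"
by (auto simp: Cc_def)

lemma Cc_cont: "f : Cc ==> cont UNIV f"
by (auto simp: Cc_def)

lemma Cc_support: assumes "f : Cc" obtains K where "compact K" "!!x. x ~: K ==> f x = 0"
using assms by (auto simp: Cc_def)

lemma Cc_measurable [measurable_dest]: "f : Cc ==> f : bmeas borel"
by (auto intro: cont_bmeas Cc_cont)

lemma Cc_integrable: assumes "f : Cc" shows "integ f"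
proof -
obtain K where K: "compact K" "!!x. x ~: K ==> f x = 0" using assms by (rule Cc_support) blast
have "integ (%x. indicator K x *: f x)"
 using K Cc_cont[OF assms] by (intro borel_integrable_compact) (auto intro: continuous_on_subset)
also have "(%x. indicator K x *: f x) = f"
 using K by (auto simp: indicator_def)
finally show ?thesis .
qed

lemma Cc_mult: assumes "f : Cc" "cont UNIV c" shows "(%x. c x *: f x) : Cc"
proof -
obtain K where K: "compact K" "!!x. x ~: K ==> f x = 0" using assms(1) by (rule Cc_support) blast
show ?thesis using K assms(2) by (intro CcI[of _ K] continuous_on_scaleR[OF _ Cc_cont[OF assms(1)]]) auto
qed

lemma Cc_comp0: assumes "f : Cc" "cont UNIV ph" "ph 0 = 0" shows "(%x. ph (f x)) : Cc"
proof -
obtain K where K: "compact K" "!!x. x ~: K ==> f x = 0" using assms(1) by (rule Cc_support) blast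
show ?thesis using K assms by (intro CcI[of _ K] cont_comp2[OF assms(2) Cc_cont[OF assms(1)]]) auto
qed

lemma Cc_Pair: assumes "f : Cc" "g : Cc" shows "(%x. (f x, g x)) : Cc"
proof -
obtain K where K: "compact K" "!!x. x ~: K ==> f x = 0" using assms(1) by (rule Cc_support) blast
obtain L where L: "compact L" "!!x. x ~: L ==> g x = 0" using assms(2) by (rule Cc_support) blast
show ?thesis using K L
 by (intro CcI[of _ "K \<union> L"] continuous_on_Pair[OF Cc_cont[OF assms(1)] Cc_cont[OF assms(2)]]) (auto simp: zero_prod_def)
qed

lemma Cc_comp2:
assumes "f : Cc" "g : Cc" "cont UNIV (%z. ph (fst z) (snd z))" "ph 0 0 = 0"
shows "(%x. ph (f x) (g x)) : Cc"
using Cc_comp0[OF Cc_Pair[OF assms(1,2)] assms(3)] assms(4) by simp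

lemma Cc_add: "f : Cc ==> g : Cc ==> (%x. f x + g x) : Cc"
by (rule Cc_comp2[where ph="(+)"]) (auto intro!: cintro)

lemma Cc_diff: "f : Cc ==> g : Cc ==> (%x. f x - g x) : Cc"
by (rule Cc_comp2[where ph="(-)"]) (auto intro!: cintro)

lemma Cc_minus: "f : Cc ==> (%x. - f x) : Cc"
by (rule Cc_comp0[where ph=uminus]) (auto intro!: cintro)

lemma Cc_scaleR: "f : Cc ==> (%x. c *: f x) : Cc"
by (rule Cc_comp0[where ph="%v. c *: v"]) (auto intro!: cintro)

lemma Cc_comp2c:
assumes "f : Cc" "cont UNIV g" "cont UNIV (%z. ph (fst z) (snd z))" "!!v. ph 0 v = 0"
shows "(%x. ph (f x) (g x)) : Cc"
proof -
obtain K where K: "compact K" "!!x. x ~: K ==> f x = 0" using assms(1) by (rule Cc_support) blast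
have "cont UNIV (%x. ph (fst (f x, g x)) (snd (f x, g x)))"
 by (rule cont_comp2[OF assms(3) continuous_on_Pair[OF Cc_cont[OF assms(1)] assms(2)]]) auto
thus ?thesis using K assms(4) by (intro CcI[of _ K]) auto
qed

lemma Cc_inner: "f : Cc ==> cont UNIV g ==> (%x. f x *. g x) : Cc"
by (rule Cc_comp2c[where ph="(\<bullet>)"]) (auto intro!: cintro)

lemma Cc_inner': "f : Cc ==> cont UNIV g ==> (%x. g x *. f x) : Cc"
by (subst inner_commute) (rule Cc_inner)

lemma Cc_times: "f : Cc ==> cont UNIV g ==> (%x. f x * g x :: real) : Cc"
using Cc_inner[of f g] by simp

lemma Cc_times': "f : Cc ==> cont UNIV g ==> (%x. g x * f x :: real) : Cc"
using Cc_inner'[of f g] by simp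

lemma Cc_scaleR_left: "f : Cc ==> cont UNIV g ==> (%x. f x *: g x) : Cc"
by (rule Cc_comp2c[where ph="(*:)"]) (auto intro!: cintro)

lemma Cc_zero [simp]: "(%x. 0) : Cc"
by (rule CcI[of _ "{}"]) auto

lemma Cc_sum: "finite I ==> (!!i. i : I ==> f i : Cc) ==> (%x. SUM i:I. f i x) : Cc"
by (induction I rule: finite_induct) (auto intro: Cc_add)

lemma continuous_norm_powr: "p > 0 ==> cont UNIV (%v::'b::real_normed_vector. norm v powr p)"
by (rule continuous_on_powr'[OF continuous_on_norm_id continuous_on_const]) auto

lemma Cc_norm_powr: "f : Cc ==> p > 0 ==> (%x. norm (f x) powr p) : Cc"
by (rule Cc_comp0[where ph="%v. norm v powr p"]) (auto intro!: continuous_norm_powr)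

lemma Cc_int_powr: "f : Cc ==> p > 0 ==> integ (%x. norm (f x) powr p)"
by (intro Cc_integrable Cc_norm_powr)

lemma Cc_norm: "f : Cc ==> (%x. norm (f x)) : Cc"
by (rule Cc_comp0[where ph="%v. norm v"]) (auto intro!: cintro)

lemma Cc_bounded: assumes "f : Cc" obtains B where "B > 0" "!!x. norm (f x) <= B"
proof -
obtain K where K: "compact K" "!!x. x ~: K ==> f x = 0" using assms by (rule Cc_support) blast
have "bounded (f ` K)"
 using K Cc_cont[OF assms] by (intro compact_imp_bounded compact_continuous_image) (auto intro: continuous_on_subset)
then obtain B where "B > 0" "ALL x:K. norm (f x) <= B" by (auto simp: bounded_pos)
thus ?thesis using K by (intro that[of B]) (metis norm_zero less_imp_le)+
qed

lemma Cc_holder: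
fixes f g :: "'a::euclidean_space => 'b::euclidean_space"
assumes "conj_exp p q" "f : Cc" "g : Cc" shows "abs (LBINT x. f x *. g x) <= nrm p f * nrm q g"
using assms conj_expD(1,2)[OF assms(1)]
by (intro holder_inner) (auto intro: Cc_int_powr)

lemma Cc_triangle: "p >= 1 ==> f : Cc ==> g : Cc ==> nrm p (%x. f x + g x) <= nrm p f + nrm p g"
by (intro pn_triangle) (auto intro: Cc_int_powr)

lemma Cc_triangle_diff: "p >= 1 ==> f : Cc ==> g : Cc ==> nrm p (%x. f x - g x) <= nrm p f + nrm p g"
using Cc_triangle[of p f "%x. - g x"] Cc_minus[of g] by (simp add: pn_minus)

lemma Cc_pn_mono: "p > 0 ==> g : Cc ==> (!!x. norm (f x) <= norm (g x)) ==> nrm p f <= nrm p g"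
by (intro pn_mono) (auto intro: Cc_int_powr)

lemma pn_zero [simp]: "p > 0 ==> pn M p (%x. 0) = 0"
by (simp add: pn_def)

lemma Cc_triangle_sum:
assumes "finite I" "p >= 1" "!!i. i : I ==> f i : Cc"
shows "nrm p (%x. SUM i:I. f i x) <= (SUM i:I. nrm p (f i))"
using assms
proof (induction I rule: finite_induct)
case (insert i I)
have "nrm p (%x. SUM i:insert i I. f i x) = nrm p (%x. f i x + (SUM i:I. f i x))"
 using insert by simp
also have "... <= nrm p (f i) + nrm p (%x. SUM i:I. f i x)"
 using insert by (intro Cc_triangle Cc_sum) auto
also have "... <= nrm p (f i) + (SUM i:I. nrm p (f i))" using insert by auto
finally show ?case using insert by simp
qed simp

section \<open>The duality map of L^p\<close>

definition dmap :: "real => 'b::euclidean_space => 'b" where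
"dmap p v = norm v powr (p-2) *: v"

lemma dmap_norm: "p > 1 ==> norm (dmap p v) = norm v powr (p-1)"
proof (cases "v = 0")
case False
hence "norm v powr (p-2) * norm v powr 1 = norm v powr (p-1)"
 by (subst powr_add[symmetric]) (auto simp: asimps)
thus ?thesis using False by (simp add: dmap_def)
qed (simp add: dmap_def)

lemma dmap_inner: "p > 1 ==> v *. dmap p v = norm v powr p"
proof (cases "v = 0")
case False
hence "norm v powr (p-2) * norm v powr 2 = norm v powr p"
 by (subst powr_add[symmetric]) (auto simp: asimps)
thus ?thesis using False by (simp add: dmap_def power2_norm_eq_inner[symmetric])
qed (simp add: dmap_def)

lemma dmap_0 [simp]: "dmap p 0 = 0" by (simp add: dmap_def)

text \<open>For p < 2 the factor |v|^(p-2) blows up at 0; continuity there is read off from |dmap p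
  v| = |v|^(p-1).\<close>

lemma continuous_dmap: assumes "p > 1" shows "cont UNIV (dmap p :: 'b::euclidean_space => 'b)"
proof -
have "isCont (dmap p) (v::'b)" for v
proof (cases "v = 0")
 case True
 have "((%v. norm v powr (p-1)) \<longlongrightarrow> norm (0::'b) powr (p-1)) (at (0::'b))"
 proof -
  have "cont UNIV (%v::'b. norm v powr (p-1))"
   using assms by (auto intro!: continuous_norm_powr)
  hence "isCont (%v::'b. norm v powr (p-1)) 0" by (simp add: continuous_on_eq_continuous_at)
  thus ?thesis by (simp only: isCont_def)
 qed
 hence "((%v. norm (dmap p v)) \<longlongrightarrow> 0) (at (0::'b))"
  using assms by (simp add: dmap_norm)
 hence "(dmap p \<longlongrightarrow> 0) (at (0::'b))" by (rule tendsto_norm_zero_cancel)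
 thus ?thesis using True by (simp add: isCont_def)
next
 case False
 thus ?thesis unfolding dmap_def by (intro cintro) auto
qed
thus ?thesis by (simp add: continuous_on_eq_continuous_at)
qed

lemma Cc_dmap: "f : Cc ==> p > 1 ==> (%x. dmap p (f x)) : Cc"
by (intro Cc_comp0[where ph="dmap p"] continuous_dmap) auto

lemma nrm_dmap:
assumes pq: "conj_exp p q"
shows "nrm q (%x. dmap p (f x)) = nrm p f powr (p-1)"
proof -
note pq' = conj_expD[OF pq]
have "nrm q (%x. dmap p (f x)) = (LBINT x. norm (f x) powr p) powr (1/q)"
 unfolding pn_def using pq' by (simp add: dmap_norm powr_powr)
also have "1/q = (1/p) * (p-1)" using pq' by (simp add: field_simps)
finally show ?thesis by (simp add: pn_def powr_powr)
qed

lemma int_inner_dmap: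
assumes "p > 1"
shows "(LBINT x. f x *. dmap p (f x)) = nrm p f powr p"
using assms by (simp add: dmap_inner pn_powr)

text \<open>Pairing f with its duality map gives the p-th power of its norm, while the dual norm of
  that map is only the (p-1)-st power. Hence a bound tested on this single field already bounds the
  norm.\<close>

lemma nrm_le_dual:
fixes f :: "'a::euclidean_space => 'b::euclidean_space"
assumes pq: "conj_exp p q" and "f : Cc" and M: "M >= 0"
 and *: "(LBINT x. f x *. dmap p (f x)) <= M * nrm q (%x. dmap p (f x))"
shows "nrm p f <= M"
proof (cases "nrm p f = 0")
case False
hence pos: "nrm p f > 0" by (simp add: less_le)
note pq' = conj_expD[OF pq]
have "nrm p f powr p <= M * nrm p f powr (p-1)"
 using * pq' by (simp add: int_inner_dmap nrm_dmap[OF pq])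
moreover have "nrm p f powr p = nrm p f * nrm p f powr (p-1)"
 using pos powr_add[of "nrm p f" 1 "p-1"] by simp
ultimately show ?thesis using pos by simp
qed (use M in simp)

section \<open>Invariance of Lebesgue measure\<close>

lemma nn_integral_translate:
fixes f :: "'a::euclidean_space => ennreal"
assumes [measurable]: "f : bmeas borel"
shows "(\<integral>\<^sup>+x. f (x + c) \<partial>lborel) = (\<integral>\<^sup>+x. f x \<partial>lborel)"
proof -
have "(\<integral>\<^sup>+x. f x \<partial>lborel) = (\<integral>\<^sup>+x. f x \<partial>distr lborel borel ((+) c))" by (simp add: lborel_distr_plus)
also have "... = (\<integral>\<^sup>+x. f (c + x) \<partial>lborel)" by (subst nn_integral_distr) auto
finally show ?thesis by (simp add: add.commute)
qed

text \<open>Averaging over translations in the direction \<open>e\<close> reduces the invariance of Lebesgue measure under maps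
  that preserve the lines parallel to \<open>e\<close> to the one-dimensional case.\<close>

lemma nn_integral_lines:
fixes ta :: "'a::euclidean_space => 'a" and f :: "'a => ennreal"
assumes e: "norm e = 1" and [measurable]: "ta : borel \<rightarrow>\<^sub>M borel" "f : bmeas borel"
 and r: "r = 1 | r = -(1::real)" and ta: "!!x s. ta (x + s *: e) = ta x + (r * s) *: e"
 and ty: "!!x. ta x = x + ty x *: e"
shows "(\<integral>\<^sup>+x. f (ta x) \<partial>lborel) = (\<integral>\<^sup>+x. indicator {0..1} (x *. e) * (\<integral>\<^sup>+s. f (x + s *: e) \<partial>lborel) \<partial>lborel)"
proof -
have "(\<integral>\<^sup>+x. f (ta x) \<partial>lborel) = (\<integral>\<^sup>+x. (\<integral>\<^sup>+s. f (ta x) * indicator {0..1} (x *. e + s) \<partial>lborel) \<partial>lborel)"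
proof (rule nn_integral_cong)
 fix x
 have "(\<integral>\<^sup>+s. indicator {0..1} (x *. e + s) \<partial>lborel) = (\<integral>\<^sup>+s. indicator {0..1::real} s \<partial>lborel)"
  by (subst nn_integral_real_affine[where c=1 and t="x *. e"]) auto
 also have "... = 1" by simp
 finally show "f (ta x) = (\<integral>\<^sup>+s. f (ta x) * indicator {0..1} (x *. e + s) \<partial>lborel)"
  by (simp add: nn_integral_cmult)
qed
also have "... = (\<integral>\<^sup>+s. (\<integral>\<^sup>+x. f (ta x) * indicator {0..1} (x *. e + s) \<partial>lborel) \<partial>lborel)"
 by (rule lborel_pair.Fubini'[symmetric]) measurable
also have "... = (\<integral>\<^sup>+s. (\<integral>\<^sup>+x. f (ta (x + (-s) *: e)) * indicator {0..1} ((x + (-s) *: e) *. e + s) \<partial>lborel) \<partial>lborel)"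
 by (intro nn_integral_cong nn_integral_translate[symmetric]) measurable
also have "... = (\<integral>\<^sup>+s. (\<integral>\<^sup>+x. f (ta x - (r * s) *: e) * indicator {0..1} (x *. e) \<partial>lborel) \<partial>lborel)"
 unfolding ta using e by (simp add: inner_simps dot_square_norm)
also have "... = (\<integral>\<^sup>+x. (\<integral>\<^sup>+s. f (ta x - (r * s) *: e) * indicator {0..1} (x *. e) \<partial>lborel) \<partial>lborel)"
 by (rule lborel_pair.Fubini') measurable
also have "... = (\<integral>\<^sup>+x. indicator {0..1} (x *. e) * (\<integral>\<^sup>+s. f (x + s *: e) \<partial>lborel) \<partial>lborel)"
proof (rule nn_integral_cong)
 fix x
 have "(\<integral>\<^sup>+s. f (x + s *: e) \<partial>lborel) = (\<integral>\<^sup>+s. f (x + (ty x + (-r) * s) *: e) \<partial>lborel)"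
  using r by (subst nn_integral_real_affine[where c="-r" and t="ty x"]) auto
 also have "... = (\<integral>\<^sup>+s. f (ta x - (r * s) *: e) \<partial>lborel)"
  by (simp add: ty asimps)
 finally show "(\<integral>\<^sup>+s. f (ta x - (r * s) *: e) * indicator {0..1} (x *. e) \<partial>lborel) =
   indicator {0..1} (x *. e) * (\<integral>\<^sup>+s. f (x + s *: e) \<partial>lborel)"
  by (subst nn_integral_multc) (auto simp: mult.commute)
qed
finally show ?thesis .
qed

definition mpres :: "('a::euclidean_space => 'a) => bool" where
"mpres ta \<longleftrightarrow> ta : borel \<rightarrow>\<^sub>M borel & distr lborel borel ta = lborel"

lemma mpresI:
fixes ta :: "'a::euclidean_space => 'a"
assumes [measurable]: "ta : borel \<rightarrow>\<^sub>M borel"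
 and "!!f. f : bmeas borel ==> (\<integral>\<^sup>+x. f (ta x) \<partial>lborel) = (\<integral>\<^sup>+x. f x \<partial>lborel)"
shows "mpres ta"
unfolding mpres_def
proof
show "distr lborel borel ta = lborel"
proof (rule measure_eqI)
 fix A assume "A : sets (distr lborel borel ta)"
 hence [measurable]: "A : sets borel" by simp
 have "emeasure (distr lborel borel ta) A = (\<integral>\<^sup>+x. indicator A x \<partial>distr lborel borel ta)"
  by simp
 also have "... = (\<integral>\<^sup>+x. indicator A (ta x) \<partial>lborel)" by (subst nn_integral_distr) auto
 also have "... = (\<integral>\<^sup>+x. indicator A x \<partial>lborel)" by (rule assms(2)) measurable
 finally show "emeasure (distr lborel borel ta) A = emeasure lborel A" by simp
qed simp
qed (rule assms)

text \<open>The right side of \<open>nn_integral_lines\<close> does not involve \<open>ta\<close>,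
  so the integral along \<open>ta\<close> is compared with the one along the identity. The case r =
  1 covers shears in direction \<open>e\<close>, the case r = -1 mirror maps.\<close>

lemma mpres_lines:
fixes ta :: "'a::euclidean_space => 'a"
assumes "norm e = 1" "ta : borel \<rightarrow>\<^sub>M borel" "r = 1 | r = -(1::real)"
 "!!x s. ta (x + s *: e) = ta x + (r * s) *: e" "!!x. ta x = x + ty x *: e"
shows "mpres ta"
proof (rule mpresI[OF assms(2)])
fix f :: "'a => ennreal" assume f: "f : bmeas borel"
show "(\<integral>\<^sup>+x. f (ta x) \<partial>lborel) = (\<integral>\<^sup>+x. f x \<partial>lborel)"
 using nn_integral_lines[OF assms(1,2) f assms(3-5)]
  nn_integral_lines[OF assms(1) _ f, of id 1 "%x. 0"] by simp
qed

lemma mpres_integral: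
fixes f :: "'a::euclidean_space => 'b::{banach,second_countable_topology}"
assumes "mpres ta" "f : bmeas borel"
shows "(LBINT x. f (ta x)) = (LBINT x. f x)"
using assms integral_distr[of ta lborel borel f] by (simp add: mpres_def)

lemma mpres_integrable:
fixes f :: "'a::euclidean_space => 'b::{banach,second_countable_topology}"
assumes "mpres ta" "f : bmeas borel"
shows "integ (%x. f (ta x)) \<longleftrightarrow> integ f"
using assms integrable_distr_eq[of ta lborel borel f] by (simp add: mpres_def)

lemma mpres_translate: "mpres (%x::'a::euclidean_space. x + c)"
by (rule mpresI) (auto intro: nn_integral_translate)

lemma mpres_uminus: "mpres (%x::'a::euclidean_space. c - x)"
proof -
have "distr lborel borel (%x::'a. c - x) = lborel"
 using lborel_affine[of "-1::real" c] by (simp add: density_1)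
thus ?thesis by (simp add: mpres_def)
qed

lemma integral_scale:
fixes f :: "'a::euclidean_space => 'b::{banach,second_countable_topology}"
assumes "c > 0" "f : bmeas borel"
shows "(LBINT x. f x) = c ^ DIM('a) *: (LBINT x. f (c *: x))"
proof -
have [measurable]: "f : bmeas borel" by fact
have "(LBINT x. f x) = (\<integral>x. f x \<partial>density (distr lborel borel (%x::'a. 0 + c *: x)) (%_. ennreal (abs c ^ DIM('a))))"
 using lborel_affine[of c "0::'a"] assms by (simp add: ennreal_power)
also have "... = c ^ DIM('a) *: (LBINT x. f (c *: x))"
 using assms(1) by (subst integral_density) (auto simp: integral_distr)
finally show ?thesis .
qed

section \<open>Gradients\<close>

lemma gradI:
assumes "GDERIV u x :> g" shows "grad u x = g"
proof -
have "(%h. h *. g) = frechet_derivative u (at x)"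
 using assms unfolding gderiv_def by (rule frechet_derivative_at)
hence "!!h. frechet_derivative u (at x) h = h *. g" by metis
hence "grad u x = (SUM b:Basis. (g *. b) *: b)"
 by (simp add: grad_def inner_commute)
thus ?thesis by (simp add: euclidean_representation)
qed

lemma GDERIV_differentiable: "GDERIV u x :> g ==> u differentiable at x"
by (auto simp: gderiv_def differentiable_def)

lemma GDERIV_frechet: assumes "u differentiable at x" shows "frechet_derivative u (at x) h = h *. grad u x"
proof -
have "linear (frechet_derivative u (at x))"
 using assms by (rule linear_frechet_derivative)
hence "frechet_derivative u (at x) (SUM b:Basis. (h *. b) *: b) = (SUM b:Basis. (h *. b) * frechet_derivative u (at x) b)"
 by (simp add: linear_sum linear_scale)
thus ?thesis
 by (simp add: grad_def euclidean_representation inner_sum_right mult.commute)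
qed

lemma GDERIV_grad: assumes "u differentiable at x" shows "GDERIV u x :> grad u x"
proof -
have "(u has_derivative frechet_derivative u (at x)) (at x)"
 using assms by (simp add: frechet_derivative_works)
moreover have "frechet_derivative u (at x) = (%h. h *. grad u x)"
 using GDERIV_frechet[OF assms] by auto
ultimately show ?thesis by (simp add: gderiv_def)
qed

definition C1 :: "('a::euclidean_space => real) => bool" where
"C1 u \<longleftrightarrow> (ALL x. u differentiable at x) & cont UNIV (grad u)"

text \<open>The working class is C^1 and not smooth because composition with shears along a C^1
  graph preserves no more. The link with smooth test functions is made by
  \<open>test_functions_dense\<close> and \<open>bnd_test_functions\<close>.\<close>

definition C1c :: "'a::euclidean_space set => ('a => real) set" where
"C1c Om = {u. C1 u & (EX K. compact K & K <= Om & (ALL x. x ~: K --> u x = 0))}"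

lemma C1_GDERIV: "C1 u ==> GDERIV u x :> grad u x"
by (auto simp: C1_def intro: GDERIV_grad)

lemma C1I: assumes "!!x. GDERIV u x :> g x" "cont UNIV g" shows "C1 u" "grad u = g"
proof -
show "grad u = g" using gradI[OF assms(1)] by auto
thus "C1 u" using assms by (auto simp: C1_def intro: GDERIV_differentiable)
qed

lemma GDERIV_has_derivative: "GDERIV u x :> g ==> (u has_derivative (%h. h *. g)) (at x)"
by (simp add: gderiv_def)

lemma GDERIV_cont: "GDERIV u x :> g ==> isCont u x"
by (auto simp: gderiv_def dest: has_derivative_continuous)

lemma C1_cont: "C1 u ==> cont UNIV u"
by (auto simp: continuous_on_eq_continuous_at intro: GDERIV_cont[OF C1_GDERIV])

lemma C1_cont_grad: "C1 u ==> cont UNIV (grad u)"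
by (simp add: C1_def)

lemma GDERIV_line:
assumes "GDERIV u (x + t *: e) :> g"
shows "((%t. u (x + t *: e)) hrd g *. e) (at t)"
proof -
have "((%t. u (x + t *: e)) has_derivative (%s. (s *: e) *. g)) (at t)"
 by (rule has_derivative_compose[of "%t. x + t *: e" "%s. s *: e" t UNIV u, OF _ GDERIV_has_derivative[OF assms]])
  (auto intro!: derivative_eq_intros)
moreover have "(%s. (s *: e) *. g) = (*) (g *. e)" by (auto simp: inner_commute)
ultimately show ?thesis by (simp only: has_field_derivative_def)
qed

lemma C1_add: assumes "C1 u" "C1 v"
shows "C1 (%x. u x + v x)" "grad (%x. u x + v x) = (%x. grad u x + grad v x)"
by (rule C1I[OF GDERIV_add[OF C1_GDERIV[OF assms(1)] C1_GDERIV[OF assms(2)]]],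
  intro continuous_on_add C1_cont_grad assms)+

lemma C1_diff: assumes "C1 u" "C1 v"
shows "C1 (%x. u x - v x)" "grad (%x. u x - v x) = (%x. grad u x - grad v x)"
by (rule C1I[OF GDERIV_diff[OF C1_GDERIV[OF assms(1)] C1_GDERIV[OF assms(2)]]],
  intro continuous_on_diff C1_cont_grad assms)+

lemma C1_mult: assumes "C1 u" "C1 v"
shows "C1 (%x. u x * v x)" "grad (%x. u x * v x) = (%x. u x *: grad v x + v x *: grad u x)"
by (rule C1I[OF GDERIV_mult[OF C1_GDERIV[OF assms(1)] C1_GDERIV[OF assms(2)]]],
  intro continuous_on_add continuous_on_scaleR C1_cont_grad C1_cont assms)+

lemma C1_const: "C1 (%x. c)" "grad (%x. c) = (%x::'a::euclidean_space. 0)"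
by (rule C1I[OF GDERIV_const], simp)+

lemma C1_cmult: assumes "C1 u"
shows "C1 (%x. c * u x)" "grad (%x. c * u x) = (%x. c *: grad u x)"
using C1_mult[OF C1_const(1)[of c] assms] by (simp_all add: C1_const(2))

lemma C1_minus: assumes "C1 u"
shows "C1 (%x. - u x)" "grad (%x. - u x) = (%x. - grad u x)"
using C1_cmult[OF assms, of "-1"] by simp_all

lemma C1_inner: "C1 (%x::'a::euclidean_space. x *. c)" "grad (%x::'a. x *. c) = (%x. c)" (is ?A)
proof -
have "GDERIV (%x::'a. x *. c) x :> c" for x
 unfolding gderiv_def by (auto intro!: derivative_eq_intros)
from C1I[OF this] show "C1 (%x::'a. x *. c)" ?A by auto
qed

lemma C1_chain:
assumes "C1 u" "!!t. (f hrd f' t) (at t)" "cont UNIV f'"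
shows "C1 (%x. f (u x))" (is ?A) "grad (%x. f (u x)) = (%x. f' (u x) *: grad u x)"
proof -
have *: "GDERIV (%x. f (u x)) x :> f' (u x) *: grad u x" for x
 by (rule GDERIV_DERIV_compose[OF C1_GDERIV[OF assms(1)] assms(2)])
have c: "cont UNIV (%x. f' (u x) *: grad u x)"
 by (intro continuous_on_scaleR C1_cont_grad assms cont_comp2[OF assms(3) C1_cont[OF assms(1)]]) auto
show ?A "grad (%x. f (u x)) = (%x. f' (u x) *: grad u x)"
 using C1I[OF * c] by auto
qed

lemma C1_norm2: "C1 (%x::'a::euclidean_space. (norm (x - z))\<^sup>2)" "grad (%x::'a. (norm (x - z))\<^sup>2) = (%x. 2 *: (x - z))" (is ?A)
proof -
have "GDERIV (%x::'a. (norm (x - z))\<^sup>2) x :> 2 *: (x - z)" for x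
 unfolding gderiv_def power2_norm_eq_inner by (auto intro!: derivative_eq_intros simp: inner_commute)
moreover have "cont UNIV (%x. 2 *: (x - z))" by (intro cintro)
ultimately show "C1 (%x::'a. (norm (x - z))\<^sup>2)" ?A
 using C1I[of "%x::'a. (norm (x - z))\<^sup>2" "%x. 2 *: (x - z)"] by blast+
qed

lemma C1cD: assumes "u : C1c Om" shows "C1 u" "u : Cc" "grad u : Cc"
proof -
from assms obtain K where K: "compact K" "ALL x. x ~: K --> u x = 0" and u: "C1 u" by (auto simp: C1c_def)
show "C1 u" by fact
show "u : Cc" using K C1_cont[OF u] by (auto simp: Cc_def)
have "grad u x = 0" if "x ~: K" for x
proof (rule gradI)
 have "open (- K)" using K by (simp add: compact_imp_closed open_Compl)
 have "((%x. 0) has_derivative (%h. h *. 0)) (at x)" by simp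
 hence "(u has_derivative (%h. h *. 0)) (at x)"
  by (rule has_derivative_transform_within_open[OF _ `open (- K)`]) (use K that in auto)
 thus "GDERIV u x :> 0" by (simp add: gderiv_def)
qed
thus "grad u : Cc" using K C1_cont_grad[OF u] by (auto simp: Cc_def)
qed

lemma C1c_support:
assumes "u : C1c Om"
obtains K where "compact K" "K <= Om" "!!x. x ~: K ==> u x = 0" "!!x. x ~: K ==> grad u x = 0"
proof -
from assms obtain K where K: "compact K" "K <= Om" "ALL x. x ~: K --> u x = 0" and u: "C1 u" by (auto simp: C1c_def)
have "grad u x = 0" if "x ~: K" for x
proof (rule gradI)
 have "open (- K)" using K by (simp add: compact_imp_closed open_Compl)
 have "((%x. 0) has_derivative (%h. h *. 0)) (at x)" by simp
 hence "(u has_derivative (%h. h *. 0)) (at x)"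
  by (rule has_derivative_transform_within_open[OF _ `open (- K)`]) (use K that in auto)
 thus "GDERIV u x :> 0" by (simp add: gderiv_def)
qed
thus ?thesis using that K by blast
qed

lemma C1cI: "C1 u ==> compact K ==> K <= Om ==> (!!x. x ~: K ==> u x = 0) ==> u : C1c Om"
by (auto simp: C1c_def)

lemma C1c_mono: "u : C1c Om ==> Om <= Om' ==> u : C1c Om'"
by (auto simp: C1c_def)

lemma C1c_mult: "u : C1c Om ==> C1 v ==> (%x. v x * u x) : C1c Om"
by (auto simp: C1c_def intro!: C1_mult)

lemma C1c_cmult: "u : C1c Om ==> (%x. c * u x) : C1c Om"
by (auto simp: C1c_def intro!: C1_cmult)

lemma C1c_minus: "u : C1c Om ==> (%x. - u x) : C1c Om"
by (auto simp: C1c_def intro!: C1_minus)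

lemma C1c_add: assumes "u : C1c Om" "v : C1c Om" shows "(%x. u x + v x) : C1c Om"
proof -
obtain K where K: "compact K" "K <= Om" "!!x. x ~: K ==> u x = 0" using assms(1) by (rule C1c_support) blast
obtain L where L: "compact L" "L <= Om" "!!x. x ~: L ==> v x = 0" using assms(2) by (rule C1c_support) blast
show ?thesis using K L C1cD[OF assms(1)] C1cD[OF assms(2)]
 by (intro C1cI[of _ "K \<union> L"] C1_add) auto
qed

lemma C1c_diff: "u : C1c Om ==> v : C1c Om ==> (%x. u x - v x) : C1c Om"
using C1c_add[of u Om "%x. - v x"] C1c_minus[of v Om] by simp

section \<open>Integration by parts\<close>

text \<open>Integrating G along the segment from x to x + e gives F(x + e) - F(x), whose integral
  vanishes by translation invariance; Fubini turns the other side into the integral of G. Only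
  derivatives along the one direction \<open>e\<close> are assumed, so the lemma also applies to
  fields such as those in \<open>ibp_bump\<close>, which are differentiated line by line.\<close>

lemma integral_line_deriv_0:
fixes F G :: "'a::euclidean_space => real"
assumes F: "F : Cc" and G: "G : Cc" and FG: "!!x. ((%t. F (x + t *: e)) hrd G x) (at 0)"
shows "(LBINT x. G x) = 0"
proof -
have [measurable]: "F : bmeas borel" "G : bmeas borel" using F G by (auto dest: Cc_measurable)
obtain K where K: "compact K" "!!x. x ~: K ==> G x = 0" using G by (rule Cc_support) blast
have Gc: "cont UNIV G" by (rule Cc_cont[OF G])
have d: "((%t. F (x + t *: e)) hrd G (x + t *: e)) (at t)" for x t
proof -
 have "((%s. F ((x + t *: e) + (s - t) *: e)) hrd G (x + t *: e) * 1) (at t)"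
  by (rule DERIV_chain2[of "%s. F ((x + t *: e) + s *: e)" _ "%s. s - t"])
   (use FG[of "x + t *: e"] in \<open>auto intro!: derivative_eq_intros\<close>)
 thus ?thesis by (simp add: asimps)
qed
have ftc: "(LBINT t. indicator {0..1::real} t * G (x + t *: e)) = F (x + e) - F x" for x
proof -
 have "(LBINT t. G (x + t *: e) * indicator {0..1::real} t) = F (x + 1 *: e) - F (x + 0 *: e)"
 proof (rule integral_FTC_Icc_real)
  have "cont UNIV (%t. G (x + t *: e))"
   by (rule cont_comp2[OF Gc]) (auto intro!: cintro)
  thus "isCont (%t. G (x + t *: e)) t" for t
   by (simp add: continuous_on_eq_continuous_at)
 qed (use d in auto)
 thus ?thesis by (simp add: mult.commute)
qed
let ?H = "%(t::real, x). indicator {0..1} t * G (x + t *: e)"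
have int: "integrable lborel2 ?H"
proof -
 have cp: "compact ((%(t::real,x). x - t *: e) ` ({0..1} \<times> K))"
  using K by (intro compact_continuous_image) (auto intro!: cintro compact_Times simp: split_beta)
 let ?L = "{0..1::real} \<times> ((%(t::real,x). x - t *: e) ` ({0..1} \<times> K))"
 have "integ (%z. indicator ?L z *: (%z. G (snd z + fst z *: e)) z)"
 proof (rule borel_integrable_compact)
  show "compact ?L" using cp by (intro compact_Times) auto
  show "cont ?L (%z. G (snd z + fst z *: e))"
   by (intro cont_comp2[OF Gc] cintro) auto
 qed
 also have "(%z. indicator ?L z *: (%z. G (snd z + fst z *: e)) z) = ?H"
 proof
  fix z :: "real \<times> 'a"
  obtain t x where z: "z = (t, x)" by (cases z)
  have "G (x + t *: e) = 0" if "t : {0..1}" "x ~: ((%(t::real,x). x - t *: e) ` ({0..1} \<times> K))"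
  proof (rule K(2), rule notI)
   assume "x + t *: e : K"
   with that(1) have "(t, x + t *: e) : {0..1} \<times> K" by auto
   hence "(%(t::real,x). x - t *: e) (t, x + t *: e) : ((%(t::real,x). x - t *: e) ` ({0..1} \<times> K))" by (rule imageI)
   with that(2) show False by simp
  qed
  thus "indicator ?L z *: (%z. G (snd z + fst z *: e)) z = ?H z"
   unfolding z by (auto simp: indicator_def)
 qed
 finally show ?thesis by (simp add: lborel_prod)
qed
have "(LBINT x. F (x + e) - F x) = 0"
 using Cc_integrable[OF F] mpres_integrable[OF mpres_translate[of e], of F] mpres_integral[OF mpres_translate[of e], of F]
 by (subst integral_diff) auto
hence "0 = (LBINT x. (LBINT t. indicator {0..1::real} t * G (x + t *: e)))"
 by (simp add: ftc)
also have "... = (LBINT t. (LBINT x. indicator {0..1::real} t * G (x + t *: e)))"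
 using lborel_pair.Fubini_integral[OF int] .
also have "... = (LBINT t. indicator {0..1::real} t * (LBINT x. G x))"
 by (intro integral_cong) (auto simp: mpres_integral[OF mpres_translate])
also have "... = (LBINT x. G x)" by simp
finally show ?thesis by simp
qed

lemma integral_grad_0:
assumes "u : C1c UNIV" shows "(LBINT x. grad u x *. e) = 0"
proof (rule integral_line_deriv_0)
show "u : Cc" "(%x. grad u x *. e) : Cc" using C1cD[OF assms] by (auto intro: Cc_inner)
show "((%t. u (x + t *: e)) hrd grad u x *. e) (at 0)" for x
 using GDERIV_line[where u=u and x=x and t=0 and e=e, OF C1_GDERIV[OF C1cD(1)[OF assms]]] by simp
qed

lemma integral_by_parts:
assumes u: "u : C1c Om" and v: "C1 v"
shows "(LBINT x. u x * (grad v x *. e)) = - (LBINT x. v x * (grad u x *. e))"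
proof -
note uD = C1cD[OF u]
have uv: "(%x. u x * v x) : C1c UNIV"
 using C1c_mult[OF u v] by (auto simp: mult.commute intro: C1c_mono)
have "0 = (LBINT x. u x * (grad v x *. e) + v x * (grad u x *. e))"
 using integral_grad_0[OF uv, of e] by (simp add: C1_mult(2)[OF uD(1) v] inner_simps)
also have "... = (LBINT x. u x * (grad v x *. e)) + (LBINT x. v x * (grad u x *. e))"
 using uD v by (intro integral_add Cc_integrable Cc_times Cc_times' Cc_inner
   continuous_on_inner C1_cont_grad C1_cont continuous_on_const) auto
finally show ?thesis by simp
qed

section \<open>Convolutions and smooth approximation\<close>

lemma Cc_int_pos:
fixes f :: "'a::euclidean_space => real"
assumes f: "f : Cc" and nn: "!!x. f x >= 0" and pos: "f a > 0"
shows "(LBINT x. f x) > 0"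
proof (rule ccontr)
assume "~ (LBINT x. f x) > 0"
hence "(LBINT x. f x) = 0" using integral_nonneg_AE[of f lborel] nn by (simp add: less_le)
hence "AE x in lborel. f x = 0"
 using integral_nonneg_eq_0_iff_AE[OF Cc_integrable[OF f]] nn by auto
hence "AE x in lebesgue. x : {x. f x = 0}" by (auto intro: AE_completion)
moreover have "closed {x. f x = 0}"
 by (intro closed_Collect_eq Cc_cont[OF f] continuous_on_const)
ultimately have "a : {x. f x = 0}" by (intro mem_closed_if_AE_lebesgue)
thus False using pos by simp
qed

lemma Cc_uniformly_continuous:
assumes f: "f : Cc" shows "uniformly_continuous_on UNIV f"
proof -
obtain K where K: "compact K" "!!x. x ~: K ==> f x = 0" using f by (rule Cc_support) blast
obtain R where "ALL x:K. norm x <= R" using compact_imp_bounded[OF K(1)] unfolding bounded_iff by blast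
hence R: "K <= cball 0 R" by auto
have uc: "uniformly_continuous_on (cball 0 (R+1)) f"
 by (rule compact_uniformly_continuous) (auto intro: continuous_on_subset[OF Cc_cont[OF f]])
show ?thesis
 unfolding uniformly_continuous_on_def
proof (intro allI impI)
 fix e :: real assume "e > 0"
 with uc obtain d where d: "d > 0" "!!x y. x : cball 0 (R+1) ==> y : cball 0 (R+1) ==> dist y x < d ==> dist (f y) (f x) < e"
  unfolding uniformly_continuous_on_def by meson
 have "dist (f y) (f x) < e" if "dist y x < min d 1" for x y
 proof (cases "x : cball 0 R | y : cball 0 R")
  case True
  have "x : cball 0 (R+1) & y : cball 0 (R+1)"
   using True that norm_triangle_ineq2[of x y] norm_triangle_ineq2[of y x]
   by (auto simp: dist_norm norm_minus_commute)
  thus ?thesis using d that by auto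
 next
  case False
  hence "x ~: K" "y ~: K" using R by blast+
  hence "f x = 0" "f y = 0" using K(2) by auto
  thus ?thesis using `e > 0` by simp
 qed
 thus "EX d>0. ALL x:UNIV. ALL x':UNIV. dist x' x < d --> dist (f x') (f x) < e"
  using d(1) by (intro exI[of _ "min d 1"]) auto
qed
qed

lemma conv_integrable:
fixes ph :: "'a::euclidean_space => real" and g :: "'a => 'b::euclidean_space"
assumes ph: "integ ph" and g: "cont UNIV g" and B: "!!x. norm (g x) <= B"
shows "integ (%y. ph y *: g (x - y))"
proof (rule integrable_bound[of _ "%y. B * ph y"])
have [measurable]: "g : bmeas borel" by (rule cont_bmeas[OF g])
have [measurable]: "ph : bmeas borel" using ph by auto
show "integ (%y. B * ph y)" using ph by simp
show "(%y. ph y *: g (x - y)) : bmeas lborel" by simp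
have "B >= 0" using B[of 0] norm_ge_zero order_trans by blast
thus "AE y in lborel. norm (ph y *: g (x - y)) <= norm (B * ph y)"
 using B by (auto simp: abs_mult mult.commute[of B] intro!: mul_l)
qed

lemma conv_sym:
fixes ph :: "'a::euclidean_space => real" and g :: "'a => 'b::euclidean_space"
assumes [measurable]: "ph : bmeas borel" "g : bmeas borel"
shows "(LBINT y. ph y *: g (x - y)) = (LBINT y. ph (x - y) *: g y)"
using mpres_integral[OF mpres_uminus[of x], of "%z. ph (x - z) *: g z"] by simp

lemma conv_cont:
fixes ph :: "'a::euclidean_space => real" and g :: "'a => 'b::euclidean_space"
assumes ph: "integ ph" and g: "cont UNIV g" and B: "!!x. norm (g x) <= B"
shows "cont UNIV (%x. LBINT y. ph y *: g (x - y))"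
proof -
have [measurable]: "g : bmeas borel" by (rule cont_bmeas[OF g])
have [measurable]: "ph : bmeas borel" using ph by auto
have "B >= 0" using B[of 0] norm_ge_zero order_trans by blast
have gi: "isCont g x" for x using g by (simp add: continuous_on_eq_continuous_at)
show ?thesis
 unfolding continuous_on_sequentially
proof (intro allI impI ballI, elim conjE)
 fix X :: "nat => 'a" and a assume X: "X ----> a"
 show "((%x. LBINT y. ph y *: g (x - y)) \<circ> X) ----> (LBINT y. ph y *: g (a - y))"
  unfolding o_def
 proof (rule integral_dominated_convergence[where w="%y. B * abs (ph y)"])
  show "integ (%y. B * abs (ph y))" using ph by auto
  show "AE y in lborel. (%n. ph y *: g (X n - y)) ----> ph y *: g (a - y)"
   by (intro AE_I2 tendsto_scaleR tendsto_const isCont_tendsto_compose[OF gi] tendsto_diff X)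
  show "AE y in lborel. norm (ph y *: g (X n - y)) <= B * abs (ph y)" for n
   using B \<open>B >= 0\<close> by (auto simp: mult.commute[of B] intro!: mul_l)
 qed auto
qed
qed

text \<open>The difference quotients of G, corrected by the gradient, are bounded by 2B, so 2B |ph|
  dominates and the limit passes under the integral. The density \<open>ph\<close> is merely
  integrable; all regularity comes from G.\<close>

lemma conv_GDERIV:
fixes ph G :: "'a::euclidean_space => real"
assumes ph: "integ ph" and G: "C1 G" and B: "!!x. abs (G x) <= B" "!!x. norm (grad G x) <= B"
shows "GDERIV (%x. LBINT y. ph y * G (x - y)) x :> (LBINT y. ph y *: grad G (x - y))"
proof -
note Gc = C1_cont[OF G] and gc = C1_cont_grad[OF G]
have [measurable]: "G : bmeas borel" "grad G : bmeas borel"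
 using Gc gc by (auto intro: cont_bmeas)
have [measurable]: "ph : bmeas borel" using ph by auto
have "B >= 0" using B(1)[of 0] by linarith
have i1: "integ (%y. ph y * G (x - y))" for x
 using conv_integrable[OF ph Gc, of B x] B(1) by simp
have i2: "integ (%y. ph y *: grad G (x - y))" for x
 using conv_integrable[OF ph gc, of B x] B(2) by simp
have lip: "abs (G a - G b) <= B * norm (a - b)" for a b
proof -
 have "norm (G a - G b) <= B * norm (a - b)"
 proof (rule differentiable_bound[of UNIV G "%x h. h *. grad G x"])
  show "(G has_derivative (%h. h *. grad G z)) (at z within UNIV)" for z
   using C1_GDERIV[OF G, of z] by (simp add: gderiv_def)
  show "onorm (%h. h *. grad G z) <= B" for z
  proof (rule onorm_bound[OF \<open>B >= 0\<close>])
   show "norm (h *. grad G z) <= B * norm h" for h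
    using Cauchy_Schwarz_ineq2[of h "grad G z"] mul_l[OF B(2)[of z], of "norm h"]
    by (simp add: mult.commute)
  qed
 qed auto
 thus ?thesis by simp
qed
have bl: "bounded_linear (%h. h *. (LBINT y. ph y *: grad G (x - y)))"
 by (rule bounded_linear_inner_left)
let ?R = "%h y. ph y * ((G (x + h - y) - G (x - y) - h *. grad G (x - y)) / norm h)"
have "((%h. LBINT y. ?R h y) \<longlongrightarrow> 0) (at 0)"
 unfolding tendsto_at_iff_sequentially
proof (intro allI impI)
 fix X :: "nat => 'a" assume X0: "ALL i. X i : UNIV - {0}" and X: "X ----> 0"
 have "(%n. LBINT y. ?R (X n) y) ----> (LBINT y::'a. 0)"
 proof (rule integral_dominated_convergence[where w="%y. (2 * B) * abs (ph y)"])
  show "integ (%y. (2*B) * abs (ph y))" using ph by auto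
  show "AE y in lborel. (%n. ?R (X n) y) ----> 0"
  proof (rule AE_I2)
   fix y
   have "(G has_derivative (%h. h *. grad G (x - y))) (at (x - y))"
    using C1_GDERIV[OF G] by (simp add: gderiv_def)
   hence "((%h. (G (x - y + h) - G (x - y) - h *. grad G (x - y)) / norm h) \<longlongrightarrow> 0) (at 0)"
    unfolding has_derivative_at
    by (intro tendsto_norm_zero_cancel[of "%h. (G (x - y + h) - G (x - y) - h *. grad G (x - y)) / norm h"]) simp
   hence "((%h. (G (x - y + h) - G (x - y) - h *. grad G (x - y)) / norm h) \<circ> X) ----> 0"
    using X X0 unfolding tendsto_at_iff_sequentially by blast
   hence "(%n. ph y * ((G (x - y + X n) - G (x - y) - X n *. grad G (x - y)) / norm (X n))) ----> ph y * 0"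
    unfolding o_def by (rule tendsto_mult_left)
   thus "(%n. ?R (X n) y) ----> 0" by (simp add: asimps)
  qed
  show "AE y in lborel. norm (?R (X n) y) <= (2*B) * abs (ph y)" for n
  proof (rule AE_I2)
   fix y
   have pos: "norm (X n) > 0" using X0 by auto
   have "abs (G (x + X n - y) - G (x - y)) <= B * norm (X n)"
    using lip[of "x + X n - y" "x - y"] by simp
   moreover have "abs (X n *. grad G (x - y)) <= B * norm (X n)"
    using Cauchy_Schwarz_ineq2[of "X n" "grad G (x-y)"] mul_l[OF B(2)[of "x-y"], of "norm (X n)"]
    by (simp add: mult.commute)
   ultimately have "abs (G (x + X n - y) - G (x - y) - X n *. grad G (x - y)) <= 2 * B * norm (X n)" by linarith
   hence "abs ((G (x + X n - y) - G (x - y) - X n *. grad G (x - y)) / norm (X n)) <= 2 * B"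
    using pos by (simp add: field_simps)
   hence "abs (ph y) * abs ((G (x + X n - y) - G (x - y) - X n *. grad G (x - y)) / norm (X n)) <= abs (ph y) * (2 * B)"
    by (rule mul_l) simp
   thus "norm (?R (X n) y) <= (2*B) * abs (ph y)"
    by (simp add: abs_mult mult.commute)
  qed
 qed auto
 thus "((%h. LBINT y. ?R h y) \<circ> X) ----> 0" by (simp add: o_def)
qed
moreover have "(LBINT y. ?R h y) = ((LBINT y. ph y * G (x + h - y)) - (LBINT y. ph y * G (x - y))
  - h *. (LBINT y. ph y *: grad G (x - y))) / norm h" for h
proof -
 have i3: "integ (%y. h *. (ph y *: grad G (x - y)))"
  by (rule integrable_inner_right) (use i2 in auto)
 have "(LBINT y. ?R h y) = (LBINT y. (ph y * G (x + h - y) - ph y * G (x - y) - h *. (ph y *: grad G (x - y))) / norm h)"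
  by (intro integral_cong) (auto simp: asimps)
 also have "... = ((LBINT y. ph y * G (x + h - y)) - (LBINT y. ph y * G (x - y))
  - (LBINT y. h *. (ph y *: grad G (x - y)))) / norm h"
  using i1[of "x+h"] i1[of x] i3 by (simp del: inner_scaleR_right)
 also have "(LBINT y. h *. (ph y *: grad G (x - y))) = h *. (LBINT y. ph y *: grad G (x - y))"
  by (rule integral_inner_right) (use i2 in auto)
 finally show ?thesis .
qed
ultimately have "((%h. ((LBINT y. ph y * G (x + h - y)) - (LBINT y. ph y * G (x - y))
  - h *. (LBINT y. ph y *: grad G (x - y))) / norm h) \<longlongrightarrow> 0) (at 0)" by (simp only:)
hence "((%h. norm ((LBINT y. ph y * G (x + h - y)) - (LBINT y. ph y * G (x - y))
  - h *. (LBINT y. ph y *: grad G (x - y))) / norm h) \<longlongrightarrow> 0) (at 0)"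
 using tendsto_norm_zero by fastforce
thus ?thesis unfolding gderiv_def has_derivative_at using bl by simp
qed

section \<open>Smooth bump functions\<close>

lemma CkI:
assumes "!!x. GDERIV f x :> g x" "!!b. b : Basis ==> Ck k (%x. g x *. b)"
shows "Ck (Suc k) f"
proof -
have "f differentiable at x" for x using assms(1) by (rule GDERIV_differentiable)
moreover have "frechet_derivative f (at x) b = g x *. b" for x b
 using GDERIV_frechet[OF GDERIV_differentiable[OF assms(1)]] gradI[OF assms(1)] by (simp add: inner_commute)
ultimately show ?thesis using assms(2) by simp
qed

lemma CkD:
assumes "Ck (Suc k) f"
shows "GDERIV f x :> grad f x" (is ?A) "b : Basis ==> Ck k (%x. grad f x *. b)"
proof -
have d: "f differentiable at x" for x using assms by simp
show ?A using GDERIV_grad[OF d] .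
show "b : Basis ==> Ck k (%x. grad f x *. b)" using assms GDERIV_frechet[OF d] by (simp add: inner_commute)
qed

lemma Ck_mono: "Ck (Suc k) f ==> Ck k f"
proof (induction k arbitrary: f)
case 0
thus ?case using GDERIV_cont[OF CkD(1)[OF 0]] by (auto simp: continuous_on_eq_continuous_at)
next
case (Suc k)
show ?case by (rule CkI[OF CkD(1)[OF Suc.prems] Suc.IH[OF CkD(2)[OF Suc.prems]]])
qed

lemma Ck_C1: "Ck 1 f ==> C1 f"
proof -
assume f: "Ck 1 f"
have "cont UNIV (%x. SUM b:Basis. (grad f x *. b) *: b)"
 using CkD(2)[of 0 f] f by (intro continuous_on_sum continuous_on_scaleR continuous_on_const) auto
thus "C1 f" using f by (simp add: C1_def euclidean_representation)
qed

lemma Ck_const: "Ck k (%x::'a::euclidean_space. c)"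
proof (induction k arbitrary: c)
case (Suc k)
show ?case by (rule CkI[OF GDERIV_const]) (simp add: Suc)
qed simp

lemma Ck_add: "Ck k f ==> Ck k g ==> Ck k (%x. f x + g x)"
proof (induction k arbitrary: f g)
case (Suc k)
show ?case using Suc
 by (intro CkI[OF GDERIV_add[OF CkD(1)[OF Suc.prems(1)] CkD(1)[OF Suc.prems(2)]]])
  (auto simp: inner_add_left intro!: Suc.IH CkD(2))
qed (auto intro: continuous_on_add)

lemma Ck_mult: "Ck k f ==> Ck k g ==> Ck k (%x. f x * g x)"
proof (induction k arbitrary: f g)
case (Suc k)
show ?case using Suc
 by (intro CkI[OF GDERIV_mult[OF CkD(1)[OF Suc.prems(1)] CkD(1)[OF Suc.prems(2)]]])
  (auto simp: inner_add_left intro!: Ck_add Suc.IH CkD(2) intro: Ck_mono)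
qed (auto intro: continuous_on_mult)

lemma Ck_inner: "Ck k (%x::'a::euclidean_space. x *. c)"
proof (cases k)
case 0
thus ?thesis by (auto intro!: cintro)
next
case (Suc m)
have "GDERIV (%x::'a. x *. c) x :> c" for x
 unfolding gderiv_def by (auto intro!: derivative_eq_intros)
thus ?thesis unfolding Suc by (rule CkI) (rule Ck_const)
qed

text \<open>Allowing powers of s in the denominator makes the family closed under differentiation:
  the derivative of \<open>flat n\<close> is a combination of \<open>flat (n+2)\<close> and
  \<open>flat (n+1)\<close>. Smoothness of exp(-1/s) then is an induction on the order that treats
  all n at once.\<close>

definition flat :: "nat => real => real" where
"flat n s = (if s <= 0 then 0 else exp (- 1 / s) / s ^ n)"

text \<open>This is (1 + y/m)^m <= exp y with m = n + 2 and y = 1/s. The surplus of two powers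
  leaves a quadratic bound, which is what makes the derivative at 0 vanish.\<close>

lemma flat_bound: assumes "s > 0" shows "flat n s <= real (n+2) ^ (n+2) * s^2"
proof -
let ?m = "n + 2"
have "(1 / (s * real ?m)) ^ ?m <= (1 + (1/s) / real ?m) ^ ?m"
 using assms by (intro power_mono) auto
also have "... <= exp (1 / s)" using assms
 by (intro exp_ge_one_plus_x_over_n_power_n) (auto intro: order_trans[of _ 0])
finally have "1 / exp (1/s) <= 1 / (1 / (s * real ?m)) ^ ?m"
 using assms by (intro divide_left_mono) auto
hence "exp (- 1/s) <= (s * real ?m) ^ ?m"
 by (simp add: exp_minus inverse_eq_divide power_one_over)
hence "exp (-1/s) / s ^ n <= (s * real ?m) ^ ?m / s ^ n"
 using assms by (intro divide_right_mono) auto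
also have "... = real ?m ^ ?m * s^2" using assms by (simp add: power_mult_distrib power_add pow2)
finally show ?thesis using assms by (simp add: flat_def)
qed

lemma flat_nonneg: "flat n s >= 0"
by (simp add: flat_def)

lemma flat_deriv: "(flat n hrd (flat (n+2) s - real n * flat (n+1) s)) (at s)"
proof (cases s "0::real" rule: linorder_cases)
case less
have "((%s. 0) hrd 0) (at s)" by simp
hence "(flat n hrd 0) (at s)"
 by (rule has_field_derivative_transform_within_open[where S="{..<0}"]) (use less in \<open>auto simp: flat_def\<close>)
thus ?thesis using less by (simp add: flat_def)
next
case greater
have "((%s. exp (- 1 / s) / s ^ n) hrd (exp (- 1 / s) / s ^ (n+2) - real n * (exp (- 1 / s) / s ^ (n+1)))) (at s)"
proof -
 have e: "((%s. exp (- 1 / s)) hrd exp (- 1 / s) * (1 / s^2)) (at s)"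
  using greater by (auto intro!: derivative_eq_intros simp: pow2)
 have p: "((%s. s ^ n) hrd real n * s ^ (n - 1)) (at s)"
  using DERIV_pow[of n s] by simp
 have "((%s. exp (- 1 / s) / s ^ n) hrd
   (exp (- 1 / s) * (1 / s^2) * s ^ n - exp (- 1 / s) * (real n * s ^ (n - 1))) / (s ^ n * s ^ n)) (at s)"
  by (rule DERIV_divide[OF e p]) (use greater in simp)
 moreover have "(exp (- 1 / s) * (1 / s^2) * s ^ n - exp (- 1 / s) * (real n * s ^ (n - 1))) / (s ^ n * s ^ n)
  = exp (- 1 / s) / s ^ (n+2) - real n * (exp (- 1 / s) / s ^ (n+1))"
  using greater by (cases n) (simp_all add: field_simps pow2 power_add)
 ultimately show ?thesis by simp
qed
hence "(flat n hrd (exp (- 1 / s) / s ^ (n+2) - real n * (exp (- 1 / s) / s ^ (n+1)))) (at s)"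
 by (rule has_field_derivative_transform_within_open[where S="{0<..}"]) (use greater in \<open>auto simp: flat_def\<close>)
thus ?thesis using greater by (simp add: flat_def)
next
case equal
let ?C = "real (n+2) ^ (n+2)"
have "((%h. flat n h / h) \<longlongrightarrow> 0) (at 0)"
proof (rule tendsto_0_le[where K="?C"])
 show "((%h::real. h) \<longlongrightarrow> 0) (at 0)" by (rule tendsto_ident_at)
 show "\<forall>\<^sub>F h in at 0. norm (flat n h / h) <= norm h * ?C"
 proof (rule always_eventually, rule allI)
  fix h :: real
  show "norm (flat n h / h) <= norm h * ?C"
  proof (cases "h > 0")
   case True
   hence "flat n h / h <= ?C * h^2 / h" using flat_bound[OF True] by (intro divide_right_mono) auto
   thus ?thesis using True flat_nonneg[of n h] by (simp add: pow2 mult.commute)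
  next
   case False
   hence "flat n h = 0" by (simp add: flat_def)
   moreover have "0 <= norm h * ?C" by (intro mult_nonneg_nonneg) auto
   ultimately show ?thesis by simp
  qed
 qed
qed
hence "(flat n hrd 0) (at 0)" by (simp add: has_field_derivative_iff flat_def)
thus ?thesis using equal by (simp add: flat_def)
qed

lemma Ck_flat: "Ck k (%x::'a::euclidean_space. flat n (r - (norm x)^2))"
proof (induction k arbitrary: n)
case 0
have "isCont (flat n) s" for s using flat_deriv[of n s] by (rule DERIV_isCont)
hence "cont UNIV (flat n)" by (simp add: continuous_on_eq_continuous_at)
moreover have "cont UNIV (%x::'a. r - (norm x)^2)" by (intro cintro)
ultimately show ?case unfolding Ck.simps by (rule cont_comp2) simp
next
case (Suc k)
have "GDERIV (%x::'a. r - (norm x)^2) x :> (-2) *: x" for x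
 using GDERIV_diff[OF GDERIV_const[of r x] C1_GDERIV[OF C1_norm2(1)[of 0]]] by (simp add: C1_norm2(2)[of 0, simplified])
hence "GDERIV (%x::'a. flat n (r - (norm x)^2)) x :>
  (flat (n+2) (r - (norm x)^2) - real n * flat (n+1) (r - (norm x)^2)) *: ((-2) *: x)" for x
 by (rule GDERIV_DERIV_compose[OF _ flat_deriv])
thus ?case
proof (rule CkI)
 fix b :: 'a
 have "Ck k (%x::'a. (flat (n+2) (r - (norm x)^2) + (- real n) * flat (n+1) (r - (norm x)^2)) * ((-2) * (x *. b)))"
  by (intro Ck_mult Ck_add Suc.IH Ck_const Ck_inner)
 also have "(%x::'a. (flat (n+2) (r - (norm x)^2) + (- real n) * flat (n+1) (r - (norm x)^2)) * ((-2) * (x *. b))) =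
  (%x. ((flat (n + 2) (r - (norm x)^2) - real n * flat (n + 1) (r - (norm x)^2)) *: ((-2) *: x)) *. b)"
  by (rule ext) (simp add: asimps)
 finally show "Ck k (%x. ((flat (n + 2) (r - (norm x)^2) - real n * flat (n + 1) (r - (norm x)^2)) *: ((-2) *: x)) *. b)" .
qed
qed

lemma mollifier_exists:
assumes "dr > 0"
obtains rh :: "'a::euclidean_space => real" where "!!k. Ck k rh" "!!x. rh x >= 0" "!!x. norm x >= dr ==> rh x = 0"
 "(LBINT x. rh x) = 1" "rh : C1c UNIV"
proof -
define f where "f = (%x::'a. flat 0 (dr^2 - (norm x)^2))"
have k: "Ck k f" for k unfolding f_def by (rule Ck_flat)
have nn: "f x >= 0" for x by (simp add: f_def flat_nonneg)
have z: "f x = 0" if "norm x >= dr" for x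
 using that assms power_mono[of dr "norm x" 2] by (simp add: f_def flat_def)
have fc: "f : C1c UNIV" using Ck_C1[OF k] z by (intro C1cI[of _ "cball 0 dr"]) auto
define c where "c = (LBINT x. f x)"
have c: "c > 0" unfolding c_def
 by (rule Cc_int_pos[where a=0]) (use C1cD(2)[OF fc] nn assms in \<open>auto simp: f_def flat_def\<close>)
show ?thesis
proof (rule that[of "%x. (1/c) * f x"])
 show "Ck k (%x. (1/c) * f x)" for k by (intro Ck_mult Ck_const k)
 show "(%x. (1/c) * f x) : C1c UNIV" by (rule C1c_cmult[OF fc])
 show "(LBINT x. 1/c * f x) = 1" using c by (simp add: c_def)
qed (use nn z c in auto)
qed

lemma average_close:
fixes g :: "'a::euclidean_space => 'b::euclidean_space"
assumes rh: "integ rh" "!!y. rh y >= 0" "(LBINT y. rh y) = 1"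
 and z: "!!y. norm y >= dr ==> rh y = 0" and g: "g : Cc"
 and close: "!!y. norm y < dr ==> norm (g (x - y) - g x) <= et"
shows "norm ((LBINT y. rh y *: g (x - y)) - g x) <= et"
proof -
obtain B where B: "!!x. norm (g x) <= B" using Cc_bounded[OF g] by blast
have i: "integ (%y. rh y *: g (x - y))" by (rule conv_integrable[OF rh(1) Cc_cont[OF g] B])
have i2: "integ (%y. rh y *: g x)" using rh by simp
have "(LBINT y. rh y *: g (x - y)) - g x = (LBINT y. rh y *: g (x - y) - rh y *: g x)"
 using i i2 rh by simp
also have "norm ... <= (LBINT y. et * rh y)"
proof (rule integral_norm_bound_integral)
 show "integ (%y. rh y *: g (x - y) - rh y *: g x)" using i i2 by auto
 show "integ (%y. et * rh y)" using rh by simp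
 fix y
 show "norm (rh y *: g (x - y) - rh y *: g x) <= et * rh y"
 proof (cases "norm y < dr")
  case True
  have "norm (rh y *: g (x - y) - rh y *: g x) = rh y * norm (g (x - y) - g x)"
   using rh(2)[of y] by (simp add: scaleR_diff_right[symmetric])
  thus ?thesis using mul_l[OF close[OF True] rh(2)[of y]] by (simp add: mult.commute)
 qed (use z in auto)
qed
also have "... = et" using rh by simp
finally show ?thesis .
qed

text \<open>u is only continuous, so every derivative is put on \<open>rh\<close>. The induction
  therefore ranges over all smooth compactly supported \<open>rh\<close> and passes to the partial
  derivatives.\<close>

lemma Ck_conv:
assumes u: "u : Cc" and "!!k. Ck k rh" "rh : C1c UNIV"
shows "Ck k (%x. LBINT y. u y * rh (x - y))"
using assms(2,3)
proof (induction k arbitrary: rh)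
case 0
obtain B where B: "!!x. norm (rh x) <= B" using Cc_bounded[OF C1cD(2)[OF 0(2)]] by blast
show ?case using conv_cont[OF Cc_integrable[OF u] Cc_cont[OF C1cD(2)[OF 0(2)]] B] by simp
next
case (Suc k)
note D = C1cD[OF Suc.prems(2)]
obtain B where B: "!!x. norm (rh x) <= B" using Cc_bounded[OF D(2)] by blast
obtain B' where B': "!!x. norm (grad rh x) <= B'" using Cc_bounded[OF D(3)] by blast
have der: "GDERIV (%x. LBINT y. u y * rh (x - y)) x :> (LBINT y. u y *: grad rh (x - y))" for x
 by (rule conv_GDERIV[OF Cc_integrable[OF u] D(1), of "max B B'"])
  (use B B' in \<open>simp_all add: le_max_iff_disj\<close>)
show ?case
proof (rule CkI[OF der])
 fix b :: 'a assume b: "b : Basis"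
 have k: "Ck k (%x. grad rh x *. b)" for k using CkD(2)[OF Suc.prems(1) b] .
 obtain K where K: "compact K" "!!x. x ~: K ==> grad rh x = 0" using Suc.prems(2) by (rule C1c_support) blast
 have "(%x. grad rh x *. b) : C1c UNIV"
  using Ck_C1[OF k] K by (intro C1cI[of _ K]) auto
 from Suc.IH[OF k this] have "Ck k (%x. LBINT y. u y * (grad rh (x - y) *. b))" .
 moreover have "(LBINT y. u y * (grad rh (x - y) *. b)) = (LBINT y. u y *: grad rh (x - y)) *. b" for x
  using conv_integrable[OF Cc_integrable[OF u] Cc_cont[OF D(3)] B', of x]
  by (subst integral_inner_left[symmetric]) auto
 ultimately show "Ck k (%x. (LBINT y. u y *: grad rh (x - y)) *. b)" by simp
qed
qed

lemma test_functions_C1c: assumes "ph : test_functions Om" shows "ph : C1c Om"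
proof -
have "ph x = 0" if "x ~: closure {x. ph x ~= 0}" for x
 using that closure_subset[of "{x. ph x ~= 0}"] by auto
moreover have "Ck k ph" for k using assms by (simp add: test_functions_def)
ultimately show ?thesis using assms unfolding test_functions_def
 by (intro C1cI[OF Ck_C1, of _ "closure {x. ph x ~= 0}"]) blast+
qed

text \<open>Mollification converges uniformly together with the gradient, and all approximants live
  in one compact subset of \<open>Om\<close>. The two facts together give convergence in every
  Lebesgue norm at once.\<close>

lemma test_functions_dense:
fixes u :: "'a::euclidean_space => real"
assumes u: "u : C1c Om" and Om: "open Om"
obtains K where "compact K" "K <= Om" "!!x. x ~: K ==> u x = 0" "!!x. x ~: K ==> grad u x = 0"
 "!!et. et > 0 ==> EX ph:test_functions Om. (ALL x. x ~: K --> ph x = 0 & grad ph x = 0) &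
   (ALL x. abs (ph x - u x) <= et & norm (grad ph x - grad u x) <= et)"
proof -
note D = C1cD[OF u]
obtain K where K: "compact K" "K <= Om" "!!x. x ~: K ==> u x = 0" "!!x. x ~: K ==> grad u x = 0"
 by (rule C1c_support[OF u]) blast
obtain r where r: "r > 0" "(\<Union>x\<in>K. cball x r) <= Om"
 using compact_subset_open_imp_cball_epsilon_subset[OF K(1) Om K(2)] by blast
have L: "compact (\<Union>x\<in>K. cball x r)" using compact_minkowski_sum_cball[OF K(1)] by auto
have KL: "K <= (\<Union>x\<in>K. cball x r)" using r by force
show ?thesis
proof (rule that[OF L r(2)])
 show "x ~: (\<Union>x\<in>K. cball x r) ==> u x = 0" "x ~: (\<Union>x\<in>K. cball x r) ==> grad u x = 0" for x
  using K KL by blast+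
 fix et :: real assume et: "et > 0"
 obtain d1 where d1: "d1 > 0" "!!x y. dist y x < d1 ==> dist (u y) (u x) < et"
  using Cc_uniformly_continuous[OF D(2), unfolded uniformly_continuous_on_def, rule_format, OF et] by auto
 obtain d2 where d2: "d2 > 0" "!!x y. dist y x < d2 ==> dist (grad u y) (grad u x) < et"
  using Cc_uniformly_continuous[OF D(3), unfolded uniformly_continuous_on_def, rule_format, OF et] by auto
 \<comment> \<open>\<open>r\<close> keeps the support inside the enlarged compact set,
   \<open>d1\<close> and \<open>d2\<close> are moduli of uniform continuity of u and of its
   gradient.\<close>
 define dr where "dr = min r (min d1 d2)"
 have dr: "dr > 0" using r d1 d2 by (simp add: dr_def)
 obtain rh :: "'a => real" where rh: "!!k. Ck k rh" "!!x. rh x >= 0" "!!x. norm x >= dr ==> rh x = 0"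
  "(LBINT x. rh x) = 1" "rh : C1c UNIV" using mollifier_exists[OF dr] by blast
 note rhD = C1cD[OF rh(5)]
 have mb: "u : bmeas borel" "rh : bmeas borel" using D rhD by (auto dest: Cc_measurable)
 define ph where "ph = (%x. LBINT y. u y * rh (x - y))"
 have ph': "ph = (%x. LBINT y. rh y *: u (x - y))"
  using conv_sym[OF mb(2,1)] by (simp add: ph_def mult.commute)
 have phz: "ph x = 0" if "x ~: (\<Union>x\<in>K. cball x r)" for x
 proof -
  have "u y * rh (x - y) = 0" for y
   using that K(3)[of y] rh(3)[of "x - y"] by (force simp: dr_def dist_norm norm_minus_commute)
  hence "(%y. u y * rh (x - y)) = (%y. 0)" by auto
  thus ?thesis by (simp add: ph_def)
 qed
 obtain B where B: "!!x. norm (u x) <= B" using Cc_bounded[OF D(2)] by blast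
 obtain B' where B': "!!x. norm (grad u x) <= B'" using Cc_bounded[OF D(3)] by blast
 have gph: "grad ph x = (LBINT y. rh y *: grad u (x - y))" for x
  unfolding ph' real_scaleR_def
  by (rule gradI, rule conv_GDERIV[OF Cc_integrable[OF rhD(2)] D(1), of "max B B'"])
   (use B B' in \<open>simp_all add: le_max_iff_disj\<close>)
 have tf: "ph : test_functions Om"
 proof -
  have "{x. ph x ~= 0} <= (\<Union>x\<in>K. cball x r)" using phz by blast
  hence cl: "closure {x. ph x ~= 0} <= (\<Union>x\<in>K. cball x r)"
   by (intro closure_minimal compact_imp_closed[OF L])
  hence "compact (closure {x. ph x ~= 0})"
   using L by (meson closed_closure compact_Int_closed compact_closure bounded_subset compact_imp_bounded closure_subset order_trans)
  thus ?thesis using cl r(2) Ck_conv[OF D(2) rh(1,5)] by (auto simp: test_functions_def ph_def)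
 qed
 have gphz: "grad ph x = 0" if "x ~: (\<Union>x\<in>K. cball x r)" for x
 proof -
  have "rh y *: grad u (x - y) = 0" for y
   using that K(4)[of "x - y"] rh(3)[of y] by (force simp: dr_def dist_norm norm_minus_commute)
  hence "(%y. rh y *: grad u (x - y)) = (%y. 0)" by auto
  thus ?thesis by (simp add: gph)
 qed
 show "EX ph:test_functions Om. (ALL x. x ~: (\<Union>x\<in>K. cball x r) --> ph x = 0 & grad ph x = 0) &
   (ALL x. abs (ph x - u x) <= et & norm (grad ph x - grad u x) <= et)"
 proof (intro bexI[OF _ tf] conjI allI impI)
  fix x
  show "x ~: (\<Union>x\<in>K. cball x r) ==> ph x = 0" "x ~: (\<Union>x\<in>K. cball x r) ==> grad ph x = 0"
   using phz gphz by auto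
  have "norm (u (x - y) - u x) <= et" if "norm y < dr" for y
   using d1(2)[of "x - y" x] that by (simp add: dist_norm dr_def)
  thus "abs (ph x - u x) <= et"
   using average_close[where x=x and et=et, OF Cc_integrable[OF rhD(2)] rh(2,4,3) D(2)] by (simp add: ph')
  have "norm (grad u (x - y) - grad u x) <= et" if "norm y < dr" for y
   using d2(2)[of "x - y" x] that by (simp add: dist_norm dr_def)
  thus "norm (grad ph x - grad u x) <= et"
   using average_close[where x=x and et=et, OF Cc_integrable[OF rhD(2)] rh(2,4,3) D(3)] by (simp add: gph)
 qed
qed
qed

section \<open>Inf-sup inequalities\<close>

text \<open>The form \<open>dform l\<close> below is the energy form of \<open>l\<^sup>2 - \<Delta>\<close>.\<close>

definition Dl :: "real => ('a::euclidean_space => real) => 'a => 'a \<times> real" where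
"Dl l u x = (grad u x, l * u x)"

abbreviation "dform l u v == LBINT x. Dl l u x *. Dl l v x"

text \<open>A bound for the norm of the functional \<open>dform l u\<close> on gradients measured in
  L^q. One sign is enough, because \<open>pv\<close> may be replaced by its negative.\<close>

definition bnd :: "'a::euclidean_space set => real => real => ('a => real) => real => bool" where
"bnd Om l q u N \<longleftrightarrow> (ALL pv:C1c Om. dform l u pv <= N * nrm q (Dl l pv))"

definition infsup :: "'a::euclidean_space set => real => real => real => real => bool" where
"infsup Om l p q K \<longleftrightarrow> (ALL u:C1c Om. ALL N>=0. bnd Om l q u N --> nrm p (Dl l u) <= K * N)"

lemma infsupD: "infsup Om l p q K ==> u : C1c Om ==> N >= 0 ==> bnd Om l q u N ==> nrm p (Dl l u) <= K * N"
by (auto simp: infsup_def)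

lemma infsup_mono: "infsup Om l p q K ==> K <= K' ==> infsup Om l p q K'"
unfolding infsup_def by (meson mul_r order_trans)

lemma bndD: "bnd Om l q u N ==> pv : C1c Om ==> dform l u pv <= N * nrm q (Dl l pv)"
by (auto simp: bnd_def)

lemma Dl_Cc: "u : C1c Om ==> Dl l u : Cc"
unfolding Dl_def[abs_def] using C1cD[of u Om] Cc_scaleR[of u l] by (intro Cc_Pair) auto

lemma Dl_add: "C1 u ==> C1 v ==> Dl l (%x. u x + v x) = (%x. Dl l u x + Dl l v x)"
by (auto simp: Dl_def fun_eq_iff C1_add(2) asimps)

lemma Dl_diff: "C1 u ==> C1 v ==> Dl l (%x. u x - v x) = (%x. Dl l u x - Dl l v x)"
by (auto simp: Dl_def fun_eq_iff C1_diff(2) asimps)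

lemma Dl_cmult: "C1 u ==> Dl l (%x. c * u x) = (%x. c *: Dl l u x)"
by (auto simp: Dl_def fun_eq_iff C1_cmult(2) asimps)

lemma Dl_mult: "C1 u ==> C1 v ==> Dl l (%x. v x * u x) = (%x. v x *: Dl l u x + (u x *: grad v x, 0))"
by (auto simp: Dl_def fun_eq_iff C1_mult(2) asimps)

lemma norm_Dl: "norm (Dl l u x) = sqrt ((norm (grad u x))^2 + (l * u x)^2)"
by (simp add: Dl_def norm_Pair)

lemma norm_Dl_ge: "norm (grad u x) <= norm (Dl l u x)" "abs (l * u x) <= norm (Dl l u x)"
using norm_fst_le[of "grad u x" "l * u x"] norm_snd_le[of "l * u x" "grad u x"] by (simp_all add: Dl_def)

lemma norm_Dl_le: "norm (Dl l u x) <= norm (grad u x) + abs (l * u x)"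
unfolding Dl_def using norm_Pair_le[of "grad u x" "l * u x"] by simp

lemma norm_Dl0: "norm (Dl 0 u x) = norm (grad u x)"
by (simp add: norm_Dl)

lemma pn_Dl0: "pn M p (Dl 0 u) = pn M p (grad u)"
by (rule pn_cong) (rule norm_Dl0)

lemma Dl_inner: "Dl l u x *. Dl l v x = grad u x *. grad v x + l^2 * (u x * v x)"
by (simp add: Dl_def pow2)

lemma Dl_inner_integrable: "u : C1c Om ==> v : C1c Om' ==> integ (%x. Dl l u x *. Dl l v x)"
by (intro Cc_integrable Cc_inner Dl_Cc Cc_cont[OF Dl_Cc])

lemma nrm_bounded_support:
fixes g :: "'a::euclidean_space => 'b::euclidean_space"
assumes p: "p > 0" and K: "compact K" "!!x. x ~: K ==> g x = 0" and b: "!!x. norm (g x) <= et"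
shows "nrm p g <= et * measure lborel K powr (1/p)"
proof -
have et: "et >= 0" using b[of undefined] norm_ge_zero order_trans by blast
have Kb: "K : sets borel" using K by (simp add: borel_compact)
have iK: "integ (indicator K :: 'a => real)"
 using emeasure_compact_finite[OF K(1)] Kb by (auto intro!: integrable_real_indicator)
have "(LBINT x. norm (g x) powr p) <= (LBINT x. et powr p * indicator K x)"
proof (rule integral_mono')
 show "integ (%x. et powr p * indicator K x)" using iK by simp
 show "norm (g x) powr p <= et powr p * indicator K x" for x
  using K(2)[of x] b[of x] p by (cases "x : K") (auto intro: powr_mono2)
qed auto
also have "... = et powr p * measure lborel K" by simp
finally have "nrm p g <= (et powr p * measure lborel K) powr (1/p)"
 unfolding pn_def using p by (intro powr_mono2) (auto intro: integral_nonneg_AE)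
also have "... = et * measure lborel K powr (1/p)"
 using p et by (simp add: powr_mult powr_powr)
finally show ?thesis .
qed

lemma Cc_nrm_approx:
assumes "p >= 1" "f : Cc" "g : Cc" "compact K" "!!x. x ~: K ==> f x = 0" "!!x. x ~: K ==> g x = 0"
 "!!x. norm (f x - g x) <= et"
shows "nrm p f <= nrm p g + et * measure lborel K powr (1/p)"
proof -
have "nrm p (%x. g x + (f x - g x)) <= nrm p g + nrm p (%x. f x - g x)"
 using assms by (intro Cc_triangle Cc_diff) auto
also have "nrm p (%x. f x - g x) <= et * measure lborel K powr (1/p)"
 using assms by (intro nrm_bounded_support) auto
finally show ?thesis by simp
qed

lemma Dl_close:
assumes "abs (ph x - u x) <= et" "norm (grad ph x - grad u x) <= et"
shows "norm (Dl l ph x - Dl l u x) <= (1 + abs l) * et"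
proof -
have "norm (Dl l ph x - Dl l u x) <= norm (grad ph x - grad u x) + norm (l * ph x - l * u x)"
 unfolding Dl_def minus_prod_def fst_conv snd_conv by (rule norm_Pair_le)
also have "norm (l * ph x - l * u x) = abs l * abs (ph x - u x)"
 by (simp add: abs_mult right_diff_distrib[symmetric])
finally show ?thesis using assms mul_l[OF assms(1), of "abs l"] by (simp add: asimps)
qed

text \<open>The weak formulation tests only with smooth functions, whereas \<open>bnd\<close>
  quantifies over C^1 functions. Both sides of the inequality are continuous under the approximation
  of \<open>test_functions_dense\<close>.\<close>

lemma bnd_test_functions:
assumes Om: "open Om" and q: "q > 1" and u: "u : C1c Om'" and N: "N >= 0"
 and t: "!!pv. pv : test_functions Om ==> dform l u pv <= N * nrm q (Dl l pv)"
shows "bnd Om l q u N"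
unfolding bnd_def
proof
fix pv assume pv: "pv : C1c Om"
obtain K where K: "compact K" "K <= Om" "!!x. x ~: K ==> pv x = 0" "!!x. x ~: K ==> grad pv x = 0"
 "!!et. et > 0 ==> EX ph:test_functions Om. (ALL x. x ~: K --> ph x = 0 & grad ph x = 0) &
   (ALL x. abs (ph x - pv x) <= et & norm (grad ph x - grad pv x) <= et)"
 using test_functions_dense[OF pv Om] by metis
define A where "A = (LBINT x. norm (Dl l u x))"
have iu: "integ (%x. norm (Dl l u x))" by (intro Cc_integrable Cc_norm Dl_Cc[OF u])
have A: "A >= 0" by (simp add: A_def)
define m where "m = measure lborel K powr (1/q)"
have m: "m >= 0" by (simp add: m_def)
have est: "dform l u pv <= N * nrm q (Dl l pv) + et * ((1 + abs l) * (A + N * m))" if et: "et > 0" for et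
proof -
 obtain ph where ph: "ph : test_functions Om" "!!x. x ~: K ==> ph x = 0" "!!x. x ~: K ==> grad ph x = 0"
  "!!x. abs (ph x - pv x) <= et" "!!x. norm (grad ph x - grad pv x) <= et"
  using K(5)[OF et] by blast
 have phc: "ph : C1c Om" by (rule test_functions_C1c[OF ph(1)])
 have cl: "norm (Dl l ph x - Dl l pv x) <= (1 + abs l) * et" for x
  by (rule Dl_close[OF ph(4,5)])
 have "dform l u pv - dform l u ph
   = (LBINT x. Dl l u x *. (Dl l pv x - Dl l ph x))"
  using Dl_inner_integrable[OF u pv] Dl_inner_integrable[OF u phc] by (simp add: inner_diff_right)
 also have "... <= (LBINT x. ((1 + abs l) * et) * norm (Dl l u x))"
 proof (rule integral_mono)
  show "integ (%x. Dl l u x *. (Dl l pv x - Dl l ph x))"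
   using Dl_inner_integrable[OF u pv] Dl_inner_integrable[OF u phc] by (simp add: inner_diff_right)
  show "integ (%x. (1 + abs l) * et * norm (Dl l u x))" using iu by simp
  fix x
  have "Dl l u x *. (Dl l pv x - Dl l ph x) <= norm (Dl l u x) * norm (Dl l pv x - Dl l ph x)"
   by (rule norm_cauchy_schwarz)
  also have "... <= norm (Dl l u x) * ((1 + abs l) * et)"
   using cl[of x] by (intro mul_l) (auto simp: norm_minus_commute)
  finally show "Dl l u x *. (Dl l pv x - Dl l ph x) <= (1 + abs l) * et * norm (Dl l u x)"
   by (simp add: mult.commute)
 qed
 also have "... = (1 + abs l) * et * A" by (simp add: A_def)
 finally have 1: "dform l u pv <= N * nrm q (Dl l ph) + (1 + abs l) * et * A"
  using t[OF ph(1)] by linarith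
 have "nrm q (Dl l ph) <= nrm q (Dl l pv) + (1 + abs l) * et * m"
  unfolding m_def using q K ph pv phc cl
  by (intro Cc_nrm_approx[OF _ Dl_Cc[OF phc] Dl_Cc[OF pv]]) (auto simp: Dl_def zero_prod_def)
 hence "N * nrm q (Dl l ph) <= N * (nrm q (Dl l pv) + (1 + abs l) * et * m)"
  using N by (intro mul_l)
 thus ?thesis using 1 by (simp add: asimps)
qed
show "dform l u pv <= N * nrm q (Dl l pv)"
proof (rule field_le_epsilon)
 fix e :: real assume e: "e > 0"
 define B where "B = (1 + abs l) * (A + N * m)"
 have B: "B >= 0" using A N m by (simp add: B_def)
 have "e / (B + 1) * B <= e" using e B by (simp add: field_simps)
 thus "dform l u pv <= N * nrm q (Dl l pv) + e"
  using est[of "e / (B+1)"] e B unfolding B_def[symmetric] by simp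
qed
qed

lemma integral_lebesgue_on_Cc:
fixes f :: "'a::euclidean_space => 'b::euclidean_space"
assumes "f : bmeas borel" "Om : sets borel" "!!x. x ~: Om ==> f x = 0"
shows "(LINT x|lebesgue_on Om. f x) = (LBINT x. f x)" (is ?A)
 and "integrable (lebesgue_on Om) f \<longleftrightarrow> integ f" (is ?B)
proof -
have Om: "Om \<inter> space lebesgue : sets lebesgue" using assms by auto
have eq: "(%x. indicator Om x *: f x) = f" using assms(3) by (auto simp: indicator_def)
have "(LINT x|lebesgue_on Om. f x) = (\<integral>x. indicator Om x *: f x \<partial>lebesgue)"
 by (rule integral_restrict_space[OF Om])
also have "... = (LBINT x. f x)" unfolding eq by (rule integral_completion) (use assms in auto)
finally show ?A .
have "integrable (lebesgue_on Om) f \<longleftrightarrow> integrable lebesgue (%x. indicator Om x *: f x)"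
 by (rule integrable_restrict_space[OF Om])
also have "... \<longleftrightarrow> integ f" unfolding eq by (rule integrable_completion) (use assms in auto)
finally show ?B .
qed

text \<open>The inf-sup inequality is applied to the test functions \<open>ph n\<close> that
  approximate u. Their functional differs from that of u by at most the gradient error
  \<open>e n\<close>, by Hoelder, so its norm is at most \<open>e n\<close> plus the norm of f; then
  n tends to infinity.\<close>

lemma weak_solution_estimate:
fixes Om :: "'a::euclidean_space set"
assumes Om: "open Om" and pq: "conj_exp p q" and inf: "infsup Om 0 p q K" and K: "K >= 0"
 and f: "f : Lp Om p" and sol: "weak_solution Om p f u"
shows "Lp_norm Om p (weak_gradient Om u) <= K * Lp_norm Om p f"
proof -
note pq' = conj_expD(1,2)[OF pq]
define M where "M = lebesgue_on Om"
define w where "w = weak_gradient Om u"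
have Lpn: "Lp_norm Om p g = pn M p g" for g :: "'a => 'a" by (simp add: Lp_norm_def pn_def M_def)
have Omb: "Om : sets borel" using Om by simp
have bm: "g : bmeas M" if "g : bmeas borel" for g :: "'a => 'a"
 unfolding M_def using that by (intro measurable_restrict_space1 measurable_completion) simp
have fM: "f : bmeas M" "integrable M (%x. norm (f x) powr p)"
 using f by (auto simp: Lp_def M_def)
from sol have uW: "u : W1p Om p" and we: "!!ph. ph : test_functions Om ==> (LINT x|M. w x *. grad ph x) = - (LINT x|M. f x *. grad ph x)"
 by (auto simp: weak_solution_def W1p_0_def M_def w_def)
from sol obtain ph where ph: "!!n::nat. ph n : test_functions Om"
 and lim: "(%n. Lp_norm Om p (%x. grad (ph n) x - w x)) ----> 0"
 unfolding weak_solution_def W1p_0_def w_def by blast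
have wM: "w : bmeas M" "integrable M (%x. norm (w x) powr p)"
 using uW by (auto simp: W1p_def Lp_def M_def w_def)
define e where "e n = pn M p (%x. grad (ph n) x - w x)" for n
have e0: "e ----> 0" using lim unfolding Lpn e_def[symmetric] by (simp add: e_def[abs_def])
have e_nn: "e n >= 0" for n by (simp add: e_def)
have gM: "grad pv : bmeas M" "!!r. r > 0 ==> integrable M (%x. norm (grad pv x) powr r)"
 "!!r. r > 0 ==> pn M r (grad pv) = nrm r (grad pv)" if h: "pv : C1c Om" for pv
proof -
 note D = C1cD[OF h]
 obtain L where L: "L <= Om" "!!x. x ~: L ==> grad pv x = 0" using h by (rule C1c_support) blast
 have mb: "grad pv : bmeas borel" using D by (auto dest: Cc_measurable)
 show "grad pv : bmeas M" by (rule bm[OF mb])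
 fix r :: real assume r: "r > 0"
 have z: "x ~: Om ==> norm (grad pv x) powr r = 0" for x using L by auto
 have mb': "(%x. norm (grad pv x) powr r) : bmeas borel" using mb by simp
 note i = integral_lebesgue_on_Cc[OF mb' Omb z]
 show "integrable M (%x. norm (grad pv x) powr r)"
  using i(2) Cc_int_powr[OF D(3) r] by (simp add: M_def)
 show "pn M r (grad pv) = nrm r (grad pv)" using i(1) by (simp add: pn_def M_def)
qed
have ip: "(LINT x|M. grad xi x *. grad pv x) = (LBINT x. grad xi x *. grad pv x)"
 if h: "xi : C1c Om" "pv : C1c Om" for xi pv
proof -
 obtain L where L: "L <= Om" "!!x. x ~: L ==> grad pv x = 0" using h(2) by (rule C1c_support) blast
 have "grad xi : bmeas borel" "grad pv : bmeas borel" using C1cD(3)[OF h(1)] C1cD(3)[OF h(2)] by (auto dest: Cc_measurable)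
 moreover have "grad pv x = 0" if "x ~: Om" for x using L that by blast
 ultimately show ?thesis unfolding M_def by (intro integral_lebesgue_on_Cc(1) Omb) auto
qed
have est: "nrm p (grad (ph n)) <= K * (e n + pn M p f)" for n
proof -
 have phc: "ph n : C1c Om" by (rule test_functions_C1c[OF ph])
 have dM: "(%x. grad (ph n) x - w x) : bmeas M" using gM(1)[OF phc] wM(1) by simp
 have di: "integrable M (%x. norm (grad (ph n) x - w x) powr p)"
  using integrable_powr_add[of p "grad (ph n)" M "%x. - w x"] gM(1,2)[OF phc] wM pq' by simp
 have "bnd Om 0 q (ph n) (e n + pn M p f)"
 proof (rule bnd_test_functions[OF Om pq'(2) phc])
  show "0 <= e n + pn M p f" using e_nn by simp
  fix pv assume pv: "pv : test_functions Om"
  have pvc: "pv : C1c Om" by (rule test_functions_C1c[OF pv])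
  have q0: "q > 0" using pq' by simp
  note g = gM(1)[OF pvc] gM(2)[OF pvc q0]
  have "(LBINT x. Dl 0 (ph n) x *. Dl 0 pv x) = (LINT x|M. grad (ph n) x *. grad pv x)"
   by (simp add: Dl_inner ip[OF phc pvc])
  also have "... = (LINT x|M. (grad (ph n) x - w x) *. grad pv x + w x *. grad pv x)"
   by (simp add: inner_diff_left)
  also have "... = (LINT x|M. (grad (ph n) x - w x) *. grad pv x) + (LINT x|M. w x *. grad pv x)"
   by (intro integral_add holder_inner(1)[OF pq dM g(1) di g(2)] holder_inner(1)[OF pq wM(1) g(1) wM(2) g(2)])
  also have "... <= e n * pn M q (grad pv) + pn M p f * pn M q (grad pv)"
   using holder_inner(2)[OF pq dM g(1) di g(2)] holder_inner(2)[OF pq fM(1) g(1) fM(2) g(2)] we[OF pv]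
   unfolding e_def by linarith
  also have "... = (e n + pn M p f) * nrm q (Dl 0 pv)"
   using gM(3)[OF pvc q0] by (simp add: asimps pn_Dl0)
  finally show "(LBINT x. Dl 0 (ph n) x *. Dl 0 pv x) <= (e n + pn M p f) * nrm q (Dl 0 pv)" .
 qed
 from infsupD[OF inf phc _ this] have "nrm p (Dl 0 (ph n)) <= K * (e n + pn M p f)" using e_nn by simp
 thus ?thesis by (simp add: pn_Dl0)
qed
have fin: "pn M p w <= e n + K * (e n + pn M p f)" for n
proof -
 have phc: "ph n : C1c Om" by (rule test_functions_C1c[OF ph])
 have p0: "p > 0" using pq' by simp
 have dM: "(%x. w x - grad (ph n) x) : bmeas M" using gM(1)[OF phc] wM(1) by simp
 have di: "integrable M (%x. norm (w x - grad (ph n) x) powr p)"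
  using integrable_powr_add[of p "%x. - grad (ph n) x" M w] gM(1)[OF phc] gM(2)[OF phc p0] wM pq' by simp
 have "pn M p (%x. (w x - grad (ph n) x) + grad (ph n) x) <= pn M p (%x. w x - grad (ph n) x) + pn M p (grad (ph n))"
  using pq' by (intro pn_triangle dM di gM(1)[OF phc] gM(2)[OF phc]) auto
 also have "pn M p (%x. w x - grad (ph n) x) = e n"
  unfolding e_def by (rule pn_cong) (simp add: norm_minus_commute)
 finally show ?thesis using est[of n] gM(3)[OF phc p0] by simp
qed
have "(%n. e n + K * (e n + pn M p f)) ----> 0 + K * (0 + pn M p f)"
 by (intro tendsto_intros e0)
hence "pn M p w <= 0 + K * (0 + pn M p f)" by (rule tendsto_lowerbound) (auto simp: fin)
thus ?thesis by (simp add: Lpn w_def)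
qed

section \<open>The heat kernel\<close>

lemma ennreal_le_suminf: "(f n :: ennreal) <= suminf f"
using sum_le_suminf[of f "{n}"] by simp

text \<open>A comparison with a geometric series over dyadic balls: the ball of radius 2^n has
  volume of order 2^(nd), while the function is of order 2^(-ka n) outside the ball of half that
  radius.\<close>

lemma decay_integrable:
assumes ka: "ka > real DIM('a)"
shows "integ (%z::'a::euclidean_space. (1 + (norm z)^2) powr (- ka/2))"
proof (rule integrableI_bounded)
have "cont UNIV (%z::'a. (1 + (norm z)^2) powr (- ka/2))"
 by (intro cintro) (auto simp: add_nonneg_eq_0_iff)
thus "(%z::'a. (1 + (norm z)^2) powr (- ka/2)) : bmeas lborel"
 by (auto intro: cont_bmeas)
let ?d = "real DIM('a)"
let ?c = "%n::nat. 2 powr (ka * (1 - real n))"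
let ?V = "unit_ball_vol ?d"
have ka0: "ka > 0" using ka by (auto intro: le_less_trans)
have pt: "ennreal (norm ((1 + (norm z)^2) powr (- ka/2))) <= (\<Sum>n. ennreal (?c n) * indicator (ball (0::'a) (2 ^ n)) z)" for z :: 'a
proof -
 \<comment> \<open>Only the term of this index is retained from the series. The shift 1 - n in the
   coefficient accounts for the lower bound |z| >= 2^(n-1) and also makes the coefficient at n = 0
   at least 1.\<close>
 define n where "n = (LEAST n::nat. norm z < 2 ^ n)"
 have ex: "EX n::nat. norm z < 2 ^ n" using real_arch_pow[of 2 "norm z"] by auto
 have n: "norm z < 2 ^ n" unfolding n_def by (rule LeastI_ex[OF ex])
 have "(1 + (norm z)^2) powr (- ka/2) <= ?c n"
 proof (cases n)
  case 0
  have "(1 + (norm z)^2) powr (- ka/2) <= 1"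
   using ka0 powr_mono2'[of "-ka/2" 1 "1 + (norm z)^2"] by simp
  also have "1 <= (2::real) powr ka" using ka0 by (simp add: ge_one_powr_ge_zero)
  finally show ?thesis using 0 by simp
 next
  case (Suc m)
  have "~ norm z < 2 ^ m" using not_less_Least[of m "%n. norm z < 2 ^ n"] Suc n_def by auto
  hence ge: "2 ^ m <= norm z" by simp
  have "(2 powr (real m * 2)) = ((2::real) ^ m)^2"
   by (simp add: powr_realpow[symmetric] powr_powr)
  also have "... <= (norm z)^2" using ge by (intro power_mono) auto
  finally have "2 powr (real m * 2) <= 1 + (norm z)^2" by simp
  hence "(1 + (norm z)^2) powr (- (ka/2)) <= (2 powr (real m * 2)) powr (- (ka/2))"
   using ka0 by (intro powr_mono2') auto
  also have "... = ?c n" using Suc by (simp add: powr_powr asimps)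
  finally show ?thesis by simp
 qed
 hence "ennreal (norm ((1 + (norm z)^2) powr (- ka/2))) <= ennreal (?c n) * indicator (ball (0::'a) (2 ^ n)) z"
  using n by (simp add: ennreal_leI)
 also have "... <= (\<Sum>n. ennreal (?c n) * indicator (ball (0::'a) (2 ^ n)) z)"
  by (rule ennreal_le_suminf)
 finally show ?thesis .
qed
have "(\<integral>\<^sup>+z. ennreal (norm ((1 + (norm (z::'a))^2) powr (- ka/2))) \<partial>lborel) <=
  (\<integral>\<^sup>+z. (\<Sum>n. ennreal (?c n) * indicator (ball (0::'a) (2 ^ n)) z) \<partial>lborel)"
 by (intro nn_integral_mono pt)
also have "... = (\<Sum>n. ennreal (?c n) * emeasure lborel (ball (0::'a) (2 ^ n)))"
proof (subst nn_integral_suminf)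
 show "(%z. ennreal (?c n) * indicator (ball (0::'a) (2 ^ n)) z) : bmeas lborel" for n
  by (rule borel_measurable_times_ennreal[OF borel_measurable_const borel_measurable_indicator]) simp
 have "(\<integral>\<^sup>+z. ennreal (?c n) * indicator (ball (0::'a) (2 ^ n)) z \<partial>lborel) = ennreal (?c n) * emeasure lborel (ball (0::'a) (2 ^ n))" for n
  by (rule nn_integral_cmult_indicator) simp
 thus "(\<Sum>n. \<integral>\<^sup>+z. ennreal (?c n) * indicator (ball (0::'a) (2 ^ n)) z \<partial>lborel) =
  (\<Sum>n. ennreal (?c n) * emeasure lborel (ball (0::'a) (2 ^ n)))" by (simp only:)
qed
also have "... = (\<Sum>n. ennreal (2 powr ka * ?V * (2 powr (?d - ka)) ^ n))"
proof (rule arg_cong[where f=suminf], rule ext)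
 fix n :: nat
 have p1: "((2::real) ^ n) ^ DIM('a) = 2 powr (real n * ?d)"
  using powr_realpow[of 2 "n * DIM('a)"] by (simp add: power_mult)
 have p2: "((2::real) powr (?d - ka)) ^ n = 2 powr ((?d - ka) * real n)"
  using powr_realpow[of "2 powr (?d - ka)" n] by (simp add: powr_powr)
 have "?c n * 2 powr (real n * ?d) = 2 powr ka * 2 powr ((?d - ka) * real n)"
  unfolding powr_add[symmetric] by (rule arg_cong[where f="%e. 2 powr e"]) (simp add: asimps)
 hence "?c n * (?V * (2 ^ n) ^ DIM('a)) = 2 powr ka * ?V * (2 powr (?d - ka)) ^ n"
  unfolding p1 p2 by (simp only: mult_ac)
 thus "ennreal (?c n) * emeasure lborel (ball (0::'a) (2 ^ n)) = ennreal (2 powr ka * ?V * (2 powr (?d - ka)) ^ n)"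
  by (simp only: emeasure_ball ennreal_mult'[symmetric] powr_ge_zero zero_le_power zero_le_numeral)
qed
also have "... < \<infinity>"
proof -
 have "2 powr (?d - ka) < 1" using ka powr_less_mono[of "?d - ka" 0 2] by simp
 hence "summable (%n. 2 powr ka * ?V * (2 powr (?d - ka)) ^ n)"
  by (intro summable_mult summable_geometric) simp
 thus ?thesis by (subst suminf_ennreal2) (auto intro!: mult_nonneg_nonneg)
qed
finally show "(\<integral>\<^sup>+z. ennreal (norm ((1 + (norm (z::'a))^2) powr (- ka/2))) \<partial>lborel) < \<infinity>" .
qed

text \<open>A single integrable weight, against which the spatial decay of the heat kernel, of its
  derivatives and of all heat flows is recorded. Its polynomial decay is weak enough to survive
  translations with a constant factor.\<close>

definition dw :: "'a::euclidean_space => real" where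
"dw z = 1 / (1 + (norm z)^2) ^ DIM('a)"

lemma one_plus_pos [simp]: "1 + (norm z)^2 > 0" "1 + (norm z)^2 ~= 0"
by (smt (verit) zero_le_power2)+

lemma dw_pos: "dw z > 0" and dw_le_1: "dw z <= 1"
by (auto simp: dw_def divide_le_eq_1 one_le_power)

lemma dw_integrable: "integ (dw :: 'a::euclidean_space => real)"
proof -
have "dw z = (1 + (norm z)^2) powr (- (2 * real DIM('a)) / 2)" for z :: 'a
proof -
 have "(1 + (norm z)^2) powr (- (2 * real DIM('a)) / 2) = (1 + (norm z)^2) powr (- real DIM('a))" by simp
 also have "... = inverse ((1 + (norm z)^2) powr (real DIM('a)))" by (rule powr_minus)
 also have "(1 + (norm z)^2) powr (real DIM('a)) = (1 + (norm z)^2) ^ DIM('a)" by (rule powr_realpow[OF one_plus_pos(1)])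
 finally show ?thesis by (simp only: dw_def inverse_eq_divide)
qed
hence "dw = (%z::'a. (1 + (norm z)^2) powr (- (2 * real DIM('a)) / 2))" by auto
moreover have "2 * real DIM('a) > real DIM('a)" by (simp add: DIM_positive)
ultimately show ?thesis using decay_integrable[where 'a='a and ka="2 * real DIM('a)"] by simp
qed

text \<open>Peetre's inequality 1 + |x|^2 <= 2 (1 + |y|^2) (1 + |x-y|^2), raised to the power
  d.\<close>

lemma dw_shift:
fixes x y :: "'a::euclidean_space"
assumes "norm y <= rh" shows "dw (x - y) <= (2 * (1 + rh^2)) ^ DIM('a) * dw x"
proof -
have "(norm x)^2 <= (norm (x - y) + norm y)^2"
 using norm_triangle_ineq[of "x - y" y] by (intro power_mono) auto
also have "... <= 2 * (norm (x - y))^2 + 2 * (norm y)^2"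
 using zero_le_power2[of "norm (x-y) - norm y"] by (simp add: pow2 asimps)
finally have "(norm x)^2 <= 2 * (norm (x - y))^2 + 2 * (norm y)^2" .
moreover have "2 * (1 + (norm y)^2) * (1 + (norm (x-y))^2) =
  2 + 2 * (norm (x - y))^2 + 2 * (norm y)^2 + 2 * ((norm y)^2 * (norm (x-y))^2)" by (simp add: asimps)
moreover have "0 <= (norm y)^2 * (norm (x-y))^2" by simp
ultimately have "1 + (norm x)^2 <= 2 * (1 + (norm y)^2) * (1 + (norm (x-y))^2)" by linarith
also have "... <= 2 * (1 + rh^2) * (1 + (norm (x-y))^2)"
 using assms by (intro mul_r mul_l add_left_mono power_mono) auto
finally have "(1 + (norm x)^2) ^ DIM('a) <= (2 * (1 + rh^2) * (1 + (norm (x-y))^2)) ^ DIM('a)"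
 by (intro power_mono) auto
hence "(1 + (norm x)^2) ^ DIM('a) <= (2 * (1 + rh^2)) ^ DIM('a) * (1 + (norm (x-y))^2) ^ DIM('a)"
 by (simp only: power_mult_distrib)
moreover have "1 / P <= A * (1 / Q)" if "Q <= A * P" "P > 0" "Q > 0" for A P Q :: real
 using that by (simp add: field_simps)
ultimately show ?thesis unfolding dw_def by (auto intro: zero_less_power)
qed

text \<open>The constant is uniform over the times in T, which is what dominated convergence in time
  and time integrals over compact intervals require.\<close>

definition dwle :: "real set => (real => 'a::euclidean_space => 'b::real_normed_vector) => bool" where
"dwle T F \<longleftrightarrow> (EX C>0. ALL t:T. ALL x. norm (F t x) <= C * dw x)"

lemma dwleI: assumes "!!t x. t : T ==> norm (F t x) <= C * dw x" shows "dwle T F"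
proof -
have "C * dw x <= (abs C + 1) * dw x" for x :: 'a using dw_pos[of x] by (intro mul_r) auto
thus ?thesis unfolding dwle_def using assms order_trans by (intro exI[of _ "abs C + 1"]) fastforce
qed

lemma dwleE: assumes "dwle T F"
obtains C where "C > 0" "!!t x. t : T ==> norm (F t x) <= C * dw x" "!!t x. t : T ==> norm (F t x) <= C"
proof -
obtain C where C: "C > 0" "!!t x. t : T ==> norm (F t x) <= C * dw x" using assms unfolding dwle_def by blast
show ?thesis
 by (rule that[OF C]) (auto intro: order_trans[OF C(2)] simp: dw_le_1 C(1) mult_le_cancel_left1)
qed

lemma dwle_le: assumes "dwle T F" "!!t x. t : T ==> norm (G t x) <= K * norm (F t x)" shows "dwle T G"
proof -
obtain C where C: "!!t x. t : T ==> norm (F t x) <= C * dw x" using assms(1) by (rule dwleE) blast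
have "norm (G t x) <= abs K * C * dw x" if "t : T" for t x
 using order_trans[OF assms(2)[OF that] mult_mono[OF abs_ge_self C[OF that]]] by (simp add: mult.assoc)
thus ?thesis by (rule dwleI)
qed

lemma dwle_add: assumes "dwle T F" "dwle T G" shows "dwle T (%t x. F t x + G t x)"
proof -
obtain A B where "!!t x. t : T ==> norm (F t x) <= A * dw x" "!!t x. t : T ==> norm (G t x) <= B * dw x"
 using dwleE[OF assms(1)] dwleE[OF assms(2)] by metis
thus ?thesis by (intro dwleI[of _ _ "A + B"]) (auto simp: distrib_right intro!: order_trans[OF norm_triangle_ineq] add_mono)
qed

lemma dwleE2:
fixes F :: "real => 'a::euclidean_space => 'b::real_normed_vector" and G :: "real => 'a => 'c::real_normed_vector"
assumes "dwle T F" "dwle T G"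
obtains C where "C > 0" "!!t x. t : T ==> norm (F t x) <= C * dw x" "!!t x. t : T ==> norm (G t x) <= C * dw x"
 "!!t x. t : T ==> norm (F t x) <= C" "!!t x. t : T ==> norm (G t x) <= C"
proof -
have "dwle T (%t x. norm (F t x) + norm (G t x))" using assms by (intro dwle_add) (auto simp: dwle_def)
then obtain C where C: "C > 0" "!!t x. t : T ==> norm (norm (F t x) + norm (G t x)) <= C * dw x" "!!t x. t : T ==> norm (norm (F t x) + norm (G t x)) <= C"
 by (rule dwleE) blast
have "norm (F t x) <= norm (norm (F t x) + norm (G t x))" "norm (G t x) <= norm (norm (F t x) + norm (G t x))" for t x by simp_all
with C show ?thesis by (intro that[of C]) (blast intro: order_trans)+
qed

lemma dwle_bdd2:
fixes F :: "real => 'a::euclidean_space => 'b::real_normed_vector" and G :: "real => 'a => 'c::real_normed_vector"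
assumes "dwle {t..t} F" "dwle {t..t} G"
obtains C where "C > 0" "!!x. norm (F t x) <= C" "!!x. norm (G t x) <= C"
proof -
have t: "t : {t..t}" by simp
obtain C where "C > 0" "!!s x. s : {t..t} ==> norm (F s x) <= C" "!!s x. s : {t..t} ==> norm (G s x) <= C"
 by (rule dwleE2[OF assms]) blast
thus ?thesis using that t by blast
qed

lemma dwle_comp: "dwle T F ==> (!!t. t : S ==> r t : T) ==> dwle S (%t. F (r t))"
unfolding dwle_def by blast

lemma dwle_diff: "dwle T F ==> dwle T G ==> dwle T (%t x. F t x - G t x)"
using dwle_add[of T F "%t x. - G t x"] dwle_le[of T G "%t x. - G t x" 1] by simp

lemma dwle_sum: "(!!i. i : I ==> dwle T (F i)) ==> dwle T (%t x. SUM i:I. F i t x)"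
by (induction I rule: infinite_finite_induct) (auto intro: dwle_add dwleI[of _ _ 0])

lemma dwle_mult:
fixes F G :: "real => 'a::euclidean_space => real"
assumes F: "dwle T F" and G: "dwle T G" shows "dwle T (%t x. F t x * G t x)"
proof -
obtain C where C: "C > 0" "!!t x. t : T ==> norm (F t x) <= C" using F by (rule dwleE) blast
show ?thesis by (rule dwle_le[OF G, of _ C]) (auto simp: abs_mult intro!: mul_r C(2)[simplified])
qed

lemma exp_poly_bound:
assumes "c > 0" shows "EX C>0. ALL s>=1. s ^ m * exp (- c * s) <= (C::real)"
proof (cases "m = 0")
case True
thus ?thesis using assms by (intro exI[of _ 1]) auto
next
case False
have "s ^ m * exp (- c * s) <= (real m / c) ^ m" if "s >= 1" for s
proof -
 have "(c * s / real m) ^ m <= (1 + c * s / real m) ^ m"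
  using assms that by (intro power_mono) auto
 also have "... <= exp (c * s)" using assms that False
  by (intro exp_ge_one_plus_x_over_n_power_n) (auto intro: order_trans[of _ 0])
 finally have "(c * s / real m) ^ m * exp (- c * s) <= exp (c * s) * exp (- c * s)" by (rule mul_r) simp
 also have "... = 1" by (simp add: mult_exp_exp)
 finally have "(c / real m) ^ m * (s ^ m * exp (- c * s)) <= 1" by (simp add: power_mult_distrib power_divide mult_ac)
 thus ?thesis using assms False by (simp add: power_divide field_simps)
qed
thus ?thesis using assms False by (intro exI[of _ "(real m / c) ^ m"]) auto
qed

text \<open>Normalizing by the integral itself avoids evaluating the Gaussian integral; only its
  positivity matters.\<close>

definition gc0 :: "'a::euclidean_space itself => real" where
"gc0 _ = (LBINT z. exp (- (norm (z::'a))\<^sup>2 / 4))"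

definition hk :: "real => 'a::euclidean_space => real" where
"hk t z = t powr (- real DIM('a) / 2) * exp (- (norm z)\<^sup>2 / (4 * t)) / gc0 TYPE('a)"

lemma gauss_decay:
assumes "c > 0"
shows "EX C>0. ALL z::'a::euclidean_space. (1 + (norm z)^2) ^ m * exp (- c * (norm z)^2) <= C * dw z"
proof -
obtain C where C: "C > 0" "!!s. s >= 1 ==> s ^ (m + DIM('a)) * exp (- c * s) <= C"
 using exp_poly_bound[OF assms, of "m + DIM('a)"] by blast
have "(1 + (norm z)^2) ^ m * exp (- c * (norm z)^2) <= (C * exp c) * dw z" for z :: 'a
proof -
 have "exp (- c * (1 + (norm z)^2)) * exp c = exp (- c * (norm z)^2)" by (simp add: mult_exp_exp asimps)
 moreover have "(1 + (norm z)^2) ^ (m + DIM('a)) * exp (- c * (1 + (norm z)^2)) * exp c <= C * exp c"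
  using C(2)[of "1 + (norm z)^2"] by (intro mul_r) auto
 ultimately have "(1 + (norm z)^2) ^ (m + DIM('a)) * exp (- c * (norm z)^2) <= C * exp c" by (simp add: mult.assoc)
 thus ?thesis by (simp add: dw_def power_add field_simps)
qed
thus ?thesis using C by (intro exI[of _ "C * exp c"]) auto
qed

lemma gauss_cont: "cont UNIV (%z::'a::euclidean_space. exp (- (norm z)\<^sup>2 / c))"
unfolding divide_inverse by (intro cintro)

lemma gauss_integrable: "c > 0 ==> integ (%z::'a::euclidean_space. exp (- (norm z)\<^sup>2 / c))"
proof -
assume c: "c > 0"
obtain C where C: "C > 0" "!!z::'a. (1 + (norm z)^2) ^ 0 * exp (- (1/c) * (norm z)^2) <= C * dw z"
 using gauss_decay[of "1/c" 0] c by auto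
show ?thesis
proof (rule integrable_bound)
 show "integ (%z::'a. C * dw z)" using dw_integrable[where 'a='a] by simp
 show "(%z::'a. exp (- (norm z)\<^sup>2 / c)) : bmeas lborel"
  using gauss_cont by (auto intro: cont_bmeas)
 show "AE z::'a in lborel. norm (exp (- (norm z)\<^sup>2 / c)) <= norm (C * dw z)"
 proof (rule AE_I2)
  fix z :: 'a
  have "exp (- (norm z)\<^sup>2 / c) <= C * dw z" using C(2)[of z] by simp
  thus "norm (exp (- (norm z)\<^sup>2 / c)) <= norm (C * dw z)" using C(1) dw_pos[of z] by simp
 qed
qed
qed

lemma gc0_pos: "gc0 TYPE('a::euclidean_space) > 0"
proof -
have "gc0 TYPE('a) >= 0" unfolding gc0_def by (rule integral_nonneg_AE) auto
moreover have "gc0 TYPE('a) ~= 0"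
proof
 assume "gc0 TYPE('a) = 0"
 hence "AE z::'a in lborel. exp (- (norm z)\<^sup>2 / 4) = 0"
  using integral_nonneg_eq_0_iff_AE[OF gauss_integrable[of 4, where 'a='a]] unfolding gc0_def by auto
 hence "AE z::'a in lborel. z : {}" by simp
 hence "AE z::'a in lebesgue. z : {}" by (rule AE_completion)
 from mem_closed_if_AE_lebesgue[OF closed_empty this] show False by simp
qed
ultimately show ?thesis by simp
qed

lemma hk_pos: "t > 0 ==> hk t (z::'a::euclidean_space) > 0"
using gc0_pos[where 'a='a] by (simp add: hk_def)

lemma hk_minus: "hk t (- z) = hk t z" and hk_sym: "hk t (x - y) = hk t (y - x)"
by (simp_all add: hk_def norm_minus_commute)

lemma hk_integrable: assumes "t > 0" shows "integ (hk t :: 'a::euclidean_space => real)"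
unfolding hk_def using gauss_integrable[of "4*t", where 'a='a] assms by simp

lemma hk_integral: assumes t: "t > 0" shows "(LBINT z. hk t (z::'a::euclidean_space)) = 1"
proof -
have [measurable]: "hk t : bmeas (borel :: 'a measure)" using hk_integrable[OF t] by auto
have e: "hk t (sqrt t *: z) = t powr (- real DIM('a) / 2) / gc0 TYPE('a) * exp (- (norm z)\<^sup>2 / 4)" for z :: 'a
 using t by (simp add: hk_def power_mult_distrib)
have "(LBINT z. hk t (z::'a)) = sqrt t ^ DIM('a) * (LBINT z. hk t (sqrt t *: (z::'a)))"
 using integral_scale[of "sqrt t" "hk t :: 'a => real"] t by simp
also have "... = sqrt t ^ DIM('a) * (t powr (- real DIM('a) / 2) / gc0 TYPE('a) * gc0 TYPE('a))"
 unfolding e by (simp add: gc0_def)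
also have "... = sqrt t ^ DIM('a) * t powr (- real DIM('a) / 2)"
 using gc0_pos[where 'a='a] by simp
also have "sqrt t ^ DIM('a) = t powr (real DIM('a) / 2)"
 using t by (simp add: powr_half_sqrt[symmetric] powr_realpow[symmetric] powr_powr)
finally show ?thesis using t by (simp add: powr_add[symmetric])
qed

text \<open>The row in direction \<open>e\<close> of the Hessian of the heat kernel;
  \<open>hk1\<close> below is its gradient.\<close>

definition hk2 :: "'a::euclidean_space => real => 'a => 'a" where
"hk2 e t z = (hk t z / (4 * t^2) * (z *. e)) *: z - (hk t z / (2 * t)) *: e"

definition hk1 :: "real => 'a::euclidean_space => 'a" where
"hk1 t z = (- (hk t z / (2 * t))) *: z"

lemma hk_jcont: "cont ({0<..} \<times> UNIV) (%p. hk (fst p) (snd p :: 'a::euclidean_space))"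
unfolding hk_def using gc0_pos[where 'a='a] by (intro cintro) auto

lemma hk1_jcont: "cont ({0<..} \<times> UNIV) (%p. hk1 (fst p) (snd p :: 'a::euclidean_space))"
unfolding hk1_def by (intro cintro hk_jcont) auto

lemma hk2_jcont: "cont ({0<..} \<times> UNIV) (%p. hk2 e (fst p) (snd p :: 'a::euclidean_space))"
unfolding hk2_def by (intro cintro hk_jcont) auto

lemma jcont_slice:
fixes f :: "real => 'a::euclidean_space => 'b::euclidean_space"
assumes "jcont f" "t > 0"
shows "cont UNIV (f t)"
proof -
have c: "cont UNIV (%x::'a. (t, x))" by (intro cintro)
show ?thesis using cont_comp2[OF assms(1) c] assms(2) by auto
qed

lemma hk_GDERIV: assumes "t > 0" shows "GDERIV (hk t) z :> hk1 t z"
proof -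
have "GDERIV (%z::'a. (norm z)\<^sup>2) z :> 2 *: z"
 using C1_GDERIV[OF C1_norm2(1)[of 0]] by (simp add: C1_norm2(2)[of 0, simplified])
moreover have "((%r. t powr (- real DIM('a) / 2) * exp (- r / (4 * t)) / gc0 TYPE('a)) hrd
  t powr (- real DIM('a) / 2) * (exp (- r / (4 * t)) * (- 1 / (4*t))) / gc0 TYPE('a)) (at r)" for r
 using assms gc0_pos[where 'a='a] by (auto intro!: derivative_eq_intros simp: field_simps)
ultimately have "GDERIV (%z::'a. t powr (- real DIM('a) / 2) * exp (- (norm z)\<^sup>2 / (4 * t)) / gc0 TYPE('a)) z :>
 (t powr (- real DIM('a) / 2) * (exp (- (norm z)\<^sup>2 / (4 * t)) * (- 1 / (4*t))) / gc0 TYPE('a)) *: 2 *: z"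
 by (rule GDERIV_DERIV_compose)
thus ?thesis unfolding hk_def[abs_def] hk1_def by (simp add: field_simps)
qed

lemma hk_C1: assumes "t > 0" shows "C1 (hk t)" "grad (hk t) = hk1 t"
using C1I[OF hk_GDERIV[OF assms] jcont_slice[OF hk1_jcont assms]] by auto

lemma hk1_GDERIV: assumes "t > 0" shows "GDERIV (%z. hk1 t z *. e) z :> hk2 e t z"
proof -
have "GDERIV (%z. hk t z * ((-1/(2*t)) * (z *. e))) z :> hk t z *: ((-1/(2*t)) *: e) + ((-1/(2*t)) * (z *. e)) *: hk1 t z"
 by (rule GDERIV_mult[OF hk_GDERIV[OF assms] C1_GDERIV[OF C1_cmult(1)[OF C1_inner(1)[of e], of "-1/(2*t)"],
  unfolded C1_cmult(2)[OF C1_inner(1)] C1_inner(2)]])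
moreover have "hk t z *: ((-1/(2*t)) *: e) + ((-1/(2*t)) * (z *. e)) *: hk1 t z = hk2 e t z"
 using assms by (simp add: hk1_def hk2_def pow2)
moreover have "(%z. hk t z * ((-1/(2*t)) * (z *. e))) = (%z. hk1 t z *. e)"
 by (auto simp: hk1_def)
ultimately show ?thesis by simp
qed

lemma hk1_C1: assumes "t > 0" shows "C1 (%z. hk1 t z *. e)" "grad (%z. hk1 t z *. e) = hk2 e t"
using C1I[OF hk1_GDERIV[OF assms] jcont_slice[OF hk2_jcont assms]] by auto

text \<open>The trace of the Hessian. That it is at the same time the time derivative, as shown in
  \<open>hk_time_deriv\<close>, is the heat equation.\<close>

definition hkt :: "real => 'a::euclidean_space => real" where
"hkt t z = (SUM e:Basis. hk2 e t z *. e)"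

lemma hkt_eq: "hkt t z = hk t z * ((norm z)^2 / (4 * t^2) - real DIM('a) / (2 * t))" for z :: "'a::euclidean_space"
proof -
have "hkt t z = (SUM e:Basis. hk t z / (4 * t^2) * ((z *. e) * (z *. e)) - hk t z / (2 * t))"
 by (simp add: hkt_def hk2_def inner_diff_left mult.assoc)
also have "... = hk t z / (4 * t^2) * (SUM e:Basis. (z *. e) * (z *. e)) - real DIM('a) * (hk t z / (2 * t))"
 by (simp add: sum_subtractf sum_distrib_left)
also have "(SUM e:Basis. (z *. e) * (z *. e)) = (norm z)^2"
 by (simp add: power2_norm_eq_inner euclidean_inner[of z z])
finally show ?thesis by (simp add: asimps)
qed

lemma hkt_jcont: "cont ({0<..} \<times> UNIV) (%p. hkt (fst p) (snd p :: 'a::euclidean_space))"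
unfolding hkt_def by (intro cintro hk2_jcont)

lemma hk_time_deriv:
fixes z :: "'a::euclidean_space"
assumes "t > 0" shows "((%t. hk t z) hrd hkt t z) (at t)"
proof -
have "((%t. t powr (- real DIM('a) / 2) * exp (- (norm z)\<^sup>2 / (4 * t)) / gc0 TYPE('a)) hrd
 ((- real DIM('a) / 2) * t powr (- real DIM('a) / 2 - 1) * exp (- (norm z)\<^sup>2 / (4 * t)) +
  t powr (- real DIM('a) / 2) * (exp (- (norm z)\<^sup>2 / (4 * t)) * ((norm z)^2 / (4 * t^2)))) / gc0 TYPE('a)) (at t)"
 using assms gc0_pos[where 'a='a] by (auto intro!: derivative_eq_intros simp: pow2)
moreover have pw: "t powr (- real DIM('a) / 2 - 1) = t powr (- real DIM('a) / 2) / t"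
 using assms by (simp add: powr_diff)
moreover have "((- D / 2) * (P / t) * E + P * (E * X)) / c = (P * E / c) * (X - D / (2 * t))" for P E c X D :: real
 by (simp add: asimps add_divide_distrib diff_divide_distrib)
ultimately show ?thesis unfolding hk_def[abs_def] hkt_eq by (simp only: hk_def)
qed

text \<open>All three functions are bounded by a multiple of the kernel times 1 + |z|^2, the
  multiple depending only on the smallest time a. The Gaussian at the largest time b absorbs this
  polynomial factor.\<close>

lemma hk_bounds:
assumes "0 < a" "a <= b"
shows "dwle {a..b} (hk :: real => 'a::euclidean_space => real)" "dwle {a..b} (hk1 :: real => 'a => 'a)" (is ?A)
 "norm (e::'a) = 1 ==> dwle {a..b} (hk2 e)"
proof -
let ?h = "%t z::'a. hk t z * (1 + (norm z)^2)"
have "1 / (4*b) > 0" using assms by simp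
then obtain C where C: "C > 0" "!!z::'a. (1 + (norm z)^2) ^ 1 * exp (- (1/(4*b)) * (norm z)^2) <= C * dw z"
 using gauss_decay[where 'a='a and m=1] by blast
define M where "M = a powr (- real DIM('a) / 2) / gc0 TYPE('a)"
have M: "M > 0" using assms gc0_pos[where 'a='a] by (simp add: M_def)
have hp: "hk t z > 0" "norm (?h t z) = ?h t z" "1 / (2*t) <= 1/(2*a)" "1 / (4*t^2) <= 1/(4*a^2)" "t > 0" if "t : {a..b}" for t z
proof -
 show t: "t > 0" using that assms by simp
 show "1 / (2*t) <= 1/(2*a)" "1 / (4*t^2) <= 1/(4*a^2)"
  using that assms by (auto intro!: divide_left_mono mul_l power_mono)
 show "hk t z > 0" by (rule hk_pos[OF t])
 thus "norm (?h t z) = ?h t z" by (simp only: real_norm_def abs_of_nonneg less_imp_le zero_le_mult_iff) (simp add: less_imp_le)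
qed
have H: "dwle {a..b} ?h"
proof (rule dwleI)
 fix t and z :: 'a assume t: "t : {a..b}"
 have "t powr (- real DIM('a) / 2) <= a powr (- real DIM('a) / 2)"
  using t assms powr_mono2'[of "- real DIM('a) / 2" a t] by simp
 moreover have "exp (- (norm z)\<^sup>2 / (4 * t)) <= exp (- (1/(4*b)) * (norm z)^2)"
  using t assms by (simp add: frac_le)
 ultimately have "t powr (- real DIM('a) / 2) * exp (- (norm z)\<^sup>2 / (4 * t)) <=
   a powr (- real DIM('a) / 2) * exp (- (1/(4*b)) * (norm z)^2)" by (intro mult_mono) auto
 hence "hk t z <= M * exp (- (1/(4*b)) * (norm z)^2)"
  using gc0_pos[where 'a='a] by (simp add: hk_def M_def divide_right_mono)
 hence "?h t z <= M * exp (- (1/(4*b)) * (norm z)^2) * (1 + (norm z)^2)" by (rule mul_r) simp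
 also have "... <= M * (C * dw z)" using mul_l[OF C(2)[of z], of M] M by (simp add: mult_ac)
 finally show "norm (?h t z) <= (M * C) * dw z" unfolding hp(2)[OF t] by (simp add: mult.assoc)
qed
have nz: "norm z <= 1 + (norm z)^2" for z :: 'a
 using sum_squares_bound[of 1 "norm z"] by (simp add: pow2) (smt (verit) norm_ge_zero mult_nonneg_nonneg)
show "dwle {a..b} (hk :: real => 'a => real)"
proof (rule dwle_le[OF H, of _ 1])
 show "norm (hk t z) <= 1 * norm (?h t z)" if t: "t : {a..b}" for t z
  using hp(1)[OF t, of z] unfolding hp(2)[OF t] by (simp add: mult_le_cancel_left1)
qed
show ?A
proof (rule dwle_le[OF H])
 fix t and z :: 'a assume t: "t : {a..b}"
 have "norm (hk1 t z) = 1/(2*t) * (hk t z * norm z)" using hp(1)[OF t, of z] hp(5)[OF t] by (simp add: hk1_def)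
 also have "... <= 1/(2*a) * ?h t z" using hp(3)[OF t] hp(1)[OF t, of z] assms nz[of z] by (intro mult_mono mul_l) auto
 finally show "norm (hk1 t z) <= 1/(2*a) * norm (?h t z)" unfolding hp(2)[OF t] .
qed
assume e: "norm e = 1"
show "dwle {a..b} (hk2 e)"
proof (rule dwle_le[OF H])
 fix t z assume t: "t : {a..b}"
 have "abs (z *. e) * norm z <= norm z * norm z" using Cauchy_Schwarz_ineq2[of z e] e by (intro mul_r) auto
 hence "hk t z / (4*t^2) * (abs (z *. e) * norm z) <= hk t z / (4*t^2) * (norm z * norm z)"
  using hp(1)[OF t, of z] by (intro mul_l) auto
 moreover have "norm (hk2 e t z) <= hk t z / (4*t^2) * (abs (z *. e) * norm z) + hk t z / (2*t)"
  unfolding hk2_def using hp(1)[OF t, of z] hp(5)[OF t] e by (intro order_trans[OF norm_triangle_ineq4]) (simp add: abs_mult)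
 ultimately have "norm (hk2 e t z) <= 1/(4*t^2) * (hk t z * (norm z)^2) + 1/(2*t) * hk t z" by (simp add: pow2)
 also have "... <= 1/(4*a^2) * ?h t z + 1/(2*a) * ?h t z"
  using hp(3,4)[OF t] hp(1)[OF t, of z] assms by (intro add_mono mult_mono mul_l) (auto simp: mult_le_cancel_left1)
 finally show "norm (hk2 e t z) <= (1/(4*a^2) + 1/(2*a)) * norm (?h t z)" unfolding hp(2)[OF t] by (simp only: distrib_right)
qed
qed

text \<open>Completing the square: |y|^2 + |z-y|^2 = |z|^2/2 + 2 |y - z/2|^2. The case of equal
  times is the one used later, when a flow over time 2t is split evenly between the two sides of a
  pairing.\<close>

lemma hk_semigroup:
fixes z :: "'a::euclidean_space"
assumes t: "t > 0"
shows "hk (2 * t) z = (LBINT y. hk t y * hk t (z - y))"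
proof -
let ?d = "real DIM('a)" and ?c = "gc0 TYPE('a)"
have id: "(norm y)^2 + (norm (z - y))^2 = (norm z)^2 / 2 + 2 * (norm (y - z /\<^sub>R 2))^2" for y
 unfolding power2_norm_eq_inner by (simp add: inner_simps inner_commute field_simps)
have e: "hk t y * hk t (z - y) = hk (2*t) z * hk (t/2) (y + (- (z /\<^sub>R 2)))" for y
proof -
 have "exp (- (norm y)\<^sup>2 / (4 * t)) * exp (- (norm (z - y))\<^sup>2 / (4 * t)) =
  exp (- ((norm y)^2 + (norm (z - y))^2) / (4 * t))" by (simp add: mult_exp_exp diff_divide_distrib)
 also have "... = exp (- (norm z)\<^sup>2 / (4 * (2*t))) * exp (- (norm (y - z /\<^sub>R 2))\<^sup>2 / (4 * (t/2)))"
  unfolding id using t by (simp add: mult_exp_exp field_simps)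
 finally have ex: "exp (- (norm y)\<^sup>2 / (4 * t)) * exp (- (norm (z - y))\<^sup>2 / (4 * t)) =
  exp (- (norm z)\<^sup>2 / (4 * (2*t))) * exp (- (norm (y - z /\<^sub>R 2))\<^sup>2 / (4 * (t/2)))" .
 have "t powr (-?d/2) * t powr (-?d/2) = (2*t) powr (-?d/2) * (t/2) powr (-?d/2)"
  using t by (simp add: powr_mult powr_divide)
 hence "(t powr (-?d/2) * t powr (-?d/2)) * (exp (- (norm y)\<^sup>2 / (4 * t)) * exp (- (norm (z - y))\<^sup>2 / (4 * t))) / (?c * ?c) =
  ((2*t) powr (-?d/2) * (t/2) powr (-?d/2)) * (exp (- (norm z)\<^sup>2 / (4 * (2*t))) * exp (- (norm (y - z /\<^sub>R 2))\<^sup>2 / (4 * (t/2)))) / (?c * ?c)"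
  using ex by (simp only:)
 thus ?thesis by (simp add: hk_def mult_ac)
qed
have [measurable]: "hk (t/2) : bmeas (borel::'a measure)" using hk_integrable[of "t/2"] t by auto
have "(LBINT y. hk t y * hk t (z - y)) = hk (2*t) z * (LBINT y. hk (t/2) (y + (- (z /\<^sub>R 2))))"
 by (simp add: e)
also have "(LBINT y. hk (t/2) (y + (- (z /\<^sub>R 2)))) = (LBINT y. hk (t/2) (y::'a))"
 by (rule mpres_integral[OF mpres_translate]) measurable
also have "... = 1" using t by (intro hk_integral) simp
finally show ?thesis by simp
qed

section \<open>A Bellman function\<close>

text \<open>The function \<open>Bf\<close> built from these is y^q + c x^2 (y + x^(p-1))^(2-q), a
  variant of the Nazarov-Treil Bellman function without case distinction: the second term behaves
  like x^2 y^(2-q) where x^(p-1) is small against y, and like x^p in the opposite regime. Keeping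
  \<open>x powr (p-2)\<close>, \<open>bm\<close> and \<open>bc\<close> as atoms makes all
  derivatives up to second order polynomials in them, apart from pure powers of y.\<close>

definition bm :: "real => real => real => real" where "bm p x y = y + x * x powr (p-2)"
definition bc :: "real => real => real => real => real" where "bc p q x y = bm p x y powr (-q)"
definition bd :: "real => real" where "bd q = q * (q-1) / 8"

definition Bf :: "real => real => real => real => real" where
"Bf p q x y = y powr q + bd q * (x^2 * (bm p x y)^2 * bc p q x y)"

definition B1 :: "real => real => real => real => real" where
"B1 p q x y = bd q * (2 * x * (bm p x y)^2 * bc p q x y + (2-q) * (p-1) * (x^2 * x powr (p-2) * bm p x y * bc p q x y))"

definition B2 :: "real => real => real => real => real" where
"B2 p q x y = q * y powr (q-1) + bd q * (2-q) * (x^2 * bm p x y * bc p q x y)"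

definition B11 :: "real => real => real => real => real" where
"B11 p q x y = bd q * (2 * (bm p x y)^2 * bc p q x y + 2 * x * (2-q) * bm p x y * bc p q x y * ((p-1) * x powr (p-2))
 + (2-q) * (p-1) * (p * x * x powr (p-2) * bm p x y * bc p q x y
  + x^2 * x powr (p-2) * (1-q) * bc p q x y * ((p-1) * x powr (p-2))))"

definition B12 :: "real => real => real => real => real" where
"B12 p q x y = bd q * (2-q) * (2 * x * bm p x y * bc p q x y + (p-1) * (1-q) * (x^2 * x powr (p-2) * bc p q x y))"

definition B22 :: "real => real => real => real => real" where
"B22 p q x y = q * (q-1) * y powr (q-2) + bd q * (2-q) * (1-q) * (x^2 * bc p q x y)"

lemma powr_chain:
assumes "(X hrd X') (at r)" "X r > (0::real)"
shows "((%r. X r powr a) hrd a * X r powr (a-1) * X') (at r)"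
by (rule DERIV_chain2[OF has_real_derivative_powr[OF assms(2)] assms(1)])

lemma bm_pos: "x > 0 ==> y > 0 ==> bm p x y > 0"
by (simp add: bm_def add_pos_pos)
context
fixes p q :: real and X Y :: "real => real" and X' Y' r :: real
assumes X: "(X hrd X') (at r)" "X r > 0" and Y: "(Y hrd Y') (at r)" "Y r > 0"
begin

lemma deriv_xa: "((%r. X r powr (p-2)) hrd (p-2) * (X r powr (p-2) / X r) * X') (at r)"
proof -
have "X r powr (p - 2 - 1) = X r powr (p - 2) / X r" using powr_diff[of "X r" "p-2" 1] X(2) by simp
thus ?thesis using powr_chain[OF X, of "p-2"] by (simp only:)
qed

lemma deriv_bm: "((%r. bm p (X r) (Y r)) hrd Y' + (p-1) * X r powr (p-2) * X') (at r)"
proof -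
have "((%r. Y r + X r * X r powr (p-2)) hrd Y' + (X' * X r powr (p-2) + ((p-2) * (X r powr (p-2) / X r) * X') * X r)) (at r)"
 by (intro DERIV_add DERIV_mult X Y deriv_xa)
moreover have "X' * X r powr (p-2) + ((p-2) * (X r powr (p-2) / X r) * X') * X r = (p-1) * X r powr (p-2) * X'"
 using X(2) by (simp add: field_simps)
ultimately show ?thesis by (simp add: bm_def)
qed

lemma deriv_bc: "((%r. bc p q (X r) (Y r)) hrd
 (-q) * (bc p q (X r) (Y r) / bm p (X r) (Y r)) * (Y' + (p-1) * X r powr (p-2) * X')) (at r)"
using powr_chain[OF deriv_bm bm_pos[OF X(2) Y(2)], of "-q"] bm_pos[OF X(2) Y(2), of p]
by (simp add: bc_def powr_diff)

text \<open>Derivatives are taken along an arbitrary curve in the open quadrant, so that one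
  computation serves differentiation along lines in space as well as differentiation in
  time.\<close>

lemma deriv_Bf: "((%r. Bf p q (X r) (Y r)) hrd B1 p q (X r) (Y r) * X' + B2 p q (X r) (Y r) * Y') (at r)"
proof -
note m = bm_pos[OF X(2) Y(2), of p]
define a m c d e where "a = X r powr (p-2)" "m = bm p (X r) (Y r)" "c = bc p q (X r) (Y r)" "d = bd q" "e = Y r powr (q-1)"
note [derivative_intros] = X(1) Y(1) deriv_xa deriv_bm deriv_bc powr_chain[OF Y]
have "((%r. Bf p q (X r) (Y r)) hrd
 q * e * Y' + d * ((2 * X r * X' * m^2 + (X r)^2 * (2 * m * (Y' + (p-1) * a * X'))) * c
  + (X r)^2 * m^2 * ((-q) * (c / m) * (Y' + (p-1) * a * X')))) (at r)"
 unfolding Bf_def a_m_c_d_e_def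
 by (rule derivative_eq_intros refl)+ (simp add: asimps)
moreover have "q * e * Y' + d * ((2 * X r * X' * m^2 + (X r)^2 * (2 * m * (Y' + (p-1) * a * X'))) * c
  + (X r)^2 * m^2 * ((-q) * (c / m) * (Y' + (p-1) * a * X'))) =
 (d * (2 * X r * m^2 * c + (2-q) * (p-1) * ((X r)^2 * a * m * c))) * X' + (q * e + d * (2-q) * ((X r)^2 * m * c)) * Y'"
 using m unfolding a_m_c_d_e_def(2)[symmetric] by (simp add: field_simps pow2)
ultimately show ?thesis by (simp add: B1_def B2_def a_m_c_d_e_def)
qed

lemma deriv_B1: "((%r. B1 p q (X r) (Y r)) hrd B11 p q (X r) (Y r) * X' + B12 p q (X r) (Y r) * Y') (at r)"
proof -
note m = bm_pos[OF X(2) Y(2), of p]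
define a m c d x where "a = X r powr (p-2)" "m = bm p (X r) (Y r)" "c = bc p q (X r) (Y r)" "d = bd q" "x = X r"
note [derivative_intros] = X(1) Y(1) deriv_xa deriv_bm deriv_bc powr_chain[OF Y]
have "((%r. B1 p q (X r) (Y r)) hrd
 d * ((2 * X' * m^2 + 2 * x * (2 * m * (Y' + (p-1) * a * X'))) * c + 2 * x * m^2 * ((-q) * (c / m) * (Y' + (p-1) * a * X'))
  + (2-q) * (p-1) * (((2 * x * X' * a + x^2 * ((p-2) * (a / x) * X')) * m + x^2 * a * (Y' + (p-1) * a * X')) * c
   + x^2 * a * m * ((-q) * (c / m) * (Y' + (p-1) * a * X'))))) (at r)"
 unfolding B1_def a_m_c_d_x_def
 by (rule derivative_eq_intros refl)+ (simp add: asimps)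
moreover have "d * ((2 * X' * m^2 + 2 * x * (2 * m * (Y' + (p-1) * a * X'))) * c + 2 * x * m^2 * ((-q) * (c / m) * (Y' + (p-1) * a * X'))
  + (2-q) * (p-1) * (((2 * x * X' * a + x^2 * ((p-2) * (a / x) * X')) * m + x^2 * a * (Y' + (p-1) * a * X')) * c
   + x^2 * a * m * ((-q) * (c / m) * (Y' + (p-1) * a * X')))) =
  (d * (2 * m^2 * c + 2 * x * (2-q) * m * c * ((p-1) * a)
 + (2-q) * (p-1) * (p * x * a * m * c + x^2 * a * (1-q) * c * ((p-1) * a)))) * X'
 + (d * (2-q) * (2 * x * m * c + (p-1) * (1-q) * (x^2 * a * c))) * Y'"
proof -
 have m0: "m > 0" and x0: "x > 0" using m X(2) by (simp_all add: a_m_c_d_x_def)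
 have "x^2 * ((p-2) * (a / x) * X') = x * (p-2) * a * X'" "m^2 * ((-q) * (c / m) * Z) = m * (-q) * c * Z" "m * ((-q) * (c / m) * Z) = (-q) * c * Z" for Z
  using m0 x0 by (simp_all add: pow2)
 note s = this
 have "2 * x * m^2 * ((-q) * (c / m) * Z) = 2 * x * (m * (-q) * c * Z)"
   "x^2 * a * m * ((-q) * (c / m) * Z) = x^2 * a * ((-q) * c * Z)" for Z
  using s(2,3)[of Z] by (simp_all only: mult.assoc)
 with m0 x0 show ?thesis unfolding s by (simp add: asimps pow2)
qed
ultimately show ?thesis by (simp add: B11_def B12_def a_m_c_d_x_def)
qed

lemma deriv_B2: "((%r. B2 p q (X r) (Y r)) hrd B12 p q (X r) (Y r) * X' + B22 p q (X r) (Y r) * Y') (at r)"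
proof -
note m = bm_pos[OF X(2) Y(2), of p]
define a m c d x e where "a = X r powr (p-2)" "m = bm p (X r) (Y r)" "c = bc p q (X r) (Y r)" "d = bd q" "x = X r" "e = Y r powr (q-2)"
have y: "((%r. Y r powr (q-1)) hrd (q-1) * Y r powr (q-2) * Y') (at r)"
 using powr_chain[OF Y, of "q-1"] by simp
note [derivative_intros] = X(1) Y(1) deriv_xa deriv_bm deriv_bc y
have "((%r. B2 p q (X r) (Y r)) hrd
 q * ((q-1) * e * Y') + d * (2-q) * ((2 * x * X' * m + x^2 * (Y' + (p-1) * a * X')) * c
  + x^2 * m * ((-q) * (c / m) * (Y' + (p-1) * a * X')))) (at r)"
 unfolding B2_def a_m_c_d_x_e_def
 by (rule derivative_eq_intros refl)+ (simp add: asimps)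
moreover have "q * ((q-1) * e * Y') + d * (2-q) * ((2 * x * X' * m + x^2 * (Y' + (p-1) * a * X')) * c
  + x^2 * m * ((-q) * (c / m) * (Y' + (p-1) * a * X'))) =
  (d * (2-q) * (2 * x * m * c + (p-1) * (1-q) * (x^2 * a * c))) * X'
 + (q * (q-1) * e + d * (2-q) * (1-q) * (x^2 * c)) * Y'"
proof -
 have m0: "m > 0" using m by (simp add: a_m_c_d_x_e_def)
 have "m * ((-q) * (c / m) * Z) = (-q) * c * Z" for Z
  using m0 by simp
 hence "x^2 * m * ((-q) * (c / m) * Z) = x^2 * ((-q) * c * Z)" for Z
  by (simp only: mult.assoc)
 with m0 show ?thesis by (simp add: asimps pow2)
qed
ultimately show ?thesis by (simp add: B12_def B22_def a_m_c_d_x_e_def)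
qed
end
context
fixes p q :: real
assumes pq: "conj_exp p q" and q2: "q <= 2"
begin

lemma bd_bounds: "0 < bd q" "bd q <= 1" "q * (q-1) = 8 * bd q" (is ?A) "(2-q) * (q-1) <= 1" (is ?B)
proof -
have q1: "q > 1" using conj_expD(2)[OF pq] .
show "0 < bd q" using q1 by (simp add: bd_def)
have "q * (q-1) <= 2 * 1" using q1 q2 by (intro mult_mono) auto
thus "bd q <= 1" by (simp add: bd_def)
show ?A by (simp add: bd_def)
have "(2-q) * (q-1) <= 1 * 1" using q1 q2 by (intro mult_mono) auto
thus ?B by simp
qed

text \<open>Conjugacy gives x = (x^(p-1))^(q-1), hence x <= m^(q-1), and with it x m c <= 1. Because
  q <= 2 the exponent q - 2 is not positive, so y <= m turns into m^(q-2) <= y^(q-2).\<close>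

lemma bell_aux:
assumes xy: "x > 0" "y > 0"
defines "m == bm p x y" and "c == bc p q x y"
shows "m > 0" "c > 0" "x * x powr (p-2) <= m" "y <= m" "x * m * c <= 1" "x <= m powr (q-1)"
 "1 / (m^2 * c) = m powr (q-2)" "1 / (m^2 * c) <= y powr (q-2)" (is ?A) "y^2 / (m^2 * c) <= y powr q" (is ?B)
 "m powr q <= 2 powr q * (x powr p + y powr q)" (is ?C)
proof -
note e = conj_expD[OF pq]
show m: "m > 0" using bm_pos[OF xy] by (simp add: m_def)
show c: "c > 0" using m by (simp add: c_def bc_def m_def)
show xa: "x * x powr (p-2) <= m" and ym: "y <= m" using xy by (simp_all add: m_def bm_def)
have xp: "x * x powr (p-2) = x powr (p-1)" using xy powr_add[of x 1 "p-2"] by simp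
have "x = (x powr (p-1)) powr (q-1)" using xy e by (simp add: powr_powr)
also have "... <= m powr (q-1)" using xa xp e by (intro powr_mono2) auto
finally show xm: "x <= m powr (q-1)" .
have mc: "m * c = m powr (1-q)" using m powr_add[of m 1 "-q"] by (simp add: c_def bc_def m_def)
have "x * m * c = x * m powr (1-q)" using mc by (simp add: mult.assoc)
also have "... <= m powr (q-1) * m powr (1-q)" using xm by (intro mul_r) auto
also have "... = 1" using m by (simp add: powr_add[symmetric])
finally show "x * m * c <= 1" .
have m2c: "m^2 * c = m powr (2-q)" using m powr_add[of m 2 "-q"] by (simp add: c_def bc_def m_def)
show i: "1 / (m^2 * c) = m powr (q-2)" unfolding m2c using m by (simp add: powr_minus[symmetric] divide_inverse)
have le: "m powr (q-2) <= y powr (q-2)" using xy ym q2 by (intro powr_mono2') auto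
thus ?A using i by simp
have "y^2 / (m^2 * c) = y^2 * m powr (q-2)" using i by (simp add: divide_inverse)
also have "... <= y^2 * y powr (q-2)" using le by (intro mul_l) auto
also have "... = y powr q" using xy powr_add[of y 2 "q-2"] by simp
finally show ?B .
have "m powr q <= 2 powr q * (y powr q + (x powr (p-1)) powr q)"
 unfolding m_def bm_def xp using xy e by (intro powr_add_le) auto
thus ?C
 using e by (simp add: powr_powr add.commute)
qed

lemma Bf_nonneg: "x > 0 ==> y > 0 ==> Bf p q x y >= 0"
using bell_aux(1,2)[of x y] bd_bounds by (simp add: Bf_def less_imp_le)

lemma Bf_upper:
assumes xy: "x > 0" "y > 0" shows "Bf p q x y <= (1 + 2 powr q) * (x powr p + y powr q)"
proof -
note a = bell_aux[OF xy]
define m c where "m = bm p x y" and "c = bc p q x y"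
have "x^2 * m^2 * c = (x * m * c) * (x * m)" by (simp add: pow2)
also have "... <= 1 * (x * m)" using a xy unfolding m_def c_def by (intro mul_r) auto
also have "... <= m powr (q-1) * m" using a unfolding m_def by simp
also have "... = m powr q" using a(1) powr_add[of m "q-1" 1] unfolding m_def by simp
also have "... <= 2 powr q * (x powr p + y powr q)" using a(10) by (simp add: m_def)
finally have 1: "x^2 * m^2 * c <= 2 powr q * (x powr p + y powr q)" .
have "bd q * (x^2 * m^2 * c) <= 1 * (x^2 * m^2 * c)"
 using bd_bounds a(2) by (intro mul_r) (auto simp: c_def)
hence "Bf p q x y <= y powr q + 2 powr q * (x powr p + y powr q)"
 using 1 by (simp add: Bf_def m_def c_def)
moreover have "0 <= x powr p" by simp
ultimately show ?thesis by (simp only: distrib_right mult_1)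
qed

text \<open>T is the scale that balances the two variables: the diagonal entries of the Hessian are
  at least 2 c T and 7 c / T with c = \<open>bd q\<close>, and the mixed entry is at most 2 c in
  absolute value, so the quadratic form is bounded below by a diagonal one. The same diagonal form
  bounds the radial derivative, which accounts for the zero-order part of the operator.\<close>

lemma bell_hess:
fixes al be :: real
assumes xy: "x > 0" "y > 0"
defines "T == (bm p x y)^2 * bc p q x y"
shows "T > 0"
 "B11 p q x y * al^2 + 2 * B12 p q x y * (al * be) + B22 p q x y * be^2 >= bd q * (T * al^2 + be^2 / T)"
 "x * B1 p q x y + y * B2 p q x y >= bd q * (T * x^2 + y^2 / T)"
proof -
note e = conj_expD[OF pq] and ax = bell_aux[OF xy] and b = bd_bounds
define m c a where "m = bm p x y" and "c = bc p q x y" and "a = x powr (p-2)"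
have m: "m > 0" and c: "c > 0" and xa: "x * a <= m" and S1: "x * m * c <= 1" and a: "a > 0"
 and T1: "1 / T <= y powr (q-2)" and yq: "y^2 / T <= y powr q"
 using ax xy by (simp_all add: m_def c_def a_def T_def)
have T: "T = m^2 * c" by (simp add: T_def m_def c_def)
show T0: "T > 0" using m c by (simp add: T)
let ?d = "bd q"
have "(p-1) * (1-q) = - ((p-1)*(q-1))" by (simp add: asimps)
hence pq1: "(p-1) * (1-q) = -1" using e by simp
have B12: "B12 p q x y = ?d * ((2-q) * (2 * (x * m * c) - x * (x * a) * c))"
 unfolding B12_def m_def[symmetric] c_def[symmetric] a_def[symmetric] pq1 by (simp add: pow2 asimps)
have xac: "0 <= x * (x * a) * c" "x * (x * a) * c <= x * m * c"
 using xy a c xa by (auto intro!: mul_r mul_l)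
have "0 <= (2-q) * (2 * (x * m * c) - x * (x * a) * c)" using q2 xac by (intro mult_nonneg_nonneg) auto
moreover have "(2-q) * (2 * (x * m * c) - x * (x * a) * c) <= 1 * 2"
 using q2 e(2) xac S1 by (intro mult_mono) auto
ultimately have B12b: "abs (B12 p q x y) <= 2 * ?d" unfolding B12 using b(1) by (simp add: abs_mult)
have "B11 p q x y = ?d * (2 * T + (2-q) * (p-1) * ((2 + p) * (x * a) * m * c + ((p-1) * (1-q)) * ((x*a) * (x * a) * c)))"
 unfolding B11_def m_def[symmetric] c_def[symmetric] a_def[symmetric] T by (simp add: pow2 asimps)
also have "... = ?d * (2 * T + (2-q) * (p-1) * ((2 + p) * (x * a) * m * c - (x*a) * (x * a) * c))"
 unfolding pq1 by simp
also have "... >= ?d * (2 * T + 0)"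
proof (intro mul_l add_left_mono mult_nonneg_nonneg)
 have "(x*a) * (x * a) * c <= (x*a) * m * c" using xy a c xa by (intro mul_r mul_l) auto
 also have "... = 1 * ((x*a) * m * c)" by simp
 also have "... <= (2+p) * ((x*a) * m * c)" using xy a c m e(1) by (intro mul_r) auto
 finally show "0 <= (2 + p) * (x * a) * m * c - (x*a) * (x * a) * c" by (simp add: mult.assoc)
qed (use q2 e(1) b(1) in auto)
finally have B11b: "B11 p q x y >= 2 * ?d * T" by simp
have "x^2 * c = (x * m * c)^2 / T" using m c by (simp add: T pow2)
also have "... <= 1 / T" using S1 xy m c T0 by (intro divide_right_mono) (auto simp: power_le_one)
finally have xc: "x^2 * c <= 1 / T" .
\<comment> \<open>The divisor 8 in \<open>bd\<close> is spent here: seven parts remain after the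
  negative contribution of the second term of \<open>Bf\<close>, and this is enough to absorb the
  mixed derivative.\<close>
have "8 * ?d * (1/T) <= q * (q-1) * y powr (q-2)" unfolding b(3)[symmetric]
 using T1 e(2) by (intro mul_l) auto
moreover have "?d * (2-q) * (q-1) * (x^2 * c) <= ?d * (1 * (1/T))"
 unfolding mult.assoc[of ?d] using b(1,4) q2 e(2) xc c by (intro mul_l mult_mono) auto
moreover have "B22 p q x y = q * (q-1) * y powr (q-2) - ?d * (2-q) * (q-1) * (x^2 * c)"
 unfolding B22_def c_def[symmetric] by (simp add: asimps)
ultimately have B22b: "B22 p q x y >= 7 * ?d / T" by simp
have "2 * B12 p q x y * (al * be) >= - (4 * ?d * abs (al * be))"
proof -
 have "abs (2 * B12 p q x y * (al * be)) = 2 * (abs (B12 p q x y) * abs (al * be))" by (simp add: abs_mult)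
 also have "... <= 2 * ((2 * ?d) * abs (al * be))" using B12b by (intro mul_l mul_r) auto
 finally show ?thesis by linarith
qed
moreover have "B11 p q x y * al^2 >= 2 * ?d * T * al^2" using B11b by (intro mul_r) auto
moreover have "B22 p q x y * be^2 >= 7 * ?d / T * be^2" using B22b by (intro mul_r) auto
moreover have "2 * ?d * T * al^2 - 4 * ?d * abs (al * be) + 7 * ?d / T * be^2 >= ?d * (T * al^2 + be^2 / T)"
proof -
 \<comment> \<open>Completing the square with weights 1 and 2; the extra 2 be^2 raises the
   coefficient of be^2 from 4 to 6, one less than the 7 at hand.\<close>
 have "0 <= (T * abs (al) - 2 * abs (be))^2 + 2 * be^2" by simp
 also have "... = T * (T * al^2 - 4 * abs (al * be) + 6 / T * be^2)"
  using T0 by (simp add: pow2 asimps abs_mult)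
 finally have "0 <= T * al^2 - 4 * abs (al * be) + 6 / T * be^2" using T0 by (simp add: zero_le_mult_iff)
 hence "0 <= ?d * (T * al^2 - 4 * abs (al * be) + 6 / T * be^2)" using b by simp
 moreover have "?d * (T * al^2 - 4 * abs (al * be) + 6 / T * be^2) =
   (2 * ?d * T * al^2 - 4 * ?d * abs (al * be) + 7 * ?d / T * be^2) - ?d * (T * al^2 + be^2 / T)"
  by (simp add: asimps)
 ultimately show ?thesis by linarith
qed
ultimately show "B11 p q x y * al^2 + 2 * B12 p q x y * (al * be) + B22 p q x y * be^2 >= ?d * (T * al^2 + be^2 / T)"
 by linarith
have "x * B1 p q x y = ?d * (2 * T * x^2 + (2-q) * (p-1) * (x * x^2 * a * m * c))"
 unfolding B1_def m_def[symmetric] c_def[symmetric] a_def[symmetric] T by (simp add: pow2 asimps)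
also have "... >= ?d * (1 * (T * x^2) + 0)"
 using b(1) q2 e(1) xy a c m T0 by (intro mul_l add_mono mult_nonneg_nonneg) auto
finally have 1: "x * B1 p q x y >= ?d * (T * x^2)" by simp
have "y * B2 p q x y = q * (y * y powr (q-1)) + ?d * (2-q) * (y * x^2 * m * c)"
 unfolding B2_def m_def[symmetric] c_def[symmetric] by (simp add: asimps)
also have "y * y powr (q-1) = y powr q" using xy powr_add[of y 1 "q-1"] by simp
finally have "y * B2 p q x y >= q * y powr q + 0"
 using b(1) q2 xy c m by simp
moreover have "?d * (y^2 / T) <= q * y powr q" using b(1,2) e(2) yq T0 by (intro mult_mono) auto
ultimately have "y * B2 p q x y >= ?d * (y^2 / T)" by linarith
with 1 show "x * B1 p q x y + y * B2 p q x y >= ?d * (T * x^2 + y^2 / T)" by (simp add: asimps)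
qed

text \<open>One and the same T serves every direction and the zero-order term, so the diagonal
  bounds are summed before 2 A B <= T A^2 + B^2 / T is applied. This gives the product of the full
  norms with a constant that does not depend on the dimension.\<close>

lemma bell_main:
fixes U V :: "'a::euclidean_space"
assumes xy: "x > 0" "y > 0"
shows "(SUM i:Basis. B11 p q x y * (U *. i)^2 + 2 * B12 p q x y * ((U *. i) * (V *. i)) + B22 p q x y * (V *. i)^2)
 + l^2 * (x * B1 p q x y + y * B2 p q x y) >= 2 * bd q * (norm (U, l * x) * norm (V, l * y))"
proof -
define T where "T = (bm p x y)^2 * bc p q x y"
note h = bell_hess[OF xy, folded T_def]
have T0: "T > 0" by (rule h(1))
have nU: "(SUM i:Basis. (W *. i)\<^sup>2) = (norm W)^2" for W :: 'a
proof -
 have "(SUM i:Basis. (W *. i)\<^sup>2) = W *. W" by (subst (2) euclidean_inner) (simp add: pow2)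
 thus ?thesis by (simp add: power2_norm_eq_inner)
qed
have "(SUM i:Basis. bd q * (T * (U *. i)^2 + (V *. i)^2 / T)) <=
 (SUM i:Basis. B11 p q x y * (U *. i)^2 + 2 * B12 p q x y * ((U *. i) * (V *. i)) + B22 p q x y * (V *. i)^2)"
 by (intro sum_mono h(2))
also have "(SUM i:Basis. bd q * (T * (U *. i)^2 + (V *. i)^2 / T)) = bd q * (T * (norm U)^2 + (norm V)^2 / T)"
 by (simp add: sum_distrib_left[symmetric] sum.distrib sum_divide_distrib[symmetric] nU)
finally have 1: "bd q * (T * (norm U)^2 + (norm V)^2 / T) <=
 (SUM i:Basis. B11 p q x y * (U *. i)^2 + 2 * B12 p q x y * ((U *. i) * (V *. i)) + B22 p q x y * (V *. i)^2)" .
have 2: "l^2 * (x * B1 p q x y + y * B2 p q x y) >= l^2 * (bd q * (T * x^2 + y^2 / T))"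
 by (intro mul_l h(3)) simp
define A B where "A = norm (U, l * x)" and "B = norm (V, l * y)"
have A2: "A^2 = (norm U)^2 + l^2 * x^2" and B2: "B^2 = (norm V)^2 + l^2 * y^2"
 by (simp_all add: A_def B_def norm_Pair power_mult_distrib)
have "0 <= (T * A - B)^2" by simp
also have "... = T * (T * A^2 + B^2 / T - 2 * (A * B))" using T0 by (simp add: pow2 asimps)
finally have "2 * (A * B) <= T * A^2 + B^2 / T" using T0 by (simp add: zero_le_mult_iff)
hence "bd q * (2 * (A * B)) <= bd q * (T * A^2 + B^2 / T)" using bd_bounds by (intro mul_l) auto
also have "... = bd q * (T * (norm U)^2 + (norm V)^2 / T) + l^2 * (bd q * (T * x^2 + y^2 / T))"
 unfolding A2 B2 by (simp add: asimps add_divide_distrib)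
finally show ?thesis using 1 2 unfolding A_def B_def by linarith
qed
end

section \<open>The heat semigroup\<close>

lemma Cc_integral_cbox:
fixes g :: "'a::euclidean_space => 'b::euclidean_space"
assumes "g : Cc" "!!x. x ~: cbox a b ==> g x = 0"
shows "(LBINT x. g x) = integral (cbox a b) g"
proof -
have "(LBINT x. g x) = integral UNIV g" by (rule integral_lborel[OF Cc_integrable[OF assms(1)], symmetric])
also have "g = (%x. if x : cbox a b then g x else 0)" using assms(2) by auto
hence "integral UNIV g = integral UNIV (%x. if x : cbox a b then g x else 0)" by simp
also have "... = integral (cbox a b) g" by (rule integral_restrict_UNIV)
finally show ?thesis .
qed

lemma Cc_cbox: assumes "f : Cc" obtains a b where "!!x. x ~: cbox a b ==> f x = 0"
proof -
obtain K where K: "compact K" "!!x. x ~: K ==> f x = 0" using assms by (rule Cc_support) blast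
obtain a b where "K <= cbox a b" using bounded_subset_cbox_symmetric[OF compact_imp_bounded[OF K(1)]] by metis
thus ?thesis using that K by blast
qed

lemma Cc_conv_slice:
fixes ka :: "'a::euclidean_space => 'b::euclidean_space"
assumes f: "f : Cc" and c: "cont UNIV ka"
shows "(%y. f y *: ka (x - y)) : Cc"
by (rule Cc_scaleR_left[OF f]) (intro cont_comp2[OF c] cintro subset_UNIV)

text \<open>The compact support of f turns the integral into one over a fixed box, where continuity
  in a parameter follows from joint continuity of the integrand.\<close>

lemma conv_jcont:
fixes ka :: "real => 'a::euclidean_space => 'b::euclidean_space"
assumes f: "f : Cc" and c: "jcont ka"
shows "cont ({0<..} \<times> UNIV) (%p. LBINT y. f y *: ka (fst p) (snd p - y))"
proof -
obtain a b where ab: "!!x. x ~: cbox a b ==> f x = 0" using Cc_cbox[OF f] by blast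
have "cont ({0<..} \<times> UNIV) (%p. integral (cbox a b) (%y. f y *: ka (fst p) (snd p - y)))"
proof (rule integral_continuous_on_param)
 have 1: "cont (({0<..} \<times> UNIV) \<times> cbox a b) (%z. f (snd z))"
  by (intro cont_comp2[OF Cc_cont[OF f]] cintro subset_UNIV)
 have 2: "cont (({0<..} \<times> UNIV) \<times> cbox a b) (%z. (fst (fst z), snd (fst z) - snd z))"
  by (intro cintro)
 have sub: "(%z. (fst (fst z), snd (fst z) - snd z)) ` (({0<..} \<times> UNIV) \<times> cbox a b) <= {0<..} \<times> UNIV" by auto
 have 3: "cont (({0<..} \<times> UNIV) \<times> cbox a b) (%z. ka (fst (fst z)) (snd (fst z) - snd z))"
  using cont_comp2[OF c 2 sub] by simp
 show "cont (({0<..} \<times> UNIV) \<times> cbox a b) (%(p, y). f y *: ka (fst p) (snd p - y))"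
  using continuous_on_scaleR[OF 1 3] by (simp add: case_prod_unfold)
qed
thus ?thesis
proof (rule continuous_on_cong[THEN iffD1, rotated 2, OF _ refl])
 fix p :: "real \<times> 'a" assume "p : {0<..} \<times> UNIV"
 hence t: "fst p > 0" by auto
 show "integral (cbox a b) (%y. f y *: ka (fst p) (snd p - y)) = (LBINT y. f y *: ka (fst p) (snd p - y))"
  by (rule Cc_integral_cbox[symmetric, OF Cc_conv_slice[OF f jcont_slice[OF c t]]]) (simp add: ab)
qed
qed

definition hP :: "real => ('a::euclidean_space => real) => 'a => real" where
"hP t f x = (LBINT y. f y * hk t (x - y))"
definition hP1 :: "real => ('a::euclidean_space => real) => 'a => 'a" where
"hP1 t f x = (LBINT y. f y *: hk1 t (x - y))"
definition hP2 :: "'a::euclidean_space => real => ('a => real) => 'a => 'a" where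
"hP2 e t f x = (LBINT y. f y *: hk2 e t (x - y))"
definition hPt :: "real => ('a::euclidean_space => real) => 'a => real" where
"hPt t f x = (LBINT y. f y * hkt t (x - y))"

lemma hP_jcont: "f : Cc ==> cont ({0<..} \<times> UNIV) (%p. hP (fst p) f (snd p))"
using conv_jcont[OF _ hk_jcont] by (simp add: hP_def)
lemma hP1_jcont: "f : Cc ==> cont ({0<..} \<times> UNIV) (%p. hP1 (fst p) f (snd p))"
using conv_jcont[OF _ hk1_jcont] by (simp add: hP1_def)
lemma hP2_jcont: "f : Cc ==> cont ({0<..} \<times> UNIV) (%p. hP2 e (fst p) f (snd p))"
using conv_jcont[OF _ hk2_jcont] by (simp add: hP2_def)
lemma hPt_jcont: "f : Cc ==> cont ({0<..} \<times> UNIV) (%p. hPt (fst p) f (snd p))"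
using conv_jcont[OF _ hkt_jcont] by (simp add: hPt_def)

lemma hk_bdd:
assumes t: "t > 0"
obtains C where "C > 0" "!!z::'a::euclidean_space. abs (hk t z) <= C" "!!z::'a. norm (hk1 t z) <= C"
proof -
show ?thesis
 by (rule dwle_bdd2[OF hk_bounds(1,2)[OF t order_refl, where 'a='a]]) (rule that; simp)
qed

lemma hP_GDERIV: assumes f: "f : Cc" and t: "t > 0" shows "GDERIV (hP t f) x :> hP1 t f x"
proof -
obtain C where C: "!!z::'a. abs (hk t z) <= C" "!!z::'a. norm (hk1 t z) <= C" using hk_bdd[OF t] by metis
show ?thesis
 unfolding hP_def[abs_def] hP1_def
 using conv_GDERIV[OF Cc_integrable[OF f] hk_C1(1)[OF t] C(1)] C(2) by (simp add: hk_C1(2)[OF t])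
qed

lemma hP_C1: assumes "f : Cc" "t > 0" shows "C1 (hP t f)" "grad (hP t f) = hP1 t f"
using C1I[OF hP_GDERIV[OF assms] jcont_slice[OF hP1_jcont[OF assms(1)] assms(2)]] by auto

lemma hP1_inner: assumes f: "f : Cc" and t: "t > 0"
shows "hP1 t f x *. e = (LBINT y. f y * (hk1 t (x - y) *. e))"
proof -
have "(LBINT y. (f y *: hk1 t (x - y)) *. e) = hP1 t f x *. e"
 unfolding hP1_def by (rule integral_inner_left) (use Cc_integrable[OF Cc_conv_slice[OF f jcont_slice[OF hk1_jcont t]]] in auto)
thus ?thesis by simp
qed

lemma hP1_GDERIV: assumes f: "f : Cc" and t: "t > 0" and e: "norm e = 1"
shows "GDERIV (%x. hP1 t f x *. e) x :> hP2 e t f x"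
proof -
obtain C where C: "!!z::'a. norm (hk1 t z) <= C" using hk_bdd[OF t] by metis
obtain D where D: "!!z. norm (hk2 e t z) <= D" using dwleE[OF hk_bounds(3)[OF t order_refl e]] by (metis atLeastAtMost_singleton insertI1)
have "abs (hk1 t z *. e) <= max C D" for z using Cauchy_Schwarz_ineq2[of "hk1 t z" e] e C[of z] by simp
thus ?thesis
 unfolding hP1_inner[OF f t] hP2_def hk1_C1(2)[OF t, symmetric]
 by (intro conv_GDERIV[OF Cc_integrable[OF f] hk1_C1(1)[OF t], of _ "max C D"]) (auto simp: hk1_C1(2)[OF t] le_max_iff_disj D)
qed

lemma hPt_hP2: assumes f: "f : Cc" and t: "t > 0" shows "hPt t f x = (SUM e:Basis. hP2 e t f x *. e)"
proof -
have i: "integ (%y. f y *: hk2 e t (x - y))" for e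
 by (rule Cc_integrable[OF Cc_conv_slice[OF f jcont_slice[OF hk2_jcont t]]])
have "hPt t f x = (LBINT y. (SUM e:Basis. (f y *: hk2 e t (x - y)) *. e))"
 by (simp add: hPt_def hkt_def sum_distrib_left)
also have "... = (SUM e:Basis. (LBINT y. (f y *: hk2 e t (x - y)) *. e))"
 by (rule integral_sum) (rule integrable_inner_left[OF i])
also have "... = (SUM e:Basis. hP2 e t f x *. e)"
 unfolding hP2_def by (intro sum.cong refl integral_inner_left i)
finally show ?thesis .
qed

lemma jcont_comp:
assumes c: "jcont F" and f: "cont UNIV f"
shows "cont ({0<..} \<times> UNIV) (%p. F (fst p) (f (snd p)))"
proof -
have 1: "cont ({0<..} \<times> UNIV) (%p. (fst p, f (snd p)))"
 by (intro cintro cont_comp2[OF f]) auto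
have "(%p. (fst p, f (snd p))) ` ({0<..} \<times> UNIV) <= {0<..} \<times> UNIV" by auto
from cont_comp2[OF c 1 this] show ?thesis by simp
qed

lemma LBINT_flow_cont:
fixes F :: "real => 'a::euclidean_space => 'b::euclidean_space"
assumes ch: "ch : Cc" and c: "jcont F"
shows "cont {0<..} (%t. LBINT x. ch x *: F t x)"
proof -
have "cont ({0<..} \<times> UNIV) (%p. F (fst p) (- snd p))" by (intro jcont_comp[OF c] cintro)
note conv_jcont[OF ch this]
hence "cont {0<..} (%t. LBINT y. ch y *: F (fst (t, 0::'a)) (- (snd (t, 0) - y)))"
 by (rule cont_comp2) (auto intro!: cintro)
thus ?thesis by simp
qed

lemma LBINT_flow_integrable:
fixes F :: "real => 'a::euclidean_space => real"
assumes "ch : Cc" "jcont F" "0 < a"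
shows "(%t. LBINT x. ch x * F t x) integrable_on {a..b}"
proof -
have "{a..b} <= {0<..}" using assms(3) by auto
from continuous_on_subset[OF LBINT_flow_cont[OF assms(1,2)] this] show ?thesis
 by (intro integrable_continuous_real) simp
qed

lemma LBINT_flow_deriv:
fixes F :: "real => 'a::euclidean_space => real"
assumes ch: "ch : Cc" and c: "jcont F"
 and c': "jcont F'"
 and d: "!!t x. t > 0 ==> ((%t. F t x) hrd F' t x) (at t)" and t: "t > 0"
shows "((%t. LBINT x. ch x * F t x) hrd (LBINT x. ch x * F' t x)) (at t)"
proof -
obtain a b where ab: "!!x. x ~: cbox a b ==> ch x = 0" using Cc_cbox[OF ch] by blast
have eq: "(LBINT x. ch x * G t x) = integral (cbox a b) (%x. ch x * G t x)"
 if "jcont G" "t > 0" for G :: "real => 'a => real" and t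
 using ab by (intro Cc_integral_cbox Cc_times ch jcont_slice[OF that]) auto
have "((%t. integral (cbox a b) (%x. ch x * F t x)) hrd integral (cbox a b) (%x. ch x * F' t x)) (at t within {0<..})"
proof (rule leibniz_rule_field_derivative)
 show "((%t. ch x * F t x) hrd ch x * F' s x) (at s within {0<..})" if "s : {0<..}" for s x
  using that by (intro DERIV_subset[OF DERIV_cmult[OF d]]) auto
 show "(%x. ch x * F s x) integrable_on cbox a b" if "s : {0<..}" for s
  by (rule integrable_continuous, rule continuous_on_subset[OF continuous_on_mult[OF Cc_cont[OF ch] jcont_slice[OF c]] subset_UNIV]) (use that in auto)
 have "cont ({0<..} \<times> cbox a b) (%z. ch (snd z) * F' (fst z) (snd z))"
  by (intro continuous_on_mult cont_comp2[OF Cc_cont[OF ch]] continuous_on_subset[OF c'] cintro) auto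
 thus "cont ({0<..} \<times> cbox a b) (%(s, x). ch x * F' s x)" by (simp add: case_prod_unfold)
qed (use t in auto)
hence "((%t. integral (cbox a b) (%x. ch x * F t x)) hrd (LBINT x. ch x * F' t x)) (at t)"
 using eq[OF c' t] t at_within_open[of t "{0<..}"] by simp
thus ?thesis
 by (rule has_field_derivative_transform_within_open[where S="{0<..}"]) (use t eq[OF c] in auto)
qed

lemma hP_time_deriv: assumes f: "f : Cc" and t: "t > 0" shows "((%t. hP t f x) hrd hPt t f x) (at t)"
unfolding hP_def hPt_def
by (intro LBINT_flow_deriv f t jcont_comp[OF hk_jcont] jcont_comp[OF hkt_jcont] cintro hk_time_deriv)

lemma hP_pos:
assumes f: "f : Cc" and t: "t > 0" and nn: "!!x. f x >= 0" and a: "f a > 0"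
shows "hP t f x > 0"
unfolding hP_def
proof (rule Cc_int_pos[where a=a])
show "(%y. f y * hk t (x - y)) : Cc"
 using Cc_conv_slice[OF f jcont_slice[OF hk_jcont t], of x] by simp
show "f y * hk t (x - y) >= 0" for y using nn[of y] hk_pos[OF t, of "x - y"] by simp
show "f a * hk t (x - a) > 0" using a hk_pos[OF t, of "x - a"] by simp
qed

text \<open>The points y contributing to the convolution lie in a fixed compact set, and by
  \<open>dw_shift\<close> a translation by such a y costs only a constant factor.\<close>

lemma dwle_conv:
fixes ka :: "real => 'a::euclidean_space => 'b::euclidean_space"
assumes f: "f : Cc" and c: "jcont ka" and T: "T <= {0<..}" and d: "dwle T ka"
shows "dwle T (%t x. LBINT y. f y *: ka t (x - y))"
proof -
obtain C where C: "C > 0" "!!t x. t : T ==> norm (ka t x) <= C * dw x" using d by (rule dwleE) blast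
obtain K where K: "compact K" "!!x. x ~: K ==> f x = 0" using f by (rule Cc_support) blast
obtain rh where rh: "!!x. x : K ==> norm x <= rh" using compact_imp_bounded[OF K(1)] unfolding bounded_iff by blast
define M where "M = (2 * (1 + rh^2)) ^ DIM('a)"
show ?thesis
proof (rule dwleI)
 fix t x assume t: "t : T"
 have "norm (LBINT y. f y *: ka t (x - y)) <= (LBINT y. abs (f y) * (C * M * dw x))"
 proof (rule integral_norm_bound_integral)
  show "integ (%y. f y *: ka t (x - y))" using T t by (intro Cc_integrable[OF Cc_conv_slice[OF f jcont_slice[OF c]]]) auto
  show "integ (%y. abs (f y) * (C * M * dw x))" using Cc_integrable[OF f] by simp
  fix y
  show "norm (f y *: ka t (x - y)) <= abs (f y) * (C * M * dw x)"
  proof (cases "y : K")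
   case True
   have "C * dw (x - y) <= C * (M * dw x)" using dw_shift[OF rh[OF True], of x] C(1) by (intro mul_l) (auto simp: M_def)
   from order_trans[OF C(2)[OF t] this] show ?thesis by (simp add: mul_l mult.assoc)
  qed (use K(2) in auto)
 qed
 thus "norm (LBINT y. f y *: ka t (x - y)) <= ((LBINT y. abs (f y)) * C * M) * dw x" by (simp add: mult.assoc)
qed
qed

lemma hP_decay:
assumes f: "f : Cc" and ab: "0 < a" "a <= b"
shows "dwle {a..b} (%t. hP t f)" (is ?A) "dwle {a..b} (%t. hP1 t f)" "norm e = 1 ==> dwle {a..b} (%t. hP2 e t f)"
proof -
have T: "{a..b} <= {0<..}" using ab by auto
show ?A "dwle {a..b} (%t. hP1 t f)" "norm e = 1 ==> dwle {a..b} (%t. hP2 e t f)"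
 using dwle_conv[OF f hk_jcont T hk_bounds(1)[OF ab]] dwle_conv[OF f hk1_jcont T hk_bounds(2)[OF ab]] dwle_conv[OF f hk2_jcont T hk_bounds(3)[OF ab]]
 unfolding hP_def[abs_def] hP1_def[abs_def] hP2_def[abs_def] by auto
qed

lemma conv_Fubini_integrable:
fixes ph :: "'a::euclidean_space => real" and ka :: "'a => 'b::euclidean_space"
assumes ph: "integ ph" and ka: "integ ka"
shows "integrable lborel2 (%(y, x). ph y *: ka (x - y))"
proof (rule lborel_pair.Fubini_integrable)
have [measurable]: "ph : bmeas borel" "ka : bmeas borel" using ph ka by auto
have tr: "integ (%x. g (x - y)) = integ g" "(LBINT x. g (x - y)) = (LBINT x. g x)"
 if "g : bmeas borel" for g :: "'a => 'c::euclidean_space" and y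
 using mpres_integrable[OF mpres_translate[of "-y"] that] mpres_integral[OF mpres_translate[of "-y"] that] by simp_all
show "(%(y, x). ph y *: ka (x - y)) : bmeas lborel2" by measurable
have "(LBINT x. norm (ka (x - y))) = (LBINT x. norm (ka x))" for y
 by (rule tr(2)) measurable
hence "(%y. LBINT x. norm (case (y, x) of (y, x) => ph y *: ka (x - y))) = (%y. abs (ph y) * (LBINT x. norm (ka x)))"
 by simp
thus "integ (%y. LBINT x. norm (case (y, x) of (y, x) => ph y *: ka (x - y)))"
 using ph by simp
show "AE y in lborel. integ (%x. case (y, x) of (y, x) => ph y *: ka (x - y))"
 using ka tr(1)[of ka] by (intro AE_I2) simp
qed

lemma conv_L1:
fixes ph :: "'a::euclidean_space => real" and ka :: "'a => real"
assumes ph: "integ ph" and ka: "integ ka"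
shows "integ (%x. LBINT y. ph y * ka (x - y))" (is ?A)
 "(LBINT x. (LBINT y. ph y * ka (x - y))) = (LBINT y. ph y) * (LBINT x. ka x)" (is ?B)
proof -
have kam: "ka : bmeas borel" using ka by auto
have i: "integrable lborel2 (%(y, x). ph y * ka (x - y))"
 using conv_Fubini_integrable[OF ph ka] by simp
show ?A
 using lborel_pair.integrable_snd[OF i] by simp
have "(LBINT x. ph y * ka (x - y)) = ph y * (LBINT x. ka x)" for y
 using mpres_integral[OF mpres_translate[of "-y"] kam] by simp
hence "(LBINT y. (LBINT x. ph y * ka (x - y))) = (LBINT y. ph y) * (LBINT x. ka x)"
 by (simp only: integral_mult_left_zero)
with lborel_pair.Fubini_integral[OF i] show ?B
 by (simp only:)
qed

text \<open>The tangent line of s^r at s0 lies below the graph; Young's inequality for s and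
  s0^(r-1) is exactly this statement.\<close>

lemma powr_tangent:
fixes r s s0 :: real
assumes "r > 1" "s >= 0" "s0 >= 0"
shows "s powr r >= s0 powr r + r * s0 powr (r-1) * (s - s0)"
proof -
define r' where "r' = r / (r-1)"
have c: "conj_exp r r'" unfolding r'_def by (rule conj_exp_conv[OF assms(1)])
have "s * s0 powr (r-1) <= s powr r / r + (s0 powr (r-1)) powr r' / r'"
 using c assms by (intro Youngs_inequality) (auto simp: conj_exp_def)
also have "(s0 powr (r-1)) powr r' = s0 powr r" using conj_expD(3)[OF c] by (simp add: powr_powr)
also have "s0 powr r / r' = s0 powr r * (1 - 1/r)" using assms by (simp add: r'_def field_simps)
finally have "r * (s * s0 powr (r-1)) <= r * (s powr r / r + s0 powr r * (1 - 1/r))"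
 using assms by (intro mul_l) auto
also have "... = s powr r + (r-1) * s0 powr r" using assms by (simp add: field_simps)
finally have "r * (s * s0 powr (r-1)) <= s powr r + (r-1) * s0 powr r" .
moreover have "s0 * s0 powr (r-1) = s0 powr r" using assms powr_add[of s0 1 "r-1"] by (cases "s0 = 0") auto
ultimately show ?thesis by (simp add: asimps)
qed

text \<open>The tangent inequality at the average s0 = \<open>hP t f x\<close> is integrated against
  the heat kernel, a probability density.\<close>

lemma hP_Jensen:
assumes f: "f : Cc" and t: "t > 0" and nn: "!!x. f x >= 0" and r: "r > 1"
shows "(hP t f x) powr r <= hP t (%y. f y powr r) x"
proof -
have hc: "cont UNIV (%y. hk t (x - y))"
 by (intro cont_comp2[OF jcont_slice[OF hk_jcont t]] cintro subset_UNIV)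
have fr: "(%y. f y powr r) : Cc" using Cc_norm_powr[OF f, of r] r nn by simp
define s0 where "s0 = hP t f x"
have s0: "s0 >= 0" unfolding s0_def hP_def by (intro integral_nonneg_AE AE_I2 mult_nonneg_nonneg nn less_imp_le[OF hk_pos] t)
have ih: "integ (%y. hk t (x - y))" "(LBINT y. hk t (x - y)) = 1"
proof -
 have m: "hk t : bmeas (borel::'a measure)" using hk_integrable[OF t, where 'a='a] by auto
 show "integ (%y. hk t (x - y))" "(LBINT y. hk t (x - y)) = 1"
  using mpres_integrable[OF mpres_uminus m] mpres_integral[OF mpres_uminus m] hk_integrable[OF t, where 'a='a] hk_integral[OF t, where 'a='a] by auto
qed
have i1: "integ (%y. f y * hk t (x - y))" and i2: "integ (%y. f y powr r * hk t (x - y))"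
 by (rule Cc_integrable[OF Cc_times[OF f hc]], rule Cc_integrable[OF Cc_times[OF fr hc]])
have "(LBINT y. (s0 powr r - r * s0 powr (r-1) * s0) * hk t (x - y) + r * s0 powr (r-1) * (f y * hk t (x - y)))
  <= (LBINT y. f y powr r * hk t (x - y))"
proof (rule integral_mono)
 show "integ (%y. (s0 powr r - r * s0 powr (r-1) * s0) * hk t (x - y) + r * s0 powr (r-1) * (f y * hk t (x - y)))"
  using ih i1 by (intro integrable_add) auto
 fix y
 have "(s0 powr r + r * s0 powr (r-1) * (f y - s0)) * hk t (x - y) <= f y powr r * hk t (x - y)"
  using powr_tangent[OF r nn[of y] s0] hk_pos[OF t, of "x - y"] by (intro mul_r) auto
 thus "(s0 powr r - r * s0 powr (r-1) * s0) * hk t (x - y) + r * s0 powr (r-1) * (f y * hk t (x - y)) <= f y powr r * hk t (x - y)"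
  by (simp add: asimps)
qed (rule i2)
moreover have "(LBINT y. (s0 powr r - r * s0 powr (r-1) * s0) * hk t (x - y) + r * s0 powr (r-1) * (f y * hk t (x - y)))
 = (s0 powr r - r * s0 powr (r-1) * s0) * 1 + r * s0 powr (r-1) * s0"
 using ih i1 by (subst integral_add) (auto simp: s0_def hP_def)
ultimately show ?thesis by (simp add: s0_def hP_def)
qed

lemma hP_contraction:
assumes f: "f : Cc" and t: "t > 0" and nn: "!!x. f x >= 0" and r: "r > 1"
shows "integ (%x. (hP t f x) powr r)"
 "(LBINT x. (hP t f x) powr r) <= (LBINT x. f x powr r)" (is ?A)
proof -
have fr: "(%y. f y powr r) : Cc" using Cc_norm_powr[OF f, of r] r nn by simp
have i: "integ (hP t (%y. f y powr r))" "(LBINT x. hP t (%y. f y powr r) x) = (LBINT x. f x powr r)"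
 using conv_L1[OF Cc_integrable[OF fr] hk_integrable[OF t]] hk_integral[OF t, where 'a='a] unfolding hP_def[abs_def] by simp_all
have m: "(%x. (hP t f x) powr r) : bmeas lborel"
proof -
 have [measurable]: "hP t f : bmeas borel"
  using C1_cont[OF hP_C1(1)[OF f t]] by (intro cont_bmeas)
 show ?thesis by simp
qed
show i2: "integ (%x. (hP t f x) powr r)"
 by (rule integrable_bound[OF i(1) m])
  (use order_trans[OF hP_Jensen[OF f t nn r] abs_ge_self] in auto)
show ?A
 unfolding i(2)[symmetric] by (rule integral_mono[OF i2 i(1) hP_Jensen[OF f t nn r]])
qed

section \<open>Cutoff functions\<close>

lemma pospow_deriv: "((%s. (max 0 s) ^ (n+2)) hrd real (n+2) * (max 0 s) ^ (n+1)) (at (s::real))"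
proof (cases s "0::real" rule: linorder_cases)
case less
have "((%s. 0) hrd 0) (at s)" by simp
hence "((%s. (max 0 s) ^ (n+2)) hrd 0) (at s)"
 by (rule has_field_derivative_transform_within_open[where S="{..<0}"]) (use less in auto)
thus ?thesis using less by simp
next
case greater
have "((%s. s ^ (n+2)) hrd real (n+2) * s ^ (n+1)) (at s)"
 using DERIV_pow[of "n+2" s] by simp
hence "((%s. (max 0 s) ^ (n+2)) hrd real (n+2) * s ^ (n+1)) (at s)"
 by (rule has_field_derivative_transform_within_open[where S="{0<..}"]) (use greater in auto)
thus ?thesis using greater by simp
next
case equal
have "((%h. (max 0 h) ^ (n+2) / h) \<longlongrightarrow> 0) (at (0::real))"
proof (rule Lim_null_comparison)
 have "((%h::real. abs h ^ (n+1)) \<longlongrightarrow> abs 0 ^ (n+1)) (at 0)" by (intro tendsto_intros)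
 thus "((%h::real. abs h ^ (n+1)) \<longlongrightarrow> 0) (at 0)" by simp
 show "\<forall>\<^sub>F h in at (0::real). norm ((max 0 h) ^ (n+2) / h) <= abs h ^ (n+1)"
 proof (rule always_eventually, rule allI)
  fix h :: real
  show "norm ((max 0 h) ^ (n+2) / h) <= abs h ^ (n+1)"
  proof (cases "h > 0")
   case False
   hence "norm ((max 0 h) ^ (n+2) / h) = 0" by simp
   thus ?thesis by (simp only: zero_le_power abs_ge_zero)
  qed simp
 qed
qed
hence "((%s. (max 0 s) ^ (n+2)) hrd 0) (at (0::real))" by (simp add: has_field_derivative_iff)
thus ?thesis using equal by simp
qed

definition C2 :: "('a::euclidean_space => real) => bool" where
"C2 ph \<longleftrightarrow> C1 ph & (ALL e:Basis. C1 (%x. grad ph x *. e))"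

definition lap :: "('a::euclidean_space => real) => 'a => real" where
"lap ph x = (SUM e:Basis. grad (%x. grad ph x *. e) x *. e)"

lemma C2_C1: "C2 ph ==> C1 ph" by (simp add: C2_def)

lemma C2_lap_cont: "C2 ph ==> cont UNIV (lap ph)"
unfolding lap_def C2_def by (intro continuous_on_sum continuous_on_inner continuous_on_const C1_cont_grad) auto

text \<open>The cube of a truncated quadratic is C^2, just enough for a Laplacian, and its
  derivatives are explicit enough for numerical bounds.\<close>

definition bump :: "'a::euclidean_space => real => 'a => real" where
"bump z r x = (max 0 (1 - (norm (x - z))^2 / r^2)) ^ 3"

lemma pospow_bump_C1:
fixes z :: "'a::euclidean_space"
shows "C1 (%x. (max 0 (1 - (norm (x - z))^2 / r^2)) ^ (n+2))" (is ?A)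
 "grad (%x. (max 0 (1 - (norm (x - z))^2 / r^2)) ^ (n+2)) =
  (%x. (real (n+2) * (max 0 (1 - (norm (x - z))^2 / r^2)) ^ (n+1)) *: (- (2 / r^2) *: (x - z)))"
proof -
have "C1 (%x. 1 - (1 / r^2) * (norm (x - z))^2)"
 by (intro C1_diff C1_const C1_cmult C1_norm2)
moreover have "grad (%x. 1 - (1 / r^2) * (norm (x - z))^2) = (%x. - (2 / r^2) *: (x - z))"
 unfolding C1_diff(2)[OF C1_const(1) C1_cmult(1)[OF C1_norm2(1)]] C1_const(2) C1_cmult(2)[OF C1_norm2(1)] C1_norm2(2)
 by (simp add: fun_eq_iff)
ultimately have c: "C1 (%x. 1 - (norm (x - z))^2 / r^2)" "grad (%x. 1 - (norm (x - z))^2 / r^2) = (%x. - (2 / r^2) *: (x - z))"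
 by simp_all
have k: "cont UNIV (%s::real. real (n+2) * (max 0 s) ^ (n+1))"
 by (intro cintro)
show ?A
 "grad (%x. (max 0 (1 - (norm (x - z))^2 / r^2)) ^ (n+2)) =
  (%x. (real (n+2) * (max 0 (1 - (norm (x - z))^2 / r^2)) ^ (n+1)) *: (- (2 / r^2) *: (x - z)))"
 using C1_chain[OF c(1) pospow_deriv k] unfolding c(2) by blast+
qed

lemma bump_C1: "C1 (bump z r)"
"grad (bump z r) = (%x. (- (6 / r^2) * (max 0 (1 - (norm (x - z))^2 / r^2)) ^ 2) *: (x - z))"
using pospow_bump_C1[of z r 1] by (simp_all add: bump_def[abs_def] numeral_eq_Suc)

lemma bump_C2: "C2 (bump z r)"
and bump_lap: "lap (bump z r) x = - (6 / r^2) * (real DIM('a) * (max 0 (1 - (norm (x - z))^2 / r^2)) ^ 2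
 - (4 / r^2) * max 0 (1 - (norm (x - z))^2 / r^2) * (norm (x - z))^2)" for z :: "'a::euclidean_space"
proof -
let ?s = "%x. max 0 (1 - (norm (x - z))^2 / r^2)"
note p = pospow_bump_C1[of z r 0]
have f: "(%x. grad (bump z r) x *. e) = (%x. - (6 / r^2) * ((?s x) ^ (0+2) * ((x *. e) - (z *. e))))" for e
 by (auto simp: bump_C1(2) inner_diff_left pow2)
have l: "C1 (%x::'a. (x *. e) - (z *. e))" "grad (%x::'a. (x *. e) - (z *. e)) = (%x. e)" for e
 using C1_diff[OF C1_inner(1)[of e] C1_const(1)] by (simp_all add: C1_inner(2) C1_const(2))
have c: "C1 (%x. grad (bump z r) x *. e)" for e
 unfolding f by (intro C1_cmult C1_mult p l)
show "C2 (bump z r)" using c bump_C1(1) by (simp add: C2_def)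
have g: "grad (%x. grad (bump z r) x *. e) x *. e = - (6 / r^2) * ((?s x) ^ 2 * (e *. e) - (4 / r^2) * ?s x * (((x - z) *. e) * ((x - z) *. e)))" for e
 unfolding f C1_cmult(2)[OF C1_mult(1)[OF p(1) l(1)]] C1_mult(2)[OF p(1) l(1)] p(2) l(2)
 by (simp add: inner_diff_left inner_add_left asimps diff_divide_distrib add_divide_distrib pow2)
have "lap (bump z r) x = (SUM e:Basis. - (6 / r^2) * ((?s x) ^ 2 - (4 / r^2) * ?s x * (((x - z) *. e) * ((x - z) *. e))))"
 unfolding lap_def g by simp
also have "... = - (6 / r^2) * (real DIM('a) * (?s x) ^ 2 - (4 / r^2) * ?s x * (SUM e:Basis. ((x - z) *. e) * ((x - z) *. e)))"
 by (simp only: sum_distrib_left[symmetric] sum_subtractf sum_constant)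
also have "(SUM e:Basis. ((x - z) *. e) * ((x - z) *. e)) = (norm (x - z))^2"
 by (simp add: power2_norm_eq_inner euclidean_inner[of "x-z" "x-z"])
finally show "lap (bump z r) x = - (6 / r^2) * (real DIM('a) * (?s x) ^ 2 - (4 / r^2) * ?s x * (norm (x - z))^2)" .
qed

lemma bump_bounds:
fixes z :: "'a::euclidean_space"
assumes r: "r > 0"
shows "0 <= bump z r x" (is ?A) "bump z r x <= 1" "norm (x - z) >= r ==> bump z r x = 0"
 "norm (x - z) < r ==> bump z r x > 0" "norm (grad (bump z r) x) <= 6 / r" (is ?B) "abs (lap (bump z r) x) <= (24 + 6 * real DIM('a)) / r^2" (is ?C)
 "norm (x - z) >= r ==> grad (bump z r) x = 0" "norm (x - z) >= r ==> lap (bump z r) x = 0"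
proof -
define s where "s = max 0 (1 - (norm (x - z))^2 / r^2)"
have s: "0 <= s" "s <= 1" by (auto simp: s_def)
have b: "bump z r x = s ^ 3" by (simp add: bump_def s_def)
have g: "grad (bump z r) x = (- (6 / r^2) * s ^ 2) *: (x - z)" by (simp add: bump_C1(2) s_def)
have lp: "lap (bump z r) x = - (6 / r^2) * (real DIM('a) * s ^ 2 - (4 / r^2) * s * (norm (x - z))^2)" by (simp add: bump_lap s_def)
show ?A "bump z r x <= 1" using s by (auto simp: b power_le_one)
have s0: "s = 0" if "norm (x - z) >= r"
 using that r power_mono[OF that, of 2] by (simp add: s_def)
show "norm (x - z) >= r ==> bump z r x = 0" "norm (x - z) >= r ==> grad (bump z r) x = 0"
 "norm (x - z) >= r ==> lap (bump z r) x = 0"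
 using s0 by (auto simp: b g lp)
show "norm (x - z) < r ==> bump z r x > 0"
 using r power_strict_mono[of "norm (x - z)" r 2] by (simp add: b s_def)
have s1: "s * norm (x - z) <= r" "s * (norm (x - z))^2 <= r^2"
proof -
 consider "norm (x - z) >= r" | "norm (x - z) <= r" by linarith
 hence "s * norm (x - z) <= r & s * (norm (x - z))^2 <= r^2"
 proof cases
  case 2
  have "s * norm (x - z) <= 1 * r" using s 2 r by (intro mult_mono) auto
  moreover have "s * (norm (x - z))^2 <= 1 * r^2" using s 2 r by (intro mult_mono power_mono) auto
  ultimately show ?thesis by simp
 qed (use s0 r in auto)
 thus "s * norm (x - z) <= r" "s * (norm (x - z))^2 <= r^2" by auto
qed
have "norm (grad (bump z r) x) = (6 / r^2) * (s * (s * norm (x - z)))"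
 using s by (simp add: g pow2 abs_mult)
also have "... <= (6 / r^2) * (1 * r)" using s s1 r by (intro mul_l mult_mono) auto
finally show ?B using r by (simp add: pow2)
have "abs (lap (bump z r) x) <= (6 / r^2) * (real DIM('a) * s ^ 2 + (4 / r^2) * (s * (norm (x - z))^2))"
 unfolding lp abs_mult using s r by (intro mult_mono order_trans[OF abs_triangle_ineq4]) (auto simp: abs_mult)
also have "... <= (6 / r^2) * (real DIM('a) * 1 + (4 / r^2) * r^2)"
 using s s1 r by (intro mul_l add_mono) (auto simp: power_le_one)
also have "... = (24 + 6 * real DIM('a)) / r^2" using r by (simp add: field_simps)
finally show ?C .
qed

lemma bump_C1c: "r > 0 ==> cball z r <= Om ==> bump z r : C1c Om"
using bump_bounds(3)[where r=r and z=z] by (intro C1cI[OF bump_C1(1), of "cball z r"]) (auto simp: dist_norm norm_minus_commute)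

lemma bump_lap_Cc: "r > 0 ==> lap (bump z r) : Cc"
using bump_bounds(8)[where r=r and z=z] by (intro CcI[OF C2_lap_cont[OF bump_C2], of "cball z r"]) (auto simp: dist_norm norm_minus_commute)

section \<open>The heat flow estimate\<close>

lemma bump_Cc: "R > 0 ==> bump z R : Cc"
using C1cD(2)[OF bump_C1c[of R z UNIV]] by auto

lemma bump_tendsto: "(%n. bump 0 (real (Suc n)) x) ----> 1"
proof -
have "(%n. 1 / real (Suc n)) ----> 0" by (rule LIMSEQ_inverse_real_of_nat[unfolded inverse_eq_divide])
hence "(%n. (max 0 (1 - (norm x)^2 * (1 / real (Suc n))^2)) ^ 3) ----> (max 0 (1 - (norm x)^2 * 0\<^sup>2)) ^ 3"
 by (intro tendsto_intros)
thus ?thesis by (simp add: bump_def power_one_over divide_inverse power_inverse)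
qed

text \<open>Removes the spatial cutoffs: multiplication by bumps of growing radius reduces
  everything to compactly supported integrands, and the weight \<open>dw\<close> dominates uniformly
  in time.\<close>

lemma decay_flow:
fixes F :: "real => 'a::euclidean_space => real"
assumes c: "jcont F" and a: "0 < a"
 and d: "dwle {a..b} F"
shows "t : {a..b} ==> integ (F t)"
 "(%t. LBINT x. F t x) integrable_on {a..b}" (is ?A)
 "(%n. integral {a..b} (%t. LBINT x. bump 0 (real (Suc n)) x * F t x)) ----> integral {a..b} (%t. LBINT x. F t x)"
proof -
obtain C where C: "!!t x. t : {a..b} ==> abs (F t x) <= C * dw x" using d by (rule dwleE) (metis real_norm_def)
have dwi: "integ (%x::'a. C * dw x)" using dw_integrable[where 'a='a] by simp
have m: "F t : bmeas borel" if "t : {a..b}" for t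
 using cont_bmeas[OF jcont_slice[OF c]] that a by auto
have b: "bump (0::'a) (real (Suc n)) : bmeas borel" "0 <= bump (0::'a) (real (Suc n)) x" "bump (0::'a) (real (Suc n)) x <= 1" for n x
 by (rule Cc_measurable[OF bump_Cc] bump_bounds(1,2); simp)+
have bd: "norm (bump 0 (real (Suc n)) x * F t x) <= C * dw x" if "t : {a..b}" for n t x
 using order_trans[OF mult_left_le_one_le[OF abs_ge_zero b(2,3)] C[OF that, of x]] b(2)[of n x] by (simp add: abs_mult)
have L: "(%n. LBINT x. bump 0 (real (Suc n)) x * F t x) ----> (LBINT x. F t x)"
 and i: "integ (F t)" if t: "t : {a..b}" for t
proof -
 have "AE x in lborel. (%n. bump 0 (real (Suc n)) x * F t x) ----> F t x"
  using tendsto_mult[OF bump_tendsto tendsto_const] by (intro AE_I2) (simp only: mult_1)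
 note * = _ _ dwi this AE_I2[OF bd[OF t]]
 show "(%n. LBINT x. bump 0 (real (Suc n)) x * F t x) ----> (LBINT x. F t x)"
  by (rule integral_dominated_convergence[OF *]) (use m[OF t] b(1) in simp_all)
 show "integ (F t)"
  by (rule integrable_dominated_convergence[OF *]) (use m[OF t] b(1) in simp_all)
qed
show "t : {a..b} ==> integ (F t)" by (rule i)
have 1: "(%t. LBINT x. bump 0 (real (Suc n)) x * F t x) integrable_on {a..b}" for n
 by (intro LBINT_flow_integrable bump_Cc c a) simp
have 2: "norm (LBINT x. bump 0 (real (Suc n)) x * F t x) <= (LBINT x. C * dw (x::'a))" if "t : {a..b}" for n t
 by (rule integral_norm_bound_integral[OF integrable_bound[OF dwi] dwi bd[OF that]])
  (use m[OF that] b(1) order_trans[OF bd[OF that] abs_ge_self] in simp_all)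
show ?A
 "(%n. integral {a..b} (%t. LBINT x. bump 0 (real (Suc n)) x * F t x)) ----> integral {a..b} (%t. LBINT x. F t x)"
 by (rule dominated_convergence[OF 1 integrable_const_ivl 2 L]; assumption)+
qed

lemma Dl_hP_jcont:
assumes f: "f : Cc" shows "cont ({0<..} \<times> UNIV) (%p. Dl l (hP (fst p) f) (snd p))"
proof -
have "cont ({0<..} \<times> UNIV) (%p. (hP1 (fst p) f (snd p), l * hP (fst p) f (snd p)))"
 by (intro cintro hP_jcont hP1_jcont f)
thus ?thesis by (rule continuous_on_cong[THEN iffD1, rotated 2, OF _ refl]) (auto simp: Dl_def hP_C1(2)[OF f])
qed

text \<open>The integrand of the bilinear estimate. The semigroup of l^2 - Laplacian is the heat
  flow times exp(-l^2 t), and the factor occurs squared because both flows carry it.\<close>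

definition FF :: "real => ('a::euclidean_space => real) => ('a => real) => real => 'a => real" where
"FF l g h t x = norm (Dl l (hP t h) x) * norm (Dl l (hP t g) x) * (exp (- (l^2 * t)))^2"

lemma FF_jcont: "f : Cc ==> g : Cc ==> cont ({0<..} \<times> UNIV) (%p. FF l f g (fst p) (snd p))"
unfolding FF_def by (intro cintro Dl_hP_jcont)

lemma FF_decay:
assumes "f : Cc" "g : Cc" and ab: "0 < a" "a <= b" shows "dwle {a..b} (FF l f g)"
proof -
have D: "dwle {a..b} (%t x. norm (Dl l (hP t f) x))" if f: "f : Cc" for f
proof (rule dwle_le[OF dwle_add[OF dwle_le[OF hP_decay(2)[OF f ab]] dwle_le[OF hP_decay(1)[OF f ab]]], where K=1])
 show "norm (norm (hP1 t f x)) <= 1 * norm (hP1 t f x)" "norm (abs (l * hP t f x)) <= abs l * norm (hP t f x)" for t x by (simp_all add: abs_mult)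
 show "norm (norm (Dl l (hP t f) x)) <= 1 * norm (norm (hP1 t f x) + abs (l * hP t f x))" if "t : {a..b}" for t x
  using norm_Dl_le[of l "hP t f" x] hP_C1(2)[OF f, of t] that ab by simp
qed
show ?thesis
proof (rule dwle_le[OF dwle_mult[OF D D], where K=1])
 show "norm (FF l f g t x) <= 1 * norm (norm (Dl l (hP t g) x) * norm (Dl l (hP t f) x))" if "t : {a..b}" for t x
  using that ab by (simp add: FF_def abs_mult mult_left_le power_le_one)
qed fact+
qed

lemma cont_B:
assumes X: "cont S X" and Y: "cont S Y" and pos: "!!s. s : S ==> X s > 0 & Y s > 0"
shows "cont S (%s. Bf p q (X s) (Y s))" (is ?A) "cont S (%s. B1 p q (X s) (Y s))"
 "cont S (%s. B2 p q (X s) (Y s))" "cont S (%s. B11 p q (X s) (Y s))"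
 "cont S (%s. B12 p q (X s) (Y s))" "cont S (%s. B22 p q (X s) (Y s))"
proof -
have px: "cont S (%s. X s powr a)" "cont S (%s. Y s powr a)" for a
 by (rule continuous_on_powr[OF X continuous_on_const], use pos in force,
   rule continuous_on_powr[OF Y continuous_on_const], use pos in force)
have m: "cont S (%s. bm p (X s) (Y s))" unfolding bm_def by (intro continuous_on_add continuous_on_mult X Y px)
have c: "cont S (%s. bc p q (X s) (Y s))" unfolding bc_def
 by (rule continuous_on_powr[OF m continuous_on_const]) (use bm_pos pos in \<open>force simp: less_le\<close>)
show ?A "cont S (%s. B1 p q (X s) (Y s))"
 "cont S (%s. B2 p q (X s) (Y s))" "cont S (%s. B11 p q (X s) (Y s))"
 "cont S (%s. B12 p q (X s) (Y s))" "cont S (%s. B22 p q (X s) (Y s))"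
 unfolding Bf_def B1_def B2_def B11_def B12_def B22_def
 by (intro continuous_on_add continuous_on_diff continuous_on_mult continuous_on_power continuous_on_const X Y px m c)+
qed
text \<open>The data are nonnegative and not identically zero, so their heat flows are strictly
  positive and stay in the open quadrant where the Bellman function is differentiable. X evolves h,
  measured with exponent p, and Y evolves g, measured with q.\<close>

locale heat_pair =
fixes p q l :: real and g h :: "'a::euclidean_space => real"
assumes pq: "conj_exp p q" and q2: "q <= 2"
 and g: "g : Cc" "!!x. g x >= 0" "EX a. g a > 0" and h: "h : Cc" "!!x. h x >= 0" "EX a. h a > 0"
begin

definition E :: "real => real" where "E t = exp (- (l^2 * t))"
definition X :: "real => 'a => real" where "X t x = E t * hP t h x"
definition Y :: "real => 'a => real" where "Y t x = E t * hP t g x"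
definition U :: "real => 'a => 'a" where "U t x = E t *: hP1 t h x"
definition V :: "real => 'a => 'a" where "V t x = E t *: hP1 t g x"
definition b :: "real => 'a => real" where "b t x = Bf p q (X t x) (Y t x)"
definition b1 :: "real => 'a => real" where "b1 t x = B1 p q (X t x) (Y t x)"
definition b2 :: "real => 'a => real" where "b2 t x = B2 p q (X t x) (Y t x)"
definition b11 :: "real => 'a => real" where "b11 t x = B11 p q (X t x) (Y t x)"
definition b12 :: "real => 'a => real" where "b12 t x = B12 p q (X t x) (Y t x)"
definition b22 :: "real => 'a => real" where "b22 t x = B22 p q (X t x) (Y t x)"
text \<open>\<open>bi e\<close> and \<open>bii e\<close> are the first and second derivatives of b
  in direction e, written out by the chain rule; \<open>bt\<close> is the time derivative.\<close>

definition bi :: "'a => real => 'a => real" where "bi e t x = b1 t x * (U t x *. e) + b2 t x * (V t x *. e)"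
definition bii :: "'a => real => 'a => real" where
"bii e t x = (b11 t x * (U t x *. e) + b12 t x * (V t x *. e)) * (U t x *. e) + b1 t x * (E t * (hP2 e t h x *. e))
 + ((b12 t x * (U t x *. e) + b22 t x * (V t x *. e)) * (V t x *. e) + b2 t x * (E t * (hP2 e t g x *. e)))"
definition bt :: "real => 'a => real" where
"bt t x = b1 t x * (E t * hPt t h x - l^2 * X t x) + b2 t x * (E t * hPt t g x - l^2 * Y t x)"
abbreviation "F == FF l g h"

lemma E_pos: "E t > 0" by (simp add: E_def)

lemma XY_pos: assumes "t > 0" shows "X t x > 0" "Y t x > 0"
using g h hP_pos[OF h(1) assms h(2)] hP_pos[OF g(1) assms g(2)] E_pos by (auto simp: X_def Y_def)

lemma E_cont: "cont S (%p. E (fst p))"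
unfolding E_def by (intro cintro)

lemma XY_jcont: "jcont X" "jcont Y"
"jcont U" "jcont V"
unfolding X_def Y_def U_def V_def by (intro cintro E_cont hP_jcont hP1_jcont g h)+

lemma b_jcont: "jcont b" "jcont b1"
"jcont b2" "jcont b11"
"jcont b12" "jcont b22"
unfolding b_def b1_def b2_def b11_def b12_def b22_def
by (intro cont_B XY_jcont; use XY_pos in force)+

lemma bi_jcont: "cont ({0<..} \<times> UNIV) (%p. bi e (fst p) (snd p))"
unfolding bi_def by (intro cintro b_jcont XY_jcont)

lemma bii_jcont: "cont ({0<..} \<times> UNIV) (%p. bii e (fst p) (snd p))"
unfolding bii_def by (intro cintro b_jcont XY_jcont E_cont hP2_jcont g h)

lemma bt_jcont: "jcont bt"
unfolding bt_def by (intro cintro b_jcont XY_jcont E_cont hPt_jcont g h)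

lemma F_eq: assumes "t > 0" shows "F t x = norm (U t x, l * X t x) * norm (V t x, l * Y t x)"
proof -
have "(U t x, l * X t x) = E t *: Dl l (hP t h) x" "(V t x, l * Y t x) = E t *: Dl l (hP t g) x"
 using assms g h by (simp_all add: U_def V_def X_def Y_def Dl_def hP_C1(2))
thus ?thesis using E_pos[of t] by (simp add: FF_def E_def pow2)
qed

lemma line_derivs:
assumes t: "t > 0" and e: "e : Basis"
shows "((%r. b t (x + r *: e)) hrd bi e t x) (at 0)" (is ?A)
 "((%r. bi e t (x + r *: e)) hrd bii e t x) (at 0)" (is ?B)
proof -
have n: "norm e = 1" using e by simp
have dX: "((%r. X t (x + r *: e)) hrd U t x *. e) (at 0)"
 "((%r. Y t (x + r *: e)) hrd V t x *. e) (at 0)"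
 unfolding X_def Y_def U_def V_def inner_scaleR_left
 using GDERIV_line[where t=0 and e=e, OF hP_GDERIV[OF h(1) t, of "x + 0 *: e"]]
  GDERIV_line[where t=0 and e=e, OF hP_GDERIV[OF g(1) t, of "x + 0 *: e"]]
 by (auto intro!: DERIV_cmult)
have dU: "((%r. U t (x + r *: e) *. e) hrd E t * (hP2 e t h x *. e)) (at 0)"
 "((%r. V t (x + r *: e) *. e) hrd E t * (hP2 e t g x *. e)) (at 0)"
 unfolding U_def V_def inner_scaleR_left
 using GDERIV_line[where t=0 and e=e, OF hP1_GDERIV[OF h(1) t n, of "x + 0 *: e"]]
  GDERIV_line[where t=0 and e=e, OF hP1_GDERIV[OF g(1) t n, of "x + 0 *: e"]]
 by (auto intro!: DERIV_cmult)
note pos = XY_pos[OF t, of "x + 0 *: e"]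
show ?A
 using deriv_Bf[where r=0, OF dX(1) pos(1) dX(2) pos(2), of p q] by (simp add: b_def bi_def b1_def b2_def)
have d1: "((%r. b1 t (x + r *: e)) hrd b11 t x * (U t x *. e) + b12 t x * (V t x *. e)) (at 0)"
 using deriv_B1[where r=0, OF dX(1) pos(1) dX(2) pos(2), of p q] by (simp add: b1_def b11_def b12_def)
have d2: "((%r. b2 t (x + r *: e)) hrd b12 t x * (U t x *. e) + b22 t x * (V t x *. e)) (at 0)"
 using deriv_B2[where r=0, OF dX(1) pos(1) dX(2) pos(2), of p q] by (simp add: b2_def b22_def b12_def)
have "((%r. bi e t (x + r *: e)) hrd
 ((b11 t x * (U t x *. e) + b12 t x * (V t x *. e)) * (U t (x + 0 *: e) *. e) + (E t * (hP2 e t h x *. e)) * b1 t (x + 0 *: e))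
 + ((b12 t x * (U t x *. e) + b22 t x * (V t x *. e)) * (V t (x + 0 *: e) *. e) + (E t * (hP2 e t g x *. e)) * b2 t (x + 0 *: e))) (at 0)"
 unfolding bi_def by (intro DERIV_add DERIV_mult d1 d2 dU)
thus ?B
 by (simp add: bii_def mult.commute)
qed

lemma time_deriv:
assumes t: "t > 0"
shows "((%t. b t x) hrd bt t x) (at t)"
proof -
have dE: "(E hrd - l\<^sup>2 * E t) (at t)"
 unfolding E_def[abs_def] by (auto intro!: derivative_eq_intros)
have dX: "((%t. X t x) hrd E t * hPt t h x - l^2 * X t x) (at t)"
 "((%t. Y t x) hrd E t * hPt t g x - l^2 * Y t x) (at t)"
 unfolding X_def Y_def using DERIV_mult[OF dE hP_time_deriv[OF h(1) t, of x]] DERIV_mult[OF dE hP_time_deriv[OF g(1) t, of x]]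
 by (simp_all add: asimps)
show ?thesis
 using deriv_Bf[where r=t, OF dX(1) XY_pos(1)[OF t] dX(2) XY_pos(2)[OF t], of p q] by (simp add: b_def bt_def b1_def b2_def)
qed

text \<open>In the time derivative minus the Laplacian of b, the second derivatives of the two flows
  cancel by the heat equation. What remains is minus the Hessian form in the gradients together with
  the radial term from the factor \<open>E\<close>, and \<open>bell_main\<close> bounds it.\<close>

lemma bt_le: assumes t: "t > 0" shows "bt t x <= (SUM e:Basis. bii e t x) - 2 * bd q * F t x"
proof -
have s: "(SUM e:Basis. bii e t x) = (SUM i:Basis. b11 t x * (U t x *. i)^2 + 2 * b12 t x * ((U t x *. i) * (V t x *. i)) + b22 t x * (V t x *. i)^2)
 + b1 t x * (E t * hPt t h x) + b2 t x * (E t * hPt t g x)"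
 unfolding hPt_hP2[OF g(1) t] hPt_hP2[OF h(1) t] sum_distrib_left sum.distrib[symmetric]
 by (intro sum.cong refl) (simp add: bii_def pow2 asimps)
have "2 * bd q * F t x <= (SUM i:Basis. b11 t x * (U t x *. i)^2 + 2 * b12 t x * ((U t x *. i) * (V t x *. i)) + b22 t x * (V t x *. i)^2)
 + l^2 * (X t x * b1 t x + Y t x * b2 t x)"
 using bell_main[where U="U t x" and V="V t x" and l=l, OF pq q2 XY_pos[OF t]]
 unfolding F_eq[OF t] b1_def b2_def b11_def b12_def b22_def by simp
thus ?thesis unfolding s bt_def by (simp add: asimps)
qed

definition La :: real where "La = (LBINT x. h x powr p) + (LBINT x. g x powr q)"

lemma b_integral: assumes t: "t > 0" shows "integ (b t)" "(LBINT x. b t x) <= (1 + 2 powr q) * La" (is ?A) "b t x >= 0"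
proof -
note pq' = conj_expD(1,2)[OF pq]
show nn: "b t x >= 0" for x unfolding b_def by (rule Bf_nonneg[OF pq q2 XY_pos[OF t]])
have E1: "E t <= 1" using t by (simp add: E_def)
have up: "b t x <= (1 + 2 powr q) * ((hP t h x) powr p + (hP t g x) powr q)" for x
proof -
 have hp: "hP t h x > 0" "hP t g x > 0" using XY_pos[OF t, of x] E_pos[of t] by (auto simp: X_def Y_def zero_less_mult_iff)
 have "b t x <= (1 + 2 powr q) * ((X t x) powr p + (Y t x) powr q)" unfolding b_def by (rule Bf_upper[OF pq q2 XY_pos[OF t]])
 also have "... <= (1 + 2 powr q) * ((hP t h x) powr p + (hP t g x) powr q)"
 proof (intro mul_l add_mono powr_mono2)
  show "X t x <= hP t h x" "Y t x <= hP t g x" using mul_r[OF E1, of "hP t h x"] mul_r[OF E1, of "hP t g x"] hp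
   by (simp_all add: X_def Y_def)
 qed (use pq' XY_pos[OF t, of x] in \<open>auto simp: less_imp_le\<close>)
 finally show ?thesis .
qed
note c1 = hP_contraction[OF h(1) t h(2) pq'(1)] and c2 = hP_contraction[OF g(1) t g(2) pq'(2)]
have i: "integ (%x. (1 + 2 powr q) * ((hP t h x) powr p + (hP t g x) powr q))" using c1 c2 by auto
have m: "b t : bmeas lborel"
 using cont_bmeas[OF jcont_slice[OF b_jcont(1) t]] by simp
show ib: "integ (b t)"
 by (rule integrable_bound[OF i m]) (use nn order_trans[OF up abs_ge_self] in auto)
have "(LBINT x. b t x) <= (LBINT x. (1 + 2 powr q) * ((hP t h x) powr p + (hP t g x) powr q))"
 by (rule integral_mono[OF ib i up])
also have "... = (1 + 2 powr q) * ((LBINT x. (hP t h x) powr p) + (LBINT x. (hP t g x) powr q))" using c1 c2 by simp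
also have "... <= (1 + 2 powr q) * La" unfolding La_def using c1 c2 by (intro mul_l add_mono) auto
finally show ?A .
qed

text \<open>Both integrations by parts are done at once: the directional derivative of ch b_e - b
  ch_e is ch b_ee - b ch_ee, because the cross terms cancel, and its integral vanishes by
  \<open>integral_line_deriv_0\<close>.\<close>

lemma ibp_bump:
assumes t: "t > 0" and R: "R > 0"
shows "(LBINT x. bump 0 R x * (SUM e:Basis. bii e t x)) = (LBINT x. b t x * lap (bump 0 R) x)"
proof -
define ch :: "'a => real" where "ch = bump 0 R"
have chc: "ch : C1c UNIV" unfolding ch_def using R by (intro bump_C1c) auto
note D = C1cD[OF chc]
have ch2: "C1 (%x. grad ch x *. e)" if "e : Basis" for e using bump_C2[of "0::'a" R] that by (simp add: C2_def ch_def)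
have Ge: "(%x. grad ch x *. e) : C1c UNIV" if "e : Basis" for e
proof -
 obtain K where K: "compact K" "!!x. x ~: K ==> grad ch x = 0" using chc by (rule C1c_support) blast
 show ?thesis using K by (intro C1cI[OF ch2[OF that], of K]) auto
qed
have bc: "cont UNIV (b t)" "cont UNIV (bi e t)" "cont UNIV (bii e t)" for e
 by (rule jcont_slice[OF b_jcont(1) t], rule jcont_slice[OF bi_jcont t], rule jcont_slice[OF bii_jcont t])
have one: "(LBINT x. ch x * bii e t x) = (LBINT x. b t x * (grad (%x. grad ch x *. e) x *. e))"
 and i1: "integ (%x. ch x * bii e t x)" and i2: "integ (%x. b t x * (grad (%x. grad ch x *. e) x *. e))"
 if e: "e : Basis" for e
proof -
 have c1: "(%x. ch x * bii e t x) : Cc" by (rule Cc_times[OF D(2) bc(3)])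
 have c2: "(%x. b t x * (grad (%x. grad ch x *. e) x *. e)) : Cc"
  by (intro Cc_times' Cc_inner C1cD(3)[OF Ge[OF e]] bc continuous_on_const)
 show "integ (%x. ch x * bii e t x)" "integ (%x. b t x * (grad (%x. grad ch x *. e) x *. e))"
  by (rule Cc_integrable[OF c1], rule Cc_integrable[OF c2])
 have "(LBINT x. ch x * bii e t x - b t x * (grad (%x. grad ch x *. e) x *. e)) = 0"
 proof (rule integral_line_deriv_0)
  show "(%x. ch x * bi e t x - b t x * (grad ch x *. e)) : Cc"
   by (intro Cc_diff Cc_times Cc_times' D(2) C1cD(2)[OF Ge[OF e]] bc)
  show "(%x. ch x * bii e t x - b t x * (grad (%x. grad ch x *. e) x *. e)) : Cc" by (rule Cc_diff[OF c1 c2])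
  fix x
  have dch: "((%r. ch (x + r *: e)) hrd grad ch x *. e) (at 0)"
   using GDERIV_line[where t=0 and e=e, OF C1_GDERIV[OF D(1), of "x + 0 *: e"]] by simp
  have dG: "((%r. grad ch (x + r *: e) *. e) hrd grad (%x. grad ch x *. e) x *. e) (at 0)"
   using GDERIV_line[where t=0 and e=e, OF C1_GDERIV[OF ch2[OF e], of "x + 0 *: e"]] by simp
  have "((%r. ch (x + r *: e) * bi e t (x + r *: e) - b t (x + r *: e) * (grad ch (x + r *: e) *. e)) hrd
    ((grad ch x *. e) * bi e t (x + 0 *: e) + bii e t x * ch (x + 0 *: e)) -
    (bi e t x * (grad ch (x + 0 *: e) *. e) + (grad (%x. grad ch x *. e) x *. e) * b t (x + 0 *: e))) (at 0)"
   by (intro DERIV_diff DERIV_mult dch dG line_derivs t e)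
  thus "((%r. ch (x + r *: e) * bi e t (x + r *: e) - b t (x + r *: e) * (grad ch (x + r *: e) *. e)) hrd
    ch x * bii e t x - b t x * (grad (%x. grad ch x *. e) x *. e)) (at 0)"
   by (simp add: mult.commute)
 qed
 thus "(LBINT x. ch x * bii e t x) = (LBINT x. b t x * (grad (%x. grad ch x *. e) x *. e))"
  using Cc_integrable[OF c1] Cc_integrable[OF c2] by simp
qed
have "(LBINT x. ch x * (SUM e:Basis. bii e t x)) = (SUM e:Basis. LBINT x. ch x * bii e t x)"
 using i1 by (simp add: sum_distrib_left integral_sum)
also have "... = (SUM e:Basis. LBINT x. b t x * (grad (%x. grad ch x *. e) x *. e))" using one by simp
also have "... = (LBINT x. b t x * lap ch x)"
 using i2 by (simp add: lap_def sum_distrib_left integral_sum)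
finally show ?thesis by (simp add: ch_def)
qed

lemma flow_deriv:
assumes t: "t > 0" and R: "R > 0"
shows "((%t. LBINT x. bump 0 R x * b t x) hrd (LBINT x. bump 0 R x * bt t x)) (at t)" (is ?A)
 "(LBINT x. bump 0 R x * bt t x) <= (24 + 6 * real DIM('a)) / R^2 * ((1 + 2 powr q) * La) - 2 * bd q * (LBINT x. bump 0 R x * F t x)" (is ?B)
proof -
define ch :: "'a => real" where "ch = bump 0 R"
have chc: "ch : C1c UNIV" unfolding ch_def using R by (intro bump_C1c) auto
note D = C1cD[OF chc]
show ?A
 unfolding ch_def[symmetric] by (intro LBINT_flow_deriv D(2) b_jcont bt_jcont time_deriv t)
have ch0: "ch x >= 0" for x unfolding ch_def by (rule bump_bounds(1)[OF R])
have iF: "integ (%x. ch x * F t x)" by (rule Cc_integrable[OF Cc_times[OF D(2) jcont_slice[OF FF_jcont[OF g(1) h(1)] t]]])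
have iS: "integ (%x. ch x * (SUM e:Basis. bii e t x))"
 by (intro Cc_integrable Cc_times D(2) continuous_on_sum jcont_slice[OF bii_jcont t])
have it: "integ (%x. ch x * bt t x)" by (rule Cc_integrable[OF Cc_times[OF D(2) jcont_slice[OF bt_jcont t]]])
have "(LBINT x. ch x * bt t x) <= (LBINT x. ch x * (SUM e:Basis. bii e t x) - 2 * bd q * (ch x * F t x))"
proof (rule integral_mono[OF it])
 show "integ (%x. ch x * (SUM e:Basis. bii e t x) - 2 * bd q * (ch x * F t x))" using iS iF by auto
 show "ch x * bt t x <= ch x * (SUM e:Basis. bii e t x) - 2 * bd q * (ch x * F t x)" for x
  using mul_l[OF bt_le[OF t, of x] ch0[of x]] by (simp add: asimps)
qed
also have "... = (LBINT x. ch x * (SUM e:Basis. bii e t x)) - 2 * bd q * (LBINT x. ch x * F t x)"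
 using iS iF by simp
also have "(LBINT x. ch x * (SUM e:Basis. bii e t x)) = (LBINT x. b t x * lap ch x)"
 unfolding ch_def by (rule ibp_bump[OF t R])
also have "(LBINT x. b t x * lap ch x) <= (LBINT x. b t x * ((24 + 6 * real DIM('a)) / R^2))"
proof (rule integral_mono)
 show "integ (%x. b t x * lap ch x)"
  unfolding ch_def by (rule Cc_integrable[OF Cc_times'[OF bump_lap_Cc[OF R] jcont_slice[OF b_jcont(1) t]]])
 show "integ (%x. b t x * ((24 + 6 * real DIM('a)) / R^2))" using b_integral(1)[OF t] by simp
 show "b t x * lap ch x <= b t x * ((24 + 6 * real DIM('a)) / R^2)" for x
  using bump_bounds(6)[OF R, of "0::'a" x] b_integral(3)[OF t, of x] unfolding ch_def by (intro mul_l) auto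
qed
also have "... = (24 + 6 * real DIM('a)) / R^2 * (LBINT x. b t x)" by simp
also have "... <= (24 + 6 * real DIM('a)) / R^2 * ((1 + 2 powr q) * La)"
 using b_integral(2)[OF t] by (intro mul_l) auto
finally show ?B
 by (simp add: ch_def)
qed

text \<open>Integrating the differential inequality in time, the nonnegativity of b at the final
  time leaves only the integral of b at the initial time. The Laplacian of the cutoff contributes an
  error of order (T - s) / R^2, which disappears as the radius R grows.\<close>

lemma flow_estimate:
assumes st: "0 < s" "s <= T"
shows "2 * bd q * integral {s..T} (%t. LBINT x. F t x) <= (1 + 2 powr q) * La"
proof -
let ?K = "(24 + 6 * real DIM('a))" and ?L = "(1 + 2 powr q) * La" and ?r = "%n. real (Suc n)"
define ep where "ep n t = (LBINT x. bump 0 (?r n) x * F t x)" for n t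
define be where "be n t = (LBINT x. bump 0 (?r n) x * b t x)" for n t
have R: "?r n > 0" for n by simp
have "2 * bd q * integral {s..T} (ep n) <= ?L + (T - s) * (?K * (1 / ?r n)^2 * ?L)" for n
proof -
 let ?k = "?K / (?r n)^2 * ?L"
 have ftc: "((%t. LBINT x. bump 0 (?r n) x * bt t x) has_integral (be n T - be n s)) {s..T}"
  unfolding be_def using DERIV_subset[OF flow_deriv(1)[OF _ R] subset_UNIV] st
  by (intro fundamental_theorem_of_calculus) (auto simp del: of_nat_Suc simp flip: has_real_derivative_iff_has_vector_derivative)
 have "ep n integrable_on {s..T}"
  unfolding ep_def by (intro LBINT_flow_integrable bump_Cc FF_jcont[OF g(1) h(1)] R st(1))
 hence i: "(%t. 2 * bd q * ep n t) integrable_on {s..T}" using integrable_cmul[of "ep n" _ "2 * bd q"] by simp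
 have "be n T - be n s <= integral {s..T} (%t. ?k - 2 * bd q * ep n t)"
 proof (rule has_integral_le[OF ftc integrable_integral])
  show "(%t. ?k - 2 * bd q * ep n t) integrable_on {s..T}" by (rule Henstock_Kurzweil_Integration.integrable_diff[OF integrable_const_ivl i])
 qed (use flow_deriv(2)[OF _ R] st in \<open>auto simp: ep_def\<close>)
 also have "... = (T - s) * ?k - 2 * bd q * integral {s..T} (ep n)"
  using st by (subst Henstock_Kurzweil_Integration.integral_diff[OF integrable_const_ivl i]) simp
 moreover have "be n T >= 0" unfolding be_def using b_integral(3) bump_bounds(1)[OF R] st
  by (intro integral_nonneg_AE AE_I2 mult_nonneg_nonneg) auto
 moreover have "be n s <= (LBINT x. b s x)" unfolding be_def
 proof (rule integral_mono')
  show "bump 0 (?r n) x * b s x <= b s x" for x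
   by (rule mult_left_le_one_le) (simp_all add: b_integral(3)[OF st(1)] bump_bounds(1,2)[OF R] del: of_nat_Suc)
 qed (use b_integral(1,3)[OF st(1)] in auto)
 ultimately show ?thesis using b_integral(2)[OF st(1)] by (simp add: power_one_over)
qed
moreover have "(%n. ?L + (T - s) * (?K * (1 / ?r n)^2 * ?L)) ----> ?L + (T - s) * (?K * 0\<^sup>2 * ?L)"
 by (intro tendsto_intros LIMSEQ_inverse_real_of_nat[unfolded inverse_eq_divide])
moreover have "(%n. 2 * bd q * integral {s..T} (ep n)) ----> 2 * bd q * integral {s..T} (%t. LBINT x. F t x)"
 unfolding ep_def by (intro tendsto_intros decay_flow(3) FF_jcont FF_decay g(1) h(1) st)
ultimately have "2 * bd q * integral {s..T} (%t. LBINT x. F t x) <= ?L + (T - s) * (?K * 0\<^sup>2 * ?L)"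
 by (intro LIMSEQ_le) auto
thus ?thesis by simp
qed
end

section \<open>A bilinear embedding\<close>

lemma hP_cmult: "hP t (%y. c * f y) x = c * hP t f x"
by (simp add: hP_def mult.assoc)

lemma hP_diff: assumes "f : Cc" "f' : Cc" "t > 0" shows "hP t (%y. f y - f' y) x = hP t f x - hP t f' x"
proof -
have "integ (%y. f y * hk t (x - y))" "integ (%y. f' y * hk t (x - y))"
 using Cc_integrable[OF Cc_conv_slice[OF assms(1) jcont_slice[OF hk_jcont assms(3)], of x]]
  Cc_integrable[OF Cc_conv_slice[OF assms(2) jcont_slice[OF hk_jcont assms(3)], of x]] by simp_all
thus ?thesis by (simp add: hP_def left_diff_distrib)
qed

definition Cq :: "real => real" where "Cq q = (1 + 2 powr q) / bd q"

text \<open>The flow estimate bounds the integral by a sum of powers of the two norms. Normalizing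
  both data to norm 1 makes this sum equal to 2, and homogeneity restores the product of the
  norms.\<close>

lemma IR_bound:
fixes g h :: "'a::euclidean_space => real"
assumes pq: "conj_exp p q" and q2: "q <= 2" and g: "g : Cc" "!!x. g x >= 0" and h: "h : Cc" "!!x. h x >= 0"
 and st: "0 < s" "s <= T"
shows "integral {s..T} (%t. LBINT x. FF l g h t x) <= Cq q * (nrm p h * nrm q g)"
proof -
note pq' = conj_expD(1,2)[OF pq]
have bd0: "bd q > 0" by (rule bd_bounds(1)[OF pq q2])
have rhs: "0 <= Cq q * (nrm p h * nrm q g)" using bd0 by (auto simp: Cq_def intro!: mult_nonneg_nonneg divide_nonneg_pos add_nonneg_nonneg)
show ?thesis
proof (cases "(EX a. g a > 0) & (EX a. h a > 0)")
 case False
 hence "(ALL x. g x = 0) | (ALL x. h x = 0)" using g(2) h(2) by (metis less_le)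
 hence z: "hP t g = (%x. 0) | hP t h = (%x. 0)" for t by (auto simp: hP_def)
 have "Dl l (%x::'a. 0) x = 0" for x by (simp add: Dl_def C1_const(2) zero_prod_def)
 hence "FF l g h t x = 0" for t x using z[of t] by (auto simp: FF_def)
 thus ?thesis using rhs by simp
next
 case True
 define nh ng where "nh = nrm p h" and "ng = nrm q g"
 have pos: "nh > 0" "ng > 0"
 proof -
  obtain c d where cd: "g c > 0" "h d > 0" using True by blast
  have "0 < (LBINT x. norm (h x) powr p)"
   by (rule Cc_int_pos[where a=d]) (use Cc_norm_powr[OF h(1), of p] pq' cd in auto)
  moreover have "0 < (LBINT x. norm (g x) powr q)"
   by (rule Cc_int_pos[where a=c]) (use Cc_norm_powr[OF g(1), of q] pq' cd in auto)
  ultimately have "0 < (LBINT x. norm (h x) powr p)" "0 < (LBINT x. norm (g x) powr q)" by auto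
  thus "nh > 0" "ng > 0" by (simp_all add: nh_def ng_def pn_def)
 qed
 define g' where "g' = (%x. (1/ng) * g x)"
 define h' where "h' = (%x. (1/nh) * h x)"
 have g'c: "g' : Cc" and h'c: "h' : Cc" unfolding g'_def h'_def by (rule Cc_times'[OF g(1) continuous_on_const], rule Cc_times'[OF h(1) continuous_on_const])
 interpret hp: heat_pair p q l g' h'
 proof
  show "g' x >= 0" "h' x >= 0" for x using g(2) h(2) pos by (auto simp: g'_def h'_def)
  obtain c d where cd: "g c > 0" "h d > 0" using True by blast
  hence "g' c > 0" "h' d > 0" using pos by (auto simp: g'_def h'_def)
  thus "EX a. 0 < g' a" "EX a. 0 < h' a" by blast+
 qed (use pq q2 g'c h'c in auto)
 have "nrm p h' = 1" "nrm q g' = 1" using pos pn_scaleR[of p lborel "1/nh" h] pn_scaleR[of q lborel "1/ng" g] pq'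
  by (simp_all add: h'_def g'_def nh_def ng_def)
 hence "(LBINT x. h' x powr p) = 1" "(LBINT x. g' x powr q) = 1"
  using pn_powr[of p lborel h'] pn_powr[of q lborel g'] pq' hp.g(2) hp.h(2) by simp_all
 hence L: "hp.La = 2" by (simp add: hp.La_def)
 have Fs: "FF l g h t x = nh * ng * hp.F t x" if t: "t > 0" for t x
 proof -
  have "hP t h = (%x. nh * hP t h' x)" "hP t g = (%x. ng * hP t g' x)"
   unfolding h'_def g'_def using pos by (simp_all only: hP_cmult[abs_def] mult.assoc[symmetric]) simp_all
  hence "Dl l (hP t h) x = nh *: Dl l (hP t h') x" "Dl l (hP t g) x = ng *: Dl l (hP t g') x"
   using Dl_cmult[OF hP_C1(1)[OF h'c t]] Dl_cmult[OF hP_C1(1)[OF g'c t]] by simp_all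
  thus ?thesis using pos by (simp add: FF_def FF_def)
 qed
 have "integral {s..T} (%t. LBINT x. FF l g h t x) = integral {s..T} (%t. nh * ng * (LBINT x. hp.F t x))"
  using st by (intro Henstock_Kurzweil_Integration.integral_cong) (simp add: Fs)
 also have "... = nh * ng * (2 * bd q * integral {s..T} (%t. LBINT x. hp.F t x)) / (2 * bd q)" using bd0 by simp
 also have "... <= nh * ng * ((1 + 2 powr q) * 2) / (2 * bd q)"
  using hp.flow_estimate[OF st] pos bd0 unfolding L by (intro divide_right_mono mul_l) auto
 also have "... = Cq q * (nh * ng)" using bd0 by (simp add: Cq_def field_simps)
 finally show ?thesis by (simp add: nh_def ng_def)
qed
qed

text \<open>\<open>hS l t g\<close> is the adjoint of \<open>Dl l\<close> applied to the heat flow of the field \<open>g\<close>.\<close>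

definition hS :: "real => real => ('a::euclidean_space => 'a \<times> real) => 'a => real" where
"hS l t g x = l * hP t (%y. g y *. (0, 1)) x - (SUM e:Basis. hP1 t (%y. g y *. (e, 0)) x *. e)"

definition hS1 :: "real => real => ('a::euclidean_space => 'a \<times> real) => 'a => 'a" where
"hS1 l t g x = l *: hP1 t (%y. g y *. (0, 1)) x - (SUM e:Basis. hP2 e t (%y. g y *. (e, 0)) x)"

lemma Cc_comp: "g : Cc ==> (%y. g y *. c) : Cc"
by (rule Cc_inner[OF _ continuous_on_const])

lemma hS_jcont: "g : Cc ==> cont ({0<..} \<times> UNIV) (%p. hS l (fst p) g (snd p))"
unfolding hS_def by (intro cintro hP_jcont hP1_jcont Cc_comp)

lemma hS1_jcont: "g : Cc ==> cont ({0<..} \<times> UNIV) (%p. hS1 l (fst p) g (snd p))"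
unfolding hS1_def by (intro cintro hP1_jcont hP2_jcont Cc_comp)

lemma GDERIV_sum: "finite I ==> (!!i. i : I ==> GDERIV (f i) x :> f' i) ==> GDERIV (%x. SUM i:I. f i x) x :> (SUM i:I. f' i)"
by (induction I rule: finite_induct) (auto intro!: GDERIV_add GDERIV_const)

lemma hS_C1: assumes g: "g : Cc" and t: "t > 0" shows "C1 (hS l t g)" "grad (hS l t g) = hS1 l t g" (is ?A)
proof -
have "GDERIV (%x. l * hP t (%y. g y *. (0, 1)) x) x :> l *: hP1 t (%y. g y *. (0, 1)) x" for x
 using C1_GDERIV[OF C1_cmult(1)[OF hP_C1(1)[OF Cc_comp[OF g] t]]] by (simp add: C1_cmult(2)[OF hP_C1(1)[OF Cc_comp[OF g] t]] hP_C1(2)[OF Cc_comp[OF g] t])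
hence "GDERIV (hS l t g) x :> hS1 l t g x" for x
 unfolding hS_def[abs_def] hS1_def by (intro GDERIV_diff GDERIV_sum hP1_GDERIV Cc_comp g t) auto
from C1I[OF this jcont_slice[OF hS1_jcont[OF g] t]] show "C1 (hS l t g)" ?A by auto
qed

lemma sum_Basis_prod: "(SUM c:(Basis :: ('a::euclidean_space \<times> real) set). f c) = (SUM e:Basis. f (e, 0)) + f (0, 1)"
proof -
have "(SUM c:(Basis :: ('a \<times> real) set). f c) = (SUM c:(%u. (u, 0)) ` Basis. f c) + (SUM c:(%u. (0, u)) ` Basis. f c)"
 unfolding Basis_prod_def by (rule sum.union_disjoint) auto
also have "(SUM c:(%u. (u, 0)) ` Basis. f c) = (SUM e:Basis. f (e, 0))" by (subst sum.reindex) (auto intro: inj_onI)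
finally show ?thesis by simp
qed

text \<open>The Bellman argument wants nonnegative scalar data. A vector field is therefore split
  into positive and negative parts of its components, indexed by a basis vector and a sign.\<close>

definition sgnpart :: "('a::euclidean_space => 'b::euclidean_space) => 'b \<times> bool => 'a => real" where
"sgnpart g i y = max 0 ((if snd i then 1 else -1) * (g y *. fst i))"

lemma sgnpart_Cc: assumes "g : Cc" shows "sgnpart g i : Cc"
proof -
have "(%y. max 0 ((if snd i then 1 else -1) * (g y *. fst i))) : Cc"
 by (rule Cc_comp0[where ph="%v. max 0 ((if snd i then 1 else -1) * (v *. fst i))", OF assms]) (auto intro!: cintro)
thus ?thesis by (simp add: sgnpart_def[abs_def])
qed

lemma sgnpart_nonneg: "sgnpart g i y >= 0" by (simp add: sgnpart_def)

lemma sgnpart_diff: "g y *. c = sgnpart g (c, True) y - sgnpart g (c, False) y"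
by (simp add: sgnpart_def max_def)

lemma sgnpart_nrm: assumes "g : Cc" "fst i : Basis" "p > 0" shows "nrm p (sgnpart g i) <= nrm p g"
proof (rule Cc_pn_mono[OF assms(3,1)])
fix x
have "abs (g x *. fst i) <= norm (g x)" using Cauchy_Schwarz_ineq2[of "g x" "fst i"] assms(2) by simp
thus "norm (sgnpart g i x) <= norm (g x)" by (auto simp: sgnpart_def max_def)
qed

lemma hS_bound:
fixes g :: "'a::euclidean_space => 'a \<times> real"
assumes g: "g : Cc" and t: "t > 0"
shows "abs (hS l t g x) <= (SUM i:Basis \<times> UNIV. norm (Dl l (hP t (sgnpart g i)) x))"
proof -
have pc: "sgnpart g i : Cc" for i by (rule sgnpart_Cc[OF g])
have split: "hP t (%y. g y *. c) = (%x. hP t (sgnpart g (c, True)) x - hP t (sgnpart g (c, False)) x)" for c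
proof
 fix x
 have "(%y. g y *. c) = (%y. sgnpart g (c, True) y - sgnpart g (c, False) y)" by (rule ext) (rule sgnpart_diff)
 thus "hP t (%y. g y *. c) x = hP t (sgnpart g (c, True)) x - hP t (sgnpart g (c, False)) x"
  using hP_diff[OF pc pc t] by (simp only:)
qed
have Dd: "Dl l (hP t (%y. g y *. c)) x = Dl l (hP t (sgnpart g (c, True))) x - Dl l (hP t (sgnpart g (c, False))) x" for c
 unfolding split by (simp add: Dl_diff hP_C1(1)[OF pc t])
have nb: "norm (Dl l (hP t (%y. g y *. c)) x) <= (SUM b:UNIV. norm (Dl l (hP t (sgnpart g (c, b))) x))" for c
 unfolding Dd UNIV_bool
 using norm_triangle_ineq4[of "Dl l (hP t (sgnpart g (c, True))) x" "Dl l (hP t (sgnpart g (c, False))) x"] by simp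
have "abs (hS l t g x) <= abs (l * hP t (%y. g y *. (0, 1)) x) + (SUM e:Basis. abs (hP1 t (%y. g y *. (e, 0)) x *. e))"
 unfolding hS_def by (rule order_trans[OF abs_triangle_ineq4]) (intro add_left_mono sum_abs)
also have "... <= norm (Dl l (hP t (%y. g y *. (0, 1))) x) + (SUM e:Basis. norm (Dl l (hP t (%y. g y *. (e, 0))) x))"
proof (intro add_mono sum_mono norm_Dl_ge)
 fix e :: 'a assume e: "e : Basis"
 have "abs (hP1 t (%y. g y *. (e, 0)) x *. e) <= norm (grad (hP t (%y. g y *. (e, 0))) x)"
  unfolding hP_C1(2)[OF Cc_comp[OF g] t] using Cauchy_Schwarz_ineq2[of _ e] e by (metis mult.right_neutral norm_Basis)
 thus "abs (hP1 t (%y. g y *. (e, 0)) x *. e) <= norm (Dl l (hP t (%y. g y *. (e, 0))) x)"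
  using norm_Dl_ge(1) order_trans by blast
qed
also have "... = (SUM c:Basis. norm (Dl l (hP t (%y. g y *. c)) x))"
 by (subst sum_Basis_prod) simp
also have "... <= (SUM c:Basis. SUM b:UNIV. norm (Dl l (hP t (sgnpart g (c, b))) x))" by (intro sum_mono nb)
also have "... = (SUM i:Basis \<times> UNIV. norm (Dl l (hP t (sgnpart g i)) x))"
 by (simp add: sum.cartesian_product)
finally show ?thesis .
qed

lemma hS_decay:
assumes g: "g : Cc" and ab: "0 < a" "a <= b"
shows "dwle {a..b} (%t. hS l t g)" (is ?A) "dwle {a..b} (%t. hS1 l t g)" (is ?B)
proof -
note c = Cc_comp[OF g]
show ?A unfolding hS_def[abs_def]
proof (intro dwle_diff dwle_sum)
 show "dwle {a..b} (%t x. l * hP t (%y. g y *. (0, 1)) x)"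
  by (rule dwle_le[OF hP_decay(1)[OF c[of "(0, 1)"] ab], of _ "abs l"]) (simp add: abs_mult)
 show "dwle {a..b} (%t x. hP1 t (%y. g y *. (e, 0)) x *. e)" for e
  by (rule dwle_le[OF hP_decay(2)[OF c[of "(e, 0)"] ab], of _ "norm e"]) (metis Cauchy_Schwarz_ineq2 mult.commute real_norm_def)
qed
show ?B unfolding hS1_def[abs_def]
proof (intro dwle_diff dwle_sum hP_decay(3) c ab)
 show "dwle {a..b} (%t x. l *: hP1 t (%y. g y *. (0, 1)) x)"
  by (rule dwle_le[OF hP_decay(2)[OF c[of "(0, 1)"] ab], of _ "abs l"]) simp
qed simp
qed

lemma hS_integrable: "g : Cc ==> t > 0 ==> integ (hS l t g)"
by (rule decay_flow(1)[OF hS_jcont _ hS_decay(1), of _ t t]) auto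

lemma prod_integrable:
fixes f :: "'a::euclidean_space => real" and g :: "'b::euclidean_space => real"
assumes f: "integ f" and g: "integ g"
shows "integrable lborel2 (%(x, y). f x * g y)"
proof (rule lborel_pair.Fubini_integrable)
have [measurable]: "f : bmeas borel" "g : bmeas borel" using f g by auto
show "(%(x, y). f x * g y) : bmeas lborel2" by measurable
have "(%x. LBINT y. norm (case (x, y) of (x, y) => f x * g y)) = (%x. abs (f x) * (LBINT y. abs (g y)))"
 by (simp add: abs_mult)
thus "integ (%x. LBINT y. norm (case (x, y) of (x, y) => f x * g y))" using f by simp
show "AE x in lborel. integ (%y. case (x, y) of (x, y) => f x * g y)" using g by simp
qed

lemma hP_bounded:
assumes f: "f : Cc" and t: "t > 0"
obtains C where "C > 0" "!!x::'a::euclidean_space. abs (hP t f x) <= C" "!!x. norm (hP1 t f x) <= C"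
proof -
show ?thesis by (rule dwle_bdd2[OF hP_decay(1,2)[OF f t order_refl]]) (rule that; simp)
qed

lemma hP_double:
fixes f :: "'a::euclidean_space => real"
assumes f: "f : Cc" and t: "t > 0"
shows "hP (2*t) f x = (LBINT z. hk t z * hP t f (x - z))"
proof -
obtain C where C: "C > 0" "!!z::'a. abs (hk t z) <= C" using hk_bdd[OF t] by metis
have [measurable]: "f : bmeas borel" "hk t : bmeas (borel::'a measure)"
 using Cc_measurable[OF f] hk_integrable[OF t, where 'a='a] by auto
have i: "integrable lborel2 (%(y, z). f y * (hk t z * hk t (x - y - z)))"
proof (rule integrable_bound)
 show "integrable lborel2 (%(y, z). f y * (C * hk t z))"
  by (intro prod_integrable Cc_integrable[OF f] integrable_mult_right hk_integrable[OF t])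
 show "(%(y, z). f y * (hk t z * hk t (x - y - z))) : bmeas lborel2" by measurable
 show "AE w in lborel2. norm (case w of (y, z) => f y * (hk t z * hk t (x - y - z))) <= norm (case w of (y, z) => f y * (C * hk t z))"
 proof (rule AE_I2, clarify)
  fix y z :: 'a
  have "abs (hk t z) * abs (hk t (x - y - z)) <= abs (hk t z) * C" by (intro mul_l C) auto
  hence "abs (f y) * (abs (hk t z) * abs (hk t (x - y - z))) <= abs (f y) * (abs (hk t z) * C)" by (rule mul_l) simp
  thus "norm (f y * (hk t z * hk t (x - y - z))) <= norm (f y * (C * hk t z))"
   using C(1) by (simp add: abs_mult mult.commute)
 qed
qed
have "hP (2*t) f x = (LBINT y. (LBINT z. f y * (hk t z * hk t (x - y - z))))"
 unfolding hP_def hk_semigroup[OF t] by simp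
also have "... = (LBINT z. (LBINT y. f y * (hk t z * hk t (x - y - z))))"
 by (rule lborel_pair.Fubini_integral[OF i, symmetric])
also have "... = (LBINT z. hk t z * hP t f (x - z))"
 unfolding hP_def by (simp add: asimps flip: integral_mult_right_zero)
finally show ?thesis .
qed

lemma hP1_double:
fixes f :: "'a::euclidean_space => real"
assumes f: "f : Cc" and t: "t > 0"
shows "hP1 (2*t) f x = (LBINT z. hk t z *: hP1 t f (x - z))"
proof -
obtain C where C: "C > 0" "!!x. abs (hP t f x) <= C" "!!x. norm (hP1 t f x) <= C" using hP_bounded[OF f t] by metis
have "GDERIV (%x. LBINT z. hk t z * hP t f (x - z)) x :> (LBINT z. hk t z *: grad (hP t f) (x - z))"
 by (rule conv_GDERIV[OF hk_integrable[OF t] hP_C1(1)[OF f t] C(2)]) (simp add: hP_C1(2)[OF f t] C(3))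
hence "grad (hP (2*t) f) x = (LBINT z. hk t z *: hP1 t f (x - z))"
 unfolding hP_double[OF f t, abs_def, symmetric] hP_C1(2)[OF f t] by (rule gradI)
thus ?thesis using t by (simp add: hP_C1(2)[OF f])
qed

lemma hS_double:
fixes g :: "'a::euclidean_space => 'a \<times> real"
assumes g: "g : Cc" and t: "t > 0"
shows "hS l (2*t) g x = (LBINT z. hS l t g z * hk t (x - z))"
proof -
note gc = Cc_comp[OF g] and hi = hk_integrable[OF t, where 'a='a]
have i0: "integ (%z. hk t z * hP t (%y. g y *. c) (x - z))" for c
proof -
 obtain C where C: "!!x. abs (hP t (%y. g y *. c) x) <= C" using hP_bounded[OF gc t] by metis
 show ?thesis using conv_integrable[OF hi C1_cont[OF hP_C1(1)[OF gc t]], of c C x] C by simp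
qed
have i1: "integ (%z. hk t z *: hP1 t (%y. g y *. c) (x - z))" for c
proof -
 obtain C where C: "!!x. norm (hP1 t (%y. g y *. c) x) <= C" using hP_bounded[OF gc t] by metis
 show ?thesis using conv_integrable[OF hi jcont_slice[OF hP1_jcont[OF gc] t] C] .
qed
have "hS l (2*t) g x = l * (LBINT z. hk t z * hP t (%y. g y *. (0, 1)) (x - z))
  - (SUM e:Basis. (LBINT z. hk t z *: hP1 t (%y. g y *. (e, 0)) (x - z)) *. e)"
 by (simp add: hS_def hP_double[OF gc t] hP1_double[OF gc t])
also have "... = (LBINT z. l * (hk t z * hP t (%y. g y *. (0, 1)) (x - z)))
  - (LBINT z. (SUM e:Basis. (hk t z *: hP1 t (%y. g y *. (e, 0)) (x - z)) *. e))"
 by (subst integral_sum) (auto simp only: integral_inner_left[OF i1] integrable_inner_left[OF i1] integral_mult_right_zero)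
also have "... = (LBINT z. l * (hk t z * hP t (%y. g y *. (0, 1)) (x - z)) - (SUM e:Basis. (hk t z *: hP1 t (%y. g y *. (e, 0)) (x - z)) *. e))"
 by (rule integral_diff[symmetric])
  (intro integrable_mult_right i0, intro integrable_sum integrable_inner_left i1)
also have "... = (LBINT z. hk t z *: hS l t g (x - z))"
 by (simp add: hS_def asimps sum_distrib_left)
also have "... = (LBINT z. hk t (x - z) *: hS l t g z)"
 by (rule conv_sym) (use hi hS_integrable[OF g t, of l] in auto)
finally show ?thesis by (simp add: mult.commute)
qed

lemma hS1_double:
fixes g :: "'a::euclidean_space => 'a \<times> real"
assumes g: "g : Cc" and t: "t > 0"
shows "hS1 l (2*t) g x = (LBINT z. hS l t g z *: hk1 t (x - z))"
proof -
obtain C where C: "C > 0" "!!z::'a. abs (hk t z) <= C" "!!z::'a. norm (hk1 t z) <= C" using hk_bdd[OF t] by metis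
have "GDERIV (%x. LBINT z. hS l t g z * hk t (x - z)) x :> (LBINT z. hS l t g z *: grad (hk t) (x - z))"
 by (rule conv_GDERIV[OF hS_integrable[OF g t] hk_C1(1)[OF t] C(2)]) (simp add: hk_C1(2)[OF t] C(3))
hence "grad (hS l (2*t) g) x = (LBINT z. hS l t g z *: hk1 t (x - z))"
 unfolding hS_double[OF g t, abs_def, symmetric] hk_C1(2)[OF t] by (rule gradI)
thus ?thesis using t by (simp add: hS_C1(2)[OF g])
qed

lemma hS_transpose:
fixes h :: "'a::euclidean_space => 'a \<times> real"
assumes h: "h : Cc" and t: "t > 0"
shows "(LBINT x. h x *. (hk1 t (x - z), l * hk t (x - z))) = hS l t h z" (is ?A)
 "integ (%x. h x *. (hk1 t (x - z), l * hk t (x - z)))" (is ?B)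
proof -
note hc = Cc_comp[OF h]
have i0: "integ (%x. (h x *. (0, 1)) * hk t (z - x))"
 using Cc_integrable[OF Cc_conv_slice[OF hc jcont_slice[OF hk_jcont t], of "(0,1)" z]] by simp
have i1: "integ (%x. (h x *. (e, 0)) * (hk1 t (z - x) *. e))" for e
 using integrable_inner_left[OF Cc_integrable[OF Cc_conv_slice[OF hc jcont_slice[OF hk1_jcont t], of "(e,0)" z]], of e] by simp
have eq: "h x *. (hk1 t (x - z), l * hk t (x - z)) = l * ((h x *. (0, 1)) * hk t (z - x)) - (SUM e:Basis. (h x *. (e, 0)) * (hk1 t (z - x) *. e))" for x
proof -
 have s: "hk1 t (x - z) = - hk1 t (z - x)" by (simp add: hk1_def hk_sym[of t x z] asimps)
 obtain a b where ab: "h x = (a, b)" by (cases "h x")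
 have "a *. hk1 t (z - x) = (SUM e:Basis. (a *. e) * (hk1 t (z - x) *. e))" by (rule euclidean_inner)
 thus ?thesis by (simp add: s ab hk_sym[of t x z])
qed
have i1s: "integ (%x. SUM e:Basis. (h x *. (e, 0)) * (hk1 t (z - x) *. e))"
 by (intro integrable_sum i1)
show ?B
 unfolding eq by (intro integrable_diff integrable_mult_right i0 i1s)
have "(LBINT x. h x *. (hk1 t (x - z), l * hk t (x - z))) =
 l * (LBINT x. (h x *. (0, 1)) * hk t (z - x)) - (SUM e:Basis. LBINT x. (h x *. (e, 0)) * (hk1 t (z - x) *. e))"
 unfolding eq by (subst integral_diff[OF integrable_mult_right[OF i0] i1s])
  (simp only: integral_sum[OF i1] integral_mult_right_zero)
also have "... = hS l t h z" unfolding hS_def hP1_inner[OF hc t] by (simp add: hP_def)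
finally show ?A .
qed

text \<open>Half of the time 2t is moved to the other side: with D = \<open>Dl l\<close>, its
  adjoint D* and the heat flow P, pairing h with D P(2t) D* g equals pairing P(t) D* h with P(t) D*
  g. The kernel is even and commutes with translations.\<close>

lemma hS_pairing:
fixes g h :: "'a::euclidean_space => 'a \<times> real"
assumes g: "g : Cc" and h: "h : Cc" and t: "t > 0"
shows "(LBINT x. h x *. Dl l (hS l (2*t) g) x) = (LBINT z. hS l t g z * hS l t h z)"
proof -
obtain C where C: "C > 0" "!!z::'a. abs (hk t z) <= C" "!!z::'a. norm (hk1 t z) <= C" using hk_bdd[OF t] by metis
define ka where "ka z = (hk1 t z, l * hk t z)" for z :: 'a
have kac: "cont UNIV ka"
 unfolding ka_def by (intro cintro jcont_slice[OF hk1_jcont t] jcont_slice[OF hk_jcont t])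
have kab: "norm (ka z) <= C + abs l * C" for z
proof -
 have "norm (ka z) <= norm (hk1 t z) + norm (l * hk t z)" unfolding ka_def by (rule norm_Pair_le)
 also have "... <= C + abs l * C" using C by (intro add_mono) (auto simp: abs_mult mul_l)
 finally show ?thesis .
qed
define F where "F = hS l t g"
have F: "integ F" unfolding F_def by (rule hS_integrable[OF g t])
have [measurable]: "F : bmeas borel" "h : bmeas borel" "ka : bmeas borel"
 using F Cc_measurable[OF h] cont_bmeas[OF kac] by auto
have iF: "integ (%z. F z *: ka (x - z))" for x
 by (rule conv_integrable[OF F kac kab])
have D: "Dl l (hS l (2*t) g) x = (LBINT z. F z *: ka (x - z))" for x
proof -
 have bl: "bounded_linear (fst :: 'a \<times> real => 'a)" "bounded_linear (snd :: 'a \<times> real => real)"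
  by (rule bounded_linear_fst bounded_linear_snd)+
 have "fst (LBINT z. F z *: ka (x - z)) = (LBINT z. F z *: hk1 t (x - z))"
  using integral_bounded_linear[OF bl(1) iF[of x]] by (simp add: ka_def)
 moreover have "snd (LBINT z. F z *: ka (x - z)) = (LBINT z. l * (F z * hk t (x - z)))"
  using integral_bounded_linear[OF bl(2) iF[of x]] by (simp add: ka_def asimps)
 ultimately show ?thesis using t
  by (simp add: Dl_def hS_C1(2)[OF g] hS1_double[OF g t] hS_double[OF g t] F_def prod_eq_iff)
qed
have i: "integrable lborel2 (%(z, x). F z * (h x *. ka (x - z)))"
proof (rule integrable_bound)
 show "integrable lborel2 (%(z, x). F z * ((C + abs l * C) * norm (h x)))"
  by (intro prod_integrable F integrable_mult_right Cc_integrable Cc_norm h)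
 show "(%(z, x). F z * (h x *. ka (x - z))) : bmeas lborel2" by measurable
 show "AE w in lborel2. norm (case w of (z, x) => F z * (h x *. ka (x - z))) <= norm (case w of (z, x) => F z * ((C + abs l * C) * norm (h x)))"
 proof (rule AE_I2, clarify)
  fix z x :: 'a
  have "abs (h x *. ka (x - z)) <= norm (h x) * norm (ka (x - z))" by (rule Cauchy_Schwarz_ineq2)
  also have "... <= norm (h x) * (C + abs l * C)" by (intro mul_l kab) auto
  finally have "abs (F z) * abs (h x *. ka (x - z)) <= abs (F z) * (norm (h x) * (C + abs l * C))" by (rule mul_l) simp
  moreover have "0 <= C + abs l * C" using C(1) by simp
  ultimately show "norm (F z * (h x *. ka (x - z))) <= norm (F z * ((C + abs l * C) * norm (h x)))"
   by (simp add: abs_mult mult.commute)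
 qed
qed
have "(LBINT x. h x *. Dl l (hS l (2*t) g) x) = (LBINT x. (LBINT z. F z * (h x *. ka (x - z))))"
proof (rule integral_cong[OF refl])
 fix x
 have "h x *. (LBINT z. F z *: ka (x - z)) = (LBINT z. h x *. (F z *: ka (x - z)))"
  by (rule integral_inner_right[symmetric]) (rule iF)
 thus "h x *. Dl l (hS l (2*t) g) x = (LBINT z. F z * (h x *. ka (x - z)))" by (simp add: D)
qed
also have "... = (LBINT z. (LBINT x. F z * (h x *. ka (x - z))))"
 by (rule lborel_pair.Fubini_integral[OF i])
also have "... = (LBINT z. F z * hS l t h z)"
 unfolding ka_def using hS_transpose(1)[OF h t] by simp
finally show ?thesis by (simp add: F_def)
qed

definition hW :: "real => ('a::euclidean_space => 'a \<times> real) => ('a => 'a \<times> real) => real => real" where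
"hW l g h t = (LBINT x. hS l t g x * hS l t h x)"

text \<open>The square of the number of signed components counts the pairs of scalar flows, and the
  factor 2 is the one in front of the exponential in the time integral.\<close>

definition EC :: "'a::euclidean_space itself => real => real" where
"EC _ q = 2 * (real (card ((Basis :: ('a \<times> real) set) \<times> (UNIV :: bool set))))^2 * Cq q"

lemma hW_integrable_on:
assumes g: "g : Cc" and h: "h : Cc" and ab: "0 < a" "a <= b"
shows "t : {a..b} ==> integ (%x. hS l t g x * hS l t h x)"
 "(%t. 2 * exp (- (2 * l^2 * t)) * hW l g h t) integrable_on {a..b}" (is ?A)
proof -
have jc: "cont ({0<..} \<times> UNIV) (%p. hS l (fst p) g (snd p) * hS l (fst p) h (snd p))"
 by (intro continuous_on_mult hS_jcont g h)
have d: "dwle {a..b} (%t x. hS l t g x * hS l t h x)" by (intro dwle_mult hS_decay g h ab)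
show "t : {a..b} ==> integ (%x. hS l t g x * hS l t h x)" by (rule decay_flow(1)[OF jc ab(1) d])
have "(%t. LBINT x. 2 * exp (- (2 * l^2 * t)) * (hS l t g x * hS l t h x)) integrable_on {a..b}"
proof (rule decay_flow(2)[OF _ ab(1) dwle_le[OF d, where K=2]])
 show "cont ({0<..} \<times> UNIV) (%p. 2 * exp (- (2 * l^2 * fst p)) * (hS l (fst p) g (snd p) * hS l (fst p) h (snd p)))"
  by (intro cintro jc)
 show "norm (2 * exp (- (2 * l^2 * t)) * (hS l t g x * hS l t h x)) <= 2 * norm (hS l t g x * hS l t h x)" if "t : {a..b}" for t x
  using that ab unfolding norm_mult by (intro mul_r) auto
qed
thus ?A by (simp add: hW_def)
qed

text \<open>Each \<open>hS\<close> is bounded by the sum of the gradients of the flows of the signed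
  components. The weight exp(-2 l^2 t) is the product of the two decay factors, so each pair of
  components is an instance of \<open>IR_bound\<close>.\<close>

lemma hW_bound2:
fixes g h :: "'a::euclidean_space => 'a \<times> real"
assumes pq: "conj_exp p q" and q2: "q <= 2" and g: "g : Cc" and h: "h : Cc" and ab: "0 < a" "a <= b"
shows "abs (integral {a..b} (%t. 2 * exp (- (2 * l^2 * t)) * hW l g h t)) <= EC TYPE('a) q * (nrm p h * nrm q g)"
proof -
note pq' = conj_expD(1,2)[OF pq]
let ?I = "(Basis :: ('a \<times> real) set) \<times> (UNIV :: bool set)"
let ?ow = "%t. exp (- (2 * l^2 * t))"
let ?F = "%i j. FF l (sgnpart g i) (sgnpart h j)" and ?N = "nrm p h * nrm q g"
define J where "J i j t = (LBINT x. ?F i j t x)" for i j t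
have gp: "sgnpart g i : Cc" and hp: "sgnpart h i : Cc" for i using sgnpart_Cc[OF g] sgnpart_Cc[OF h] by auto
have om: "(exp (- (l^2 * t)))^2 = ?ow t" for t by (simp add: pow2 mult_exp_exp)
have iF: "integ (?F i j t)" if t: "t : {a..b}" for i j t
 by (rule decay_flow(1)[OF FF_jcont[OF gp hp] ab(1) FF_decay[OF gp hp ab] t])
have Jint: "J i j integrable_on {a..b}" for i j
 unfolding J_def[abs_def] by (rule decay_flow(2)[OF FF_jcont[OF gp hp] ab(1) FF_decay[OF gp hp ab]])
have fin: "finite ?I" by simp
note Si = Henstock_Kurzweil_Integration.integrable_sum[OF fin Jint]
have pt: "norm (2 * ?ow t * hW l g h t) <= 2 * (SUM i:?I. SUM j:?I. J i j t)" if t: "t : {a..b}" for t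
proof -
 have t0: "t > 0" using t ab by auto
 have "abs (hW l g h t) * ?ow t <= (LBINT x. norm (hS l t g x * hS l t h x)) * ?ow t"
  unfolding hW_def by (intro mul_r order_trans[OF _ integral_norm_bound]) auto
 also have "... = (LBINT x. norm (hS l t g x * hS l t h x) * ?ow t)" by simp
 also have "... <= (LBINT x. (SUM i:?I. SUM j:?I. ?F i j t x))"
 proof (intro integral_mono integrable_mult_left integrable_norm hW_integrable_on(1)[OF g h ab t] integrable_sum iF[OF t])
  fix x
  let ?P = "%i. norm (Dl l (hP t (sgnpart g i)) x)" and ?Q = "%j. norm (Dl l (hP t (sgnpart h j)) x)"
  have "abs (hS l t g x) * abs (hS l t h x) <= (SUM i:?I. ?P i) * (SUM j:?I. ?Q j)"
   by (intro mult_mono hS_bound g h t0 sum_nonneg) auto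
  hence "(abs (hS l t g x) * abs (hS l t h x)) * ?ow t <= ((SUM i:?I. ?P i) * (SUM j:?I. ?Q j)) * ?ow t"
   by (intro mul_r) auto
  also have "... = (SUM i:?I. SUM j:?I. ?F i j t x)"
   unfolding FF_def om sum_product by (simp only: sum_distrib_right) (simp only: mult_ac)
  finally show "norm (hS l t g x * hS l t h x) * ?ow t <= (SUM i:?I. SUM j:?I. ?F i j t x)" by (simp add: abs_mult)
 qed
 also have "... = (SUM i:?I. SUM j:?I. J i j t)" unfolding J_def
  by (subst integral_sum, intro integrable_sum iF t)
   (intro sum.cong refl integral_sum iF t)
 finally show ?thesis by (simp add: abs_mult mult.commute)
qed
have "norm (integral {a..b} (%t. 2 * ?ow t * hW l g h t)) <= integral {a..b} (%t. 2 * (SUM i:?I. SUM j:?I. J i j t))"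
 by (intro Henstock_Kurzweil_Integration.integral_norm_bound_integral hW_integrable_on(2) g h ab integrable_on_mult_right
   Henstock_Kurzweil_Integration.integrable_sum[OF fin Si] pt)
also have "... = 2 * (SUM i:?I. SUM j:?I. integral {a..b} (J i j))"
 by (simp only: integral_mult_right Henstock_Kurzweil_Integration.integral_sum[OF fin Si] Henstock_Kurzweil_Integration.integral_sum[OF fin Jint])
also have "... <= 2 * (SUM i:?I. SUM j:?I. Cq q * ?N)"
proof (intro mul_l sum_mono)
 fix i j assume i: "i : ?I" and j: "j : ?I"
 have "integral {a..b} (J i j) <= Cq q * (nrm p (sgnpart h j) * nrm q (sgnpart g i))"
  unfolding J_def[abs_def] by (intro IR_bound pq q2 gp hp sgnpart_nonneg ab)
 also have "... <= Cq q * ?N"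
  using i j pq' bd_bounds(1)[OF pq q2] by (intro mul_l mult_mono sgnpart_nrm g h) (auto simp: Cq_def add_nonneg_nonneg)
 finally show "integral {a..b} (J i j) <= Cq q * ?N" .
qed simp
finally show ?thesis by (simp add: EC_def pow2 mult.assoc)
qed

lemma EC_nonneg: "q > 1 ==> EC TYPE('a::euclidean_space) q >= 0"
by (auto simp: EC_def Cq_def bd_def intro!: mult_nonneg_nonneg divide_nonneg_nonneg add_nonneg_nonneg)

text \<open>Of two conjugate exponents the smaller is at most 2, and \<open>hW\<close> is symmetric,
  so the roles of g and h may be exchanged. This is where \<open>min p q\<close> comes from.\<close>

lemma hW_bound:
fixes g h :: "'a::euclidean_space => 'a \<times> real"
assumes pq: "conj_exp p q" and g: "g : Cc" and h: "h : Cc" and ab: "0 < a" "a <= b"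
shows "abs (integral {a..b} (%t. 2 * exp (- (2 * l^2 * t)) * hW l g h t)) <= EC TYPE('a) (min p q) * (nrm p h * nrm q g)"
proof (cases "q <= 2")
case True
have "q <= p"
proof (rule ccontr)
 assume "~ q <= p"
 hence "1/p > 1/2" "1/q >= 1/2" using True conj_expD(1,2)[OF pq] by (auto intro!: divide_strict_left_mono divide_left_mono)
 thus False using pq by (simp add: conj_exp_def)
qed
hence m: "min p q = q" by simp
show ?thesis using hW_bound2[OF pq True g h ab, of l] unfolding m .
next
case False
have p2: "p <= 2"
proof (rule ccontr)
 assume "~ p <= 2"
 hence "1/p < 1/2" "1/q < 1/2" using False by (auto intro!: divide_strict_left_mono)
 thus False using pq by (simp add: conj_exp_def)
qed
hence m: "min p q = p" using False by simp
have "hW l h g = hW l g h" by (auto simp: hW_def mult.commute)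
thus ?thesis using hW_bound2[OF conj_exp_sym[OF pq] p2 h g ab, of l] unfolding m by (simp add: mult.commute)
qed

section \<open>The whole space\<close>

lemma time_int_C1:
fixes f :: "real => 'a::euclidean_space => real" and f1 :: "real => 'a => 'a"
assumes jf: "cont ({a..b} \<times> UNIV) (%p. f (fst p) (snd p))"
 and jf1: "cont ({a..b} \<times> UNIV) (%p. f1 (fst p) (snd p))"
 and d: "!!t x. t : {a..b} ==> GDERIV (f t) x :> f1 t x"
shows "C1 (%x. integral {a..b} (%t. f t x))" (is ?A) "grad (%x. integral {a..b} (%t. f t x)) = (%x. integral {a..b} (%t. f1 t x))"
proof -
have sl: "cont {a..b} (%t. f t x)" "cont {a..b} (%t. f1 t x)" for x
proof -
 have 1: "cont {a..b} (%t::real. (t, x))" by (intro cintro)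
 show "cont {a..b} (%t. f t x)" "cont {a..b} (%t. f1 t x)"
  using cont_comp2[OF jf 1] cont_comp2[OF jf1 1] by auto
qed
have sw: "cont (UNIV \<times> {a..b}) (%z. f1 (snd z) (fst z))"
proof -
 have 1: "cont (UNIV \<times> {a..b}) (%z::'a \<times> real. (snd z, fst z))" by (intro cintro)
 have 2: "(%z::'a \<times> real. (snd z, fst z)) ` (UNIV \<times> {a..b}) <= {a..b} \<times> UNIV" by auto
 show ?thesis using cont_comp2[OF jf1 1 2] by simp
qed
have "GDERIV (%x. integral {a..b} (%t. f t x)) x :> integral {a..b} (%t. f1 t x)" for x
proof -
 have "((%x. integral (cbox a b) (%t. f t x)) has_derivative blinfun_apply (integral (cbox a b) (%t. blinfun_inner_left (f1 t x)))) (at x within UNIV)"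
 proof (rule leibniz_rule)
  show "((%x. f t x) has_derivative blinfun_apply (blinfun_inner_left (f1 t x))) (at x within UNIV)" if "t : cbox a b" for x t
   using d[of t x] that by (simp add: gderiv_def blinfun_inner_left.rep_eq)
  show "(%t. f t x) integrable_on cbox a b" for x using sl(1) by (auto intro: integrable_continuous_real)
  show "cont (UNIV \<times> cbox a b) (%(x, t). blinfun_inner_left (f1 t x))"
   using bounded_linear.continuous_on[OF bounded_linear_blinfun_inner_left sw] by (simp add: case_prod_unfold)
 qed auto
 also have "integral (cbox a b) (%t. blinfun_inner_left (f1 t x)) = blinfun_inner_left (integral (cbox a b) (%t. f1 t x))"
  using integral_linear[OF _ bounded_linear_blinfun_inner_left, of "%t. f1 t x" "cbox a b"] sl(2)[of x]
  by (simp add: o_def integrable_continuous_real)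
 finally show ?thesis by (simp add: gderiv_def blinfun_inner_left.rep_eq)
qed
moreover have "cont UNIV (%x. integral {a..b} (%t. f1 t x))"
 using integral_continuous_on_param[of UNIV a b "%x t. f1 t x"] sw by (simp add: case_prod_unfold)
ultimately show ?A "grad (%x. integral {a..b} (%t. f t x)) = (%x. integral {a..b} (%t. f1 t x))"
 using C1I[of "%x. integral {a..b} (%t. f t x)" "%x. integral {a..b} (%t. f1 t x)"] by blast+
qed

lemma time_Fubini:
fixes h :: "'a::euclidean_space => 'b::euclidean_space" and V :: "real => 'a => 'b"
assumes h: "h : Cc" and j: "cont ({a..b} \<times> UNIV) (%p. V (fst p) (snd p))"
shows "(LBINT x. h x *. integral {a..b} (%t. V t x)) = integral {a..b} (%t. LBINT x. h x *. V t x)"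
proof -
obtain c d where cd: "!!x. x ~: cbox c d ==> h x = 0" using Cc_cbox[OF h] by blast
have slt: "cont {a..b} (%t. V t x)" for x
proof -
 have 1: "cont {a..b} (%t::real. (t, x))" by (intro cintro)
 show ?thesis using cont_comp2[OF j 1] by auto
qed
have slx: "cont UNIV (V t)" if "t : {a..b}" for t
proof -
 have 1: "cont UNIV (%x::'a. (t, x))" by (intro cintro)
 have 2: "range (%x::'a. (t, x)) <= {a..b} \<times> UNIV" using that by auto
 show ?thesis using cont_comp2[OF j 1 2] by simp
qed
have sw: "cont (UNIV \<times> {a..b}) (%z. V (snd z) (fst z))"
proof -
 have 1: "cont (UNIV \<times> {a..b}) (%z::'a \<times> real. (snd z, fst z))" by (intro cintro)
 have 2: "(%z::'a \<times> real. (snd z, fst z)) ` (UNIV \<times> {a..b}) <= {a..b} \<times> UNIV" by auto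
 show ?thesis using cont_comp2[OF j 1 2] by simp
qed
have ci: "cont UNIV (%x. integral {a..b} (%t. V t x))"
 using integral_continuous_on_param[of UNIV a b "%x t. V t x"] sw by (simp add: case_prod_unfold)
have "(LBINT x. h x *. integral {a..b} (%t. V t x)) = integral (cbox c d) (%x. h x *. integral {a..b} (%t. V t x))"
 by (rule Cc_integral_cbox[OF Cc_inner[OF h ci]]) (simp add: cd)
also have "... = integral (cbox c d) (%x. integral (cbox a b) (%t. h x *. V t x))"
proof (rule Henstock_Kurzweil_Integration.integral_cong)
 fix x
 show "h x *. integral {a..b} (%t. V t x) = integral (cbox a b) (%t. h x *. V t x)"
  using integral_linear[OF integrable_continuous_real[OF slt[of x]] bounded_linear_inner_right[of "h x"]] by (simp add: o_def)
qed
also have "... = integral (cbox a b) (%t. integral (cbox c d) (%x. h x *. V t x))"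
proof (rule integral_swap_continuous)
 have "cont (cbox (c, a) (d, b)) (%z. h (fst z))"
  by (intro cont_comp2[OF Cc_cont[OF h]] cintro subset_UNIV)
 moreover have "cont (cbox (c, a) (d, b)) (%z. V (snd z) (fst z))"
  by (rule continuous_on_subset[OF sw]) (auto simp: cbox_Pair_eq)
 ultimately show "cont (cbox (c, a) (d, b)) (%(x, t). h x *. V t x)"
  by (simp add: case_prod_unfold continuous_on_inner)
qed
also have "... = integral {a..b} (%t. LBINT x. h x *. V t x)"
proof -
 have "integral (cbox c d) (%x. h x *. V t x) = (LBINT x. h x *. V t x)" if "t : {a..b}" for t
  by (rule Cc_integral_cbox[OF Cc_inner[OF h slx[OF that]], symmetric]) (simp add: cd)
 thus ?thesis by (auto intro!: Henstock_Kurzweil_Integration.integral_cong)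
qed
finally show ?thesis .
qed

text \<open>Both sides are, up to sign, components at \<open>0\<close> of the gradient of one convolution; this replaces the
  symmetry of second derivatives for functions that are only continuously differentiable.\<close>

lemma cross_parts:
fixes u w :: "'a::euclidean_space => real"
assumes u: "u : C1c Om" and w: "C1 w" and B: "!!x. abs (w x) <= B" "!!x. norm (grad w x) <= B"
 and i: "integ (%x. grad w x *. e)"
shows "(LBINT x. (grad u x *. e) * (grad w x *. e')) = (LBINT x. (grad u x *. e') * (grad w x *. e))"
proof -
note D = C1cD[OF u]
obtain Bu where Bu: "!!x. norm (u x) <= Bu" using Cc_bounded[OF D(2)] by blast
obtain Bg where Bg: "!!x. norm (grad u x) <= Bg" using Cc_bounded[OF D(3)] by blast
have [measurable]: "u : bmeas borel" "grad u : bmeas borel" "w : bmeas borel" "grad w : bmeas borel"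
 using D w by (auto intro: cont_bmeas C1_cont C1_cont_grad Cc_measurable)
define ph where "ph y = grad u (- y) *. e" for y
have um: "mpres (%x::'a. - x)" using mpres_uminus[of 0] by simp
have phi: "integ ph"
 unfolding ph_def using mpres_integrable[OF um, of "%y. grad u y *. e"] Cc_integrable[OF Cc_inner[OF D(3) continuous_on_const]] by simp
define H where "H z = (LBINT y. ph y * w (z - y))" for z
have H1: "GDERIV H z :> (LBINT y. ph y *: grad w (z - y))" for z
 unfolding H_def[abs_def] by (rule conv_GDERIV[OF phi w B])
define ur where "ur x = - u (- x)" for x
have ur: "C1 ur" "grad ur = (%x. grad u (- x))"
proof -
 have "GDERIV ur x :> grad u (- x)" for x
 proof -
  have "(u has_derivative (%h. h *. grad u (- x))) (at (- x))" using C1_GDERIV[OF D(1)] by (simp add: gderiv_def)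
  hence "((%x. - u (- x)) has_derivative (%h. - ((- h) *. grad u (- x)))) (at x)"
   by (intro has_derivative_minus has_derivative_compose[of uminus "%h. - h" x UNIV u, OF _ ]) (auto intro!: derivative_eq_intros)
  thus ?thesis by (simp add: gderiv_def ur_def[abs_def])
 qed
 moreover have "cont UNIV (%x. grad u (- x))"
  by (intro cont_comp2[OF C1_cont_grad[OF D(1)]] cintro subset_UNIV)
 ultimately show "C1 ur" "grad ur = (%x. grad u (- x))" using C1I[of ur "%x. grad u (- x)"] by blast+
qed
have Heq: "H z = (LBINT y. (grad w y *. e) * ur (z - y))" for z
proof -
 have sh: "(%y. grad w (y + z) *. e) = (%y. grad (%y. w (y + z)) y *. e)" "C1 (%y. w (y + z))"
 proof -
  have "GDERIV (%y. w (y + z)) y :> grad w (y + z)" for y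
  proof -
   have "(w has_derivative (%h. h *. grad w (y + z))) (at (y + z))" using C1_GDERIV[OF w] by (simp add: gderiv_def)
   hence "((%y. w (y + z)) has_derivative (%h. h *. grad w (y + z))) (at y)"
    by (intro has_derivative_compose[of "%y. y + z" "%h. h" y UNIV w, OF _ ]) (auto intro!: derivative_eq_intros)
   thus ?thesis by (simp add: gderiv_def)
  qed
  moreover have "cont UNIV (%y. grad w (y + z))"
   by (intro cont_comp2[OF C1_cont_grad[OF w]] cintro subset_UNIV)
  ultimately have "C1 (%y. w (y + z))" "grad (%y. w (y + z)) = (%y. grad w (y + z))"
   using C1I[of "%y. w (y + z)" "%y. grad w (y + z)"] by blast+
  thus "(%y. grad w (y + z) *. e) = (%y. grad (%y. w (y + z)) y *. e)" "C1 (%y. w (y + z))" by auto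
 qed
 have "H z = (LBINT y. w (y + z) * (grad u y *. e))"
  unfolding H_def ph_def using mpres_integral[OF um, of "%y. w (y + z) * (grad u y *. e)"]
  by (simp add: mult.commute add.commute)
 also have "... = - (LBINT y. u y * (grad w (y + z) *. e))"
  using integral_by_parts[OF u sh(2), of e] unfolding fun_cong[OF sh(1)] by simp
 also have "(LBINT y. u y * (grad w (y + z) *. e)) = (LBINT y. u (y - z) * (grad w y *. e))"
  using mpres_integral[OF mpres_translate[of z], of "%y. u (y - z) * (grad w y *. e)"] by simp
 finally show ?thesis by (simp add: ur_def mult.commute flip: integral_minus)
qed
have H2: "GDERIV H z :> (LBINT y. (grad w y *. e) *: grad ur (z - y))" for z
 unfolding Heq[abs_def] by (rule conv_GDERIV[OF i ur(1), of "max Bu Bg"]) (use Bu Bg in \<open>simp_all add: ur(2) ur_def le_max_iff_disj\<close>)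
have "(LBINT y. ph y *: grad w (0 - y)) = (LBINT y. (grad w y *. e) *: grad ur (0 - y))"
 using gradI[OF H1[of 0]] gradI[OF H2[of 0]] by simp
hence "(LBINT y. (grad u (- y) *. e) *: grad w (- y)) *. e' = (LBINT y. (grad w y *. e) *: grad u y) *. e'"
 by (simp add: ph_def ur(2))
moreover have "(LBINT y. (grad u (- y) *. e) *: grad w (- y)) = (LBINT y. (grad u y *. e) *: grad w y)"
 using mpres_integral[OF um, of "%y. (grad u y *. e) *: grad w y"] by simp
moreover have "(LBINT y. (grad u y *. e) *: grad w y) *. e' = (LBINT y. (grad u y *. e) * (grad w y *. e'))"
 using integral_inner_left[where M=lborel and f="%y. (grad u y *. e) *: grad w y" and c=e'] Cc_integrable[OF Cc_scaleR_left[OF Cc_inner[OF D(3) continuous_on_const] C1_cont_grad[OF w]]] by simp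
moreover have "(LBINT y. (grad w y *. e) *: grad u y) *. e' = (LBINT y. (grad u y *. e') * (grad w y *. e))"
 using integral_inner_left[where M=lborel and f="%y. (grad w y *. e) *: grad u y" and c=e'] Cc_integrable[OF Cc_mult[OF D(3) continuous_on_inner[OF C1_cont_grad[OF w] continuous_on_const]]]
 by (simp add: mult.commute)
ultimately show ?thesis by simp
qed

lemma hP2_inner: assumes f: "f : Cc" and t: "t > 0"
shows "hP2 e t f x *. e' = (LBINT y. f y * (hk2 e t (x - y) *. e'))"
proof -
have "(LBINT y. (f y *: hk2 e t (x - y)) *. e') = hP2 e t f x *. e'"
 unfolding hP2_def by (rule integral_inner_left) (use Cc_integrable[OF Cc_conv_slice[OF f jcont_slice[OF hk2_jcont t]]] in auto)
thus ?thesis by simp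
qed

lemma hP2_sym: "f : Cc ==> t > 0 ==> hP2 e t f x *. e' = hP2 e' t f x *. e"
unfolding hP2_inner hk2_def by (simp add: inner_diff_left inner_commute[of e e'] mult_ac)

lemma hP1_C1: assumes f: "f : Cc" and t: "t > 0" and e: "norm e = 1"
shows "C1 (%x. hP1 t f x *. e)" "grad (%x. hP1 t f x *. e) = hP2 e t f"
using C1I[OF hP1_GDERIV[OF f t e] jcont_slice[OF hP2_jcont[OF f] t]] by auto

lemma Cc_grad_inner_integrable:
fixes f :: "'a::euclidean_space => real"
assumes "u : C1c Om" "cont UNIV f"
shows "integ (%x. (grad u x *. e) * f x)"
using Cc_integrable[OF Cc_times[OF Cc_inner[OF C1cD(3)[OF assms(1)] continuous_on_const] assms(2)]] .

lemma heat_pairing_grad: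
assumes u: "u : C1c Om" and f: "f : Cc" and t: "t > 0"
shows "(LBINT x. grad u x *. hP1 t f x) = - (LBINT x. u x * hPt t f x)"
proof -
note D = C1cD[OF u]
have c2: "cont UNIV (%x. hP2 e t f x *. e)" for e
 by (intro continuous_on_inner jcont_slice[OF hP2_jcont[OF f] t] continuous_on_const)
have c1: "cont UNIV (%x. hP1 t f x *. e)" for e
 by (intro continuous_on_inner jcont_slice[OF hP1_jcont[OF f] t] continuous_on_const)
have "(LBINT x. grad u x *. hP1 t f x) = (LBINT x. (SUM e:Basis. (grad u x *. e) * (hP1 t f x *. e)))"
 by (subst euclidean_inner) simp
also have "... = (SUM e:Basis. LBINT x. (grad u x *. e) * (hP1 t f x *. e))"
 by (rule integral_sum) (rule Cc_grad_inner_integrable[OF u c1])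
also have "... = (SUM e:Basis. - (LBINT x. u x * (hP2 e t f x *. e)))"
 using integral_by_parts[OF u hP1_C1(1)[OF f t]] by (intro sum.cong refl) (simp add: hP1_C1(2)[OF f t] mult.commute)
also have "... = - (LBINT x. (SUM e:Basis. u x * (hP2 e t f x *. e)))"
 by (subst integral_sum) (auto simp: sum_negf intro!: Cc_integrable Cc_times D(2) c2)
finally show ?thesis by (simp add: hPt_hP2[OF f t] sum_distrib_left)
qed

text \<open>Formally the derivatives are moved around in the integral, but u has no second
  derivatives. \<open>cross_parts\<close> exchanges the two directions with u differentiated only
  once.\<close>

lemma heat_pairing_hess:
assumes u: "u : C1c Om" and f: "f : Cc" and t: "t > 0" and e: "e : Basis"
shows "(LBINT x. grad u x *. hP2 e t f x) = (LBINT x. (grad u x *. e) * hPt t f x)"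
proof -
have c2: "cont UNIV (%x. hP2 i t f x *. j)" for i j
 by (intro continuous_on_inner jcont_slice[OF hP2_jcont[OF f] t] continuous_on_const)
have x: "(LBINT x. (grad u x *. i) * (hP2 i t f x *. e)) = (LBINT x. (grad u x *. e) * (hP2 i t f x *. i))"
 if i: "i : Basis" for i
proof -
 have i1: "norm i = 1" using i by simp
 obtain A where A: "!!x. norm (hP1 t f x) <= A" using hP_bounded[OF f t] by metis
 obtain B where B: "!!x. norm (hP2 i t f x) <= B" using dwleE[OF hP_decay(3)[OF f t order_refl i1]] by (metis atLeastAtMost_singleton insertI1)
 have "(LBINT x. (grad u x *. e) * (grad (%x. hP1 t f x *. i) x *. i)) = (LBINT x. (grad u x *. i) * (grad (%x. hP1 t f x *. i) x *. e))"
 proof (rule cross_parts[OF u hP1_C1(1)[OF f t i1], of "max A B"])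
  show "abs (hP1 t f x *. i) <= max A B" for x
   using Cauchy_Schwarz_ineq2[of "hP1 t f x" i] i1 A[of x] by simp
  show "norm (grad (%x. hP1 t f x *. i) x) <= max A B" for x using B by (simp add: hP1_C1(2)[OF f t i1] le_max_iff_disj)
  show "integ (%x. grad (%x. hP1 t f x *. i) x *. e)"
   unfolding hP1_C1(2)[OF f t i1]
  proof (rule decay_flow(1)[where a=t and b=t and F="%t x. hP2 i t f x *. e"])
   show "dwle {t..t} (%t x. hP2 i t f x *. e)"
    by (rule dwle_le[OF hP_decay(3)[OF f t order_refl i1], of _ 1]) (use Cauchy_Schwarz_ineq2[of _ e] e in simp)
  show "cont ({0<..} \<times> UNIV) (%p. hP2 i (fst p) f (snd p) *. e)" by (intro continuous_on_inner hP2_jcont f continuous_on_const)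
  qed (use t in auto)
 qed
 thus ?thesis by (simp add: hP1_C1(2)[OF f t i1])
qed
have "(LBINT x. grad u x *. hP2 e t f x) = (LBINT x. (SUM i:Basis. (grad u x *. i) * (hP2 i t f x *. e)))"
 by (subst euclidean_inner) (simp add: hP2_sym[OF f t, of e])
also have "... = (SUM i:Basis. LBINT x. (grad u x *. i) * (hP2 i t f x *. e))"
 by (rule integral_sum) (rule Cc_grad_inner_integrable[OF u c2])
also have "... = (SUM i:Basis. LBINT x. (grad u x *. e) * (hP2 i t f x *. i))" by (intro sum.cong refl x)
also have "... = (LBINT x. (SUM i:Basis. (grad u x *. e) * (hP2 i t f x *. i)))"
 by (rule integral_sum[symmetric]) (rule Cc_grad_inner_integrable[OF u c2])
finally show ?thesis by (simp add: hPt_hP2[OF f t] sum_distrib_left)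
qed

text \<open>The pairing of \<open>Dl l u\<close> with the field obtained by applying the scalar
  operator K to each component of g. Taking K to be the heat flow, its time derivative or the
  identity gives the three instances that occur.\<close>

definition hM :: "real => ('a::euclidean_space => real) => ('a => 'a \<times> real) => (('a => real) => 'a => real) => real" where
"hM l u g K = (SUM e:Basis. LBINT x. (grad u x *. e) * K (%y. g y *. (e, 0)) x) + l * (LBINT x. u x * K (%y. g y *. (0, 1)) x)"

text \<open>With D = \<open>Dl l\<close> and D* its adjoint, D D* acts on the range of D as l^2 -
  Laplacian, since D* D does so on functions. Hence pairing D u with D D* P(t) g only sees (l^2 -
  Laplacian) P(t) applied to the components of g.\<close>

lemma Dl_hS:
fixes g :: "'a::euclidean_space => 'a \<times> real"
assumes u: "u : C1c Om" and g: "g : Cc" and t: "t > 0"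
shows "dform l u (hS l t g) = l^2 * hM l u g (hP t) - hM l u g (hPt t)"
proof -
note D = C1cD[OF u]
let ?g = "%(e::'a) (y::'a). g y *. (e, 0::real)" and ?gz = "%y::'a. g y *. (0::'a, 1::real)"
have gC: "?g e : Cc" "?gz : Cc" for e using Cc_comp[OF g] by auto
have c: "cont UNIV (hP1 t (?g e))" "cont UNIV (hP2 e t (?g e))" "cont UNIV (hP1 t ?gz)" "cont UNIV (hP t ?gz)" for e
 by (auto intro!: jcont_slice[OF hP1_jcont t] jcont_slice[OF hP2_jcont t] jcont_slice[OF hP_jcont t] gC)
have i1: "integ (%x. grad u x *. hP1 t ?gz x)" and i2: "integ (%x. grad u x *. hP2 e t (?g e) x)"
 and i3: "integ (%x. u x * hP t ?gz x)" and i4: "integ (%x. u x * (hP1 t (?g e) x *. e))" for e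
 by (auto intro!: Cc_integrable Cc_inner Cc_times D continuous_on_inner c)
have "dform l u (hS l t g) =
 (LBINT x. l * (grad u x *. hP1 t ?gz x) - (SUM e:Basis. grad u x *. hP2 e t (?g e) x)
  + (l^3 * (u x * hP t ?gz x) - l^2 * (SUM e:Basis. u x * (hP1 t (?g e) x *. e))))"
 unfolding Dl_inner hS_C1(2)[OF g t] hS1_def hS_def
 by (intro integral_cong refl)
  (simp add: inner_diff_right inner_sum_right asimps pow2 power3_eq_cube sum_distrib_left)
also have "... = l * (LBINT x. grad u x *. hP1 t ?gz x) - (SUM e:Basis. LBINT x. grad u x *. hP2 e t (?g e) x)
  + (l^3 * (LBINT x. u x * hP t ?gz x) - l^2 * (SUM e:Basis. LBINT x. u x * (hP1 t (?g e) x *. e)))"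
proof -
 have s2: "integ (%x. SUM e:Basis. grad u x *. hP2 e t (?g e) x)"
  and s4: "integ (%x. SUM e:Basis. u x * (hP1 t (?g e) x *. e))"
  by (intro integrable_sum i2 i4)+
 have e2: "(LBINT x. (SUM e:Basis. grad u x *. hP2 e t (?g e) x)) = (SUM e:Basis. LBINT x. grad u x *. hP2 e t (?g e) x)"
  and e4: "(LBINT x. (SUM e:Basis. u x * (hP1 t (?g e) x *. e))) = (SUM e:Basis. LBINT x. u x * (hP1 t (?g e) x *. e))"
  by (intro integral_sum i2 i4)+
 show ?thesis unfolding e2[symmetric] e4[symmetric] using i1 i3 s2 s4 by simp
qed
also have "(LBINT x. grad u x *. hP1 t ?gz x) = - (LBINT x. u x * hPt t ?gz x)"
 by (rule heat_pairing_grad[OF u gC(2) t])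
also have "(SUM e:Basis. LBINT x. grad u x *. hP2 e t (?g e) x) = (SUM e:Basis. LBINT x. (grad u x *. e) * hPt t (?g e) x)"
 by (intro sum.cong refl heat_pairing_hess[OF u gC(1) t])
also have "(SUM e:Basis. LBINT x. u x * (hP1 t (?g e) x *. e)) = - (SUM e:Basis. LBINT x. (grad u x *. e) * hP t (?g e) x)"
 using integral_by_parts[OF u hP_C1(1)[OF gC(1) t]]
 by (simp add: hP_C1(2)[OF gC(1) t] mult.commute sum_negf)
finally show ?thesis by (simp add: hM_def asimps pow2 power3_eq_cube)
qed

lemma hM_time_deriv:
fixes g :: "'a::euclidean_space => 'a \<times> real"
assumes u: "u : C1c Om" and g: "g : Cc" and t: "t > 0"
shows "((%t. hM l u g (hP t)) hrd hM l u g (hPt t)) (at t)"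
unfolding hM_def
by (intro DERIV_add DERIV_cmult DERIV_sum LBINT_flow_deriv[OF _ hP_jcont hPt_jcont hP_time_deriv t] Cc_comp[OF g] C1cD(2)[OF u] Cc_inner[OF C1cD(3)[OF u] continuous_on_const])

text \<open>By \<open>Dl_hS\<close> and the heat equation the integrand is minus the time derivative
  of exp(-2 l^2 t) times the pairing with the flow at time 2t, so the integral telescopes to the
  values at the two endpoints.\<close>

lemma hS_integral:
fixes g :: "'a::euclidean_space => 'a \<times> real"
assumes u: "u : C1c Om" and g: "g : Cc" and ab: "0 < a" "a <= b"
shows "((%t. 2 * exp (- (2 * l^2 * t)) * (LBINT x. Dl l u x *. Dl l (hS l (2*t) g) x)) has_integral
 (exp (- (2 * l^2 * a)) * hM l u g (hP (2*a)) - exp (- (2 * l^2 * b)) * hM l u g (hP (2*b)))) {a..b}"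
proof -
let ?m = "%t. - (exp (- (2 * l^2 * t)) * hM l u g (hP (2*t)))"
have "((%t. 2 * exp (- (2 * l^2 * t)) * (LBINT x. Dl l u x *. Dl l (hS l (2*t) g) x)) has_integral (?m b - ?m a)) {a..b}"
proof (rule fundamental_theorem_of_calculus[OF ab(2)])
 fix t assume "t : {a..b}"
 hence t: "2 * t > 0" using ab by auto
 have "((%t. hM l u g (hP (2*t))) hrd hM l u g (hPt (2*t)) * 2) (at t)"
  by (rule DERIV_chain2[where f="%t. hM l u g (hP t)" and g="%t. 2 * t", OF hM_time_deriv[OF u g t]]) (auto intro!: derivative_eq_intros)
 hence "(?m hrd 2 * exp (- (2 * l^2 * t)) * (l^2 * hM l u g (hP (2*t)) - hM l u g (hPt (2*t)))) (at t)"
  by (auto intro!: derivative_eq_intros simp: asimps)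
 thus "(?m has_vector_derivative 2 * exp (- (2 * l^2 * t)) * (LBINT x. Dl l u x *. Dl l (hS l (2*t) g) x)) (at t within {a..b})"
  unfolding Dl_hS[OF u g t] has_real_derivative_iff_has_vector_derivative by (rule has_vector_derivative_at_within)
qed
thus ?thesis by simp
qed

lemma hP_dilate:
fixes f :: "'a::euclidean_space => real"
assumes f: "f : Cc" and t: "t > 0"
shows "hP t f x = (LBINT w. hk 1 w * f (x - sqrt t *: w))"
proof -
have fm: "f : bmeas borel" by (rule Cc_measurable[OF f])
have hm: "hk t : bmeas (borel :: 'a measure)" using hk_integrable[OF t, where 'a='a] by auto
have "hP t f x = (LBINT y. f (x - y) * hk t y)"
 unfolding hP_def using conv_sym[OF fm hm, of x] by simp
also have "... = sqrt t ^ DIM('a) *: (LBINT w. f (x - sqrt t *: w) * hk t (sqrt t *: w))"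
 using fm hm t by (intro integral_scale) auto
also have "... = (LBINT w. hk 1 w * f (x - sqrt t *: w))"
proof -
 have p: "sqrt t ^ DIM('a) = t powr (real DIM('a) / 2)"
  using t by (simp add: powr_half_sqrt[symmetric] powr_powr flip: powr_realpow)
 have "sqrt t ^ DIM('a) * hk t (sqrt t *: w) = hk 1 w" for w :: 'a
  using t by (simp add: hk_def p power_mult_distrib powr_minus)
 hence "sqrt t ^ DIM('a) * (f (x - sqrt t *: w) * hk t (sqrt t *: w)) = hk 1 w * f (x - sqrt t *: w)" for w
  by (metis mult.assoc mult.commute)
 thus ?thesis unfolding real_scaleR_def integral_mult_right_zero[symmetric] by (simp only:)
qed
finally show ?thesis .
qed

lemma hP_tendsto_0:
fixes f :: "'a::euclidean_space => real"
assumes f: "f : Cc" and B: "!!x. abs (f x) <= B" and t: "!!n. t n > 0" "t ----> 0"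
shows "(%n. hP (t n) f x) ----> f x" (is ?A) "abs (hP (t n) f x) <= B" (is ?B)
proof -
have fm: "f : bmeas borel" by (rule Cc_measurable[OF f])
have hi: "integ (hk 1 :: 'a => real)" by (rule hk_integrable) simp
have h0: "hk 1 w >= 0" for w :: 'a using hk_pos[of 1 w] by simp
have bd: "norm (hk 1 w * f (x - sqrt (t n) *: w)) <= hk 1 w * B" for n w
 using B[of "x - sqrt (t n) *: w"] h0[of w] by (simp add: abs_mult mul_l)
have "(%n. LBINT w. hk 1 w * f (x - sqrt (t n) *: w)) ----> (LBINT w. hk 1 (w::'a) * f x)"
proof (rule integral_dominated_convergence[where w="%w::'a. hk 1 w * B"])
 show "AE w in lborel. (%n. hk 1 w * f (x - sqrt (t n) *: w)) ----> hk 1 w * f x"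
 proof (rule AE_I2)
  fix w :: 'a
  have "(%n. x - sqrt (t n) *: w) ----> x - sqrt 0 *: w" by (intro tendsto_intros t(2))
  hence "(%n. x - sqrt (t n) *: w) ----> x" by simp
  moreover have "isCont f x" using Cc_cont[OF f] by (simp add: continuous_on_eq_continuous_at)
  ultimately have "(%n. f (x - sqrt (t n) *: w)) ----> f x" by (rule isCont_tendsto_compose[rotated])
  thus "(%n. hk 1 w * f (x - sqrt (t n) *: w)) ----> hk 1 w * f x" by (intro tendsto_intros)
 qed
 show "AE w in lborel. norm (hk 1 w * f (x - sqrt (t n) *: w)) <= hk 1 w * B" for n using bd by simp
qed (use hi fm in \<open>auto intro!: borel_measurable_times\<close>)
thus ?A
 unfolding hP_dilate[OF f t(1)] by (simp add: hk_integral[of 1 , simplified])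
have "norm (LBINT w. hk 1 w * f (x - sqrt (t n) *: w)) <= (LBINT w. hk 1 (w::'a) * B)"
 using hi bd by (intro integral_norm_bound_integral integrable_bound[of _ "%w. hk 1 w * B" "%w. hk 1 w * f (x - sqrt (t n) *: w)"])
  (use fm in \<open>auto intro!: borel_measurable_times order_trans[OF bd[unfolded real_norm_def] abs_ge_self]\<close>)
thus ?B
 unfolding hP_dilate[OF f t(1)] by (simp add: hk_integral[of 1, simplified])
qed

lemma hP_le_large:
fixes f :: "'a::euclidean_space => real"
assumes f: "f : Cc" and t: "t > 0"
shows "abs (hP t f x) <= t powr (- real DIM('a) / 2) * ((LBINT y. abs (f y)) / gc0 TYPE('a))"
proof -
let ?c = "t powr (- real DIM('a) / 2) / gc0 TYPE('a)"
have c: "hk t z <= ?c" "hk t z >= 0" for z :: 'a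
 using gc0_pos[where 'a='a] t hk_pos[OF t, of z] unfolding hk_def by (auto intro!: divide_right_mono mult_left_le)
have "norm (hP t f x) <= (LBINT y. abs (f y) * ?c)" unfolding hP_def
proof (rule integral_norm_bound_integral)
 show "integ (%y. f y * hk t (x - y))"
  using Cc_integrable[OF Cc_conv_slice[OF f jcont_slice[OF hk_jcont t]], of x] by simp
 show "integ (%y. abs (f y) * ?c)" using Cc_integrable[OF f] by simp
 show "norm (f y * hk t (x - y)) <= abs (f y) * ?c" for y
  using c[of "x - y"] unfolding real_norm_def abs_mult by (intro mul_l) auto
qed
thus ?thesis by (simp add: mult.commute)
qed

text \<open>For short times the flow tends boundedly to f; for long times the supremum of the kernel
  decays like t^(-d/2). The factor 2 in both sequences is the doubled time of
  \<open>hPsi\<close>.\<close>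

lemma pairing_tendsto:
fixes f :: "'a::euclidean_space => real"
assumes ch: "ch : Cc" and f: "f : Cc"
shows "(%n. LBINT x. ch x * hP (2 / real (Suc n)) f x) ----> (LBINT x. ch x * f x)" (is ?A)
 "(%n. LBINT x. ch x * hP (2 * real (Suc n)) f x) ----> 0" (is ?B)
proof -
obtain B where B: "!!x. abs (f x) <= B" using Cc_bounded[OF f] by (metis real_norm_def)
have i: "(%n. 1 / real (Suc n)) ----> 0" by (rule LIMSEQ_inverse_real_of_nat[unfolded inverse_eq_divide])
have t0: "(%n. 2 / real (Suc n)) ----> 0" using tendsto_mult_right_zero[OF i, of 2] by simp
have m: "(%x. ch x * hP t f x) : bmeas lborel" if "t > 0" for t
 using Cc_measurable[OF Cc_times[OF ch jcont_slice[OF hP_jcont[OF f] that]]] by simp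
show ?A
proof (rule integral_dominated_convergence[where w="%x. abs (ch x) * B"])
 show "(%x. ch x * f x) : bmeas lborel" using Cc_measurable[OF Cc_times[OF ch Cc_cont[OF f]]] by simp
 show "integ (%x. abs (ch x) * B)" using Cc_integrable[OF ch] by simp
 show "AE x in lborel. (%n. ch x * hP (2 / real (Suc n)) f x) ----> ch x * f x"
  by (intro AE_I2 tendsto_intros hP_tendsto_0(1)[OF f B _ t0]) simp
 show "AE x in lborel. norm (ch x * hP (2 / real (Suc n)) f x) <= abs (ch x) * B" for n
  unfolding real_norm_def abs_mult by (intro AE_I2 mul_l hP_tendsto_0(2)[OF f B _ t0]) auto
qed (use m in simp)
let ?d = "real DIM('a)" and ?F = "(LBINT y. abs (f y)) / gc0 TYPE('a)"
have dl: "(%n. (2 * real (Suc n)) powr (- ?d / 2)) ----> 0"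
proof (rule tendsto_neg_powr)
 show "filterlim (%n. 2 * real (Suc n)) at_top sequentially"
  by (rule filterlim_tendsto_pos_mult_at_top[OF tendsto_const[of 2]])
   (simp_all only: filterlim_compose[OF filterlim_real_sequentially filterlim_Suc] zero_less_numeral)
qed simp
have "(%n. (2 * real (Suc n)) powr (- ?d / 2) * (?F * (LBINT x. abs (ch x)))) ----> 0"
 using tendsto_mult_left_zero[OF dl] .
thus ?B
proof (rule Lim_null_comparison[rotated])
 have "norm (LBINT x. ch x * hP (2 * real (Suc n)) f x) <= (LBINT x. abs (ch x) * ((2 * real (Suc n)) powr (- ?d / 2) * ?F))" for n
 proof (rule integral_norm_bound_integral)
  show "integ (%x. ch x * hP (2 * real (Suc n)) f x)"
   by (rule Cc_integrable[OF Cc_times[OF ch jcont_slice[OF hP_jcont[OF f]]]]) simp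
  show "integ (%x. abs (ch x) * ((2 * real (Suc n)) powr (- ?d / 2) * ?F))" using Cc_integrable[OF ch] by simp
  show "norm (ch x * hP (2 * real (Suc n)) f x) <= abs (ch x) * ((2 * real (Suc n)) powr (- ?d / 2) * ?F)" for x
   unfolding real_norm_def abs_mult by (intro mul_l hP_le_large[OF f]) auto
 qed
 thus "\<forall>\<^sub>F n in sequentially. norm (LBINT x. ch x * hP (2 * real (Suc n)) f x)
  <= (2 * real (Suc n)) powr (- ?d / 2) * (?F * (LBINT x. abs (ch x)))"
  by (intro always_eventually allI) (simp add: mult_ac)
qed
qed

lemma hM_tendsto:
fixes g :: "'a::euclidean_space => 'a \<times> real"
assumes u: "u : C1c Om" and g: "g : Cc"
shows "(%n. hM l u g (hP (2 / real (Suc n)))) ----> (LBINT x. Dl l u x *. g x)" (is ?A)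
 "(%n. hM l u g (hP (2 * real (Suc n)))) ----> 0" (is ?B)
proof -
note D = C1cD[OF u]
have gu: "(%x. grad u x *. e) : Cc" for e by (rule Cc_inner[OF D(3) continuous_on_const])
have "(%n. hM l u g (hP (2 / real (Suc n)))) ----> hM l u g (%f. f)"
 unfolding hM_def by (intro tendsto_intros pairing_tendsto(1) Cc_comp[OF g] gu D(2))
also have "hM l u g (%f. f) = (LBINT x. (SUM e:Basis. (grad u x *. e) * (g x *. (e, 0))) + l * (u x * (g x *. (0, 1))))"
proof -
 have i: "integ (%x. (grad u x *. e) * (g x *. c))" "integ (%x. u x * (g x *. c))" for e c
  by (rule Cc_integrable[OF Cc_times[OF gu Cc_cont[OF Cc_comp[OF g]]]] Cc_integrable[OF Cc_times[OF D(2) Cc_cont[OF Cc_comp[OF g]]]])+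
 show ?thesis unfolding hM_def using i by (simp add: integral_sum)
qed
also have "... = (LBINT x. Dl l u x *. g x)"
proof (rule integral_cong[OF refl])
 fix x
 have "grad u x *. fst (g x) = (SUM e:Basis. (grad u x *. e) * (fst (g x) *. e))" by (rule euclidean_inner)
 thus "(SUM e:Basis. (grad u x *. e) * (g x *. (e, 0))) + l * (u x * (g x *. (0, 1))) = Dl l u x *. g x"
  by (simp add: Dl_def inner_prod_def)
qed
finally show ?A .
have "(%n. hM l u g (hP (2 * real (Suc n)))) ----> (SUM e:(Basis::'a set). 0) + l * 0"
 unfolding hM_def by (intro tendsto_intros pairing_tendsto(2) Cc_comp[OF g] gu D(2))
thus ?B by simp
qed

text \<open>A truncation of the potential (l^2 - Laplacian)^(-1) D* g, where D* is the adjoint of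
  \<open>Dl l\<close>, written as a time integral of the heat flow. With the times cut off at 0 and
  at infinity it is C^1 and decays together with its gradient.\<close>

definition hPsi :: "real => real => real => ('a::euclidean_space => 'a \<times> real) => 'a => real" where
"hPsi l a b g x = integral {a..b} (%t. 2 * exp (- (2 * l^2 * t)) * hS l (2*t) g x)"

lemma hPsi_jcont:
fixes F :: "real => 'a::euclidean_space => 'b::euclidean_space"
assumes "0 < a" "jcont F"
shows "cont ({a..b} \<times> UNIV) (%p. (2 * exp (- (2 * l^2 * fst p))) *: F (2 * fst p) (snd p))"
proof -
have 1: "cont ({a..b} \<times> (UNIV :: 'a set)) (%p. (2 * fst p, snd p))" by (intro cintro)
have 2: "(%p::real \<times> 'a. (2 * fst p, snd p)) ` ({a..b} \<times> UNIV) <= {0<..} \<times> UNIV" using assms(1) by auto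
have 3: "cont ({a..b} \<times> (UNIV :: 'a set)) (%p. F (2 * fst p) (snd p))"
 using cont_comp2[OF assms(2) 1 2] by simp
show ?thesis by (intro continuous_on_scaleR 3 cintro)
qed

lemma hPsi_C1:
fixes g :: "'a::euclidean_space => 'a \<times> real"
assumes g: "g : Cc" and ab: "0 < a" "a <= b"
shows "C1 (hPsi l a b g)" (is ?A)
 "Dl l (hPsi l a b g) = (%x. integral {a..b} (%t. (2 * exp (- (2 * l^2 * t))) *: Dl l (hS l (2*t) g) x))"
 "cont ({a..b} \<times> UNIV) (%p. (2 * exp (- (2 * l^2 * fst p))) *: Dl l (hS l (2 * fst p) g) (snd p))"
proof -
let ?w = "%t. 2 * exp (- (2 * l^2 * t))"
note j = hPsi_jcont[OF ab(1) hS_jcont[OF g], of b l l] and j1 = hPsi_jcont[OF ab(1) hS1_jcont[OF g], of b l l]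
have d: "GDERIV (%x. ?w t *: hS l (2*t) g x) x :> ?w t *: hS1 l (2*t) g x" if "t : {a..b}" for t x
 using C1_GDERIV[OF C1_cmult(1)[OF hS_C1(1)[OF g]], of "2*t" "?w t" l x] C1_cmult(2)[OF hS_C1(1)[OF g], of "2*t" "?w t" l] hS_C1(2)[OF g, of "2*t" l] that ab by simp
note T = time_int_C1[OF j j1 d]
have e: "hPsi l a b g = (%x. integral {a..b} (%t. ?w t *: hS l (2*t) g x))" by (simp add: hPsi_def[abs_def])
show ?A unfolding e by (rule T(1))
have jD: "cont ({a..b} \<times> UNIV) (%p. ?w (fst p) *: (hS1 l (2 * fst p) g (snd p), l * hS l (2 * fst p) g (snd p)))"
 unfolding scaleR_Pair using j j1 by (intro continuous_on_Pair j1) (auto dest: continuous_on_mult[OF continuous_on_const[of _ l]] simp: mult_ac)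
have eq: "?w t *: Dl l (hS l (2*t) g) x = ?w t *: (hS1 l (2*t) g x, l * hS l (2*t) g x)" if "t : {a..b}" for t x
 using hS_C1(2)[OF g, of "2*t" l] that ab by (simp add: Dl_def)
show "cont ({a..b} \<times> UNIV) (%p. ?w (fst p) *: Dl l (hS l (2 * fst p) g) (snd p))"
 using jD by (rule continuous_on_eq) (auto simp: eq)
show "Dl l (hPsi l a b g) = (%x. integral {a..b} (%t. ?w t *: Dl l (hS l (2*t) g) x))"
proof
 fix x
 let ?V = "%t. ?w t *: (hS1 l (2*t) g x, l * hS l (2*t) g x)"
 have c: "cont {a..b} ?V"
 proof -
  have 1: "cont {a..b} (%t::real. (t, x))" by (intro cintro)
  show ?thesis using cont_comp2[OF jD 1] by auto
 qed
 have "integral {a..b} (%t. ?w t *: Dl l (hS l (2*t) g) x) = integral {a..b} ?V"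
  by (intro Henstock_Kurzweil_Integration.integral_cong eq)
 also have "... = (fst (integral {a..b} ?V), snd (integral {a..b} ?V))" by simp
 also have "fst (integral {a..b} ?V) = integral {a..b} (%t. ?w t *: hS1 l (2*t) g x)"
  using integral_linear[OF integrable_continuous_real[OF c] bounded_linear_fst] by (simp add: o_def)
 also have "snd (integral {a..b} ?V) = integral {a..b} (%t. ?w t * (l * hS l (2*t) g x))"
  using integral_linear[OF integrable_continuous_real[OF c] bounded_linear_snd] by (simp add: o_def)
 also have "(%t. ?w t * (l * hS l (2*t) g x)) = (%t. l * (?w t * hS l (2*t) g x))" by (simp add: mult_ac)
 also have "integral {a..b} ... = l * hPsi l a b g x" unfolding hPsi_def by (rule integral_mult_right)
 finally show "Dl l (hPsi l a b g) x = integral {a..b} (%t. ?w t *: Dl l (hS l (2*t) g) x)"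
  unfolding Dl_def[of l "hPsi l a b g"] using T(2) e by simp
qed
qed

lemma dwle_integral:
fixes F :: "real => 'a::euclidean_space => 'b::euclidean_space"
assumes d: "dwle {a..b} F" and c: "cont ({a..b} \<times> UNIV) (%p. F (fst p) (snd p))" and ab: "a <= b"
shows "dwle S (%_ x. integral {a..b} (%t. F t x))"
proof -
obtain C where C: "!!t x. t : {a..b} ==> norm (F t x) <= C * dw (x::'a)" using d by (rule dwleE) blast
show ?thesis
proof (rule dwleI)
 fix x :: 'a
 have 1: "cont {a..b} (%t::real. (t, x))" by (intro cintro)
 have "cont {a..b} (%t. F t x)" using cont_comp2[OF c 1] by auto
 from integral_bound[OF ab this C] show "norm (integral {a..b} (%t. F t x)) <= (C * (b - a)) * dw x" by (simp add: mult_ac)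
qed
qed

lemma hPsi_decay:
assumes g: "g : Cc" and ab: "0 < a" "a <= b"
shows "dwle S (%_. hPsi l a b g)" (is ?A) "dwle S (%_. Dl l (hPsi l a b g))" (is ?B)
proof -
have w: "2 * exp (- (2 * l^2 * t)) <= 2" if "t : {a..b}" for t using that ab by simp
have D: "dwle {a..b} (%t. hS l (2*t) g)" "dwle {a..b} (%t. hS1 l (2*t) g)"
 by (rule dwle_comp[OF hS_decay(1)[OF g, of "2*a" "2*b"]] dwle_comp[OF hS_decay(2)[OF g, of "2*a" "2*b"]]; use ab in simp)+
have "dwle {a..b} (%t x. 2 * exp (- (2 * l^2 * t)) * hS l (2*t) g x)"
 by (rule dwle_le[OF D(1), of _ 2]) (simp add: abs_mult w mul_r)
thus ?A unfolding hPsi_def[abs_def]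
 using hPsi_jcont[OF ab(1) hS_jcont[OF g], of b l l] by (intro dwle_integral ab) auto
have "dwle {a..b} (%t x. norm (hS1 l (2*t) g x) + abs (l * hS l (2*t) g x))"
 by (intro dwle_add dwle_le[OF D(1), of _ "abs l"] dwle_le[OF D(2), of _ 1]) (simp_all add: abs_mult)
hence "dwle {a..b} (%t x. (2 * exp (- (2 * l^2 * t))) *: Dl l (hS l (2*t) g) x)"
proof (rule dwle_le)
 fix t x assume t: "t : {a..b}"
 have "norm (Dl l (hS l (2*t) g) x) <= norm (norm (hS1 l (2*t) g x) + abs (l * hS l (2*t) g x))"
  using norm_Dl_le[of l "hS l (2*t) g" x] t ab by (simp add: hS_C1(2)[OF g])
 thus "norm ((2 * exp (- (2 * l^2 * t))) *: Dl l (hS l (2*t) g) x) <= 2 * norm (norm (hS1 l (2*t) g x) + abs (l * hS l (2*t) g x))"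
  using w[OF t] unfolding norm_scaleR by (intro mult_mono) auto
qed
thus ?B unfolding hPsi_C1(2)[OF g ab]
 by (intro dwle_integral ab hPsi_C1(3)[OF g ab])
qed

text \<open>The boundedness of the projection D (l^2 - Laplacian)^(-1) D*, by duality: pairing with
  a field h and exchanging the space and time integrals gives the time integral of
  \<open>hW\<close>. The bump makes the field compactly supported; it is passed on to h at no cost,
  being at most 1.\<close>

lemma hPsi_dual:
fixes g :: "'a::euclidean_space => 'a \<times> real"
assumes pq: "conj_exp p q" and g: "g : Cc" and ab: "0 < a" "a <= b" and R: "R > 0"
shows "nrm q (%x. bump 0 R x *: Dl l (hPsi l a b g) x) <= EC TYPE('a) (min p q) * nrm q g"
proof -
note pq' = conj_expD(1,2)[OF pq]
have cD: "cont UNIV (Dl l (hPsi l a b g))"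
 unfolding Dl_def[abs_def] using hPsi_C1(1)[OF g ab, of l] by (intro cintro C1_cont C1_cont_grad)
let ?f = "%x. bump 0 R x *: Dl l (hPsi l a b g) x"
have f: "?f : Cc" by (rule Cc_scaleR_left[OF bump_Cc[OF R] cD])
have df: "(%x. dmap q (?f x)) : Cc" by (rule Cc_dmap[OF f pq'(2)])
define h where "h x = bump 0 R x *: dmap q (?f x)" for x
have h: "h : Cc" unfolding h_def[abs_def] by (rule Cc_scaleR_left[OF bump_Cc[OF R] Cc_cont[OF df]])
have hn: "nrm p h <= nrm p (%x. dmap q (?f x))"
proof (rule Cc_pn_mono[OF _ df])
 show "norm (h x) <= norm (dmap q (?f x))" for x
  using bump_bounds(1,2)[OF R, of 0 x] by (simp add: h_def mult_left_le_one_le)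
qed (use pq' in simp)
have E0: "EC TYPE('a) (min p q) >= 0" by (rule EC_nonneg) (use pq' in simp)
show ?thesis
proof (rule nrm_le_dual[OF conj_exp_sym[OF pq] f])
 show "0 <= EC TYPE('a) (min p q) * nrm q g" using E0 by simp
 have "(LBINT x. ?f x *. dmap q (?f x)) = (LBINT x. h x *. Dl l (hPsi l a b g) x)"
  by (intro integral_cong refl) (simp add: h_def inner_commute)
 also have "... = integral {a..b} (%t. LBINT x. h x *. ((2 * exp (- (2 * l^2 * t))) *: Dl l (hS l (2*t) g) x))"
  unfolding hPsi_C1(2)[OF g ab] by (rule time_Fubini[OF h hPsi_C1(3)[OF g ab]])
 also have "... = integral {a..b} (%t. 2 * exp (- (2 * l^2 * t)) * hW l g h t)"
  using ab hS_pairing[OF g h] by (intro Henstock_Kurzweil_Integration.integral_cong) (simp add: hW_def)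
 also have "... <= EC TYPE('a) (min p q) * (nrm p h * nrm q g)"
  using hW_bound[OF pq g h ab, of l] by linarith
 also have "... <= EC TYPE('a) (min p q) * (nrm p (%x. dmap q (?f x)) * nrm q g)"
  using E0 hn by (intro mul_l mul_r) auto
 finally show "(LBINT x. ?f x *. dmap q (?f x)) <= EC TYPE('a) (min p q) * nrm q g * nrm p (%x. dmap q (?f x))"
  by (simp add: mult_ac)
qed
qed

text \<open>\<open>hPsi\<close> is not compactly supported, so the bound on u is tested with its
  product with a bump of radius n + 1. The gradient of the bump contributes an error of order 1/(n +
  1), finite because \<open>hPsi\<close> decays like \<open>dw\<close>.\<close>

lemma hPsi_bound:
fixes g :: "'a::euclidean_space => 'a \<times> real"
assumes pq: "conj_exp p q" and g: "g : Cc" and ab: "0 < a" "a <= b"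
 and u: "u : C1c UNIV" and N: "N >= 0" and b: "bnd UNIV l q u N"
shows "dform l u (hPsi l a b g) <= N * (EC TYPE('a) (min p q) * nrm q g)"
proof -
note pq' = conj_expD(1,2)[OF pq]
obtain C where C: "C > 0" "!!x. abs (hPsi l a b g x) <= C * dw x" and pvC: "!!x. abs (hPsi l a b g x) <= C" "!!x. norm (Dl l (hPsi l a b g) x) <= C"
 by (rule dwleE2[OF hPsi_decay(1,2)[OF g ab, of UNIV l]]) auto
let ?pv = "hPsi l a b g" and ?b = "%n. bump (0::'a) (real (Suc n))"
note P1 = hPsi_C1(1)[OF g ab, of l]
define S where "S = C * (LBINT x. dw (x::'a)) powr (1/q)"
have pm: "nrm q (%x. (?pv x *: grad (?b n) x, 0::real)) <= 6 / real (Suc n) * S" for n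
proof -
 let ?w = "%x::'a. (dw x powr (1/q))"
 have wi: "integ (%x::'a. norm (?w x) powr q)"
  using dw_integrable[where 'a='a] dw_pos pq' by (simp add: powr_powr less_imp_le)
 have "nrm q (%x. (?pv x *: grad (?b n) x, 0::real)) <= nrm q (%x. (6 / real (Suc n) * C) *: ?w x)"
 proof (rule pn_mono)
  show "integ (%x::'a. norm ((6 / real (Suc n) * C) *: ?w x) powr q)"
   unfolding norm_scaleR by (subst powr_mult; simp only: abs_ge_zero norm_ge_zero integrable_mult_right wi)
  fix x :: 'a
  \<comment> \<open>Since \<open>dw\<close> is at most 1, it is below its own q-th root, whose q-th
    power is integrable.\<close>
  have "dw x <= ?w x" using dw_pos[of x] dw_le_1[of x] pq' powr_mono'[of "1/q" 1 "dw x"] by simp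
  hence "abs (?pv x) <= C * ?w x" using C(1) by (intro order_trans[OF C(2)] mul_l) auto
  moreover have "norm (grad (?b n) x) <= 6 / real (Suc n)" by (rule bump_bounds(5)) simp
  ultimately have "abs (?pv x) * norm (grad (?b n) x) <= (C * ?w x) * (6 / real (Suc n))" by (intro mult_mono) (auto simp: C(1) less_imp_le)
  thus "norm (?pv x *: grad (?b n) x, 0::real) <= norm ((6 / real (Suc n) * C) *: ?w x)"
   using C(1) by (simp add: norm_Pair abs_mult mult_ac)
 qed (use pq' in simp)
 also have "... = 6 / real (Suc n) * S"
 proof -
  have "q > 0" using pq' by simp
  have "nrm q ?w = (LBINT x. dw (x::'a)) powr (1/q)"
   using pq' by (simp add: pn_def powr_powr less_imp_le[OF dw_pos])
  thus ?thesis unfolding pn_scaleR[OF `q > 0`] using C(1) by (simp add: S_def)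
 qed
 finally show ?thesis .
qed
have cD: "cont UNIV (Dl l ?pv)"
 unfolding Dl_def[abs_def] using P1 by (intro cintro C1_cont C1_cont_grad)
have bC: "?b n : C1c UNIV" for n by (intro bump_C1c) auto
have pvn: "(%x. ?pv x * ?b n x) : C1c UNIV" for n by (rule C1c_mult[OF bC P1])
have Dn: "Dl l (%x. ?pv x * ?b n x) = (%x. ?b n x *: Dl l ?pv x + (?pv x *: grad (?b n) x, 0))" for n
 using Dl_mult[OF P1 bump_C1(1), of l 0 "real (Suc n)"] by (simp add: mult.commute)
have "dform l u (%x. ?pv x * ?b n x) <= N * (EC TYPE('a) (min p q) * nrm q g + 6 * (1 / real (Suc n)) * S)" for n
proof -
 have c2: "(%x. (?pv x *: grad (?b n) x, 0::real)) : Cc"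
  by (intro Cc_Pair Cc_mult C1cD(3)[OF bC] C1_cont[OF P1] Cc_zero)
 have "nrm q (Dl l (%x. ?pv x * ?b n x)) <= nrm q (%x. ?b n x *: Dl l ?pv x) + nrm q (%x. (?pv x *: grad (?b n) x, 0::real))"
  unfolding Dn using pq' by (intro Cc_triangle Cc_scaleR_left[OF bump_Cc cD] c2) auto
 also have "... <= EC TYPE('a) (min p q) * nrm q g + 6 / real (Suc n) * S"
  by (intro add_mono pm hPsi_dual[OF pq g ab]) simp
 finally show ?thesis using bndD[OF b pvn[of n]] mul_l[OF _ N] by force
qed
moreover have "(%n. N * (EC TYPE('a) (min p q) * nrm q g + 6 * (1 / real (Suc n)) * S)) ----> N * (EC TYPE('a) (min p q) * nrm q g + 6 * 0 * S)"
 by (intro tendsto_intros LIMSEQ_inverse_real_of_nat[unfolded inverse_eq_divide])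
moreover have "(%n. LBINT x. Dl l u x *. Dl l (%x. ?pv x * ?b n x) x) ----> dform l u ?pv"
proof (rule integral_dominated_convergence[where w="%x. norm (Dl l u x) * (7 * C)"])
 note Du = Dl_Cc[OF u, of l]
 show "(%x. Dl l u x *. Dl l ?pv x) : bmeas lborel" using Cc_measurable[OF Cc_inner[OF Du cD]] by simp
 show "(%x. Dl l u x *. Dl l (%x. ?pv x * ?b n x) x) : bmeas lborel" for n
  using Cc_measurable[OF Cc_inner[OF Du Cc_cont[OF Dl_Cc[OF pvn]]]] by simp
 show "integ (%x. norm (Dl l u x) * (7 * C))" using Cc_integrable[OF Cc_norm[OF Du]] by simp
 show "AE x in lborel. (%n. Dl l u x *. Dl l (%x. ?pv x * ?b n x) x) ----> Dl l u x *. Dl l ?pv x"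
 proof (rule AE_I2)
  fix x :: 'a
  have "(%n. grad (?b n) x) ----> 0"
  proof (rule Lim_null_comparison)
   show "(%n. 6 * (1 / real (Suc n))) ----> 0"
    by (intro tendsto_mult_right_zero LIMSEQ_inverse_real_of_nat[unfolded inverse_eq_divide])
   show "\<forall>\<^sub>F n in sequentially. norm (grad (?b n) x) <= 6 * (1 / real (Suc n))"
    using bump_bounds(5)[of "real (Suc _)" 0 x] by (intro always_eventually allI) simp
  qed
  hence "(%n. Dl l u x *. (?b n x *: Dl l ?pv x + (?pv x *: grad (?b n) x, 0))) ----> Dl l u x *. (1 *: Dl l ?pv x + (?pv x *: 0, 0))"
   by (intro tendsto_intros bump_tendsto)
  thus "(%n. Dl l u x *. Dl l (%x. ?pv x * ?b n x) x) ----> Dl l u x *. Dl l ?pv x"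
   unfolding Dn by (simp flip: zero_prod_def)
 qed
 show "AE x in lborel. norm (Dl l u x *. Dl l (%x. ?pv x * ?b n x) x) <= norm (Dl l u x) * (7 * C)" for n
 proof (rule AE_I2)
  fix x :: 'a
  have "norm (?b n x *: Dl l ?pv x + (?pv x *: grad (?b n) x, 0)) <= abs (?b n x) * norm (Dl l ?pv x) + abs (?pv x) * norm (grad (?b n) x)"
   by (rule order_trans[OF norm_triangle_ineq]) (simp add: norm_Pair)
  also have "... <= 1 * C + C * 6"
  proof (intro add_mono mult_mono pvC)
   show "abs (?b n x) <= 1" using bump_bounds(1,2)[of "real (Suc n)" 0 x] by simp
   have "norm (grad (?b n) x) <= 6 / real (Suc n)" by (rule bump_bounds(5)) simp
   also have "... <= 6" by (simp add: divide_le_eq)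
   finally show "norm (grad (?b n) x) <= 6" .
  qed (use C(1) in auto)
  finally have "norm (?b n x *: Dl l ?pv x + (?pv x *: grad (?b n) x, 0)) <= 7 * C" by simp
  thus "norm (Dl l u x *. Dl l (%x. ?pv x * ?b n x) x) <= norm (Dl l u x) * (7 * C)"
   unfolding Dn real_norm_def by (intro order_trans[OF Cauchy_Schwarz_ineq2] mul_l) auto
 qed
qed
ultimately show ?thesis using LIMSEQ_le by fastforce
qed
text \<open>As the truncation times tend to 0 and infinity, the pairing of \<open>Dl l u\<close>
  with the gradient of \<open>hPsi\<close> tends to its pairing with g, while
  \<open>hPsi_bound\<close> bounds it uniformly. Choosing g as the duality map of
  \<open>Dl l u\<close> gives the norm.\<close>

theorem infsup_UNIV:
assumes pq: "conj_exp p q"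
shows "infsup (UNIV :: 'a::euclidean_space set) l p q (EC TYPE('a) (min p q))"
unfolding infsup_def
proof (intro ballI allI impI)
fix u :: "'a => real" and N :: real assume u: "u : C1c UNIV" and N: "0 <= N" and b: "bnd UNIV l q u N"
note pq' = conj_expD(1,2)[OF pq] and Du = Dl_Cc[OF u, of l]
have E0: "EC TYPE('a) (min p q) >= 0" by (rule EC_nonneg) (use pq' in simp)
let ?E = "EC TYPE('a) (min p q)"
have main: "(LBINT x. Dl l u x *. g x) <= N * (?E * nrm q g)" if g: "g : Cc" for g
proof -
 let ?a = "%n. 1 / real (Suc n)" and ?b = "%n. real (Suc n)"
 have "exp (- (2 * l^2 * ?a n)) * hM l u g (hP (2 / real (Suc n))) - exp (- (2 * l^2 * ?b n)) * hM l u g (hP (2 * ?b n)) <= N * (?E * nrm q g)" for n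
 proof -
  have ab: "0 < ?a n" "?a n <= ?b n" using mult_mono[of 1 "real (Suc n)" 1 "real (Suc n)"] by (auto simp: divide_le_eq)
  have "(LBINT x. Dl l u x *. Dl l (hPsi l (?a n) (?b n) g) x)
   = integral {?a n..?b n} (%t. LBINT x. Dl l u x *. ((2 * exp (- (2 * l^2 * t))) *: Dl l (hS l (2*t) g) x))"
   unfolding hPsi_C1(2)[OF g ab] by (rule time_Fubini[OF Du hPsi_C1(3)[OF g ab]])
  also have "... = exp (- (2 * l^2 * ?a n)) * hM l u g (hP (2 * ?a n)) - exp (- (2 * l^2 * ?b n)) * hM l u g (hP (2 * ?b n))"
   using integral_unique[OF hS_integral[OF u g ab, of l]] by simp
  finally show ?thesis using hPsi_bound[OF pq g ab u N b] by simp
 qed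
 moreover have "(%n. exp (- (2 * l^2 * ?a n)) * hM l u g (hP (2 / real (Suc n))) - exp (- (2 * l^2 * ?b n)) * hM l u g (hP (2 * ?b n)))
  ----> exp (- (2 * l^2 * 0)) * (LBINT x. Dl l u x *. g x) - 0"
 proof (intro tendsto_intros hM_tendsto[OF u g] LIMSEQ_inverse_real_of_nat[unfolded inverse_eq_divide])
  have "(%n. abs (hM l u g (hP (2 * ?b n)))) ----> 0" using tendsto_rabs[OF hM_tendsto(2)[OF u g, of l]] by simp
  thus "(%n. exp (- (2 * l^2 * ?b n)) * hM l u g (hP (2 * ?b n))) ----> 0"
   by (rule Lim_null_comparison[rotated]) (simp add: abs_mult mult_left_le_one_le)
 qed
 ultimately show ?thesis using LIMSEQ_le_const2 by fastforce
qed
show "nrm p (Dl l u) <= ?E * N"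
 by (rule nrm_le_dual[OF pq Du]) (use E0 N main[OF Cc_dmap[OF Du pq'(1)]] in \<open>simp_all add: mult_ac\<close>)
qed

section \<open>Hardy's inequality and localization\<close>

text \<open>At half the radius the bump equals (1 - 1/4)^3 = 27/64. Later constants rely on this
  value exceeding 1/3.\<close>

lemma bump_ge_half:
assumes "norm (x - z) <= r / 2" "r > 0" shows "bump z r x >= 27 / 64"
proof -
have "(norm (x - z))^2 <= (r / 2)^2" using assms by (intro power_mono) auto
hence "3/4 <= 1 - (norm (x - z))^2 / r^2" using assms by (simp add: field_simps power_divide)
hence "(3/4)^3 <= bump z r x" unfolding bump_def by (intro power_mono max.coboundedI2) auto
thus ?thesis by (simp add: power3_eq_cube)
qed

lemma C1_chain_on:
assumes "C1 u" "!!x. (f hrd f' (u x)) (at (u x))" "cont UNIV (%x. f' (u x))"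
shows "C1 (%x. f (u x))" (is ?A) "grad (%x. f (u x)) = (%x. f' (u x) *: grad u x)"
proof -
have *: "GDERIV (%x. f (u x)) x :> f' (u x) *: grad u x" for x
 by (rule GDERIV_DERIV_compose[OF C1_GDERIV[OF assms(1)] assms(2)])
have c: "cont UNIV (%x. f' (u x) *: grad u x)" by (intro continuous_on_scaleR C1_cont_grad assms)
show ?A "grad (%x. f (u x)) = (%x. f' (u x) *: grad u x)" using C1I[OF * c] by auto
qed

text \<open>A negative power of the Japanese bracket, a smooth substitute for |x|^(-a) without
  singularity at the origin.\<close>

definition jw :: "real => 'a::euclidean_space => real" where "jw a x = (1 + (norm x)^2) powr (- a/2)"

lemma jw_pos [simp]: "jw a x > 0" "jw a x >= 0" by (simp_all add: jw_def)

lemma jw_add: "jw a x * jw b x = jw (a + b) x"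
by (simp add: jw_def powr_add[symmetric] field_simps)

lemma jw_powr: "jw a x powr b = jw (a * b) x" by (simp add: jw_def powr_powr)

lemma jw_1: "jw 1 x = inverse (sqrt (1 + (norm x)^2))"
proof -
have e: "(- 1) / 2 = - (1/2::real)" by simp
have "0 <= 1 + (norm x)^2" by simp
thus ?thesis unfolding jw_def e powr_minus by (simp only: powr_half_sqrt)
qed

lemma norm_jw: "norm x * jw a x <= jw (a - 1) x"
proof -
have "norm x <= jw (-1) x" using real_sqrt_le_mono[of "(norm x)^2" "1 + (norm x)^2"] by (simp add: jw_def powr_half_sqrt)
thus ?thesis using mul_r[of "norm x" "jw (-1) x" "jw a x"] by (simp add: jw_add)
qed

lemma jw_C1: "C1 (jw a :: 'a::euclidean_space => real)" "grad (jw a) = (%x::'a::euclidean_space. (- a * jw (a + 2) x) *: x)"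
proof -
have c: "C1 (%x::'a. (norm (x - 0))\<^sup>2)" by (rule C1_norm2)
have "cont UNIV (%x::'a. (- a/2) * (1 + (norm (x - 0))^2) powr (- a/2 - 1))"
 by (intro cintro) auto
hence "C1 (%x::'a. (1 + (norm (x - 0))^2) powr (- a/2))"
 "grad (%x::'a. (1 + (norm (x - 0))^2) powr (- a/2)) = (%x. ((- a/2) * (1 + (norm (x - 0))^2) powr (- a/2 - 1)) *: grad (%x. (norm (x - 0))\<^sup>2) x)"
 by (intro C1_chain_on[OF c, of "%t. (1 + t) powr (- a/2)" "%t. (- a/2) * (1 + t) powr (- a/2 - 1)"];
   auto intro!: derivative_eq_intros add_pos_nonneg)+
moreover have e: "- ((a + 2) / 2) = - (a/2) - 1" by (simp add: field_simps)
ultimately show "C1 (jw a :: 'a => real)" "grad (jw a) = (%x::'a. (- a * jw (a + 2) x) *: x)"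
 by (simp_all add: jw_def[abs_def] C1_norm2(2)[of 0, simplified] e)
qed

lemma abs_powr_C1:
assumes "q > 1" shows "((%t::real. abs t powr q) hrd q * dmap q t) (at t)"
proof (cases "t = 0")
case True
have "isCont (%h::real. norm h powr (q - 1)) 0"
 using continuous_norm_powr[of "q - 1", where 'b=real] assms by (simp add: continuous_on_eq_continuous_at)
hence "((%h::real. norm h powr (q - 1)) \<longlongrightarrow> 0) (at 0)" using assms by (simp add: isCont_def)
hence "((%h. abs ((abs (0 + h) powr q - abs 0 powr q) / h)) \<longlongrightarrow> 0) (at (0::real))"
proof (rule Lim_transform_eventually)
 show "\<forall>\<^sub>F h in at 0. norm h powr (q - 1) = abs ((abs (0 + h) powr q - abs 0 powr q) / h)"
  using assms by (auto simp: eventually_at_filter powr_diff)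
qed
hence "((%h. (abs (0 + h) powr q - abs 0 powr q) / h) \<longlongrightarrow> 0) (at (0::real))" by (rule tendsto_rabs_zero_cancel)
thus ?thesis using True unfolding DERIV_def by simp
next
case False
hence s: "abs t > 0" by simp
have "((%t::real. abs t powr q) hrd (q * abs t powr (q - 1)) * sgn t) (at t)"
 by (rule DERIV_chain2[where f="%z. z powr q" and g=abs, OF has_real_derivative_powr[OF s, of q]])
  (use GDERIV_norm[OF False] in \<open>simp add: gderiv_def has_field_derivative_def mult.commute[of "sgn t"]\<close>)
moreover have "(q * abs t powr (q - 1)) * sgn t = q * dmap q t"
 using False powr_mult_base[of "abs t" "q - 2"] by (auto simp: dmap_def sgn_if abs_if asimps)
ultimately show ?thesis by simp
qed

text \<open>The field jw(q) x has divergence at least (d - q) jw(q). Integrating its divergence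
  against |pv|^q by parts and applying Hoelder bounds the q-th power of the weighted norm by its
  (q-1)-st power times the norm of the gradient. The condition q < d is the positivity of the
  divergence.\<close>

lemma hardy:
fixes pv :: "'a::euclidean_space => real"
assumes pq: "conj_exp p q" and d: "q < real DIM('a)" and pv: "pv : C1c Om"
shows "nrm q (%x. jw 1 x * pv x) <= q / (real DIM('a) - q) * nrm q (grad pv)"
proof -
let ?d = "real DIM('a)"
note pq' = conj_expD(1,2)[OF pq] and D = C1cD[OF pv]
define f where "f x = abs (pv x) powr q" for x
have cd: "cont UNIV (%t::real. q * dmap q t)" using continuous_dmap[OF pq'(2)] by (intro continuous_on_mult continuous_on_const)
note F = C1_chain[OF D(1) abs_powr_C1[OF pq'(2)] cd, folded f_def]
have fC: "f : C1c UNIV"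
proof -
 obtain L where "compact L" "!!x. x ~: L ==> pv x = 0" using Cc_support[OF D(2)] by blast
 thus ?thesis using pq' by (intro C1cI[OF F(1)[folded f_def[abs_def]], of L]) (auto simp: f_def)
qed
have gf: "grad f = (%x. (q * dmap q (pv x)) *: grad pv x)" using F(2) by (simp add: f_def[abs_def])
define v where "v x = jw 1 x * pv x" for x
have v: "v : Cc" unfolding v_def[abs_def] by (rule Cc_times'[OF D(2) C1_cont[OF jw_C1(1)]])
have dv: "(%x. dmap q (v x)) : Cc" by (rule Cc_dmap[OF v pq'(2)])
have vq: "abs (v x) powr q = jw q x * f x" for x by (simp add: v_def f_def abs_mult powr_mult jw_powr)
have XC: "C1 (%x. jw q x * (x *. e))" "grad (%x. jw q x * (x *. e)) = (%x. jw q x *: e + (x *. e) *: ((- q * jw (q + 2) x) *: x))" for e :: 'a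
 using C1_mult[OF jw_C1(1) C1_inner(1), of q e] by (simp_all add: C1_inner(2) jw_C1(2))
have Xc: "cont UNIV (%x. grad (%x. jw q x * (x *. e)) x *. e)" for e :: 'a
 by (intro continuous_on_inner C1_cont_grad XC continuous_on_const)
have jc: "cont UNIV (jw a :: 'a => real)" for a by (rule C1_cont[OF jw_C1(1)])
have "(?d - q) * (LBINT x. abs (v x) powr q) = (LBINT x. (?d - q) * (jw q x * f x))" by (simp add: vq)
also have "... <= (LBINT x. (SUM e:Basis. f x * (grad (%x. jw q x * (x *. e)) x *. e)))"
proof (rule integral_mono)
 show "integ (%x. (?d - q) * (jw q x * f x))"
  by (intro integrable_mult_right Cc_integrable Cc_times' C1cD(2)[OF fC] jc)
 show "integ (%x. SUM e:Basis. f x * (grad (%x. jw q x * (x *. e)) x *. e))"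
  by (intro integrable_sum Cc_integrable Cc_times C1cD(2)[OF fC] Xc)
 fix x :: 'a
 have n: "(SUM e:Basis. (x *. e) * (x *. e)) = (norm x)^2" by (metis euclidean_inner power2_norm_eq_inner)
 \<comment> \<open>The divergence of jw(q) x is d jw(q) - q |x|^2 jw(q + 2).\<close>
 have "(norm x)^2 * jw (q + 2) x <= jw q x"
  using mul_l[OF norm_jw[of x "q+2"] norm_ge_zero[of x]] norm_jw[of x "q+1"] by (simp add: pow2 mult.assoc add.commute[of q])
 hence "(?d - q) * jw q x <= ?d * jw q x - q * jw (q + 2) x * (norm x)^2"
  using pq' mul_l[of "(norm x)^2 * jw (q + 2) x" "jw q x" q] by (simp add: asimps)
 also have "... = (SUM e:Basis. jw q x - q * jw (q + 2) x * ((x *. e) * (x *. e)))"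
  unfolding sum_subtractf sum_distrib_left[symmetric] n by simp
 finally have "(?d - q) * jw q x * f x <= (SUM e:Basis. jw q x - q * jw (q + 2) x * ((x *. e) * (x *. e))) * f x"
  by (rule mul_r) (simp add: f_def)
 also have "... = (SUM e:Basis. f x * (grad (%x. jw q x * (x *. e)) x *. e))"
  unfolding XC(2) sum_distrib_right by (intro sum.cong refl) (simp add: inner_add_left asimps)
 finally show "(?d - q) * (jw q x * f x) <= (SUM e:Basis. f x * (grad (%x. jw q x * (x *. e)) x *. e))" by (simp add: mult.assoc)
qed
also have "... = (SUM e:Basis. LBINT x. f x * (grad (%x. jw q x * (x *. e)) x *. e))"
 by (intro integral_sum Cc_integrable Cc_times C1cD(2)[OF fC] Xc)
also have "... = (SUM e:Basis. - (LBINT x. jw q x * (x *. e) * (grad f x *. e)))"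
 by (intro sum.cong refl integral_by_parts[OF fC XC(1)])
also have "... = - (LBINT x. (SUM e:Basis. jw q x * (x *. e) * (grad f x *. e)))"
 unfolding sum_negf
 by (simp only: integral_sum[OF Cc_integrable[OF Cc_times'[OF Cc_inner[OF C1cD(3)[OF fC] continuous_on_const] C1_cont[OF XC(1)]]]])
also have "... = (LBINT x. - (jw q x * (x *. grad f x)))"
 by (subst (2) euclidean_inner) (simp add: sum_distrib_left mult.assoc)
also have "... <= (LBINT x. q * (norm (grad pv x) * norm (dmap q (v x))))"
proof (rule integral_mono)
 show "integ (%x. - (jw q x * (x *. grad f x)))"
  by (intro integrable_minus Cc_integrable Cc_times' Cc_inner' C1cD(3)[OF fC] jc continuous_on_id)
 show "integ (%x. q * (norm (grad pv x) * norm (dmap q (v x))))"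
  by (intro integrable_mult_right Cc_integrable Cc_times Cc_norm D(3) Cc_cont[OF Cc_norm[OF dv]])
 fix x
 have "norm (dmap q (v x)) = jw (q - 1) x * abs (pv x) powr (q - 1)"
  using dmap_norm[OF pq'(2), of "v x"] by (simp add: v_def abs_mult powr_mult jw_powr)
 moreover have "- (jw q x * (x *. grad f x)) <= q * (norm x * jw q x) * abs (pv x) powr (q - 1) * norm (grad pv x)"
 proof -
  have "abs (x *. grad pv x) <= norm x * norm (grad pv x)" by (rule Cauchy_Schwarz_ineq2)
  hence "(jw q x * q * abs (dmap q (pv x))) * abs (x *. grad pv x) <= (jw q x * q * abs (dmap q (pv x))) * (norm x * norm (grad pv x))"
   using pq' by (intro mul_l mult_nonneg_nonneg) auto
  moreover have "- (jw q x * (x *. grad f x)) <= abs (jw q x * (x *. grad f x))" by linarith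
  moreover have "abs (jw q x * (x *. grad f x)) = (jw q x * q * abs (dmap q (pv x))) * abs (x *. grad pv x)"
   using pq' by (simp add: gf abs_mult)
  ultimately show ?thesis using dmap_norm[OF pq'(2), of "pv x"] by (simp add: mult_ac)
 qed
 moreover have "q * (norm x * jw q x) * abs (pv x) powr (q - 1) * norm (grad pv x) <= q * jw (q - 1) x * abs (pv x) powr (q - 1) * norm (grad pv x)"
  using norm_jw[of x q] pq' by (intro mul_r mul_l) auto
 ultimately show "- (jw q x * (x *. grad f x)) <= q * (norm (grad pv x) * norm (dmap q (v x)))" by (simp add: mult_ac)
qed
also have "... <= q * (nrm q (grad pv) * nrm p (%x. dmap q (v x)))"
 using holder_norm(2)[OF conj_exp_sym[OF pq], of "grad pv" lborel "%x. dmap q (v x)"] pq' Cc_int_powr[OF D(3), of q] Cc_int_powr[OF dv, of p]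
  Cc_measurable[OF D(3)] Cc_measurable[OF dv] by simp
also have "... = q * nrm q (grad pv) * nrm q v powr (q - 1)" by (simp add: nrm_dmap[OF conj_exp_sym[OF pq]])
finally have 1: "(?d - q) * nrm q v powr q <= q * nrm q (grad pv) * nrm q v powr (q - 1)"
 using pq' by (simp add: pn_powr)
show ?thesis
proof (cases "nrm q v = 0")
 case True
 thus ?thesis using pq' d by (simp add: v_def[abs_def])
next
 case False
 hence p: "nrm q v > 0" using pn_nonneg[of lborel q v] by linarith
 hence "nrm q v powr q = nrm q v powr (q - 1) * nrm q v" using powr_mult_base[of "nrm q v" "q - 1"] by (simp add: mult.commute)
 hence "nrm q v powr (q - 1) * ((?d - q) * nrm q v) <= nrm q v powr (q - 1) * (q * nrm q (grad pv))" using 1 by (simp add: mult_ac)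
 hence "(?d - q) * nrm q v <= q * nrm q (grad pv)" using p by simp
 thus ?thesis using d by (simp add: v_def[abs_def] field_simps)
qed
qed

text \<open>The gradient is dominated by a bump and the Laplacian by its square. In the commutator
  terms one factor of the bump can thus be given to u and one to the test function, where Hardy's
  inequality applies.\<close>

definition cutoff :: "real => real => ('a::euclidean_space => real) => bool" where
"cutoff A rh ph \<longleftrightarrow> C2 ph & (ALL x. abs (ph x) <= 1 & norm (grad ph x) <= A * bump 0 rh x & abs (lap ph x) <= A * (bump 0 rh x)^2)"

text \<open>The Hardy constant times the bound sqrt(1 + rh^2) for the quotient of the bump of radius
  \<open>rh\<close> by \<open>jw 1\<close>.\<close>

definition hc :: "'a::euclidean_space itself => real => real => real" where
"hc _ q rh = sqrt (1 + rh^2) * (q / (real DIM('a) - q))"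

lemma hardy_bump:
fixes pv :: "'a::euclidean_space => real"
assumes pq: "conj_exp p q" and d: "q < real DIM('a)" and pv: "pv : C1c Om" and rh: "rh > 0"
shows "nrm q (%x. bump 0 rh x * pv x) <= hc TYPE('a) q rh * nrm q (grad pv)"
proof -
note pq' = conj_expD(1,2)[OF pq]
have "nrm q (%x. bump 0 rh x * pv x) <= nrm q (%x. sqrt (1 + rh^2) *: (jw 1 x * pv x))"
proof (rule Cc_pn_mono)
 show "(%x. sqrt (1 + rh^2) *: (jw 1 x * pv x)) : Cc" by (intro Cc_scaleR Cc_times'[OF C1cD(2)[OF pv] C1_cont[OF jw_C1(1)]])
 fix x :: 'a
 have "bump 0 rh x <= sqrt (1 + rh^2) * jw 1 x"
 proof (cases "norm x < rh")
  case True
  hence "(norm x)^2 <= rh^2" by (intro power_mono) auto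
  hence "1 <= sqrt (1 + rh^2) / sqrt (1 + (norm x)^2)" by (simp add: le_divide_eq add_pos_nonneg)
  also have "... = sqrt (1 + rh^2) * jw 1 x"
   by (simp only: jw_1 divide_inverse)
  finally show ?thesis using bump_bounds(2)[OF rh, of 0 x] by linarith
 qed (use bump_bounds(3)[OF rh, of x 0] in simp)
 thus "norm (bump 0 rh x * pv x) <= norm (sqrt (1 + rh^2) *: (jw 1 x * pv x))"
  using mul_r[of "bump 0 rh x" "sqrt (1 + rh^2) * jw 1 x" "abs (pv x)"] bump_bounds(1)[OF rh, of 0 x] by (simp add: abs_mult mult.assoc)
qed (use pq' in simp)
also have "... = sqrt (1 + rh^2) * nrm q (%x. jw 1 x * pv x)" using pq' by (subst pn_scaleR) auto
also have "... <= sqrt (1 + rh^2) * (q / (real DIM('a) - q) * nrm q (grad pv))" by (intro mul_l hardy[OF pq d pv]) simp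
finally show ?thesis by (simp add: hc_def mult.assoc)
qed

text \<open>The term with the gradient of u is integrated by parts, so that u occurs
  undifferentiated in both error terms. This makes the error of lower order in u, at the price of
  the Laplacian of the cutoff.\<close>

lemma cutoff_commute:
fixes u pv :: "'a::euclidean_space => real"
assumes u: "u : C1c Om" and pv: "pv : C1c Om'" and ph: "C2 ph"
shows "dform l (%x. ph x * u x) pv = dform l u (%x. ph x * pv x)
 + 2 * (LBINT x. u x * (grad ph x *. grad pv x)) + (LBINT x. u x * (pv x * lap ph x))"
proof -
note U = C1cD[OF u] and S = C1cD[OF pv]
have P: "C1 ph" "!!e. e : Basis ==> C1 (%x. grad ph x *. e)" using ph by (auto simp: C2_def)
have cg: "cont UNIV (grad ph)" by (rule C1_cont_grad[OF P(1)])
have i1: "integ (%x. Dl l u x *. Dl l (%x. ph x * pv x) x)" by (rule Dl_inner_integrable[OF u C1c_mult[OF pv P(1)]])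
have i2: "integ (%x. u x * (grad ph x *. grad pv x))"
 by (intro Cc_integrable Cc_times U(2) continuous_on_inner cg Cc_cont[OF S(3)])
have i3: "integ (%x. pv x * (grad ph x *. grad u x))"
 by (intro Cc_integrable Cc_times S(2) continuous_on_inner cg Cc_cont[OF U(3)])
have i4: "integ (%x. u x * (pv x * lap ph x))"
 by (intro Cc_integrable Cc_times U(2) continuous_on_mult C2_lap_cont[OF ph] Cc_cont[OF S(2)])
have "(LBINT x. pv x * (grad ph x *. grad u x)) = (LBINT x. (SUM e:Basis. (pv x * (grad ph x *. e)) * (grad u x *. e)))"
 by (subst euclidean_inner) (simp add: sum_distrib_left mult.assoc)
also have "... = (SUM e:Basis. LBINT x. (pv x * (grad ph x *. e)) * (grad u x *. e))"
 by (intro integral_sum Cc_integrable Cc_times' Cc_inner U(3) continuous_on_mult Cc_cont[OF S(2)] continuous_on_inner cg continuous_on_const)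
also have "... = (SUM e:Basis. - (LBINT x. u x * (pv x * (grad (%x. grad ph x *. e) x *. e) + (grad ph x *. e) * (grad pv x *. e))))"
proof (intro sum.cong refl)
 fix e :: 'a assume e: "e : Basis"
 note M = C1_mult[OF S(1) P(2)[OF e]]
 show "(LBINT x. pv x * (grad ph x *. e) * (grad u x *. e)) = - (LBINT x. u x * (pv x * (grad (%x. grad ph x *. e) x *. e) + (grad ph x *. e) * (grad pv x *. e)))"
  using integral_by_parts[OF u M(1), of e] by (simp add: M(2) inner_add_left)
qed
also have "... = - (LBINT x. (SUM e:Basis. u x * (pv x * (grad (%x. grad ph x *. e) x *. e) + (grad ph x *. e) * (grad pv x *. e))))"
proof -
 have "integ (%x. u x * (pv x * (grad (%x. grad ph x *. e) x *. e) + (grad ph x *. e) * (grad pv x *. e)))"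
  if e: "e : Basis" for e
  by (intro Cc_integrable Cc_times U(2) continuous_on_add continuous_on_mult Cc_cont[OF S(2)] Cc_cont[OF S(3)] continuous_on_inner cg continuous_on_const C1_cont_grad P(2) e)
 thus ?thesis unfolding sum_negf by (simp only: integral_sum)
qed
also have "... = - (LBINT x. u x * (pv x * lap ph x) + u x * (grad ph x *. grad pv x))"
 by (subst (2) euclidean_inner) (simp add: lap_def sum_distrib_left sum.distrib asimps)
finally have 1: "(LBINT x. pv x * (grad ph x *. grad u x)) = - (LBINT x. u x * (pv x * lap ph x)) - (LBINT x. u x * (grad ph x *. grad pv x))"
 using i4 i2 by simp
have "dform l (%x. ph x * u x) pv =
 (LBINT x. Dl l u x *. Dl l (%x. ph x * pv x) x + u x * (grad ph x *. grad pv x) - pv x * (grad ph x *. grad u x))"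
 by (intro integral_cong refl)
  (simp add: Dl_mult[OF U(1) P(1)] Dl_mult[OF S(1) P(1)] Dl_def inner_add_left inner_add_right inner_commute asimps)
thus ?thesis using i1 i2 i3 1 by simp
qed

text \<open>The functional of the truncated function is that of u tested with the truncated test
  function, plus the commutator terms. Wherever the test function appears undifferentiated it is
  multiplied by a bump, and Hardy's inequality with exponent q < d bounds it by its
  gradient.\<close>

lemma cutoff_estimate:
fixes u :: "'a::euclidean_space => real"
assumes pq: "conj_exp p q" and d: "q < real DIM('a)" and inf: "infsup Om' l p q K" and K: "K >= 0"
 and ph: "cutoff A rh ph" "A >= 0" "rh > 0" and m: "!!pv. pv : C1c Om' ==> (%x. ph x * pv x) : C1c Om" "(%x. ph x * u x) : C1c Om'"
 and u: "u : C1c Om" and N: "N >= 0" and b: "bnd Om l q u N"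
shows "nrm p (Dl l (%x. ph x * u x)) <= K * ((1 + 2 * A + A * hc TYPE('a) q rh) * (N + nrm p (%x. bump 0 rh x * u x)))"
proof (rule infsupD[OF inf m(2)])
note pq' = conj_expD(1,2)[OF pq] and U = C1cD[OF u]
let ?b = "bump (0::'a) rh" and ?H = "hc TYPE('a) q rh" and ?B = "nrm p (%x. bump 0 rh x * u x)"
have H0: "?H >= 0" using pq' d by (auto simp: hc_def)
have B0: "?B >= 0" by simp
show "0 <= (1 + 2 * A + A * ?H) * (N + ?B)" using ph H0 N B0 by (intro mult_nonneg_nonneg add_nonneg_nonneg) auto
have C: "C2 ph" "C1 ph" and c: "abs (ph x) <= 1" "norm (grad ph x) <= A * ?b x" "abs (lap ph x) <= A * (?b x)^2" for x
 using ph(1) by (auto simp: cutoff_def C2_def)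
have b0: "?b x >= 0" for x by (rule bump_bounds(1)[OF ph(3)])
have cb: "cont UNIV ?b" by (rule C1_cont[OF bump_C1(1)])
have bu: "(%x. ?b x * u x) : Cc" by (rule Cc_times'[OF U(2) cb])
show "bnd Om' l q (%x. ph x * u x) ((1 + 2 * A + A * ?H) * (N + ?B))"
 unfolding bnd_def
proof
 fix pv assume pv: "pv : C1c Om'"
 note S = C1cD[OF pv]
 let ?G = "nrm q (Dl l pv)"
 have bs: "(%x. ?b x * pv x) : Cc" by (rule Cc_times'[OF S(2) cb])
 have gG: "nrm q (grad pv) <= ?G" using pq' norm_Dl_ge(1) by (intro Cc_pn_mono Dl_Cc[OF pv]) auto
 have hG: "nrm q (%x. ?b x * pv x) <= ?H * ?G"
  using hardy_bump[OF pq d pv ph(3)] mul_l[OF gG H0] by linarith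
 have "nrm q (Dl l (%x. ph x * pv x)) <= nrm q (%x. ph x *: Dl l pv x) + nrm q (%x. (pv x *: grad ph x, 0::real))"
  unfolding Dl_mult[OF S(1) C(2)] using pq'
  by (intro Cc_triangle Cc_mult Dl_Cc[OF pv] C1_cont[OF C(2)] Cc_Pair Cc_scaleR_left S(2) C1_cont_grad[OF C(2)] Cc_zero) auto
 also have "nrm q (%x. ph x *: Dl l pv x) <= ?G"
  using pq' c(1) by (intro Cc_pn_mono Dl_Cc[OF pv]) (auto intro: mult_left_le_one_le)
 also have "nrm q (%x. (pv x *: grad ph x, 0::real)) <= nrm q (%x. A *: (?b x * pv x))"
 proof (rule Cc_pn_mono[OF _ Cc_scaleR[OF bs]])
  show "norm (pv x *: grad ph x, 0::real) <= norm (A *: (?b x * pv x))" for x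
   using mul_l[OF c(2)[of x], of "abs (pv x)"] ph(2) b0[of x] by (simp add: norm_Pair abs_mult mult_ac)
 qed (use pq' in simp)
 also have "... = A * nrm q (%x. ?b x * pv x)" using pq' ph(2) by (subst pn_scaleR) auto
 also have "... <= A * (?H * ?G)" by (rule mul_l[OF hG ph(2)])
 finally have "N * nrm q (Dl l (%x. ph x * pv x)) <= N * (?G + A * (?H * ?G))" using N by (simp add: mul_l)
 hence 1: "dform l u (%x. ph x * pv x) <= N * (?G + A * (?H * ?G))"
  using bndD[OF b m(1)[OF pv]] by linarith
 have hold: "(LBINT x. abs (?b x * u x) * norm (F x)) <= ?B * nrm q F" if F: "F : Cc" for F :: "'a => 'b::euclidean_space"
  using holder_norm(2)[OF pq, of "%x. ?b x * u x" lborel F] pq' Cc_int_powr[OF bu, of p] Cc_int_powr[OF F, of q] Cc_measurable[OF bu] Cc_measurable[OF F] by simp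
 have hi: "integ (%x. abs (?b x * u x) * norm (F x))" if F: "F : Cc" for F :: "'a => 'b::euclidean_space"
  using Cc_integrable[OF Cc_times[OF Cc_norm[OF bu] Cc_cont[OF Cc_norm[OF F]]]] by simp
 have "(LBINT x. u x * (grad ph x *. grad pv x)) <= (LBINT x. A * (abs (?b x * u x) * norm (grad pv x)))"
 proof (rule integral_mono)
  show "integ (%x. u x * (grad ph x *. grad pv x))"
   by (intro Cc_integrable Cc_times U(2) continuous_on_inner C1_cont_grad[OF C(2)] Cc_cont[OF S(3)])
  show "integ (%x. A * (abs (?b x * u x) * norm (grad pv x)))" by (rule integrable_mult_right[OF hi[OF S(3)]])
  fix x
  have "abs (u x * (grad ph x *. grad pv x)) <= abs (u x) * ((A * ?b x) * norm (grad pv x))"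
   unfolding abs_mult by (intro mul_l order_trans[OF Cauchy_Schwarz_ineq2] mul_r c) auto
  thus "u x * (grad ph x *. grad pv x) <= A * (abs (?b x * u x) * norm (grad pv x))" using b0[of x] abs_ge_self[of "u x * (grad ph x *. grad pv x)"] by (simp add: abs_mult mult_ac)
 qed
 also have "... <= A * (?B * ?G)"
  using order_trans[OF hold[OF S(3)] mul_l[OF gG B0]] ph(2) by (simp add: mul_l)
 finally have 2: "(LBINT x. u x * (grad ph x *. grad pv x)) <= A * (?B * ?G)" .
 have "(LBINT x. u x * (pv x * lap ph x)) <= (LBINT x. A * (abs (?b x * u x) * norm (?b x * pv x)))"
 proof (rule integral_mono)
  show "integ (%x. u x * (pv x * lap ph x))"
   by (intro Cc_integrable Cc_times U(2) continuous_on_mult C2_lap_cont[OF C(1)] Cc_cont[OF S(2)])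
  show "integ (%x. A * (abs (?b x * u x) * norm (?b x * pv x)))" by (rule integrable_mult_right[OF hi[OF bs]])
  fix x
  have "abs (u x * (pv x * lap ph x)) <= abs (u x) * (abs (pv x) * (A * (?b x)^2))"
   unfolding abs_mult by (intro mul_l c) auto
  thus "u x * (pv x * lap ph x) <= A * (abs (?b x * u x) * norm (?b x * pv x))" using b0[of x] abs_ge_self[of "u x * (pv x * lap ph x)"] by (simp add: abs_mult mult_ac pow2)
 qed
 also have "... <= A * (?B * (?H * ?G))"
  using order_trans[OF hold[OF bs] mul_l[OF hG B0]] ph(2) by (simp add: mul_l)
 finally have 3: "(LBINT x. u x * (pv x * lap ph x)) <= A * (?B * (?H * ?G))" .
 have G0: "?G >= 0" by simp
 have "dform l (%x. ph x * u x) pv <= N * (?G + A * (?H * ?G)) + 2 * (A * (?B * ?G)) + A * (?B * (?H * ?G))"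
  unfolding cutoff_commute[OF u pv C(1)] using 1 2 3 by linarith
 also have "... <= ((1 + 2 * A + A * ?H) * (N + ?B)) * ?G"
 proof -
  have "0 <= 2 * A * N * ?G + ?B * ?G" using ph(2) N B0 G0 by (intro add_nonneg_nonneg mult_nonneg_nonneg) auto
  thus ?thesis by (simp add: asimps)
 qed
 finally show "dform l (%x. ph x * u x) pv <= ((1 + 2 * A + A * ?H) * (N + ?B)) * ?G" .
qed
qed

text \<open>The inf-sup inequality up to a lower-order term concentrated in a fixed ball, with a
  constant uniform in \<open>l\<close>.\<close>

definition LOCal :: "'a::euclidean_space set => real => real => real => real => bool" where
"LOCal Om p q C rh \<longleftrightarrow> (ALL l>=0. ALL u:C1c Om. ALL N>=0. bnd Om l q u N --> nrm p (Dl l u) <= C * (N + nrm p (%x. bump 0 rh x * u x)))"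

text \<open>No partition of unity is needed: \<open>ph Du = D(ph u) - u D ph\<close> recovers \<open>Du\<close> wherever some cutoff is at least \<open>1/4\<close>.\<close>

lemma LOCal_cover:
fixes Om :: "'a::euclidean_space set" and ph :: "'i => 'a => real"
assumes pq: "conj_exp p q" and d: "q < real DIM('a)" and I: "finite I" and K: "K >= 0" and A: "A >= 0" "rh > 0"
 and inf: "!!i l. i : I ==> l >= 0 ==> infsup (Om' i) l p q K" and ph: "!!i. i : I ==> cutoff A rh (ph i)"
 and m: "!!i pv. i : I ==> pv : C1c (Om' i) ==> (%x. ph i x * pv x) : C1c Om" "!!i u. i : I ==> u : C1c Om ==> (%x. ph i x * u x) : C1c (Om' i)"
 and cov: "!!x. x : Om ==> EX i:I. ph i x >= 1/4"
shows "LOCal Om p q (4 * real (card I) * (K * (1 + 2 * A + A * hc TYPE('a) q rh) + A)) rh"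
unfolding LOCal_def
proof (intro allI ballI impI)
fix l :: real and u N assume l: "0 <= l" and u: "u : C1c Om" and N: "0 <= N" and b: "bnd Om l q u N"
note pq' = conj_expD(1,2)[OF pq] and U = C1cD[OF u]
let ?H = "hc TYPE('a) q rh" and ?B = "nrm p (%x. bump 0 rh x * u x)"
have p0: "p > 0" using pq' by simp
have bu: "(%x. bump 0 rh x * u x) : Cc" by (rule Cc_times'[OF U(2) C1_cont[OF bump_C1(1)]])
have Ci: "C1 (ph i)" "norm (grad (ph i) x) <= A * bump 0 rh x" if "i : I" for i x
 using ph[OF that] by (auto simp: cutoff_def C2_def)
have Dc: "(%x. norm (Dl l (%x. ph i x * u x) x)) : Cc" if "i : I" for i by (rule Cc_norm[OF Dl_Cc[OF m(2)[OF that u]]])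
have bn: "(%x. A *: norm (bump 0 rh x * u x)) : Cc" by (intro Cc_scaleR Cc_norm bu)
let ?g = "%i x. norm (Dl l (%x. ph i x * u x) x) + A *: norm (bump 0 rh x * u x)"
have gC: "?g i : Cc" if "i : I" for i by (rule Cc_add[OF Dc[OF that] bn])
have g0: "?g i x >= 0" for i x using A by simp
have "nrm p (Dl l u) <= nrm p (%x. 4 *: (SUM i:I. ?g i x))"
proof (rule Cc_pn_mono)
 show "(%x. 4 *: (SUM i:I. ?g i x)) : Cc" by (intro Cc_scaleR Cc_sum I gC)
 fix x
 have s0: "(SUM i:I. ?g i x) >= 0" by (rule sum_nonneg[OF g0])
 show "norm (Dl l u x) <= norm (4 *: (SUM i:I. ?g i x))"
 proof (cases "x : Om")
  case True
  then obtain i where i: "i : I" "ph i x >= 1/4" using cov by blast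
  have "(1/4) * norm (Dl l u x) <= abs (ph i x) * norm (Dl l u x)" using i by (intro mul_r) auto
  also have "... = norm (Dl l (%x. ph i x * u x) x - (u x *: grad (ph i) x, 0))"
   by (simp add: Dl_mult[OF U(1) Ci(1)[OF i(1)]])
  also have "... <= norm (Dl l (%x. ph i x * u x) x) + norm (u x *: grad (ph i) x, 0::real)" by (rule norm_triangle_ineq4)
  also have "norm (u x *: grad (ph i) x, 0::real) <= A *: norm (bump 0 rh x * u x)"
   using mul_l[OF Ci(2)[OF i(1), of x], of "abs (u x)"] bump_bounds(1)[OF A(2), of 0 x] by (simp add: norm_Pair abs_mult mult_ac)
  also have "norm (Dl l (%x. ph i x * u x) x) + A *: norm (bump 0 rh x * u x) <= (SUM i:I. ?g i x)"
   by (rule member_le_sum[OF i(1) g0 I])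
  finally show ?thesis using s0 by simp
 next
  case False
  obtain L where "L <= Om" "!!x. x ~: L ==> u x = 0" "!!x. x ~: L ==> grad u x = 0" using u by (rule C1c_support) blast
  hence "Dl l u x = 0" using False by (auto simp: Dl_def zero_prod_def)
  thus ?thesis by simp
 qed
qed (use pq' in simp)
also have "... = 4 * nrm p (%x. SUM i:I. ?g i x)" using pq' by (subst pn_scaleR) auto
also have "... <= 4 * (SUM i:I. nrm p (?g i))" using pq' by (intro mul_l Cc_triangle_sum I gC) auto
also have "... <= 4 * (SUM i:I. (K * (1 + 2 * A + A * ?H) + A) * (N + ?B))"
proof (intro mul_l sum_mono)
 fix i assume i: "i : I"
 have "nrm p (?g i) <= nrm p (%x. norm (Dl l (%x. ph i x * u x) x)) + nrm p (%x. A *: norm (bump 0 rh x * u x))"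
  using pq' by (intro Cc_triangle Dc[OF i] bn) auto
 also have "... = nrm p (Dl l (%x. ph i x * u x)) + A * ?B" unfolding pn_norm pn_scaleR[OF p0] using A by simp
 also have "... <= K * ((1 + 2 * A + A * ?H) * (N + ?B)) + A * (N + ?B)"
  using A N by (intro add_mono mul_l cutoff_estimate[OF pq d inf[OF i l] K ph[OF i] A m(1)[OF i] m(2)[OF i u] u N b]) auto
 finally show "nrm p (?g i) <= (K * (1 + 2 * A + A * ?H) + A) * (N + ?B)" by (simp add: asimps)
qed simp
finally show "nrm p (Dl l u) <= 4 * real (card I) * (K * (1 + 2 * A + A * ?H) + A) * (N + ?B)" by (simp only: sum_constant mult.assoc)
qed

lemma C1_comp_scale:
assumes "C1 u" shows "C1 (%x::'a::euclidean_space. u (c *: x))" "grad (%x. u (c *: x)) = (%x. c *: grad u (c *: x))" (is ?A)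
proof -
have "GDERIV (%x. u (c *: x)) x :> c *: grad u (c *: x)" for x
 using has_derivative_compose[of "%x. c *: x" "%h. c *: h" x UNIV u, OF _ GDERIV_has_derivative[OF C1_GDERIV[OF assms]]]
 by (simp add: gderiv_def has_derivative_scaleR_right[OF has_derivative_ident])
moreover have "cont UNIV (%x. c *: grad u (c *: x))"
 by (intro continuous_on_scaleR continuous_on_const cont_comp2[OF C1_cont_grad[OF assms]] continuous_on_id) auto
ultimately show "C1 (%x. u (c *: x))" ?A
 using C1I[of "%x. u (c *: x)" "%x. c *: grad u (c *: x)"] by blast+
qed

text \<open>Dilation multiplies the norms and the form by powers of r that match because 1/p + 1/q =
  1, and replaces \<open>l\<close> by \<open>r * l\<close>. An inequality valid for all
  \<open>l >= 0\<close> therefore passes to every dilated domain with the same constant.\<close>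

lemma infsup_scale:
fixes Om :: "'a::euclidean_space set"
assumes pq: "conj_exp p q" and r: "r > 0" and inf: "infsup Om (r * l) p q K"
shows "infsup ((%x. r *: x) ` Om) l p q K"
unfolding infsup_def
proof (intro ballI allI impI)
fix u N assume u: "u : C1c ((%x. r *: x) ` Om)" and N: "(0::real) <= N" and b: "bnd ((%x. r *: x) ` Om) l q u N"
note pq' = conj_expD(1,2)[OF pq]
let ?d = "DIM('a)"
have Sc: "(%x. v (s *: x)) : C1c S" if v: "v : C1c T" and s: "s > 0" and ST: "!!y. y : T ==> inverse s *: y : S" for v s and S T :: "'a set"
proof -
 obtain L where L: "compact L" "L <= T" "!!x. x ~: L ==> v x = 0" using v by (rule C1c_support) blast
 show ?thesis
 proof (rule C1cI[OF C1_comp_scale(1)[OF C1cD(1)[OF v]], of "(%y. inverse s *: y) ` L"])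
  show "compact ((%y. inverse s *: y) ` L)" by (rule compact_scaling[OF L(1)])
  fix x assume x: "x ~: (%y. inverse s *: y) ` L"
  have "x = inverse s *: (s *: x)" using s by simp
  thus "v (s *: x) = 0" using x L(3) by blast
 qed (use L(2) ST in auto)
qed
have Dlr: "Dl (r * l) (%x. v (r *: x)) = (%x. r *: Dl l v (r *: x))" if "C1 v" for v :: "'a => real"
 by (simp add: Dl_def fun_eq_iff C1_comp_scale(2)[OF that])
have nS: "nrm s (%x. r *: F (r *: x)) = r * (r ^ ?d) powr (- 1/s) * nrm s F" if F: "F : Cc" and s: "s > 0" for s and F :: "'a => 'a \<times> real"
proof -
 have "(LBINT x. norm (F x) powr s) = r ^ ?d * (LBINT x. norm (F (r *: x)) powr s)"
  using integral_scale[OF r, of "%x. norm (F x) powr s"] Cc_measurable[OF F] by simp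
 hence "nrm s F = (r ^ ?d) powr (1/s) * nrm s (%x. F (r *: x))" by (simp add: pn_def powr_mult r less_imp_le)
 moreover have "(r ^ ?d) powr (- 1/s) * (r ^ ?d) powr (1/s) = 1" using r by (simp flip: powr_add)
 ultimately have "(r ^ ?d) powr (- 1/s) * nrm s F = nrm s (%x. F (r *: x))" by (metis mult.assoc mult_1)
 thus ?thesis using r s by (simp add: pn_scaleR mult.assoc)
qed
define w where "w x = u (r *: x)" for x
have w: "w : C1c Om" unfolding w_def[abs_def] using r by (intro Sc[OF u]) auto
let ?c = "r * (r ^ ?d) powr (- 1/p)"
have c0: "?c > 0" using r by simp
have rr: "(r ^ ?d) powr (- 1/p) * (r ^ ?d) powr (- 1/q) = inverse (r ^ ?d)"
proof -
 have "- 1/p + - 1/q = (-1::real)" using pq by (simp add: conj_exp_def)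
 hence "(r ^ ?d) powr (- 1/p) * (r ^ ?d) powr (- 1/q) = (r ^ ?d) powr (- 1)" by (simp only: powr_add[symmetric])
 thus ?thesis using r by (simp only: powr_minus powr_one zero_less_power less_imp_le)
qed
have "bnd Om (r * l) q w (?c * N)"
 unfolding bnd_def
proof
 fix pv assume pv: "pv : C1c Om"
 define pv' where "pv' x = pv (inverse r *: x)" for x
 have pv': "pv' : C1c ((%x. r *: x) ` Om)" unfolding pv'_def[abs_def] using r by (intro Sc[OF pv]) auto
 have e: "pv = (%x. pv' (r *: x))" using r by (simp add: pv'_def)
 let ?F = "%x. Dl l u x *. Dl l pv' x"
 have Fm: "?F : bmeas borel" by (rule Cc_measurable[OF Cc_inner[OF Dl_Cc[OF u] Cc_cont[OF Dl_Cc[OF pv']]]])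
 have "dform (r * l) w pv = (LBINT x. r\<^sup>2 * ?F (r *: x))"
  unfolding w_def[abs_def] e Dlr[OF C1cD(1)[OF u]] Dlr[OF C1cD(1)[OF pv']] by (simp add: pow2 mult.assoc)
 also have "... = r^2 * inverse (r ^ ?d) * (LBINT x. ?F x)" using integral_scale[OF r Fm] r by simp
 also have "... <= r^2 * inverse (r ^ ?d) * (N * nrm q (Dl l pv'))" using r by (intro mul_l bndD[OF b pv']) auto
 also have "... = ?c * N * nrm q (Dl (r * l) pv)"
  unfolding e Dlr[OF C1cD(1)[OF pv']] using pq' by (subst nS[OF Dl_Cc[OF pv']]) (auto simp: rr[symmetric] pow2)
 finally show "dform (r * l) w pv <= ?c * N * nrm q (Dl (r * l) pv)" .
qed
hence "nrm p (Dl (r * l) w) <= K * (?c * N)" using c0 N by (intro infsupD[OF inf w]) auto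
hence "?c * nrm p (Dl l u) <= ?c * (K * N)"
 unfolding w_def[abs_def] Dlr[OF C1cD(1)[OF u]] using pq' by (subst (asm) nS[OF Dl_Cc[OF u]]) (auto simp: mult_ac)
thus "nrm p (Dl l u) <= K * N" using c0 by (simp only: mult_le_cancel_left_pos)
qed

section \<open>Exponents above two\<close>

lemma Cc_translate: assumes "f : Cc" shows "(%x. f (x - y)) : Cc"
proof -
obtain L where L: "compact L" "!!x. x ~: L ==> f x = 0" using Cc_support[OF assms] by blast
show ?thesis
proof (rule CcI)
 show "cont UNIV (%x. f (x - y))" by (intro cont_comp2[OF Cc_cont[OF assms]] cintro) auto
 show "compact ((%x. x + y) ` L)" by (intro compact_continuous_image cintro L)
 fix x assume "x ~: (%x. x + y) ` L"
 hence "x - y ~: L" by (metis diff_add_cancel image_eqI)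
 thus "f (x - y) = 0" by (rule L(2))
qed
qed

lemma nrm_translate:
fixes f :: "'a::euclidean_space => 'b::euclidean_space"
assumes "f : Cc" "p > 0" shows "nrm p (%x. f (x - y)) = nrm p f"
using mpres_integral[OF mpres_translate[of "- y"], of "%x. norm (f x) powr p"] Cc_measurable[OF Cc_norm_powr[OF assms]]
by (simp add: pn_def)

text \<open>The dual form of the bound of v - v(. - y) in L^p by |y| times the norm of the gradient:
  the correlation is a C^1 function of y whose gradient is bounded by Hoelder's inequality.\<close>

lemma correlation_Lipschitz:
fixes v G :: "'a::euclidean_space => real"
assumes pq: "conj_exp p q" and v: "v : C1c Om" and G: "G : Cc"
shows "abs ((LBINT x. G x * v (x - 0)) - (LBINT x. G x * v (x - y))) <= nrm p (grad v) * nrm q G * norm y"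
proof -
note pq' = conj_expD(1,2)[OF pq] and V = C1cD[OF v]
obtain Bu Bg where B: "!!x. abs (v x) <= Bu" "!!x. norm (grad v x) <= Bg" using Cc_bounded[OF V(2)] Cc_bounded[OF V(3)] by (metis real_norm_def)
note S = C1_comp_scale[OF V(1), of "-1"]
have d: "GDERIV (%y. LBINT x. G x * v (-1 *: (y - x))) y :> (LBINT x. G x *: (-1 *: grad v (-1 *: (y - x))))" for y
 by (rule conv_GDERIV[OF Cc_integrable[OF G] S(1), unfolded S(2), where B="max Bu Bg"]) (simp_all add: le_max_iff_disj B)
have n: "norm (LBINT x. G x *: (-1 *: grad v (-1 *: (y - x)))) <= nrm p (grad v) * nrm q G" for y
proof -
 have gt: "(%x. grad v (x - y)) : Cc" by (rule Cc_translate[OF V(3)])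
 have "norm (LBINT x. G x *: (-1 *: grad v (-1 *: (y - x)))) <= (LBINT x. norm (G x *: (-1 *: grad v (-1 *: (y - x)))))"
  by (rule integral_norm_bound)
 also have "... = (LBINT x. norm (grad v (x - y)) * norm (G x))" by (simp add: mult.commute)
 also have "... <= nrm p (%x. grad v (x - y)) * nrm q G"
  using Cc_measurable[OF gt] Cc_measurable[OF G] pq' by (intro holder_norm(2)[OF pq] Cc_int_powr[OF gt] Cc_int_powr[OF G]) auto
 finally show ?thesis using pq' by (simp add: nrm_translate[OF V(3)])
qed
have "norm ((LBINT x. G x * v (-1 *: (0 - x))) - (LBINT x. G x * v (-1 *: (y - x)))) <= nrm p (grad v) * nrm q G * norm (0 - y)"
proof (rule differentiable_bound[OF convex_UNIV])
 show "((%y. LBINT x. G x * v (-1 *: (y - x))) has_derivative (%h. h *. (LBINT x. G x *: (-1 *: grad v (-1 *: (y - x)))))) (at y)" for y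
  by (rule GDERIV_has_derivative[OF d])
 show "onorm (%h. h *. (LBINT x. G x *: (-1 *: grad v (-1 *: (y - x))))) <= nrm p (grad v) * nrm q G" for y
 proof (rule onorm_le)
  fix h :: 'a
  show "norm (h *. (LBINT x. G x *: (-1 *: grad v (-1 *: (y - x))))) <= nrm p (grad v) * nrm q G * norm h"
   using Cauchy_Schwarz_ineq2[of h "LBINT x. G x *: (-1 *: grad v (-1 *: (y - x)))"] mul_l[OF n[of y] norm_ge_zero[of h]]
   by (simp add: mult.commute)
 qed
qed auto
thus ?thesis by simp
qed

lemma mollifier_difference:
fixes v m :: "'a::euclidean_space => real"
assumes pq: "conj_exp p q" and v: "v : C1c Om" and m: "m : Cc" "!!x. m x >= 0" "(LBINT x. m x) = 1" "!!x. norm x >= h ==> m x = 0" and h: "h > 0"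
 and vm: "(%x. LBINT y. m y * v (x - y)) : Cc"
shows "nrm p (%x. v x - (LBINT y. m y * v (x - y))) <= h * nrm p (grad v)"
proof -
note pq' = conj_expD(1,2)[OF pq] and V = C1cD[OF v]
let ?vm = "%x. LBINT y. m y * v (x - y)"
have F: "(%x. v x - ?vm x) : Cc" by (rule Cc_diff[OF V(2) vm])
define G where "G x = dmap p (v x - ?vm x)" for x
have G: "G : Cc" unfolding G_def[abs_def] by (rule Cc_dmap[OF F pq'(1)])
obtain B where B: "B > 0" "!!x. abs (v x) <= B" using Cc_bounded[OF V(2)] by (metis real_norm_def)
have [measurable]: "v : bmeas borel" "m : bmeas borel" "G : bmeas borel"
 using Cc_measurable[OF V(2)] Cc_measurable[OF m(1)] Cc_measurable[OF G] by auto
have ip: "integrable lborel2 (%(x, y). G x * (m y * v (x - y)))"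
proof (rule integrable_bound[of _ "%z. B * (case z of (x, y) => abs (G x) * m y)"])
 show "integrable lborel2 (%z. B * (case z of (x, y) => abs (G x) * m y))"
  by (intro integrable_mult_right prod_integrable integrable_abs Cc_integrable G m(1))
 show "AE z in lborel2. norm (case z of (x, y) => G x * (m y * v (x - y))) <= norm (B * (case z of (x, y) => abs (G x) * m y))"
 proof (rule AE_I2, clarsimp simp: abs_mult)
  fix x y :: 'a
  have "(abs (G x) * abs (m y)) * abs (v (x - y)) <= (abs (G x) * abs (m y)) * B" by (intro mul_l B(2)) auto
  thus "abs (G x) * (abs (m y) * abs (v (x - y))) <= abs B * (abs (G x) * abs (m y))" using B(1) by (simp add: mult_ac)
 qed
qed measurable
let ?Ga = "%y. LBINT x. G x * v (x - y)"
have cG: "integ (%y. m y * ?Ga y)"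
 using lborel_pair.integrable_snd[OF ip] by (simp add: mult_ac flip: integral_mult_right_zero)
have "(LBINT x. G x * ?vm x) = (LBINT x. LBINT y. G x * (m y * v (x - y)))" by simp
also have "... = (LBINT y. LBINT x. G x * (m y * v (x - y)))" by (rule lborel_pair.Fubini_integral[OF ip, symmetric])
also have "... = (LBINT y. m y * ?Ga y)" by (simp add: mult_ac flip: integral_mult_right_zero)
finally have e: "(LBINT x. G x * ?vm x) = (LBINT y. m y * ?Ga y)" .
have "(LBINT x. (v x - ?vm x) *. G x) = (LBINT x. G x * v x - G x * ?vm x)" by (intro integral_cong) (auto simp: asimps)
also have "... = ?Ga 0 - (LBINT y. m y * ?Ga y)"
 unfolding e[symmetric] by (subst integral_diff[OF Cc_integrable[OF Cc_times[OF G Cc_cont[OF V(2)]]] Cc_integrable[OF Cc_times[OF G Cc_cont[OF vm]]]]) simp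
also have "... = (LBINT y. m y * (?Ga 0 - ?Ga y))" using cG Cc_integrable[OF m(1)] m(3) by (simp add: right_diff_distrib)
also have "... <= (LBINT y. m y * (nrm p (grad v) * nrm q G * h))"
proof (rule integral_mono)
 show "integ (%y. m y * (?Ga 0 - ?Ga y))" using cG Cc_integrable[OF m(1)] by (simp add: right_diff_distrib)
 show "integ (%y. m y * (nrm p (grad v) * nrm q G * h))" using Cc_integrable[OF m(1)] by simp
 fix y
 show "m y * (?Ga 0 - ?Ga y) <= m y * (nrm p (grad v) * nrm q G * h)"
 proof (cases "norm y >= h")
  case False
  hence "nrm p (grad v) * nrm q G * norm y <= nrm p (grad v) * nrm q G * h" by (intro mul_l) auto
  thus ?thesis using correlation_Lipschitz[OF pq v G, of y] m(2)[of y] by (intro mul_l) auto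
 qed (use m(4) in simp)
qed
also have "... = h * nrm p (grad v) * nrm q G" using m(3) by simp
finally show ?thesis using h unfolding G_def[abs_def] by (intro nrm_le_dual[OF pq F]) auto
qed

text \<open>The truncated function v is split into v - m * v and m * v for a mollifier m of radius
  h. The first part costs h times the gradient; the second is bounded pointwise by the L^2 norm of v
  through Cauchy-Schwarz and has bounded support.\<close>

lemma Lp_interpolation:
assumes pq: "conj_exp p q" and pd: "p < real DIM('a::euclidean_space)" and rh: "rh > 0" and dr: "dr > 0"
shows "EX C>=0. ALL u:C1c (UNIV :: 'a set). nrm p (%x. bump 0 rh x * u x) <= dr * nrm p (grad u) + C * nrm 2 (%x. bump 0 rh x * u x)"
proof -
note pq' = conj_expD(1,2)[OF pq]
have c22: "conj_exp 2 2" by (simp add: conj_exp_def)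
let ?b = "bump (0::'a) rh"
\<comment> \<open>Q bounds the gradient of the truncated function by that of u: 6 /
  \<open>rh\<close> bounds the gradient of the bump, three times the bump of doubled radius is at
  least 1 on its support, and Hardy's inequality with p < d handles that larger bump.\<close>
define Q where "Q = 1 + 6 / rh * 3 * hc TYPE('a) p (2 * rh)"
have Q1: "Q >= 1" using pq' pd rh by (auto simp: Q_def hc_def)
define h where "h = dr / Q"
have h0: "h > 0" using Q1 dr by (simp add: h_def)
obtain m :: "'a => real" where m: "!!x. m x >= 0" "!!x. norm x >= h ==> m x = 0" "(LBINT x. m x) = 1" "m : C1c UNIV"
 using mollifier_exists[OF h0] by metis
have mC: "m : Cc" by (rule C1cD(2)[OF m(4)])
define L where "L = measure lborel (cball (0::'a) (rh + h)) powr (1/p)"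
show ?thesis
proof (intro exI[of _ "nrm 2 m * L"] conjI ballI)
 show "0 <= nrm 2 m * L" by (simp add: L_def)
 fix u :: "'a => real" assume u: "u : C1c UNIV"
 note U = C1cD[OF u]
 have v: "(%x. ?b x * u x) : C1c UNIV" by (rule C1c_mult[OF u bump_C1(1)])
 define v where "v x = ?b x * u x" for x
 have v: "v : C1c UNIV" using v by (simp add: v_def[abs_def])
 note V = C1cD[OF v]
 let ?vm = "%x. LBINT y. m y * v (x - y)"
 have v0: "v x = 0" if "norm x >= rh" for x using bump_bounds(3)[OF rh, of x 0] that by (simp add: v_def)
 obtain B where B: "!!x. norm (v x) <= B" using Cc_bounded[OF V(2)] by blast
 have vm0: "?vm x = 0" if x: "x ~: cball 0 (rh + h)" for x
 proof -
  have "m y * v (x - y) = 0" for y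
  proof (cases "norm y >= h")
   case False
   hence "norm (x - y) >= rh" using x norm_triangle_ineq2[of x y] by simp
   thus ?thesis using v0 by simp
  qed (use m(2) in simp)
  hence "(%y. m y * v (x - y)) = (%y. 0)" by (rule ext)
  thus ?thesis by (simp only: integral_zero)
 qed
 have vmC: "?vm : Cc"
  using conv_cont[OF Cc_integrable[OF mC] Cc_cont[OF V(2)] B] vm0 by (intro CcI[of _ "cball 0 (rh + h)"]) auto
 have vmb: "norm (?vm x) <= nrm 2 m * nrm 2 v" for x
 proof -
  have rv: "(%y. v (x - y)) : Cc"
  proof (rule CcI)
   show "cont UNIV (%y. v (x - y))" by (intro cont_comp2[OF Cc_cont[OF V(2)]] cintro) auto
   fix y assume "y ~: cball x rh" thus "v (x - y) = 0" by (intro v0) (simp add: dist_norm)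
  qed simp
  have "nrm 2 (%y. v (x - y)) = nrm 2 v"
   using mpres_integral[OF mpres_uminus[of x], of "%x. norm (v x) powr 2"] Cc_measurable[OF Cc_norm_powr[OF V(2), of 2]] by (simp add: pn_def)
  thus ?thesis using Cc_holder[OF c22 mC rv] by simp
 qed
 have "nrm p v <= nrm p (%x. (v x - ?vm x) + ?vm x)" by simp
 also have "... <= nrm p (%x. v x - ?vm x) + nrm p ?vm" using pq' by (intro Cc_triangle Cc_diff V(2) vmC) auto
 also have "... <= h * nrm p (grad v) + nrm 2 m * nrm 2 v * L"
  unfolding L_def using pq' vm0 vmb
  by (intro add_mono mollifier_difference[OF pq v mC m(1) m(3) m(2) h0 vmC] nrm_bounded_support) auto
 also have "nrm p (grad v) <= Q * nrm p (grad u)"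
 proof -
  have gv: "grad v = (%x. ?b x *: grad u x + u x *: grad ?b x)"
   using C1_mult(2)[OF bump_C1(1) U(1), of 0 rh] by (simp add: v_def[abs_def])
  have "nrm p (grad v) <= nrm p (%x. ?b x *: grad u x) + nrm p (%x. u x *: grad ?b x)"
   unfolding gv using pq' by (intro Cc_triangle Cc_mult U(3) C1_cont bump_C1 Cc_scaleR_left[OF U(2)] C1_cont_grad) auto
  also have "nrm p (%x. ?b x *: grad u x) <= nrm p (grad u)"
   using pq' by (intro Cc_pn_mono U(3)) (auto intro!: mult_left_le_one_le simp: abs_of_nonneg bump_bounds(1,2)[OF rh])
  also have "nrm p (%x. u x *: grad ?b x) <= nrm p (%x. (6 / rh * 3) *: (bump 0 (2 * rh) x * u x))"
  proof (rule Cc_pn_mono[OF _ Cc_scaleR[OF Cc_times'[OF U(2) C1_cont[OF bump_C1(1)]]]])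
   fix x
   have "norm (grad ?b x) <= 6 / rh * 3 * bump 0 (2 * rh) x"
   proof (cases "norm x < rh")
    case True
    hence "27/64 <= bump 0 (2 * rh) x" using bump_ge_half[of x 0 "2 * rh"] rh by simp
    hence "6 / rh * 1 <= 6 / rh * (3 * bump 0 (2 * rh) x)" using rh by (intro mul_l) (auto simp: power3_eq_cube)
    thus ?thesis using bump_bounds(5)[OF rh, of 0 x] by simp
   next
    case False
    thus ?thesis using bump_bounds(7)[OF rh, of x 0] bump_bounds(1)[of "2*rh" 0 x] rh by simp
   qed
   thus "norm (u x *: grad ?b x) <= norm ((6 / rh * 3) *: (bump 0 (2 * rh) x * u x))"
    using mul_l[of "norm (grad ?b x)" "6 / rh * 3 * bump 0 (2 * rh) x" "abs (u x)"] bump_bounds(1)[of "2*rh" 0 x] rh by (simp add: abs_mult mult_ac)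
  qed (use pq' in simp)
  also have "... = 6 / rh * 3 * nrm p (%x. bump 0 (2 * rh) x * u x)" using pq' rh by (subst pn_scaleR) auto
  also have "... <= 6 / rh * 3 * (hc TYPE('a) p (2 * rh) * nrm p (grad u))"
   using rh by (intro mul_l hardy_bump[OF conj_exp_sym[OF pq] pd u]) auto
  finally show ?thesis by (simp add: Q_def asimps)
 qed
 also have "h * (Q * nrm p (grad u)) = dr * nrm p (grad u)" using Q1 by (simp add: h_def)
 finally show "nrm p (%x. ?b x * u x) <= dr * nrm p (grad u) + nrm 2 m * L * nrm 2 (%x. ?b x * u x)"
  using h0 by (simp add: v_def[abs_def] mult_ac)
qed
qed

text \<open>Hoelder with 1/q = 1/2 + 1/s, where s = 2q/(2-q), carried out for q-th powers with the
  exponents 2/(2-q) and 2/q. The condition on a makes the weight lie in L^s.\<close>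

lemma weighted_Holder:
fixes F :: "'a::euclidean_space => 'b::euclidean_space"
assumes q: "1 < q" "q < 2" and a: "a * (2 * q / (2 - q)) > real DIM('a)" and F: "F : Cc"
shows "nrm q (%x. jw a x *: F x) <= ((LBINT x. jw (a * (2 * q / (2 - q))) (x::'a)) powr ((2 - q) / 2)) powr (1/q) * nrm 2 F"
proof -
have rr: "conj_exp (2 / (2 - q)) (2 / q)" using q by (simp add: conj_exp_def field_simps)
let ?f = "%x::'a. jw a x powr q" and ?g = "%x. norm (F x) powr q"
have jc: "cont UNIV (jw s :: 'a => real)" for s by (rule C1_cont[OF jw_C1(1)])
have f: "norm (?f x) powr (2 / (2 - q)) = jw (a * (2 * q / (2 - q))) x" for x
 by (simp add: jw_powr mult_ac)
have g: "norm (?g x) powr (2 / q) = norm (F x) powr 2" for x using q by (simp add: powr_powr)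
have fi: "integ (%x. norm (?f x) powr (2 / (2 - q)))"
 unfolding f using decay_integrable[OF a] by (simp add: jw_def)
have gi: "integ (%x. norm (?g x) powr (2 / q))" unfolding g by (rule Cc_int_powr[OF F]) simp
have Fm: "F : bmeas borel" by (rule Cc_measurable[OF F])
have jm: "jw a : bmeas (borel :: 'a measure)" by (rule cont_bmeas[OF jc])
have "(LBINT x. norm (?f x) * norm (?g x)) <= pn lborel (2 / (2 - q)) ?f * pn lborel (2 / q) ?g"
 using Fm jm by (intro holder_norm(2)[OF rr] fi gi) auto
also have "pn lborel (2 / (2 - q)) ?f = (LBINT x. jw (a * (2 * q / (2 - q))) (x::'a)) powr ((2 - q) / 2)"
 unfolding pn_def f using q by simp
also have "pn lborel (2 / q) ?g = nrm 2 F powr q" unfolding pn_def g using q by (simp add: powr_powr)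
finally have "(LBINT x. norm (jw a x *: F x) powr q) <= (LBINT x. jw (a * (2 * q / (2 - q))) (x::'a)) powr ((2 - q) / 2) * nrm 2 F powr q"
 by (simp add: powr_mult)
hence "nrm q (%x. jw a x *: F x) <= ((LBINT x. jw (a * (2 * q / (2 - q))) (x::'a)) powr ((2 - q) / 2) * nrm 2 F powr q) powr (1/q)"
 unfolding pn_def[of _ q] using q by (intro powr_mono2 integral_nonneg_AE) auto
thus ?thesis using q by (simp add: powr_mult powr_powr)
qed

text \<open>Testing with \<open>u w\<^sup>2\<close>, where \<open>w\<close> decays fast enough for \<open>u w\<^sup>2\<close> to be controlled in the dual norm, and
  slowly enough for Hardy's inequality to absorb \<open>u\<^sup>2 |grad w|\<^sup>2\<close>; both are possible exactly because \<open>p < d\<close>.\<close>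

lemma weighted_energy:
assumes pq: "conj_exp p q" and p2: "p > 2" and pd: "p < real DIM('a::euclidean_space)" and rh: "rh > 0"
shows "EX C>=0. ALL (Om::'a set) l u N. u : C1c Om --> N >= 0 --> bnd Om l q u N --> nrm 2 (%x. bump 0 rh x * u x) <= C * N"
proof -
let ?d = "real DIM('a)"
note pq' = conj_expD(1,2)[OF pq]
have c22: "conj_exp 2 2" by (simp add: conj_exp_def)
have d2: "2 < ?d" using p2 pd by simp
have q: "1 < q" "q < 2"
proof -
 have "1/p < 1/2" using p2 by (intro divide_strict_left_mono) auto
 moreover have "1/p + 1/q = 1" using pq by (simp add: conj_exp_def)
 ultimately have "1/q > 1/2" by linarith
 thus "q < 2" using pq' by (simp add: field_simps)
qed (use pq' in simp)
\<comment> \<open>Expressed in p, the integrability condition on the weight reads a > d (p-2) /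
  (2p).\<close>
have sq: "2 * q / (2 - q) = 2 * p / (p - 2)"
proof -
 have "p * q = p + q" using conj_expD(5)[OF pq] by simp
 thus ?thesis using p2 q by (simp add: field_simps)
qed
\<comment> \<open>The midpoint of the admissible interval. The lower end comes from integrability of
  the weight, the upper end (d-2)/2 from absorption by Hardy's inequality with exponent 2; the
  interval is nonempty precisely for p < d.\<close>
define a where "a = (?d * (p - 2) / (2 * p) + (?d - 2) / 2) / 2"
have lt: "?d * (p - 2) / (2 * p) < (?d - 2) / 2" using pd p2 by (simp add: field_simps)
have a1: "?d * (p - 2) / (2 * p) < a" "a < (?d - 2) / 2"
proof -
 have "x < (x + y) / 2 & (x + y) / 2 < y" if "x < y" for x y :: real using that by simp
 from this[OF lt] show "?d * (p - 2) / (2 * p) < a" "a < (?d - 2) / 2" unfolding a_def by blast+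
qed
have a0: "a > 0" using a1(1) p2 d2 by (intro le_less_trans[OF _ a1(1)]) auto
have a2: "a * (2 * q / (2 - q)) > ?d" unfolding sq using a1(1) p2 by (simp add: field_simps)
define ka where "ka = 1 - (a * (2 / (?d - 2)))^2"
have a3: "a * (2 / (?d - 2)) < 1" "0 < a * (2 / (?d - 2))" using a1(2) a0 d2 by (auto simp: field_simps)
have ka: "ka > 0" using a3 power_strict_mono[of "a * (2 / (?d - 2))" 1 2] by (simp add: ka_def)
define W where "W = ((LBINT x. jw (a * (2 * q / (2 - q))) (x::'a)) powr ((2 - q) / 2)) powr (1/q)"
have W0: "W >= 0" by (simp add: W_def)
have H0: "hc TYPE('a) 2 rh >= 0" using d2 by (auto simp: hc_def)
define R where "R = (1 + rh^2) powr (a/2)"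
show ?thesis
proof (intro exI[of _ "R * (hc TYPE('a) 2 rh * (2 * W / ka))"] conjI allI impI)
 show "0 <= R * (hc TYPE('a) 2 rh * (2 * W / ka))" using ka W0 H0 by (simp add: R_def)
 fix Om :: "'a set" and l N :: real and u assume u: "u : C1c Om" and N: "N >= 0" and b: "bnd Om l q u N"
 note U = C1cD[OF u]
 define v where "v x = jw a x * u x" for x
 have v: "v : C1c Om" unfolding v_def[abs_def] by (rule C1c_mult[OF u jw_C1(1)])
 note V = C1cD[OF v]
 have z: "(%x. jw a x * v x) : C1c Om" by (rule C1c_mult[OF v jw_C1(1)])
 let ?Y = "nrm 2 (Dl l v)"
 have gY: "nrm 2 (grad v) <= ?Y" using norm_Dl_ge(1) by (intro Cc_pn_mono Dl_Cc[OF v]) auto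
 have jv: "(%x. jw 1 x * v x) : Cc" by (rule Cc_times'[OF V(2) C1_cont[OF jw_C1(1)]])
 have hY: "nrm 2 (%x. jw 1 x * v x) <= 2 / (?d - 2) * ?Y"
  using hardy[OF c22 d2 v] mul_l[OF gY, of "2 / (?d - 2)"] d2 by simp
 have gj: "norm (grad (jw a) x) <= a * jw (a + 1) x" for x :: 'a
  using norm_jw[of x "a + 2"] a0 by (simp add: jw_C1(2) mult.commute mul_l add.commute[of a])
 have sq2: "nrm 2 f powr 2 = (nrm 2 f)^2" for f :: "'a => 'b::euclidean_space" by simp
 have p22: "(LBINT x. (norm (f x))\<^sup>2) = (nrm 2 f)^2" for f :: "'a => 'b::euclidean_space"
  using pn_powr[of 2 lborel f] by simp
 \<comment> \<open>With w = jw(a) and v = w u, the integrand of the form tested with w^2 u is |Dl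
   v|^2 - u^2 |grad w|^2 exactly; the cross terms cancel.\<close>
 have pt: "(norm (Dl l v x))^2 - a^2 * (norm (jw 1 x * v x))^2 <= Dl l u x *. Dl l (%x. jw a x * v x) x" for x
 proof -
  have gv: "grad v = (%x. jw a x *: grad u x + u x *: grad (jw a) x)" using C1_mult(2)[OF jw_C1(1) U(1)] by (simp add: v_def[abs_def])
  have gz: "grad (%x. jw a x * v x) = (%x. jw a x *: grad v x + v x *: grad (jw a) x)" using C1_mult(2)[OF jw_C1(1) V(1)] .
  have "Dl l u x *. Dl l (%x. jw a x * v x) x = (norm (Dl l v x))^2 - (u x)^2 * (norm (grad (jw a) x))^2"
   unfolding power2_norm_eq_inner Dl_inner gz gv
   by (simp add: v_def inner_add_left inner_add_right inner_commute pow2 asimps)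
  moreover have "(u x)^2 * (norm (grad (jw a) x))^2 <= (u x)^2 * (a * jw (a + 1) x)^2"
   using gj[of x] by (intro mul_l power_mono) auto
  moreover have "(u x)^2 * (a * jw (a + 1) x)^2 = a^2 * (norm (jw 1 x * v x))^2"
   by (simp add: v_def power_mult_distrib jw_add[symmetric] mult_ac)
  ultimately show ?thesis by linarith
 qed
 have "ka * ?Y^2 <= ?Y^2 - a^2 * (nrm 2 (%x. jw 1 x * v x))^2"
 proof -
  have "(nrm 2 (%x. jw 1 x * v x))^2 <= (2 / (?d - 2) * ?Y)^2" using hY by (intro power_mono) auto
  hence "a^2 * (nrm 2 (%x. jw 1 x * v x))^2 <= a^2 * (2 / (?d - 2) * ?Y)^2" by (rule mul_l) simp
  moreover have "a^2 * (2 / (?d - 2) * ?Y)^2 = (a * (2 / (?d - 2)))^2 * ?Y^2" by (simp only: power_mult_distrib mult.assoc)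
  ultimately show ?thesis by (simp add: ka_def left_diff_distrib)
 qed
 also have "... = (LBINT x. (norm (Dl l v x))\<^sup>2 - a^2 * (norm (jw 1 x * v x))^2)"
 proof -
  have "integ (%x. (norm (Dl l v x))\<^sup>2)" "integ (%x. (norm (jw 1 x * v x))\<^sup>2)"
   using Cc_int_powr[OF Dl_Cc[OF v], of 2 l] Cc_int_powr[OF jv, of 2] by simp_all
  thus ?thesis unfolding p22[symmetric] by simp
 qed
 also have "... <= dform l u (%x. jw a x * v x)"
 proof (rule integral_mono[OF _ Dl_inner_integrable[OF u z] pt])
  show "integ (%x. (norm (Dl l v x))\<^sup>2 - a^2 * (norm (jw 1 x * v x))^2)"
   using Cc_int_powr[OF Dl_Cc[OF v], of 2 l] Cc_int_powr[OF jv, of 2] by simp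
 qed
 also have "... <= N * nrm q (Dl l (%x. jw a x * v x))" by (rule bndD[OF b z])
 also have "nrm q (Dl l (%x. jw a x * v x)) <= 2 * W * ?Y"
 proof -
  have w2: "(%x. (v x *: grad (jw a) x, 0::real)) : Cc" by (intro Cc_Pair Cc_scaleR_left V(2) C1_cont_grad jw_C1 Cc_zero)
  have "nrm q (Dl l (%x. jw a x * v x)) <= nrm q (%x. jw a x *: Dl l v x) + nrm q (%x. (v x *: grad (jw a) x, 0::real))"
   unfolding Dl_mult[OF V(1) jw_C1(1)] using q by (intro Cc_triangle w2 Cc_mult Dl_Cc[OF v] C1_cont jw_C1) auto
  also have "nrm q (%x. (v x *: grad (jw a) x, 0::real)) <= nrm q (%x. a *: (jw a x *: (jw 1 x * v x)))"
  proof (rule Cc_pn_mono)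
   show "(%x. a *: (jw a x *: (jw 1 x * v x))) : Cc" by (intro Cc_scaleR Cc_mult jv C1_cont jw_C1)
   show "norm (v x *: grad (jw a) x, 0::real) <= norm (a *: (jw a x *: (jw 1 x * v x)))" for x
    using mul_l[OF gj[of x], of "abs (v x)"] a0 by (simp add: norm_Pair abs_mult jw_add[symmetric] mult_ac)
  qed (use q in simp)
  also have "... = a * nrm q (%x. jw a x *: (jw 1 x * v x))" using q a0 by (subst pn_scaleR) auto
  also have "nrm q (%x. jw a x *: Dl l v x) + a * nrm q (%x. jw a x *: (jw 1 x * v x)) <= W * ?Y + a * (W * (2 / (?d - 2) * ?Y))"
   using a0 W0 unfolding W_def
   by (intro add_mono mul_l weighted_Holder[OF q a2 Dl_Cc[OF v]] order_trans[OF weighted_Holder[OF q a2 jv]] hY) auto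
  also have "... = (1 + a * (2 / (?d - 2))) * (W * ?Y)" by (simp only: ring_distribs mult_1_left mult_1_right mult_ac)
  also have "... <= 2 * (W * ?Y)" using a3 W0 by (intro mul_r) auto
  finally show ?thesis by simp
 qed
 finally have "ka * ?Y^2 <= N * (2 * W * ?Y)" using N by (simp add: mul_l)
 hence Y: "?Y <= 2 * W / ka * N"
 proof (cases "?Y = 0")
  case False
  hence y: "?Y > 0" using pn_nonneg[of lborel 2 "Dl l v"] by linarith
  assume "ka * ?Y^2 <= N * (2 * W * ?Y)"
  hence "?Y * (ka * ?Y) <= ?Y * (N * (2 * W))" by (simp only: pow2 mult_ac)
  hence "ka * ?Y <= N * (2 * W)" using y by (simp only: mult_le_cancel_left_pos)
  thus ?thesis using ka by (simp add: field_simps)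
 qed (use W0 N ka in simp)
 have "nrm 2 (%x. bump 0 rh x * u x) <= nrm 2 (%x. R *: (bump 0 rh x * v x))"
 proof (rule Cc_pn_mono)
  show "(%x. R *: (bump 0 rh x * v x)) : Cc" by (intro Cc_scaleR Cc_times'[OF V(2)] C1_cont bump_C1)
  show "norm (bump 0 rh x * u x) <= norm (R *: (bump 0 rh x * v x))" for x
  proof (cases "norm x < rh")
   case True
   hence "(1 + (norm x)^2) powr (a/2) <= R" unfolding R_def using a0 by (intro powr_mono2 add_left_mono power_mono) auto
   moreover have "(1 + (norm x)^2) powr (a/2) * jw a x = 1" by (simp add: jw_def flip: powr_add)
   ultimately have "1 <= R * jw a x" using mul_r[of "(1 + (norm x)^2) powr (a/2)" R "jw a x"] by simp
   hence "abs (bump 0 rh x * u x) * 1 <= abs (bump 0 rh x * u x) * (R * jw a x)" by (intro mul_l) auto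
   thus ?thesis by (simp add: v_def abs_mult R_def mult_ac)
  qed (use bump_bounds(3)[OF rh, of x 0] in simp)
 qed simp
 also have "... = R * nrm 2 (%x. bump 0 rh x * v x)" by (subst pn_scaleR) (auto simp: R_def)
 also have "... <= R * (hc TYPE('a) 2 rh * (2 * W / ka * N))"
  using H0 by (intro mul_l order_trans[OF hardy_bump[OF c22 d2 v rh]] order_trans[OF gY Y]) (auto simp: R_def)
 finally show "nrm 2 (%x. bump 0 rh x * u x) <= R * (hc TYPE('a) 2 rh * (2 * W / ka)) * N" by (simp add: mult.assoc)
qed
qed

text \<open>For p = 2 testing with u itself suffices. For p > 2 the lower-order term is interpolated
  between a small multiple of the gradient, absorbed on the left, and the local L^2 norm, which
  \<open>weighted_energy\<close> bounds by N.\<close>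

lemma infsup_ge2:
assumes pq: "conj_exp p q" and p2: "p >= 2" and pd: "p < real DIM('a::euclidean_space)" and rh: "rh > 0" and C: "C >= 0"
shows "EX K>=0. ALL Om::'a set. LOCal Om p q C rh --> (ALL l>=0. infsup Om l p q K)"
proof (cases "p = 2")
case True
hence q2: "q = 2" using pq by (simp add: conj_exp_def field_simps)
have "infsup Om l 2 2 1" for Om :: "'a set" and l
 unfolding infsup_def
proof (intro ballI allI impI)
 fix u and N :: real assume u: "u : C1c Om" and N: "0 <= N" and b: "bnd Om l 2 u N"
 have e: "dmap 2 y = y" for y :: "'a \<times> real" by (cases "y = 0") (auto simp: dmap_def)
 have "conj_exp 2 2" by (simp add: conj_exp_def)
 thus "nrm 2 (Dl l u) <= 1 * N" using nrm_le_dual[OF _ Dl_Cc[OF u] N] bndD[OF b u] by (simp add: e)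
qed
thus ?thesis using True q2 by (intro exI[of _ 1]) auto
next
case False
hence p2: "p > 2" using p2 by simp
note pq' = conj_expD(1,2)[OF pq]
define dr where "dr = 1 / (2 * C + 2)"
have dr: "dr > 0" "C * dr <= 1/2" using C by (auto simp: dr_def field_simps)
obtain C1 where C1: "C1 >= 0" "!!u::'a => real. u : C1c UNIV ==> nrm p (%x. bump 0 rh x * u x) <= dr * nrm p (grad u) + C1 * nrm 2 (%x. bump 0 rh x * u x)"
 using Lp_interpolation[OF pq pd rh dr(1)] by blast
obtain C2 where C2: "C2 >= 0" "!!(Om::'a set) l u N. u : C1c Om ==> N >= 0 ==> bnd Om l q u N ==> nrm 2 (%x. bump 0 rh x * u x) <= C2 * N"
 using weighted_energy[OF pq p2 pd rh] by blast
show ?thesis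
proof (intro exI[of _ "2 * C * (1 + C1 * C2)"] conjI allI impI)
 show "0 <= 2 * C * (1 + C1 * C2)" using C C1 C2 by simp
 fix Om :: "'a set" and l :: real assume L: "LOCal Om p q C rh" and l: "l >= 0"
 show "infsup Om l p q (2 * C * (1 + C1 * C2))"
  unfolding infsup_def
 proof (intro ballI allI impI)
  fix u N assume u: "u : C1c Om" and N: "(0::real) <= N" and b: "bnd Om l q u N"
  let ?X = "nrm p (Dl l u)"
  have gX: "nrm p (grad u) <= ?X" using pq' norm_Dl_ge(1) by (intro Cc_pn_mono Dl_Cc[OF u]) auto
  have "nrm p (%x. bump 0 rh x * u x) <= dr * ?X + C1 * (C2 * N)"
   using C1(2)[OF C1c_mono[OF u subset_UNIV]] mul_l[OF gX, of dr] mul_l[OF C2(2)[OF u N b] C1(1)] dr(1) by linarith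
  hence "?X <= C * (N + (dr * ?X + C1 * (C2 * N)))"
   using L l u N b C unfolding LOCal_def by (meson add_left_mono mul_l order_trans)
  also have "... = (C * dr) * ?X + C * (1 + C1 * C2) * N" by (simp add: asimps)
  also have "(C * dr) * ?X <= 1/2 * ?X" by (rule mul_r[OF dr(2)]) simp
  finally show "?X <= 2 * C * (1 + C1 * C2) * N" by simp
 qed
qed
qed

section \<open>Exponents below two, by duality\<close>

text \<open>The parallelogram law for squares, the superadditivity of s^(q/2) and then its
  convexity, both of which hold because q/2 >= 1.\<close>

lemma clarkson:
fixes a b :: "'b::euclidean_space"
assumes q: "q >= 2"
shows "norm ((1/2) *: (a + b)) powr q + norm ((1/2) *: (a - b)) powr q <= 1/2 * (norm a powr q + norm b powr q)"
proof -
have pw: "norm z powr q = ((norm z)^2) powr (q/2)" for z :: 'b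
 using powr_powr[of "norm z" 2 "q/2"] by simp
let ?X = "(norm ((1/2) *: (a + b)))^2" and ?Y = "(norm ((1/2) *: (a - b)))^2"
have s: "?X + ?Y = 1/2 * (norm a)^2 + (1 - 1/2) * (norm b)^2"
 unfolding power2_norm_eq_inner by (simp add: inner_add_left inner_add_right inner_diff_left inner_diff_right inner_commute field_simps)
have m: "x powr (q/2) <= x * (?X + ?Y) powr (q/2 - 1)" if "0 <= x" "x <= ?X + ?Y" for x
proof -
 have "x powr (q/2) = x * x powr (q/2 - 1)" using powr_mult_base[of x "q/2 - 1"] that by simp
 thus ?thesis using that q by (simp add: mul_l powr_mono2)
qed
have "?X powr (q/2) + ?Y powr (q/2) <= (?X + ?Y) * (?X + ?Y) powr (q/2 - 1)"
 using m[of ?X] m[of ?Y] by (simp add: distrib_right)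
also have "... = (?X + ?Y) powr (q/2)" using powr_mult_base[of "?X + ?Y" "q/2 - 1"] by simp
also have "... <= 1/2 * ((norm a)^2) powr (q/2) + (1 - 1/2) * ((norm b)^2) powr (q/2)"
 unfolding s using q by (intro powr_convex_comb) auto
finally show ?thesis unfolding pw by simp
qed

lemma clarkson_nrm:
fixes f h :: "'a::euclidean_space => 'b::euclidean_space"
assumes q: "q >= 2" and f: "f : Cc" and h: "h : Cc"
shows "nrm q (%x. (1/2) *: (f x + h x)) powr q + nrm q (%x. (1/2) *: (f x - h x)) powr q <= 1/2 * (nrm q f powr q + nrm q h powr q)"
proof -
have i: "integ (%x. norm (F x) powr q)" if "F : Cc" for F :: "'a => 'b" using Cc_int_powr[OF that] q by simp
note c = i[OF Cc_scaleR[OF Cc_add[OF f h]], of "1/2"] i[OF Cc_scaleR[OF Cc_diff[OF f h]], of "1/2"] i[OF f] i[OF h]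
have "(LBINT x. norm ((1/2) *: (f x + h x)) powr q + norm ((1/2) *: (f x - h x)) powr q) <= (LBINT x. 1/2 * (norm (f x) powr q + norm (h x) powr q))"
 using c by (intro integral_mono clarkson q integrable_add integrable_mult_right)
hence "(LBINT x. norm ((1/2) *: (f x + h x)) powr q) + (LBINT x. norm ((1/2) *: (f x - h x)) powr q)
  <= 1/2 * ((LBINT x. norm (f x) powr q) + (LBINT x. norm (h x) powr q))"
 by (simp only: integral_add[OF c(1,2)] integral_add[OF c(3,4)] integral_mult_right_zero)
moreover have "q > 0" using q by simp
ultimately show ?thesis by (simp only: pn_powr)
qed

lemma C1c_zero: "(%x. 0) : C1c Om"
by (rule C1cI[OF C1_const(1), of "{}"]) auto

text \<open>Perturbing a near minimizer \<open>v\<close> of \<open>SUP pv. B v pv - ga v - n pv powr q / q\<close> in the direction \<open>w\<close> changes the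
  near maximizer \<open>pv\<close> only slightly, by uniform convexity; so \<open>B w pv - ga w\<close> is nearly nonnegative for every \<open>w\<close>.\<close>

lemma near_representation:
fixes Om :: "'a::euclidean_space set"
assumes pq: "conj_exp p q" and q: "q >= 2" and inf': "infsup Om l p q K" and K: "K >= 0" and h: "h : Cc" and ep: "ep > 0"
shows "EX pv:C1c Om. ALL w:C1c Om. nrm p (Dl l w) <= 1 --> dform l w pv - (LBINT x. Dl l w x *. h x) >= - ep"
proof -
note pq' = conj_expD(1,2)[OF pq]
have p1: "p >= 1" "p > 0" "q > 0" using pq' by auto
define V where "V = C1c Om"
define f :: "('a => real) => real => ('a => real) => 'a => real" where "f v t w = (%x. v x + t * w x)" for v t w
define z :: "'a => real" where "z = (%x. 0)"
define m n where "m v = nrm p (Dl l v)" and "n v = nrm q (Dl l v)" for v :: "'a => real"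
define B where "B v pv = dform l v pv" for v pv :: "'a => real"
define ga where "ga v = (LBINT x. Dl l v x *. h x)" for v
define g where "g = nrm q h"
have V: "z : V" "v : V ==> w : V ==> f v t w : V" for v w t
 unfolding V_def f_def z_def by (auto intro: C1c_zero C1c_add C1c_cmult)
have D: "Dl l v : Cc" if "v : V" for v using Dl_Cc that by (auto simp: V_def)
have Dz: "Dl l z = (%x. 0)" by (simp add: z_def Dl_def[abs_def] C1_const(2) zero_prod_def)
have Df: "Dl l (f v t w) = (%x. Dl l v x + t *: Dl l w x)" if "v : V" "w : V" for v w t
 using that Dl_add[OF C1cD(1) C1cD(1)[OF C1c_cmult], of v Om w Om l t] Dl_cmult[OF C1cD(1), of w Om l t] by (simp add: V_def f_def)
have lin: "(LBINT x. Dl l (f v t w) x *. k x) = (LBINT x. Dl l v x *. k x) + t * (LBINT x. Dl l w x *. k x)"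
 if "v : V" "w : V" "k : Cc" for v w t k
 unfolding Df[OF that(1,2)] using Cc_integrable[OF Cc_inner[OF D Cc_cont]] that by (simp add: inner_add_left)
have Bl: "B (f v t w) pv = B v pv + t * B w pv" if "v : V" "w : V" "pv : V" for v w t pv
 unfolding B_def using that by (intro lin D)
have Bs: "B v pv = B pv v" for v pv by (simp add: B_def inner_commute)
have Br: "B v (f pv t xi) = B v pv + t * B v xi" if "v : V" "pv : V" "xi : V" for v pv t xi
 using Bl[OF that(2,3,1)] by (simp add: Bs)
have Z: "B z pv = 0" "B v z = 0" "ga z = 0" and n0: "n z = 0" for v pv using p1 by (simp_all add: B_def ga_def n_def Dz)
have Bb: "abs (B v pv) <= m v * n pv" if "v : V" "pv : V" for v pv
 unfolding B_def m_def n_def using that by (intro Cc_holder[OF pq] D)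
have G: "v : V ==> w : V ==> ga (f v t w) = ga v + t * ga w" "v : V ==> abs (ga v) <= m v * g" "g >= 0" for v w t
 unfolding ga_def m_def g_def by (auto intro: lin h Cc_holder[OF pq] D)
have m: "m v >= 0" "v : V ==> w : V ==> m (f v t w) <= m v + abs t * m w" for v w t
 using Cc_triangle[OF p1(1) D Cc_scaleR[OF D]] unfolding m_def pn_scaleR[OF p1(2)] by (simp_all add: Df)
have n: "n v >= 0" "v : V ==> n (f z t v) = abs t * n v" for v t
 using pn_scaleR[OF p1(3)] by (simp_all add: n_def Df V(1) Dz)
have n3: "n (f z (1/2) (f pv 1 xi)) powr q + n (f z (1/2) (f pv (-1) xi)) powr q <= 1/2 * (n pv powr q + n xi powr q)"
 if "pv : V" "xi : V" for pv xi
 using clarkson_nrm[OF q D D, OF that] V that by (simp add: n_def Df Dz)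
note n = n n3
have inf: "m v <= K * N" if "v : V" "N >= 0" "!!pv. pv : V ==> B v pv <= N * n pv" for v N
 unfolding m_def using that by (intro infsupD[OF inf']) (auto simp: bnd_def V_def B_def n_def)
have sV: "f z t v : V" if "v : V" for t v using V(2)[OF V(1) that, of t] by simp
have sB: "B v (f z t pv) = t * B v pv" if "v : V" "pv : V" for t v pv
proof -
 show ?thesis using Br[OF that(1) V(1) that(2), of t] Z(2) by simp
qed
define L where "L v pv = B v pv - ga v - n pv powr q / q" for v pv
have L0: "L v z = - ga v" if "v : V" for v using Z(2) by (simp add: L_def n0)
have Lb: "L v pv <= m v powr p / p + m v * g" if "v : V" "pv : V" for v pv
proof -
 have "m v * n pv <= m v powr p / p + n pv powr q / q" using pq m(1) n(1) by (intro Youngs_inequality) (auto simp: conj_exp_def)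
 thus ?thesis using Bb[OF that] G(2)[OF that(1)] by (simp add: L_def)
qed
define Th where "Th v = (SUP pv\<in>V. L v pv)" for v
have bdd: "bdd_above (L v ` V)" if "v : V" for v using Lb[OF that] by (intro bdd_aboveI) auto
have Lle: "L v pv <= Th v" if "v : V" "pv : V" for v pv unfolding Th_def by (rule cSUP_upper[OF that(2) bdd[OF that(1)]])
have Lap: "EX pv:V. L v pv > Th v - et" if "v : V" "et > 0" for v et
 using less_cSUP_iff[OF _ bdd[OF that(1)], of "Th v - et"] V(1) that(2) by (auto simp: Th_def)
\<comment> \<open>Coercivity: if \<open>Th v\<close> is at most 1, then \<open>m v\<close> is at
  most 2 K (1 + g)^(1/p) times its own p-th root as soon as \<open>m v\<close> is at least 1.
  Solving this for \<open>m v\<close> gives A.\<close>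
define A where "A = max 1 ((2 * K * (1 + g) powr (1/p)) powr q)"
have A1: "A >= 1" by (simp add: A_def)
have mA: "m v <= A" if v: "v : V" and Th: "Th v <= 1" for v
proof (cases "m v >= 1")
 case True
 define Z where "Z = 1 + m v * g"
 have Z1: "Z >= 1" "ga v <= m v * g" using m(1) G(2)[OF v] G(3) by (auto simp: Z_def)
 have "B v pv <= (2 * Z powr (1/p)) * n pv" if pv: "pv : V" for pv
 proof (cases "n pv = 0")
  case False
  hence np: "n pv > 0" using n(1)[of pv] by simp
  \<comment> \<open>This scaling makes the q-th power of the norm of the test function equal to Z.
    The term subtracted in \<open>L\<close> then becomes Z/q, comparable with the bound Z for 1 +
    \<open>ga v\<close>.\<close>
  let ?s = "Z powr (1/q) / n pv"
  have "L v (f z ?s pv) <= 1" using Lle[OF v sV[OF pv]] Th order_trans by blast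
  moreover have "n (f z ?s pv) powr q = Z" using np Z1 pq' by (simp add: n(2)[OF pv] powr_powr)
  ultimately have "?s * B v pv <= Z + Z / q" unfolding L_def sB[OF v pv] using Z1 by (simp add: Z_def)
  also have "... <= 2 * Z" using Z1 pq' by (simp add: divide_le_eq)
  also have "... = 2 * (Z powr (1/p) * Z powr (1/q))" using pq Z1 by (simp add: conj_exp_def flip: powr_add)
  finally have "Z powr (1/q) * B v pv <= Z powr (1/q) * (2 * Z powr (1/p) * n pv)" using np by (simp add: field_simps)
  thus ?thesis using Z1 by (simp add: mult_le_cancel_left_pos)
 qed (use Bb[OF v pv] in simp)
 hence m1: "m v <= K * (2 * Z powr (1/p))" by (intro inf v) auto
 have "Z powr (1/p) <= (m v * (1 + g)) powr (1/p)" using Z1 True pq' by (intro powr_mono2) (auto simp: Z_def asimps)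
 also have "... = m v powr (1/p) * (1 + g) powr (1/p)" using m(1) G(3) by (simp add: powr_mult)
 finally have "m v <= (2 * K * (1 + g) powr (1/p)) * m v powr (1/p)" using m1 K mul_l[of "Z powr (1/p)" _ "K * 2"] by (force simp: mult_ac)
 moreover have "m v = m v powr (1/q) * m v powr (1/p)" using pq True by (simp add: conj_exp_def add.commute flip: powr_add)
 ultimately have "m v powr (1/q) * m v powr (1/p) <= (2 * K * (1 + g) powr (1/p)) * m v powr (1/p)" by simp
 hence "m v powr (1/q) <= 2 * K * (1 + g) powr (1/p)" using True by (simp add: mult_le_cancel_right_pos)
 hence "(m v powr (1/q)) powr q <= (2 * K * (1 + g) powr (1/p)) powr q" using pq' by (intro powr_mono2) auto
 thus ?thesis using True pq' by (simp add: powr_powr A_def)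
qed (use A1 in simp)
have Thb: "Th v >= - (A * g)" if "v : V" for v
proof (cases "Th v <= 1")
 case True
 have "- (m v * g) <= Th v" using Lle[OF that V(1)] L0[OF that] G(2)[OF that] by linarith
 thus ?thesis using mul_r[OF mA[OF that True] G(3)] by linarith
qed (use A1 G(3) in \<open>smt (verit) mult_nonneg_nonneg\<close>)
define m0 where "m0 = (INF v\<in>V. Th v)"
have bb: "bdd_below (Th ` V)" using Thb by (intro bdd_belowI) auto
have m0le: "m0 <= Th v" if "v : V" for v unfolding m0_def by (rule cINF_lower[OF bb that])
have "m0 <= 0"
proof -
 have "Th z <= 0" unfolding Th_def using V(1) pq' Z by (intro cSUP_least) (auto simp: L_def)
 thus ?thesis using m0le[OF V(1)] by linarith
qed
\<comment> \<open>A bound for near maximizers: n^q / q <= m n + 1 with m <= A + 1, and q >= 2 lets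
  n^q dominate n^2.\<close>
define Bn where "Bn = q * (A + 3)"
have Bn1: "Bn >= 1" using A1 q mult_mono[of 1 q 1 "A + 3"] by (simp add: Bn_def)
have nb: "n pv <= Bn" if v: "v : V" "m v <= A + 1" and pv: "pv : V" "L v pv >= Th v - 1" for v pv
proof (cases "n pv >= 1")
 case True
 have "L v pv >= - ga v - 1" using pv(2) Lle[OF v(1) V(1)] L0[OF v(1)] by linarith
 hence "n pv powr q / q <= m v * n pv + 1" using Bb[OF v(1) pv(1)] by (simp add: L_def)
 also have "... <= (A + 1) * n pv + n pv" using v(2) True n(1) by (intro add_mono mul_r) auto
 finally have "n pv powr q <= (q * (A + 2)) * n pv" using q by (simp add: divide_le_eq asimps)
 moreover have "n pv * n pv <= n pv powr q" using True q powr_mono[of 2 q "n pv"] by (simp add: pow2)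
 ultimately have "n pv * n pv <= (q * (A + 2)) * n pv" by linarith
 hence "n pv <= q * (A + 2)" using True by (simp add: mult_le_cancel_right_pos)
 thus ?thesis using q by (simp add: Bn_def asimps)
qed (use Bn1 in simp)
define M where "M = Bn + g"
have M0: "M >= 0" using Bn1 G(3) by (simp add: M_def)
\<comment> \<open>The perturbation size. The bound by ep/4 makes the first-order error 2t at most
  ep/2; the last bound makes the half-difference of the two near maximizers at most ep/4, which
  contributes the other ep/2.\<close>
define t where "t = min 1 (min (ep/4) ((ep/4) powr q / (q * (3 + M))))"
have t: "t > 0" "t <= 1" "t <= ep/4" "t <= (ep/4) powr q / (q * (3 + M))"
proof -
 show "t > 0" using ep q M0 by (simp add: t_def)
 show "t <= 1" "t <= ep/4" "t <= (ep/4) powr q / (q * (3 + M))"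
  unfolding t_def by (intro min.cobounded1 min.coboundedI2[OF min.cobounded1] min.coboundedI2[OF min.cobounded2])+
qed
have t2: "t^2 > 0" "t^2 <= t" using t by (auto simp: pow2 mult_left_le)
obtain v where v: "v : V" "Th v < m0 + t^2"
 using cINF_less_iff[OF _ bb, of "m0 + t^2"] V(1) t2 unfolding m0_def by auto
have mv: "m v <= A" using v(2) \<open>m0 <= 0\<close> t2 t by (intro mA v) linarith
obtain pv where pv: "pv : V" "L v pv > Th v - t^2" using Lap[OF v(1) t2(1)] by blast
have "EX pv:V. ALL w:V. m w <= 1 --> B w pv - ga w >= - ep"
proof (intro bexI[OF _ pv(1)] ballI impI)
 fix w assume w: "w : V" "m w <= 1"
 have v': "f v t w : V" by (rule V(2)[OF v(1) w(1)])
 obtain xi where xi: "xi : V" "L (f v t w) xi > Th (f v t w) - t^2" using Lap[OF v' t2(1)] by blast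
 have "m (f v t w) <= A + 1" using m(2)[OF v(1) w(1), of t] mv mult_mono[OF t(2) w(2)] t m(1) by (simp add: abs_of_pos)
 hence nxi: "n xi <= Bn" using xi t2 t by (intro nb[OF v']) auto
 let ?D = "B w xi - ga w"
 have D: "L (f v t w) xi = L v xi + t * ?D" unfolding L_def Bl[OF v(1) w(1) xi(1)] G(1)[OF v(1) w(1)] by (simp add: asimps)
 have "abs (B w xi) <= 1 * Bn" using order_trans[OF Bb[OF w(1) xi(1)] mult_mono[OF w(2) nxi]] n(1) by simp
 moreover have "abs (ga w) <= 1 * g" using order_trans[OF G(2)[OF w(1)] mul_r[OF w(2) G(3)]] .
 ultimately have DM: "?D <= M" by (simp add: M_def)
 \<comment> \<open>v nearly minimizes \<open>Th\<close>, so \<open>Th\<close> at the perturbed point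
   is not much smaller than at v. Comparison with L v xi <= Th v bounds ?D from below; and as ?D is
   at most M, \<open>xi\<close> is also a near maximizer at v itself.\<close>
 have low: "L v xi + t * ?D > Th v - 2 * t^2" using D xi(2) m0le[OF v'] v(2) by linarith
 hence "t * ?D > t * (- 2 * t)" using Lle[OF v(1) xi(1)] by (simp add: pow2 asimps)
 hence D1: "?D > - 2 * t" using t(1) by (simp only: mult_less_cancel_left_pos)
 have "t * ?D <= t * M" using DM t by (intro mul_l) auto
 hence Lxi: "L v xi > Th v - 2 * t^2 - t * M" using low by linarith
 \<comment> \<open>Clarkson's inequality at the midpoint of \<open>pv\<close> and \<open>xi\<close>:
   \<open>B v\<close> is linear, so the gain in the norm term, which cannot exceed the distance to
   the supremum, controls the difference of the two.\<close>
 have mid: "f z (1/2) (f pv 1 xi) : V" by (rule sV[OF V(2)[OF pv(1) xi(1)]])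
 have df: "f pv (-1) xi : V" using V(2)[OF pv(1) xi(1), of "-1"] by simp
 have Bm: "B v (f z (1/2) (f pv 1 xi)) = 1/2 * (B v pv + B v xi)"
  using sB[OF v(1) V(2)[OF pv(1) xi(1), of 1], of "1/2"] Br[OF v(1) pv(1) xi(1), of 1] by simp
 have nq: "n (f z (1/2) (f pv 1 xi)) powr q / q + n (f z (1/2) (f pv (-1) xi)) powr q / q <= 1/2 * (n pv powr q / q + n xi powr q / q)"
  using divide_right_mono[OF n(3)[OF pv(1) xi(1)], of q] q by (simp add: add_divide_distrib)
 have "L v (f z (1/2) (f pv 1 xi)) <= Th v" by (rule Lle[OF v(1) mid])
 hence "n (f z (1/2) (f pv (-1) xi)) powr q / q <= Th v - 1/2 * (L v pv + L v xi)" using nq unfolding L_def Bm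
 proof -
  have "y <= T - 1/2 * (b1 - c - s + (b2 - c - r))" if "1/2 * (b1 + b2) - c - x <= T" "x + y <= 1/2 * (s + r)" for x y T b1 b2 c s r :: real
   using that by (simp add: field_simps)
  thus "1/2 * (B v pv + B v xi) - ga v - n (f z (1/2) (f pv 1 xi)) powr q / q <= Th v ==>
   n (f z (1/2) (f pv 1 xi)) powr q / q + n (f z (1/2) (f pv (-1) xi)) powr q / q <= 1/2 * (n pv powr q / q + n xi powr q / q) ==>
   n (f z (1/2) (f pv (-1) xi)) powr q / q <= Th v - 1/2 * (B v pv - ga v - n pv powr q / q + (B v xi - ga v - n xi powr q / q))" .
 qed
 also have "... <= 3 * t^2 + t * M" proof -
  have "T - 1/2 * (x + y) <= 3 * s + r" if "x > T - s" "y > T - 2 * s - r" "r >= 0" "s >= 0" for x y T s r :: real using that by (simp add: field_simps)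
  thus ?thesis using pv(2) Lxi t M0 by simp
 qed
 also have "... <= t * (3 + M)" using t2 by (simp add: asimps)
 also have "... <= (ep/4) powr q / q" using mul_r[OF t(4), of "3 + M"] M0 by simp
 finally have "n (f z (1/2) (f pv (-1) xi)) powr q <= (ep/4) powr q" using q by (simp add: divide_le_cancel)
 hence "n (f z (1/2) (f pv (-1) xi)) <= ep/4" using q ep powr_less_mono2[of q "ep/4" "n (f z (1/2) (f pv (-1) xi))"] by force
 hence nd: "n (f pv (-1) xi) <= ep/2" using n(2)[OF df, of "1/2"] by simp
 have "B w (f pv (-1) xi) = B w pv - B w xi" using Br[OF w(1) pv(1) xi(1), of "-1"] by simp
 moreover have "abs (B w (f pv (-1) xi)) <= 1 * (ep/2)" using order_trans[OF Bb[OF w(1) df] mult_mono[OF w(2) nd]] n(1) by simp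
 ultimately show "B w pv - ga w >= - ep" using D1 t(3) by linarith
qed
thus ?thesis by (simp add: V_def m_def B_def ga_def)
qed

text \<open>The functional given by the duality map of \<open>Dl l u\<close> is nearly represented
  by some \<open>pv\<close>, whose norm the inequality for the dual exponent bounds by K; pairing
  \<open>pv\<close> with u gives the norm of u. The constant K' supplies the coercivity behind the
  representation, while the constant obtained is K. This is what allows a continuation to be
  iterated.\<close>

lemma infsup_dual:
fixes Om :: "'a::euclidean_space set"
assumes pq: "conj_exp p q" and q: "q >= 2" and inf': "infsup Om l p q K'" and inf: "infsup Om l q p K" and K: "K' >= 0" "K >= 0"
shows "infsup Om l p q K"
unfolding infsup_def
proof (intro ballI allI impI)
fix u N assume u: "u : C1c Om" and N: "(0::real) <= N" and b: "bnd Om l q u N"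
note pq' = conj_expD(1,2)[OF pq] and Du = Dl_Cc[OF u, of l]
let ?g = "%x. dmap p (Dl l u x)"
have g: "?g : Cc" by (rule Cc_dmap[OF Du pq'(1)])
let ?B = "%v pv. LBINT x. Dl l v x *. Dl l pv x" and ?ga = "%v. LBINT x. Dl l v x *. ?g x"
have Dc: "Dl l v : Cc" if "v : C1c Om" for v by (rule Dl_Cc[OF that])
have p1: "p >= 1" "p > 0" "q > 0" using pq' by auto
have main: "(LBINT x. Dl l u x *. ?g x) <= N * (K * nrm q ?g) + (N * K + nrm p (Dl l u)) * ep" if ep: "ep > 0" for ep
proof -
 from near_representation[OF pq q inf' K(1) g ep]
 obtain pv where pv: "pv : C1c Om" "!!w. w : C1c Om ==> nrm p (Dl l w) <= 1 ==> ?B w pv - ?ga w >= - ep" by blast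
 have s: "abs (?B w pv - ?ga w) <= ep * nrm p (Dl l w)" if w: "w : C1c Om" for w
 proof (cases "nrm p (Dl l w) = 0")
  case True
  thus ?thesis using Cc_holder[OF pq Dc[OF w] Dc[OF pv(1)]] Cc_holder[OF pq Dc[OF w] g] by simp
 next
  case False
  hence c: "nrm p (Dl l w) > 0" using pn_nonneg[of lborel p "Dl l w"] by linarith
  have "- ep <= r / nrm p (Dl l w) * (?B w pv - ?ga w)" if r: "abs r = 1" for r
  proof -
   let ?r = "r / nrm p (Dl l w)"
   have D: "Dl l (%x. ?r * w x) = (%x. ?r *: Dl l w x)" by (rule Dl_cmult[OF C1cD(1)[OF w]])
   have "nrm p (Dl l (%x. ?r * w x)) <= 1" unfolding D pn_scaleR[OF p1(2)] using c r by simp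
   from pv(2)[OF C1c_cmult[OF w] this] show ?thesis unfolding D by (simp add: right_diff_distrib)
  qed
  from this[of 1] this[of "-1"] show ?thesis using c by (simp add: field_simps abs_le_iff)
 qed
 have "bnd Om l p pv (nrm q ?g + ep)"
  unfolding bnd_def
 proof
  fix w assume w: "w : C1c Om"
  have "?B pv w = ?B w pv" by (simp add: inner_commute)
  thus "?B pv w <= (nrm q ?g + ep) * nrm p (Dl l w)"
   using s[OF w] Cc_holder[OF pq Dc[OF w] g] by (simp add: asimps)
 qed
 hence n: "nrm q (Dl l pv) <= K * (nrm q ?g + ep)" using ep by (intro infsupD[OF inf pv(1)]) (auto simp: add_nonneg_nonneg)
 have "?ga u <= ?B u pv + ep * nrm p (Dl l u)" using s[OF u] by linarith
 also have "?B u pv <= N * (K * (nrm q ?g + ep))" using bndD[OF b pv(1)] mul_l[OF n N] by linarith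
 finally show ?thesis by (simp add: asimps)
qed
have "?ga u <= N * (K * nrm q ?g)"
proof (rule field_le_epsilon)
 fix e :: real assume e: "e > 0"
 let ?c = "N * K + nrm p (Dl l u)"
 have c: "?c >= 0" using N K by simp
 have "?c * (e / (?c + 1)) <= e" using c e by (simp add: field_simps)
 thus "?ga u <= N * (K * nrm q ?g) + e" using main[of "e / (?c + 1)"] c e by (simp add: add_nonneg_pos)
qed
thus "nrm p (Dl l u) <= K * N" using N K by (intro nrm_le_dual[OF pq Du]) (auto simp: mult_ac)
qed

text \<open>Lowering the parameter changes the form by (l^2 - l'^2) times the L^2 pairing. On a
  bounded domain Poincare's inequality turns this into a small multiple of the norm, which is
  absorbed at the cost of a factor 2.\<close>

lemma infsup_step:
fixes Om :: "'a::euclidean_space set"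
assumes pq: "conj_exp p q" and inf: "infsup Om l p q K" and K: "K >= 0" and l: "0 <= l'" "l' <= l" and s: "K * ((l^2 - l'^2) * P^2) <= 1/2"
 and P: "!!pv. pv : C1c Om ==> nrm q pv <= P * nrm q (grad pv)" "!!pv. pv : C1c Om ==> nrm p pv <= P * nrm p (grad pv)" "P >= 0"
shows "infsup Om l' p q (2 * K)"
unfolding infsup_def
proof (intro ballI allI impI)
fix u N assume u: "u : C1c Om" and N: "(0::real) <= N" and b: "bnd Om l' q u N"
note pq' = conj_expD(1,2)[OF pq] and U = C1cD[OF u]
let ?X = "nrm p (Dl l u)"
have ll: "0 <= l^2 - l'^2" using l by (simp add: power_mono)
have mono: "nrm s (Dl l' v) <= nrm s (Dl l v)" if "v : C1c Om" "s > 0" for v s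
proof (rule Cc_pn_mono[OF that(2) Dl_Cc[OF that(1)]])
 fix x
 have "(l' * v x)^2 <= (l * v x)^2" using l by (simp add: power_mult_distrib mul_r power_mono)
 thus "norm (Dl l' v x) <= norm (Dl l v x)" unfolding norm_Dl by simp
qed
have gD: "nrm s (grad v) <= nrm s (Dl l v)" if "v : C1c Om" "s > 0" for v s
 using norm_Dl_ge(1) by (intro Cc_pn_mono Dl_Cc[OF that(1)] that(2))
let ?N = "N + (l^2 - l'^2) * P^2 * ?X"
have "bnd Om l q u ?N"
 unfolding bnd_def
proof
 fix pv assume pv: "pv : C1c Om"
 note S = C1cD[OF pv]
 have i: "integ (%x. Dl l' u x *. Dl l' pv x)" "integ (%x. u x * pv x)"
  by (rule Dl_inner_integrable[OF u pv] Cc_integrable[OF Cc_times[OF U(2) Cc_cont[OF S(2)]]])+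
 have "dform l u pv = (LBINT x. Dl l' u x *. Dl l' pv x + (l^2 - l'^2) * (u x * pv x))"
  by (intro integral_cong refl) (simp add: Dl_inner asimps)
 also have "... = dform l' u pv + (l^2 - l'^2) * (LBINT x. u x * pv x)" using i by simp
 also have "... <= N * nrm q (Dl l pv) + (l^2 - l'^2) * ((P * ?X) * (P * nrm q (Dl l pv)))"
 proof (intro add_mono mul_l ll)
  show "dform l' u pv <= N * nrm q (Dl l pv)"
   using bndD[OF b pv] mul_l[OF mono[OF pv, of q] N] pq' by linarith
  have "(LBINT x. u x * pv x) <= nrm p u * nrm q pv" using Cc_holder[OF pq U(2) S(2)] by (simp add: abs_le_iff)
  also have "... <= (P * ?X) * (P * nrm q (Dl l pv))"
   using pq' P(3) by (intro mult_mono order_trans[OF P(1)[OF pv]] order_trans[OF P(2)[OF u]] mul_l gD[OF u] gD[OF pv]) auto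
  finally show "(LBINT x. u x * pv x) <= (P * ?X) * (P * nrm q (Dl l pv))" .
 qed
 finally show "dform l u pv <= ?N * nrm q (Dl l pv)" by (simp add: asimps pow2)
qed
hence "?X <= K * ?N" using N ll by (intro infsupD[OF inf u]) auto
also have "... = K * N + (K * ((l^2 - l'^2) * P^2)) * ?X" by (simp only: distrib_left mult.assoc)
also have "(K * ((l^2 - l'^2) * P^2)) * ?X <= 1/2 * ?X" by (rule mul_r[OF s]) simp
finally show "nrm p (Dl l' u) <= 2 * K * N" using mono[OF u, of p] pq' by simp
qed

text \<open>Hardy's inequality for the bump of radius 2R, which is at least 1/3 on the
  domain.\<close>

lemma poincare:
fixes Om :: "'a::euclidean_space set"
assumes pq: "conj_exp p q" and d: "q < real DIM('a)" and R: "R > 0" "Om <= ball 0 R" and pv: "pv : C1c Om"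
shows "nrm q pv <= 3 * hc TYPE('a) q (2 * R) * nrm q (grad pv)"
proof -
note pq' = conj_expD(1,2)[OF pq]
obtain L where L: "L <= Om" "!!x. x ~: L ==> pv x = 0" using pv by (rule C1c_support) blast
have "nrm q pv <= nrm q (%x. 3 *: (bump 0 (2 * R) x * pv x))"
proof (rule Cc_pn_mono)
 show "(%x. 3 *: (bump 0 (2 * R) x * pv x)) : Cc" by (intro Cc_scaleR Cc_times'[OF C1cD(2)[OF pv]] C1_cont bump_C1)
 fix x
 show "norm (pv x) <= norm (3 *: (bump 0 (2 * R) x * pv x))"
 proof (cases "x : L")
  case True
  hence "norm x < R" using L(1) R(2) by auto
  hence "27/64 <= bump 0 (2 * R) x" using bump_ge_half[of x 0 "2 * R"] R(1) by simp
  hence "1 * abs (pv x) <= (3 * abs (bump 0 (2 * R) x)) * abs (pv x)" by (intro mul_r) (auto simp: power3_eq_cube)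
  thus ?thesis by (simp add: abs_mult)
 qed (use L(2) in simp)
qed (use pq' in simp)
also have "... = 3 * nrm q (%x. bump 0 (2 * R) x * pv x)" using pq' by (subst pn_scaleR) auto
also have "... <= 3 * (hc TYPE('a) q (2 * R) * nrm q (grad pv))" using R by (intro mul_l hardy_bump[OF pq d pv]) auto
finally show ?thesis by simp
qed

text \<open>Continuation in l^2 downwards from a large value. Each step doubles the constant and
  \<open>infsup_dual\<close> resets it to K, so the step length stays fixed. It depends on the size
  of the domain through Poincare's inequality, but the resulting constant K does not.\<close>

lemma infsup_le2:
fixes Om :: "'a::euclidean_space set"
assumes pq: "conj_exp p q" and q: "q >= 2" "q < real DIM('a)" and Om: "bounded Om" and L: "LOCal Om p q C rh" and C: "C >= 0" and rh: "rh > 0"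
 and K: "K >= 0" and inf: "!!l. l >= 0 ==> infsup Om l q p K" and l: "l >= 0"
shows "infsup Om l p q K"
proof -
note pq' = conj_expD(1,2)[OF pq]
have pd: "p < real DIM('a)"
proof -
 have "1/q <= 1/2" using q by (intro divide_left_mono) auto
 moreover have "1/p + 1/q = 1" using pq by (simp add: conj_exp_def)
 ultimately have "1/p >= 1/2" by linarith
 hence "p <= 2" using pq' by (simp add: field_simps)
 thus ?thesis using q by simp
qed
obtain R where R: "R > 0" "Om <= ball 0 R" using bounded_subset_ballD[OF Om] by blast
define P where "P = max (3 * hc TYPE('a) q (2 * R)) (3 * hc TYPE('a) p (2 * R))"
have hc0: "hc TYPE('a) q (2 * R) >= 0" using q by (auto simp: hc_def)
have P: "nrm q pv <= P * nrm q (grad pv)" "nrm p pv <= P * nrm p (grad pv)" if "pv : C1c Om" for pv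
 using poincare[OF pq q(2) R that] poincare[OF conj_exp_sym[OF pq] pd R that]
  mul_r[of "3 * hc TYPE('a) q (2 * R)" P "nrm q (grad pv)"] mul_r[of "3 * hc TYPE('a) p (2 * R)" P "nrm p (grad pv)"]
 by (auto simp: P_def intro: order_trans)
have P0: "P >= 0" using hc0 by (simp add: P_def le_max_iff_disj)
\<comment> \<open>For l >= l0 the lower-order norm is at most 1/l times the norm of
  \<open>Dl l u\<close>, and C / l <= 1/2 lets it be absorbed.\<close>
define l0 where "l0 = 2 * C + 1"
have big: "infsup Om l p q K" if l: "l >= l0" for l
proof (rule infsup_dual[OF pq q(1) _ inf])
 have l1: "l > 0" "C / l <= 1/2" using l C by (auto simp: l0_def divide_le_eq)
 show "infsup Om l p q (2 * C)"
  unfolding infsup_def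
 proof (intro ballI allI impI)
  fix u N assume u: "u : C1c Om" and N: "(0::real) <= N" and b: "bnd Om l q u N"
  note U = C1cD[OF u]
  let ?X = "nrm p (Dl l u)"
  have "nrm p (%x. bump 0 rh x * u x) <= nrm p (%x. u x)"
   using pq' by (intro Cc_pn_mono U(2)) (auto intro!: mult_left_le_one_le simp: abs_mult abs_of_nonneg bump_bounds(1,2)[OF rh])
  moreover have "l * nrm p u <= ?X"
  proof -
   have "nrm p (%x. l *: u x) <= ?X" using pq' norm_Dl_ge(2)[of l u] by (intro Cc_pn_mono Dl_Cc[OF u]) auto
   thus ?thesis using pq' l1 by (simp add: pn_scaleR[of p lborel l u, unfolded real_scaleR_def])
  qed
  moreover from this have "nrm p u <= ?X / l" by (simp only: pos_le_divide_eq[OF l1(1)] mult.commute)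
  ultimately have "nrm p (%x. bump 0 rh x * u x) <= ?X / l" by linarith
  hence "?X <= C * (N + ?X / l)"
   using L l1 u N b C unfolding LOCal_def by (meson add_left_mono less_imp_le mul_l order_trans)
  also have "... = C * N + (C / l) * ?X" by (simp add: distrib_left)
  also have "(C / l) * ?X <= 1/2 * ?X" by (rule mul_r[OF l1(2)]) simp
  finally show "?X <= 2 * C * N" by simp
 qed
qed (use C K l in \<open>auto simp: l0_def\<close>)
\<comment> \<open>The admissible decrease of l^2 in one step, chosen so that the perturbation has
  half the strength of the inverse constant.\<close>
define et where "et = 1 / (2 * (K * P^2 + 1))"
have et: "et > 0" "K * (et * P^2) <= 1/2"
proof -
 have "K * P^2 >= 0" using K by simp
 thus "et > 0" by (simp add: et_def)
 have "K * (et * P^2) = 1/2 * (K * P^2 / (K * P^2 + 1))" by (simp add: et_def)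
 also have "... <= 1/2 * 1" using \<open>K * P^2 >= 0\<close> by (intro mul_l) auto
 finally show "K * (et * P^2) <= 1/2" by simp
qed
have "ALL l>=0. l\<^sup>2 >= l0^2 - real n * et --> infsup Om l p q K" for n
proof (induction n)
 case 0
 have "l0 <= l" if "l >= 0" "l^2 >= l0^2" for l using power2_le_imp_le[OF that(2,1)] .
 thus ?case using big by simp
next
 case (Suc n)
 show ?case
 proof (intro allI impI)
  fix l :: real assume l: "0 <= l" "l0^2 - real (Suc n) * et <= l^2"
  let ?l = "sqrt (l^2 + et)"
  have e: "?l^2 = l^2 + et" using et(1) by simp
  have "0 <= ?l" "l0^2 - real n * et <= ?l^2" unfolding e using l et(1) by (simp_all add: asimps)
  hence i: "infsup Om ?l p q K" using Suc by blast
  have s1: "l <= ?l" by (rule real_le_rsqrt) (use et(1) in simp)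
  have s2: "K * ((?l^2 - l^2) * P^2) <= 1/2" unfolding e using et(2) by simp
  have "infsup Om l p q (2 * K)" by (rule infsup_step[OF pq i K l(1) s1 s2 P P0])
  from infsup_dual[OF pq q(1) this inf[OF l(1)] _ K] show "infsup Om l p q K" using K by simp
 qed
qed
moreover obtain n where "l0^2 < real n * et" using reals_Archimedean3[OF et(1)] by blast
hence "l^2 >= l0^2 - real n * et" using zero_le_power2[of l] by linarith
ultimately show ?thesis using l by blast
qed
theorem infsup_uniform:
assumes pq: "conj_exp p q" and p: "p < real DIM('a::euclidean_space)" and q: "q < real DIM('a)" and rh: "rh > 0" and C: "C >= 0" "C' >= 0"
shows "EX K>=0. ALL Om::'a set. bounded Om --> LOCal Om p q C rh --> LOCal Om q p C' rh --> (ALL l>=0. infsup Om l p q K)"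
proof (cases "p >= 2")
case True
thus ?thesis using infsup_ge2[OF pq True p rh C(1)] by blast
next
case False
have q2: "q >= 2"
proof (rule ccontr)
 assume "~ q >= 2"
 hence "1/p > 1/2" "1/q > 1/2" using False conj_expD(1,2)[OF pq] by (auto intro!: divide_strict_left_mono)
 thus False using pq by (simp add: conj_exp_def)
qed
obtain K where K: "K >= 0" "!!Om::'a set. LOCal Om q p C' rh ==> ALL l>=0. infsup Om l q p K"
 using infsup_ge2[OF conj_exp_sym[OF pq] q2 q rh C(2)] by blast
show ?thesis
proof (intro exI[of _ K] conjI allI impI)
 fix Om :: "'a set" and l :: real assume h: "bounded Om" "LOCal Om p q C rh" "LOCal Om q p C' rh" "l >= 0"
 show "infsup Om l p q K" by (rule infsup_le2[OF pq q2 q h(1,2) C(1) rh K(1) _ h(4)]) (use K(2)[OF h(3)] in blast)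
qed (rule K(1))
qed

section \<open>Domains above graphs of small slope\<close>

lemma C1_lipschitz:
assumes "C1 f" "!!x. norm (grad f x) <= B" shows "abs (f x - f y) <= B * norm (x - y)"
proof -
have "norm (f x - f y) <= B * norm (x - y)"
proof (rule differentiable_bound[OF convex_UNIV])
 show "(f has_derivative (%h. h *. grad f z)) (at z)" for z by (rule GDERIV_has_derivative[OF C1_GDERIV[OF assms(1)]])
 show "onorm (%h. h *. grad f z) <= B" for z
 proof (rule onorm_le)
  show "norm (h *. grad f z) <= B * norm h" for h
   using Cauchy_Schwarz_ineq2[of h "grad f z"] mul_l[OF assms(2)[of z] norm_ge_zero[of h]] by (simp add: mult.commute)
 qed
qed auto
thus ?thesis by simp
qed

text \<open>A C^1 transition from 0 for s <= 1 to 1 for s >= 2, composed of truncated squares, with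
  slope at most 4.\<close>

definition st :: "real => real" where "st s = 1 - (max 0 (1 - (max 0 (s - 1))^2))^2"
definition st' :: "real => real" where "st' s = 4 * (max 0 (1 - (max 0 (s - 1))^2)) * max 0 (s - 1)"

lemma st_deriv: "(st hrd st' s) (at s)"
proof -
have 1: "((%s. (max 0 s)\<^sup>2) hrd 2 * max 0 s) (at s)" for s :: real
 using pospow_deriv[of 0 s] by (simp add: numeral_2_eq_2)
have 2: "((%s. 1 - (max 0 (s - 1))^2) hrd 0 - (2 * max 0 (s - 1)) * 1) (at s)"
 by (intro DERIV_diff DERIV_const DERIV_chain2[where f="%s. (max 0 s)\<^sup>2" and g="%s. s - 1", OF 1]) (auto intro!: derivative_eq_intros)
have "((%s. 1 - (max 0 (1 - (max 0 (s - 1))^2))^2) hrd 0 - (2 * max 0 (1 - (max 0 (s - 1))^2)) * (0 - (2 * max 0 (s - 1)) * 1)) (at s)"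
 by (intro DERIV_diff DERIV_const DERIV_chain2[where f="%s. (max 0 s)\<^sup>2" and g="%s. 1 - (max 0 (s - 1))^2", OF 1 2])
thus ?thesis by (simp add: st_def[abs_def] st'_def mult_ac)
qed

lemma st_bounds: "0 <= st s" "st s <= 1" "s <= 1 ==> st s = 0" "s >= 2 ==> st s = 1" "0 <= st' s" "st' s <= 4" "s <= 1 | s >= 2 ==> st' s = 0"
proof -
let ?m = "max 0 (1 - (max 0 (s - 1))^2)"
have m: "0 <= ?m" "?m <= 1" by auto
show "0 <= st s" using m by (simp add: st_def power_le_one)
show "st s <= 1" by (simp add: st_def)
show "s <= 1 ==> st s = 0" by (simp add: st_def)
have b: "?m = 0" if "s >= 2" using that one_le_power[of "s - 1" 2] by simp
show "s >= 2 ==> st s = 1" using b by (simp add: st_def)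
show "0 <= st' s" by (simp add: st'_def)
show z: "s <= 1 | s >= 2 ==> st' s = 0" using b by (auto simp: st'_def)
show "st' s <= 4"
proof (cases "s >= 2")
 case False
 hence "4 * ?m * max 0 (s - 1) <= 4 * 1 * 1" using m by (intro mult_mono) auto
 thus ?thesis by (simp add: st'_def)
qed (use z in simp)
qed

text \<open>Extends the test to functions whose support may touch the boundary. As they vanish there
  at least linearly in d, cutting them off in the layer where n d lies between 1 and 2 produces a
  gradient error that is bounded and supported in a vanishing layer.\<close>

lemma cut_limit:
fixes d :: "'a::euclidean_space => real"
assumes \<chi>: "ch : C1c UNIV" and d: "C1 d" "!!x. norm (grad d x) <= 2" and cd: "!!x. abs (ch x) <= M * abs (d x)"
 and u: "u : C1c {x. d x > 0}" and N: "N >= 0" and b: "bnd {x. d x > 0} l q u N" and q: "q > 1"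
shows "dform l u ch <= N * nrm q (Dl l ch)"
proof -
note X = C1cD[OF \<chi>]
obtain L where L: "compact L" "!!x. x ~: L ==> ch x = 0" using Cc_support[OF X(2)] by blast
define k where "k n = real (Suc n)" for n
have k0: "k n > 0" for n by (simp add: k_def)
define c where "c n x = st (k n * d x)" for n x
have cst: "cont UNIV st'" unfolding st'_def[abs_def] by (intro cintro)
have C: "C1 (c n)" "grad (c n) = (%x. (st' (k n * d x) * k n) *: grad d x)" for n
 using C1_chain[OF C1_cmult(1)[OF d(1), of "k n"] st_deriv cst] by (simp_all add: c_def[abs_def] C1_cmult(2)[OF d(1)])
define e where "e n x = (ch x *: grad (c n) x, 0::real)" for n x
have eC: "e n : Cc" for n unfolding e_def[abs_def] by (intro Cc_Pair Cc_scaleR_left X(2) C1_cont_grad C Cc_zero)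
have M0: "M >= 0 | ch x = 0" for x using cd[of x] by (smt (verit) abs_ge_zero mult_nonpos_nonneg)
have eb: "norm (e n x) <= 16 * abs M" for n x
proof (cases "k n * d x <= 1 | k n * d x >= 2")
 case False
 hence s: "0 < k n * d x" "k n * d x <= 2" by auto
 hence dx: "d x > 0" using k0[of n] by (simp add: zero_less_mult_iff)
 have "norm (e n x) = (abs (ch x) * k n) * (st' (k n * d x) * norm (grad d x))"
  using st_bounds(5)[of "k n * d x"] k0[of n] by (simp add: e_def C norm_Pair abs_mult mult_ac)
 also have "... <= (abs M * 2) * (4 * 2)"
 proof (rule mult_mono)
  show "st' (k n * d x) * norm (grad d x) <= 4 * 2" by (rule mult_mono) (use d st_bounds(5,6)[of "k n * d x"] in auto)
  have "abs (ch x) * k n <= (abs M * d x) * k n"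
   using order_trans[OF cd[of x] mul_r[OF abs_ge_self[of M] abs_ge_zero]] dx k0[of n] by (intro mul_r) auto
  also have "... <= abs M * 2" using mul_l[OF s(2), of "abs M"] by (simp add: mult_ac)
  finally show "abs (ch x) * k n <= abs M * 2" .
 qed (use st_bounds(5)[of "k n * d x"] in auto)
 finally show ?thesis by simp
qed (simp add: e_def C st_bounds(7))
have e0: "(%n. nrm q (e n)) ----> 0"
proof -
 have "(%n. LBINT x. norm (e n x) powr q) ----> (LBINT x::'a. 0)"
 proof (rule integral_dominated_convergence[where w="%x. indicator L x * (16 * abs M) powr q"])
  show "integ (%x. indicator L x * (16 * abs M) powr q)"
   using emeasure_compact_finite[OF L(1)] L(1) by (auto intro!: integrable_mult_left integrable_real_indicator simp: borel_compact)
  show "AE x in lborel. (%n. norm (e n x) powr q) ----> 0"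
  proof (rule AE_I2, rule tendsto_eventually)
   \<comment> \<open>At each point the error is eventually exactly 0: either d is not positive
     there, or n d exceeds 2 for large n.\<close>
   fix x :: 'a
   obtain m :: nat where m: "2 < real m * d x | d x <= 0" using reals_Archimedean3[of "d x"] by (cases "d x > 0") auto
   show "\<forall>\<^sub>F n in sequentially. norm (e n x) powr q = 0"
   proof (rule eventually_sequentiallyI[of m])
    fix n assume n: "m <= n"
    have "k n * d x <= 1 | k n * d x >= 2"
    proof (cases "d x > 0")
     case True
     hence "real m * d x <= k n * d x" using n by (intro mul_r) (auto simp: k_def)
     hence "k n * d x > 2" using True m by linarith
     thus ?thesis by simp
    next
     case False
     hence "k n * d x <= 0" using k0[of n] by (intro mult_nonneg_nonpos) auto
     thus ?thesis by simp
    qed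
    thus "norm (e n x) powr q = 0" by (simp add: e_def C st_bounds(7))
   qed
  qed
  show "AE x in lborel. norm (norm (e n x) powr q) <= indicator L x * (16 * abs M) powr q" for n
   using q eb[of n] L(2) by (intro AE_I2) (auto simp: indicator_def e_def powr_mono2)
  show "(%x. norm (e n x) powr q) : bmeas lborel" for n
   using Cc_measurable[OF Cc_norm_powr[OF eC, of q n]] q by simp
 qed simp
 hence "(%n. (LBINT x. norm (e n x) powr q) powr (1/q)) ----> 0 powr (1/q)"
  using q by (intro tendsto_powr') (auto intro!: always_eventually integral_nonneg_AE)
 thus ?thesis using q by (simp add: pn_def)
qed
have ev: "\<forall>\<^sub>F n in sequentially. dform l u ch <= N * (nrm q (Dl l ch) + nrm q (e n))"
proof -
 obtain K where K: "compact K" "K <= {x. d x > 0}" "!!x. x ~: K ==> u x = 0" "!!x. x ~: K ==> grad u x = 0" using u by (rule C1c_support) blast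
 obtain m :: nat where m: "!!x. x : K ==> 2 < real m * d x"
 proof (cases "K = {}")
  case False
  obtain y where y: "y : K" "!!x. x : K ==> d y <= d x"
   using continuous_attains_inf[OF K(1) False continuous_on_subset[OF C1_cont[OF d(1)]]] by auto
  obtain m where m: "2 < real m * d y" using reals_Archimedean3[of "d y"] y(1) K(2) by auto
  show ?thesis by (rule that[of m], rule less_le_trans[OF m], rule mul_l[OF y(2)]) auto
 qed (use that in auto)
 show ?thesis
 proof (rule eventually_sequentiallyI[of m])
  fix n assume n: "m <= n"
  have z: "(%x. c n x * ch x) : C1c {x. d x > 0}"
  proof (rule C1cI[of _ "{x. k n * d x >= 1} \<inter> L"])
   show "C1 (%x. c n x * ch x)" by (rule C1_mult(1)[OF C(1) X(1)])
   have "closed {x. k n * d x >= 1}" by (intro closed_Collect_le cintro C1_cont[OF d(1)])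
   thus "compact ({x. k n * d x >= 1} \<inter> L)" by (rule closed_Int_compact[OF _ L(1)])
   show "{x. k n * d x >= 1} \<inter> L <= {x. d x > 0}"
   proof
    fix x assume "x : {x. k n * d x >= 1} \<inter> L"
    hence "k n * d x > 0" by auto
    thus "x : {x. d x > 0}" using k0[of n] by (simp add: zero_less_mult_iff)
   qed
   fix x assume "x ~: {x. k n * d x >= 1} \<inter> L"
   thus "c n x * ch x = 0" using L(2) by (auto simp: c_def st_bounds(3))
  qed
  have D: "Dl l (%x. c n x * ch x) = (%x. c n x *: Dl l ch x + e n x)"
   unfolding Dl_mult[OF X(1) C(1)] e_def ..
  have "dform l u ch = dform l u (%x. c n x * ch x)"
  proof (intro integral_cong refl)
   fix x
   show "Dl l u x *. Dl l ch x = Dl l u x *. Dl l (%x. c n x * ch x) x"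
   proof (cases "x : K")
    case True
    hence "real m * d x <= k n * d x" using n K(2) by (intro mul_r) (auto simp: k_def)
    hence "k n * d x >= 2" using m[OF True] by simp
    thus ?thesis unfolding D by (simp add: c_def e_def C st_bounds(4,7) flip: zero_prod_def)
   qed (use K(3,4) in \<open>simp add: Dl_def flip: zero_prod_def\<close>)
  qed
  also have "... <= N * nrm q (Dl l (%x. c n x * ch x))" by (rule bndD[OF b z])
  also have "... <= N * (nrm q (Dl l ch) + nrm q (e n))"
  proof (rule mul_l[OF _ N])
   have "nrm q (Dl l (%x. c n x * ch x)) <= nrm q (%x. c n x *: Dl l ch x) + nrm q (e n)"
    unfolding D using q by (intro Cc_triangle Cc_mult Dl_Cc[OF \<chi>] C1_cont C eC) auto
   also have "nrm q (%x. c n x *: Dl l ch x) <= nrm q (Dl l ch)"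
    using q by (intro Cc_pn_mono Dl_Cc[OF \<chi>]) (auto intro!: mult_left_le_one_le simp: c_def abs_of_nonneg st_bounds(1,2))
   finally show "nrm q (Dl l (%x. c n x * ch x)) <= nrm q (Dl l ch) + nrm q (e n)" by simp
  qed
  finally show "dform l u ch <= N * (nrm q (Dl l ch) + nrm q (e n))" .
 qed
qed
have "(%n. N * (nrm q (Dl l ch) + nrm q (e n))) ----> N * (nrm q (Dl l ch) + 0)" by (intro tendsto_intros e0)
thus ?thesis using tendsto_lowerbound[OF _ ev] by simp
qed

definition rf :: "'a::euclidean_space => 'a => 'a" where "rf n v = v - (2 * (v *. n)) *: n"

lemma rf_props: assumes "norm n = 1"
shows "rf n v *. w = v *. rf n w" (is ?A) "norm (rf n v) = norm v" (is ?B) "rf n (rf n v) = v" (is ?C)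
proof -
have n: "n *. n = 1" using assms by (simp add: norm_eq_1)
show ?A by (simp add: rf_def inner_diff_left inner_diff_right inner_commute)
show ?B
 unfolding norm_eq by (simp add: rf_def inner_diff_left inner_diff_right inner_commute n asimps)
show ?C by (simp add: rf_def inner_diff_left n asimps)
qed

text \<open>Odd reflection turns a problem on \<open>{d > 0}\<close> into one on the whole space; the defect \<open>dr\<close> of \<open>sg\<close> from
  being an isometry is absorbed.\<close>

lemma reflection_infsup:
fixes sg :: "'a::euclidean_space => 'a" and d :: "'a => real"
assumes pq: "conj_exp p q" and n: "norm n = 1" and mp: "mpres sg" and cs: "cont UNIV sg" and inv: "!!x. sg (sg x) = x"
 and C: "!!u. C1 u ==> C1 (%x. u (sg x))" "!!u x. C1 u ==> norm (grad (%x. u (sg x)) x - rf n (grad u (sg x))) <= dr * norm (grad u (sg x))"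
 and d: "C1 d" "!!x. norm (grad d x) <= 2" "!!x. d (sg x) = - d x" "!!x. norm (x - sg x) <= 4 * abs (d x)"
 and dr: "0 <= dr" "dr <= 1" "EC TYPE('a) (min p q) * (2 * dr) <= 1/2"
shows "infsup {x. d x > 0} l p q (6 * EC TYPE('a) (min p q))"
unfolding infsup_def
proof (intro ballI allI impI)
let ?Om = "{x. d x > 0}" and ?E = "EC TYPE('a) (min p q)"
fix u and N :: real assume u: "u : C1c ?Om" and N: "0 <= N" and b: "bnd ?Om l q u N"
note pq' = conj_expD(1,2)[OF pq] and U = C1cD[OF u]
have E0: "?E >= 0" by (rule EC_nonneg) (use pq' in simp)
have cp: "(%x. f (sg x)) : Cc" if f: "f : Cc" for f :: "'a => 'b::euclidean_space"
proof -
 obtain L where L: "compact L" "!!x. x ~: L ==> f x = 0" using Cc_support[OF f] by blast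
 have "x : sg ` L" if "sg x : L" for x using that inv[of x] by (metis image_eqI)
 thus ?thesis using L
  by (intro CcI[of _ "sg ` L"] compact_continuous_image continuous_on_subset[OF cs] cont_comp2[OF Cc_cont[OF f] cs]) auto
qed
have cc: "(%x. v (sg x)) : C1c UNIV" if v: "v : C1c S" for v S
proof -
 obtain L where "compact L" "!!x. x ~: L ==> v (sg x) = 0" using Cc_support[OF cp[OF C1cD(2)[OF v]]] by blast
 thus ?thesis by (intro C1cI[OF C(1)[OF C1cD(1)[OF v]], of L]) auto
qed
have ns: "nrm s (%x. f (sg x)) = nrm s f" if "f : Cc" "s > 0" for s and f :: "'a => 'b::euclidean_space"
 using mpres_integral[OF mp, of "%x. norm (f x) powr s"] Cc_measurable[OF Cc_norm_powr[OF that]] by (simp add: pn_def)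
define w where "w x = u x - u (sg x)" for x
have w: "w : C1c UNIV" unfolding w_def[abs_def] by (rule C1c_diff[OF C1c_mono[OF u subset_UNIV] cc[OF u]])
have Dw: "Dl l w = (%x. Dl l u x - Dl l (%x. u (sg x)) x)" unfolding w_def[abs_def] by (rule Dl_diff[OF U(1) C(1)[OF U(1)]])
let ?X = "nrm p (Dl l u)"
\<comment> \<open>The factor 3 is the norm of antisymmetrization on test functions, 1 plus 2 for the
  reflected part; the term with \<open>dr\<close> comes from the two comparisons \<open>e1\<close>
  and \<open>e2\<close>.\<close>
have "bnd UNIV l q w (3 * N + 2 * dr * ?X)"
 unfolding bnd_def
proof
 fix pv :: "'a => real" assume pv: "pv : C1c UNIV"
 note S = C1cD[OF pv] and ps = cc[OF pv] and us = cc[OF u]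
 let ?ps = "%x. pv (sg x)" and ?us = "%x. u (sg x)"
 \<comment> \<open>The model integrand for an exact reflection: composed with \<open>sg\<close> it
   would be the integrand of u o sg against \<open>pv\<close>, and by itself that of u against
   \<open>pv\<close> o sg. As \<open>sg\<close> preserves measure the two integrals agree, and each
   true integrand deviates by at most \<open>dr\<close> times the product of gradients.\<close>
 let ?f = "%y. rf n (grad u y) *. grad pv (sg y) + l^2 * (u y * pv (sg y))"
 have rc: "cont UNIV (rf n)" unfolding rf_def[abs_def] by (intro cintro)
 have rC: "(%y. rf n (grad u y)) : Cc" by (rule Cc_comp0[OF U(3) rc]) (simp add: rf_def)
 have fC: "?f : Cc"
 proof -
  have "(%y. l\<^sup>2 *: (u y * pv (sg y))) : Cc" by (rule Cc_scaleR[OF Cc_times[OF U(2) Cc_cont[OF cp[OF S(2)]]]])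
  thus ?thesis using Cc_add[OF Cc_inner[OF rC Cc_cont[OF cp[OF S(3)]]]] by simp
 qed
 let ?J = "LBINT y. norm (grad u y) * norm (grad pv (sg y))"
 have JC: "(%y. norm (grad u y) * norm (grad pv (sg y))) : Cc" by (rule Cc_times[OF Cc_norm[OF U(3)] Cc_cont[OF Cc_norm[OF cp[OF S(3)]]]])
 have e1: "abs (Dl l ?us x *. Dl l pv x - ?f (sg x)) <= dr * (norm (grad u (sg x)) * norm (grad pv (sg (sg x))))" for x
 proof -
  have "Dl l ?us x *. Dl l pv x - ?f (sg x) = (grad ?us x - rf n (grad u (sg x))) *. grad pv x"
   by (simp add: Dl_inner inv inner_diff_left)
  thus ?thesis
   using order_trans[OF Cauchy_Schwarz_ineq2 mul_r[OF C(2)[OF U(1), of x] norm_ge_zero[of "grad pv x"]]] by (simp add: inv mult.assoc)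
 qed
 have e2: "abs (?f y - Dl l u y *. Dl l ?ps y) <= dr * (norm (grad u y) * norm (grad pv (sg y)))" for y
 proof -
  have "Dl l u y *. Dl l ?ps y - ?f y = grad u y *. (grad ?ps y - rf n (grad pv (sg y)))"
   by (simp add: Dl_inner inner_diff_right rf_props(1)[OF n])
  hence "abs (?f y - Dl l u y *. Dl l ?ps y) = abs (grad u y *. (grad ?ps y - rf n (grad pv (sg y))))" by (simp add: abs_minus_commute)
  also have "... <= norm (grad u y) * (dr * norm (grad pv (sg y)))"
   by (rule order_trans[OF Cauchy_Schwarz_ineq2 mul_l[OF C(2)[OF S(1)] norm_ge_zero]])
  finally show ?thesis by (simp add: mult_ac)
 qed
 have iA: "integ (%x. Dl l ?us x *. Dl l pv x)" "integ (%x. Dl l u x *. Dl l ?ps x)" "integ (%x. Dl l u x *. Dl l pv x)"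
  by (rule Dl_inner_integrable[OF us pv] Dl_inner_integrable[OF u ps] Dl_inner_integrable[OF u pv])+
 note if1 = Cc_integrable[OF fC] and if2 = Cc_integrable[OF cp[OF fC]] and iJ = Cc_integrable[OF JC] and iJ2 = Cc_integrable[OF cp[OF JC]]
 have sf: "(LBINT x. ?f (sg x)) = (LBINT x. ?f x)" "(LBINT x. norm (grad u (sg x)) * norm (grad pv (sg (sg x)))) = ?J"
  using mpres_integral[OF mp Cc_measurable[OF fC]] mpres_integral[OF mp Cc_measurable[OF JC]] by auto
 have "(LBINT x. ?f (sg x) - Dl l ?us x *. Dl l pv x) <= (LBINT x. dr * (norm (grad u (sg x)) * norm (grad pv (sg (sg x)))))"
  using e1 if2 iA iJ2 by (intro integral_mono integrable_diff integrable_mult_right) (auto simp: abs_le_iff)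
 hence 1: "(LBINT x. ?f x) - dform l ?us pv <= dr * ?J"
  using if2 iA(1) by (simp add: sf[symmetric])
 have "(LBINT y. Dl l u y *. Dl l ?ps y - ?f y) <= (LBINT y. dr * (norm (grad u y) * norm (grad pv (sg y))))"
  using e2 if1 iA iJ by (intro integral_mono integrable_diff integrable_mult_right) (auto simp: abs_le_iff)
 hence 2: "(LBINT y. Dl l u y *. Dl l ?ps y) - (LBINT y. ?f y) <= dr * ?J"
  using if1 iA(2) by simp
 have J: "?J <= ?X * nrm q (Dl l pv)"
 proof -
  have "?J <= nrm p (grad u) * nrm q (%y. grad pv (sg y))"
   using pq' Cc_measurable[OF U(3)] Cc_measurable[OF cp[OF S(3)]] by (intro holder_norm(2)[OF pq] Cc_int_powr[OF U(3)] Cc_int_powr[OF cp[OF S(3)]]) auto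
  also have "... = nrm p (grad u) * nrm q (grad pv)" using pq' by (simp add: ns[OF S(3)])
  also have "... <= ?X * nrm q (Dl l pv)"
   using pq' norm_Dl_ge(1) by (intro mult_mono Cc_pn_mono Dl_Cc[OF u] Dl_Cc[OF pv]) auto
  finally show ?thesis .
 qed
 \<comment> \<open>The odd part of the test function vanishes on the boundary, linearly in d, so
   that \<open>cut_limit\<close> lets the bound on u be tested with it.\<close>
 let ?ch = "%x. pv x - pv (sg x)"
 have ch: "?ch : C1c UNIV" by (rule C1c_diff[OF pv ps])
 have Dch: "Dl l ?ch = (%x. Dl l pv x - Dl l ?ps x)" by (rule Dl_diff[OF S(1) C(1)[OF S(1)]])
 obtain B where B: "!!x. norm (grad pv x) <= B" "B > 0" using Cc_bounded[OF S(3)] by blast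
 have "abs (?ch x) <= B * 4 * abs (d x)" for x
  using order_trans[OF C1_lipschitz[OF S(1) B(1), of x "sg x"] mul_l[OF d(4)[of x]]] B(2) by simp
 hence 3: "dform l u ?ch <= N * nrm q (Dl l ?ch)" by (rule cut_limit[OF ch d(1,2) _ u N b pq'(2)])
 have n3: "nrm q (Dl l ?ch) <= 3 * nrm q (Dl l pv)"
 proof -
  have "nrm q (Dl l ?ch) <= nrm q (Dl l pv) + nrm q (Dl l ?ps)"
   unfolding Dch using pq' by (intro Cc_triangle_diff Dl_Cc[OF pv] Dl_Cc[OF ps]) auto
  also have "nrm q (Dl l ?ps) <= nrm q (%x. 2 *: Dl l pv (sg x))"
  proof (rule Cc_pn_mono[OF _ Cc_scaleR[OF cp[OF Dl_Cc[OF pv]]]])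
   fix x
   let ?g = "grad pv (sg x)"
   have "norm (grad ?ps x) <= norm (grad ?ps x - rf n ?g) + norm (rf n ?g)" by (metis diff_add_cancel norm_triangle_ineq)
   also have "... <= dr * norm ?g + norm ?g" using C(2)[OF S(1), of x] by (simp add: rf_props(2)[OF n])
   also have "... <= 2 * norm ?g" using mul_r[OF dr(2), of "norm ?g"] by simp
   finally have a: "(norm (grad ?ps x))^2 <= (2 * norm ?g)^2" by (intro power_mono) auto
   have b: "(l * pv (sg x))^2 <= 2\<^sup>2 * (l * pv (sg x))^2" by simp
   have "norm (Dl l ?ps x) <= sqrt (2\<^sup>2 * ((norm ?g)^2 + (l * pv (sg x))^2))"
    using add_mono[OF a b] unfolding norm_Dl by (intro real_sqrt_le_mono) (simp only: power_mult_distrib distrib_left)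
   also have "... = norm (2 *: Dl l pv (sg x))" unfolding norm_scaleR norm_Dl real_sqrt_mult by simp
   finally show "norm (Dl l ?ps x) <= norm (2 *: Dl l pv (sg x))" .
  qed (use pq' in simp)
  also have "... = 2 * nrm q (Dl l pv)" using pq' by (subst pn_scaleR) (auto simp: ns[OF Dl_Cc[OF pv]])
  finally show ?thesis by simp
 qed
 have "dform l w pv = dform l u pv - dform l ?us pv"
  unfolding Dw using iA by (simp add: inner_diff_left)
 moreover have "dform l u ?ch = dform l u pv - dform l u ?ps"
  unfolding Dch using iA by (simp add: inner_diff_right)
 moreover have "N * nrm q (Dl l ?ch) <= N * (3 * nrm q (Dl l pv))" by (rule mul_l[OF n3 N])
 moreover have "dr * ?J <= dr * (?X * nrm q (Dl l pv))" by (rule mul_l[OF J dr(1)])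
 ultimately have "dform l w pv <= N * (3 * nrm q (Dl l pv)) + 2 * (dr * (?X * nrm q (Dl l pv)))" using 1 2 3 by linarith
 thus "dform l w pv <= (3 * N + 2 * dr * ?X) * nrm q (Dl l pv)" by (simp add: asimps)
qed
hence Xw: "nrm p (Dl l w) <= ?E * (3 * N + 2 * dr * ?X)" using N dr(1) by (intro infsupD[OF infsup_UNIV[OF pq] w]) auto
\<comment> \<open>d changes sign under \<open>sg\<close>, so the reflected copy of u vanishes on the
  support of u.\<close>
have "?X <= nrm p (Dl l w)"
proof (rule Cc_pn_mono[OF _ Dl_Cc[OF w]])
 obtain K where K: "K <= ?Om" "!!x. x ~: K ==> u x = 0" "!!x. x ~: K ==> grad u x = 0" using u by (rule C1c_support) blast
 fix x
 show "norm (Dl l u x) <= norm (Dl l w x)"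
 proof (cases "x : K")
  case True
  hence "sg x ~: K" using d(3)[of x] subsetD[OF K(1), of x] subsetD[OF K(1), of "sg x"] by auto
  hence "u (sg x) = 0" "grad u (sg x) = 0" using K by auto
  hence "grad (%x. u (sg x)) x = 0" using C(2)[OF U(1), of x] by (simp add: rf_def)
  thus ?thesis unfolding Dw using `u (sg x) = 0` by (simp add: Dl_def)
 qed (use K(2,3) in \<open>simp add: Dl_def\<close>)
qed (use pq' in simp)
also note Xw
also have "?E * (3 * N + 2 * dr * ?X) = 3 * ?E * N + (?E * (2 * dr)) * ?X" by (simp add: asimps)
also have "(?E * (2 * dr)) * ?X <= 1/2 * ?X" by (rule mul_r[OF dr(3)]) simp
finally show "?X <= 6 * ?E * N" by simp
qed

section \<open>Shears, mirror maps and domains above graphs\<close>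

lemma mpres_comp: "mpres sg ==> mpres ta ==> mpres (%x. sg (ta x))"
using distr_distr[of sg borel borel ta lborel] by (auto simp: mpres_def o_def)

lemma C1_comp_map:
fixes ta :: "'a::euclidean_space => 'a"
assumes u: "C1 u" and t: "!!x. (ta has_derivative ta' x) (at x)" and g: "!!x h. ta' x h *. grad u (ta x) = h *. g x" and c: "cont UNIV g"
shows "C1 (%x. u (ta x))" (is ?A) "grad (%x. u (ta x)) = g"
proof -
have "GDERIV (%x. u (ta x)) x :> g x" for x
 using has_derivative_compose[OF t GDERIV_has_derivative[OF C1_GDERIV[OF u]], of x] by (simp add: gderiv_def g)
thus ?A "grad (%x. u (ta x)) = g" using C1I[OF _ c] by auto
qed

lemma shear_C1:
fixes ty :: "'a::euclidean_space => real"
assumes u: "C1 u" and ty: "C1 ty"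
shows "C1 (%x. u (x + ty x *: e))" (is ?A) "grad (%x. u (x + ty x *: e)) = (%x. grad u (x + ty x *: e) + (e *. grad u (x + ty x *: e)) *: grad ty x)"
proof -
have t: "((%x. x + ty x *: e) has_derivative (%h. h + (h *. grad ty x) *: e)) (at x)" for x
 using GDERIV_has_derivative[OF C1_GDERIV[OF ty]] by (auto intro!: derivative_eq_intros)
have g: "(h + (h *. grad ty x) *: e) *. grad u (x + ty x *: e) = h *. (grad u (x + ty x *: e) + (e *. grad u (x + ty x *: e)) *: grad ty x)" for x h
 by (simp add: inner_add_left inner_add_right)
have cu: "cont UNIV (%x. grad u (x + ty x *: e))"
 by (intro cont_comp2[OF C1_cont_grad[OF u]] continuous_on_add continuous_on_scaleR continuous_on_id continuous_on_const C1_cont[OF ty]) auto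
have c: "cont UNIV (%x. grad u (x + ty x *: e) + (e *. grad u (x + ty x *: e)) *: grad ty x)"
 by (intro continuous_on_add continuous_on_scaleR continuous_on_inner continuous_on_const cu C1_cont_grad[OF ty])
from C1_comp_map[OF u t g c]
show ?A "grad (%x. u (x + ty x *: e)) = (%x. grad u (x + ty x *: e) + (e *. grad u (x + ty x *: e)) *: grad ty x)" by auto
qed

lemma mirror_C1:
assumes u: "C1 u"
shows "C1 (%x. u (x - (2 * (x *. n - c)) *: n))" (is ?A) "grad (%x. u (x - (2 * (x *. n - c)) *: n)) = (%x. rf n (grad u (x - (2 * (x *. n - c)) *: n)))"
proof -
have t: "((%x. x - (2 * (x *. n - c)) *: n) has_derivative (%h. h - (2 * (h *. n)) *: n)) (at x)" for x
 by (auto intro!: derivative_eq_intros)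
have g: "(h - (2 * (h *. n)) *: n) *. grad u (x - (2 * (x *. n - c)) *: n) = h *. rf n (grad u (x - (2 * (x *. n - c)) *: n))" for x h
 by (simp add: rf_def inner_diff_left inner_diff_right inner_commute)
have cu: "cont UNIV (%x. grad u (x - (2 * (x *. n - c)) *: n))"
 by (intro cont_comp2[OF C1_cont_grad[OF u]] cintro) auto
have c: "cont UNIV (%x. rf n (grad u (x - (2 * (x *. n - c)) *: n)))"
 unfolding rf_def by (intro continuous_on_diff continuous_on_scaleR continuous_on_mult continuous_on_inner continuous_on_const cu)
from C1_comp_map[OF u t g c]
show ?A "grad (%x. u (x - (2 * (x *. n - c)) *: n)) = (%x. rf n (grad u (x - (2 * (x *. n - c)) *: n)))" by auto
qed

text \<open>The reflection is a shear flattening the graph, a mirror map and the shear back. All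
  three preserve Lebesgue measure, so no Jacobian appears, and only a first derivative of
  \<open>ty\<close> is taken. The shear direction \<open>e\<close> may differ from the normal
  \<open>n\<close>, because in a chart the direction of the graph is prescribed while the normal is
  tilted to the tangent plane.\<close>

lemma graph_infsup:
fixes ty :: "'a::euclidean_space => real"
assumes pq: "conj_exp p q" and n: "norm n = 1" and e: "norm e = 1" and ty: "C1 ty" "!!x s. ty (x + s *: e) = ty x"
 and dr: "!!x. norm (grad ty x) <= dr" "dr <= 1/3" "EC TYPE('a) (min p q) * (12 * dr) <= 1"
shows "infsup {x. x *. n - c - ty x * (e *. n) > 0} l p q (6 * EC TYPE('a) (min p q))"
proof -
have dr0: "dr >= 0" using dr(1)[of 0] norm_ge_zero order_trans by blast
have nn: "n *. n = 1" using n by (simp add: norm_eq_1)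
have tym: "ty (x - s *: e) = ty x" for x s using ty(2)[of x "- s"] by simp
define F where "F x = x + ty x *: e" for x
define G where "G x = x + (- ty x) *: e" for x
define m where "m y = y - (2 * (y *. n - c)) *: n" for y
define d where "d x = G x *. n - c" for x
have FG: "F (G x) = x" "G (F x) = x" for x by (simp_all add: F_def G_def ty(2) tym)
have mm: "m (m y) = y" "m y *. n - c = - (y *. n - c)" for y by (simp_all add: m_def inner_diff_left nn asimps)
define sg where "sg x = F (m (G x))" for x
have ty': "C1 (%x. - ty x)" "grad (%x. - ty x) = (%x. - grad ty x)" by (rule C1_minus[OF ty(1)])+
have cF: "cont UNIV F" "cont UNIV G" "cont UNIV m"
 unfolding F_def[abs_def] G_def[abs_def] m_def[abs_def] by (intro cintro C1_cont[OF ty(1)])+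
have mp: "mpres F" "mpres G" "mpres m"
proof -
 show "mpres F" using ty(2) by (intro mpres_lines[OF e cont_bmeas[OF cF(1)], of 1 ty]) (auto simp: F_def)
 show "mpres G" using ty(2) by (intro mpres_lines[OF e cont_bmeas[OF cF(2)], of 1 "%x. - ty x"]) (auto simp: G_def)
 have "s *: n + s *: n = (s * 2) *: n" for s by (metis mult_2_right scaleR_add_left)
 thus "mpres m" by (intro mpres_lines[OF n cont_bmeas[OF cF(3)], of "-1" "%y. - (2 * (y *. n - c))"]) (auto simp: m_def inner_add_left nn asimps)
qed
have dG: "d x = x *. n - c - ty x * (e *. n)" for x by (simp add: d_def G_def inner_diff_left)
have gd: "C1 d" "grad d = (%x. n - (e *. n) *: grad ty x)"
proof -
 note A = C1_diff[OF C1_inner(1)[of n] C1_const(1)[of c]] and B = C1_cmult[OF ty(1), of "e *. n"]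
 have de: "d = (%x. (x *. n - c) - (e *. n) * ty x)" by (simp add: dG fun_eq_iff)
 show "C1 d" "grad d = (%x. n - (e *. n) *: grad ty x)" unfolding de using C1_diff[OF A(1) B(1)] by (simp_all add: A(2) B(2) C1_inner(2) C1_const(2))
qed
have "infsup {x. d x > 0} l p q (6 * EC TYPE('a) (min p q))"
\<comment> \<open>The defect of the composed gradient is at most dr + (1 + dr) dr, hence at most 3
  dr; the assumptions on \<open>dr\<close> are those of the reflection lemma for 3 dr.\<close>
proof (rule reflection_infsup[OF pq n, of sg "3 * dr" d])
 show "mpres sg" unfolding sg_def[abs_def] by (rule mpres_comp[OF mp(1) mpres_comp[OF mp(3,2)]])
 show "cont UNIV sg" unfolding sg_def[abs_def]
  by (intro cont_comp2[OF cF(1)] cont_comp2[OF cF(3)] cF(2)) auto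
 show "sg (sg x) = x" for x by (simp add: sg_def FG mm)
 show "C1 d" by (rule gd(1))
 show "norm (grad d x) <= 2" for x
 proof -
  have "abs (e *. n) * norm (grad ty x) <= 1 * 1" using Cauchy_Schwarz_ineq2[of e n] e n dr(1)[of x] dr(2) by (intro mult_mono) auto
  thus ?thesis unfolding gd(2) using norm_triangle_ineq4[of n "(e *. n) *: grad ty x"] n by simp
 qed
 show "d (sg x) = - d x" for x by (simp add: d_def sg_def FG mm(2))
 show "norm (x - sg x) <= 4 * abs (d x)" for x
 proof -
  let ?y = "G x"
  have "norm (x - sg x) = norm (F ?y - F (m ?y))" by (simp add: sg_def FG)
  also have "... = norm ((?y - m ?y) + (ty ?y - ty (m ?y)) *: e)" by (simp add: F_def asimps)
  also have "... <= norm (?y - m ?y) + dr * norm (?y - m ?y)"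
   using C1_lipschitz[OF ty(1) dr(1), of ?y "m ?y"] e by (intro order_trans[OF norm_triangle_ineq]) simp
  also have "... <= 2 * norm (?y - m ?y)" using dr(2) mul_r[of dr 1 "norm (?y - m ?y)"] by simp
  also have "norm (?y - m ?y) = 2 * abs (d x)"
  proof -
   have "?y - m ?y = (2 * d x) *: n" by (simp add: m_def d_def)
   thus ?thesis using n by (simp add: abs_mult)
  qed
  finally show ?thesis by simp
 qed
 fix u :: "'a => real" assume u: "C1 u"
 note s1 = shear_C1[OF u ty(1), of e, folded F_def]
 note s2 = mirror_C1[OF s1(1), of n c, folded m_def]
 note s3 = shear_C1[OF s2(1) ty'(1), of e, folded G_def]
 show "C1 (%x. u (sg x))" using s3(1) by (simp add: sg_def)
 fix x
 let ?g = "grad u (sg x)"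
 define a where "a = (e *. ?g) *: grad ty (m (G x))"
 have e1: "abs (e *. y) <= norm y" for y using Cauchy_Schwarz_ineq2[of e y] e by simp
 have na: "norm a <= dr * norm ?g" using mult_mono[OF e1[of ?g] dr(1)[of "m (G x)"]] by (simp add: a_def mult.commute)
 have lin: "rf n (?g + a) = rf n ?g + rf n a" by (simp add: rf_def inner_add_left asimps)
 have "grad (%x. u (sg x)) x = rf n (?g + a) - (e *. rf n (?g + a)) *: grad ty x"
  using fun_cong[OF s3(2), of x] by (simp add: sg_def s1(2) s2(2) ty'(2) a_def)
 hence "grad (%x. u (sg x)) x - rf n ?g = rf n a - (e *. rf n (?g + a)) *: grad ty x" unfolding lin by simp
 also have "norm ... <= norm (rf n a) + norm ((e *. rf n (?g + a)) *: grad ty x)" by (rule norm_triangle_ineq4)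
 also have "... <= dr * norm ?g + (norm ?g + dr * norm ?g) * dr"
 proof (intro add_mono)
  show "norm (rf n a) <= dr * norm ?g" using na by (simp add: rf_props(2)[OF n])
  have "abs (e *. rf n (?g + a)) <= norm ?g + dr * norm ?g"
   using e1[of "rf n (?g + a)"] norm_triangle_ineq[of ?g a] na by (simp add: rf_props(2)[OF n])
  thus "norm ((e *. rf n (?g + a)) *: grad ty x) <= (norm ?g + dr * norm ?g) * dr"
   unfolding norm_scaleR using dr(1)[of x] dr0 by (intro mult_mono) auto
 qed
 also have "... = (2 + dr) * (dr * norm ?g)" by (simp add: asimps)
 also have "... <= 3 * (dr * norm ?g)" using dr(2) dr0 by (intro mul_r) auto
 finally show "norm (grad (%x. u (sg x)) x - rf n ?g) <= 3 * dr * norm ?g" by simp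
qed (use dr dr0 in auto)
thus ?thesis by (simp add: dG)
qed

text \<open>A C^2 cutoff complementary to the bump: 1 where the bump vanishes, 0 where it is at
  least b.\<close>

definition pcut :: "real => 'a::euclidean_space => real => 'a => real" where
"pcut b z rh x = (max 0 (1 - bump z rh x / b)) ^ 3"

lemma pcut_deriv:
"((%s. (max 0 (1 - s / b)) ^ 3) hrd (- 3 / b) * (max 0 (1 - s / b))^2) (at s)" (is ?A)
"((%s. (- 3 / b) * (max 0 (1 - s / b))^2) hrd (6 / b^2) * max 0 (1 - s / b)) (at s)" (is ?B)
proof -
have g: "((%s. 1 - s / b) hrd - (1 / b)) (at s)"
 unfolding divide_inverse by (auto intro!: derivative_eq_intros)
have 3: "((%s. (max 0 s) ^ 3) hrd 3 * (max 0 s)^2) (at s)" for s :: real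
 using pospow_deriv[of 1 s] by (simp add: numeral_3_eq_3 numeral_2_eq_2)
have 2: "((%s. (max 0 s)\<^sup>2) hrd 2 * max 0 s) (at s)" for s :: real
 using pospow_deriv[of 0 s] by (simp add: numeral_2_eq_2)
show ?A
 using DERIV_chain2[where f="%s. (max 0 s) ^ 3" and g="%s. 1 - s / b", OF 3 g] by (simp add: mult_ac)
have "((%s. (- 3 / b) * (max 0 (1 - s / b))^2) hrd (- 3 / b) * (2 * max 0 (1 - s / b) * - (1 / b))) (at s)"
 by (intro DERIV_cmult DERIV_chain2[where f="%s. (max 0 s)\<^sup>2" and g="%s. 1 - s / b", OF 2 g])
thus ?B
 by (simp add: pow2 mult_ac)
qed

lemma pcut_C2:
fixes z :: "'a::euclidean_space"
shows "C2 (pcut b z rh)" (is ?A) "grad (pcut b z rh) = (%x. ((- 3 / b) * (max 0 (1 - bump z rh x / b))^2) *: grad (bump z rh) x)" (is ?B)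
 "lap (pcut b z rh) x = (6 / b^2) * max 0 (1 - bump z rh x / b) * (norm (grad (bump z rh) x))^2 + (- 3 / b) * (max 0 (1 - bump z rh x / b))^2 * lap (bump z rh) x" (is ?C)
proof -
have c: "cont UNIV (%s. (- 3 / b) * (max 0 (1 - s / b))^2)" "cont UNIV (%s. (6 / b^2) * max 0 (1 - s / b))"
 by (simp_all only: divide_inverse) (intro cintro)+
have c0: "C1 (pcut b z rh)" and g: "grad (pcut b z rh) = (%x. ((- 3 / b) * (max 0 (1 - bump z rh x / b))^2) *: grad (bump z rh) x)"
 using C1_chain[OF bump_C1(1) pcut_deriv(1) c(1), of z rh] by (simp_all add: pcut_def[abs_def])
show ?B by (rule g)
note f = C1_chain[OF bump_C1(1) pcut_deriv(2) c(2), of z rh]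
have e: "C1 (%x. grad (bump z rh) x *. e)" if "e : Basis" for e using bump_C2 that by (auto simp: C2_def)
have ge: "(%x. grad (pcut b z rh) x *. e) = (%x. ((- 3 / b) * (max 0 (1 - bump z rh x / b))^2) * (grad (bump z rh) x *. e))" for e
 by (simp add: g)
show ?A unfolding C2_def ge using c0 C1_mult(1)[OF f(1) e] by blast
have "lap (pcut b z rh) x = (SUM e:Basis. (6 / b^2) * max 0 (1 - bump z rh x / b) * ((grad (bump z rh) x *. e) * (grad (bump z rh) x *. e))
  + (- 3 / b) * (max 0 (1 - bump z rh x / b))^2 * (grad (%x. grad (bump z rh) x *. e) x *. e))"
 unfolding lap_def ge by (intro sum.cong refl) (subst C1_mult(2)[OF f(1) e], assumption, simp only: f(2), simp add: inner_diff_left inner_add_left mult_ac)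
moreover have "(SUM e:Basis. (grad (bump z rh) x *. e) * (grad (bump z rh) x *. e)) = (norm (grad (bump z rh) x))^2"
 by (metis euclidean_inner power2_norm_eq_inner)
ultimately show ?C
 by (simp only: sum.distrib sum_distrib_left[symmetric] lap_def[of "bump z rh"])
qed

lemma pcut_bounds:
fixes z :: "'a::euclidean_space"
assumes b: "b > 0" and rh: "rh > 0"
shows "0 <= pcut b z rh x" (is ?A) "pcut b z rh x <= 1" "norm (grad (pcut b z rh) x) <= 18 / (b * rh)" (is ?B)
proof -
let ?m = "max 0 (1 - bump z rh x / b)"
have m: "0 <= ?m" "?m <= 1" using bump_bounds(1)[OF rh, of z x] b by auto
show ?A "pcut b z rh x <= 1" using m by (auto simp: pcut_def power_le_one)
have "(3 / b * ?m^2) * norm (grad (bump z rh) x) <= (3 / b * 1) * (6 / rh)"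
 using m b rh by (intro mult_mono bump_bounds(5) mul_l power_le_one) auto
thus ?B using b by (simp add: pcut_C2(2) abs_mult)
qed

text \<open>Inside the ball of radius 2 the bump of radius 4 is at least 27/64 > 1/3, so 9 times the
  bump and 9 times its square are both at least 1 there; outside, the derivatives vanish.\<close>

lemma cutoffI:
fixes ph :: "'a::euclidean_space => real"
assumes "C2 ph" "!!x. abs (ph x) <= 1" "!!x. norm (grad ph x) <= B" "!!x. abs (lap ph x) <= B" "!!x. norm x >= 2 ==> grad ph x = 0 & lap ph x = 0"
shows "cutoff (9 * B) 4 ph"
unfolding cutoff_def
proof (intro conjI allI assms(1,2))
fix x :: 'a
have B: "B >= 0" using assms(3)[of 0] norm_ge_zero order_trans by blast
let ?b = "bump (0::'a) 4 x"
have b0: "?b >= 0" by (rule bump_bounds(1)) simp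
show "norm (grad ph x) <= 9 * B * ?b"
proof (cases "norm x < 2")
 case True
 hence "?b >= 1/9" using bump_ge_half[of x 0 4] by simp
 thus ?thesis using assms(3)[of x] mul_l[of "1/9" ?b "9 * B"] B by simp
qed (use assms(5)[of x] B b0 in simp)
show "abs (lap ph x) <= 9 * B * ?b^2"
proof (cases "norm x < 2")
 case True
 hence "?b >= 1/3" using bump_ge_half[of x 0 4] by simp
 hence "?b^2 >= (1/3)^2" by (intro power_mono) auto
 hence "?b^2 >= 1/9" by (simp add: pow2)
 thus ?thesis using assms(4)[of x] mul_l[of "1/9" "?b^2" "9 * B"] B by simp
qed (use assms(5)[of x] B b0 in simp)
qed

lemma cutoff_mono: "cutoff A rh ph ==> A <= A' ==> rh > 0 ==> cutoff A' rh ph"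
unfolding cutoff_def using bump_bounds(1)[of rh 0] by (meson mul_r order_trans zero_le_power2)

lemma bump_cutoff:
fixes x :: "'a::euclidean_space"
assumes "norm x <= 1" "0 < r" "r <= 1"
shows "cutoff (9 * ((24 + 6 * real DIM('a)) / r^2)) 4 (bump x r)"
proof (rule cutoffI[OF bump_C2])
show "abs (bump x r y) <= 1" for y using bump_bounds(1,2)[OF assms(2), of x y] by simp
show "norm (grad (bump x r) y) <= (24 + 6 * real DIM('a)) / r^2" for y
proof -
 have "6 / r <= (24 + 6 * real DIM('a)) / r^2"
 proof -
  have "6 / r = 6 * r / r^2" using assms by (simp add: pow2)
  also have "... <= (24 + 6 * real DIM('a)) / r^2" using assms by (intro divide_right_mono) auto
  finally show ?thesis .
 qed
 thus ?thesis using bump_bounds(5)[OF assms(2), of x y] by linarith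
qed
show "abs (lap (bump x r) y) <= (24 + 6 * real DIM('a)) / r^2" for y by (rule bump_bounds(6)[OF assms(2)])
fix y :: 'a assume "norm y >= 2"
hence "norm (y - x) >= r" using norm_triangle_ineq2[of y x] assms by linarith
thus "grad (bump x r) y = 0 & lap (bump x r) y = 0" using bump_bounds(7,8)[OF assms(2), of y x] by simp
qed

lemma bump_transfer:
assumes "pv : C1c Om'" "r > 0" "cball x r \<inter> Om' <= Om" shows "(%y. bump x r y * pv y) : C1c Om"
proof -
obtain L where L: "compact L" "L <= Om'" "!!y. y ~: L ==> pv y = 0" using assms(1) by (rule C1c_support) blast
show ?thesis
proof (rule C1cI[of _ "cball x r \<inter> L"])
 show "C1 (%y. bump x r y * pv y)" by (rule C1_mult(1)[OF bump_C1(1) C1cD(1)[OF assms(1)]])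
 show "compact (cball x r \<inter> L)" by (rule closed_Int_compact[OF closed_cball L(1)])
 show "cball x r \<inter> L <= Om" using L(2) assms(3) by auto
 fix y assume "y ~: cball x r \<inter> L"
 thus "bump x r y * pv y = 0" using L(3) bump_bounds(3)[OF assms(2), of y x] by (auto simp: dist_norm norm_minus_commute)
qed
qed

text \<open>The linear part of the graph function at \<open>x0\<close> is moved into the normal of
  the half space. What remains has small slope near \<open>x0\<close>; cut off in the directions
  orthogonal to \<open>e\<close>, it becomes a global graph function of small slope, to which
  \<open>graph_infsup\<close> applies.\<close>

lemma chart:
fixes pv :: "'a::euclidean_space => real"
assumes pq: "conj_exp p q" and e: "norm e = 1" and pv: "C1 pv"
shows "EX Om' r. r > 0 & (ALL l. infsup Om' l p q (6 * EC TYPE('a) (min p q))) & (ALL y:ball x0 r. y : Om' \<longleftrightarrow> y *. e > pv (y - (y *. e) *: e))"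
proof -
let ?E = "EC TYPE('a) (min p q)"
have E0: "?E >= 0" by (rule EC_nonneg) (use conj_expD(1,2)[OF pq] in simp)
define dr where "dr = 1 / (3 + 12 * ?E)"
have dr: "dr > 0" "dr <= 1/3" "?E * (12 * dr) <= 1" using E0 by (auto simp: dr_def field_simps)
\<comment> \<open>In the slope of the truncated remainder, the gradient contributes 1 and the cutoff
  at most 54: the remainder is at most \<open>ta * rh\<close>, and 18 / (27/64) is below 54.\<close>
define ta where "ta = dr / 55"
have ta: "ta > 0" using dr by (simp add: ta_def)
define P where "P y = y - (y *. e) *: e" for y :: 'a
have ee: "e *. e = 1" using e by (simp add: norm_eq_1)
have Ps: "P (y + s *: e) = P y" for y s by (simp add: P_def inner_add_left ee asimps)
have Pd: "P y - P z = P (y - z)" for y z by (simp add: P_def inner_diff_left asimps)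
have Pe: "P y *. e = 0" for y by (simp add: P_def inner_diff_left ee)
have Pn: "norm (P y) <= norm y" for y
proof -
 have "norm y ^ 2 = norm (P y) ^ 2 + (y *. e)^2"
  unfolding power2_norm_eq_inner by (simp add: P_def inner_diff_left inner_diff_right ee inner_commute pow2)
 hence "(norm (P y))^2 <= (norm y)^2" by simp
 thus ?thesis by (rule power2_le_imp_le) simp
qed
have cP: "cont UNIV P" unfolding P_def[abs_def] by (intro cintro)
have CP: "C1 (%y. f (P y))" "grad (%y. f (P y)) = (%y. P (grad f (P y)))" if f: "C1 f" for f
proof -
 have t: "(P has_derivative P) (at y)" for y unfolding P_def[abs_def] by (auto intro!: derivative_eq_intros)
 have g: "P h *. grad f (P y) = h *. P (grad f (P y))" for h y by (simp add: P_def inner_diff_left inner_diff_right inner_commute)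
 have "cont UNIV (%y. P (grad f (P y)))"
  by (intro cont_comp2[OF cP] cont_comp2[OF C1_cont_grad[OF f] cP]) auto
 from C1_comp_map[OF f t g this] show "C1 (%y. f (P y))" "grad (%y. f (P y)) = (%y. P (grad f (P y)))" by auto
qed
define a where "a = P (grad pv (P x0))"
have ae: "a *. e = 0" "e *. a = 0" unfolding a_def using Pe by (simp_all add: inner_commute)
define c0 where "c0 = pv (P x0) - x0 *. a"
define rr where "rr y = pv (P y) - y *. a - c0" for y
have R: "C1 rr" "grad rr = (%y. P (grad pv (P y)) - a)"
proof -
 note A = C1_diff[OF CP(1)[OF pv] C1_inner(1)[of a]]
 show "C1 rr" "grad rr = (%y. P (grad pv (P y)) - a)"
  unfolding rr_def[abs_def] using C1_diff[OF A(1) C1_const(1)[of c0]] by (simp_all add: A(2) C1_const(2) CP(2)[OF pv] C1_inner(2))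
qed
have rs: "rr (y + s *: e) = rr y" "grad rr (y + s *: e) = grad rr y" for y s by (simp_all add: rr_def R(2) Ps inner_add_left ae)
have r0: "rr x0 = 0" "grad rr x0 = 0" by (simp_all add: rr_def c0_def R(2) a_def)
obtain rh1 where rh1: "rh1 > 0" "!!y. norm (y - x0) < rh1 ==> norm (grad rr y) < ta"
 using C1_cont_grad[OF R(1)] ta r0(2) unfolding continuous_on_iff by (auto simp: dist_norm) (metis diff_zero)
define rh where "rh = rh1 / 2"
have rh: "rh > 0" using rh1 by (simp add: rh_def)
have near: "abs (rr y) <= ta * rh" "norm (grad rr y) <= ta" if y: "norm (P y - P x0) <= rh" for y
proof -
 \<comment> \<open>The remainder is invariant along \<open>e\<close>, so y may be moved along
   \<open>e\<close> into the ball around \<open>x0\<close>. Smallness in that ball becomes smallness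
   in the whole cylinder over it.\<close>
 define z where "z = y + (- ((y - x0) *. e)) *: e"
 have zx: "z - x0 = P y - P x0" by (simp add: z_def Pd P_def asimps)
 have z: "norm (z - x0) <= rh" unfolding zx by (rule y)
 show "norm (grad rr y) <= ta" using rh1(2)[of z] z rh rs(2)[of y "- ((y - x0) *. e)"] by (simp add: rh_def z_def)
 have "norm (rr z - rr x0) <= ta * norm (z - x0)"
 proof (rule differentiable_bound[of "cball x0 rh"])
  show "(rr has_derivative (%h. h *. grad rr w)) (at w within cball x0 rh)" for w
   by (rule has_derivative_at_withinI[OF GDERIV_has_derivative[OF C1_GDERIV[OF R(1)]]])
  fix w assume "w : cball x0 rh"
  hence "norm (grad rr w) <= ta" using rh1(2)[of w] rh by (simp add: dist_norm norm_minus_commute rh_def)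
  hence "norm (h *. grad rr w) <= ta * norm h" for h
   using Cauchy_Schwarz_ineq2[of h "grad rr w"] mul_l[of "norm (grad rr w)" ta "norm h"] by (simp add: mult.commute)
  thus "onorm (%h. h *. grad rr w) <= ta" by (rule onorm_le)
 qed (use z rh in \<open>auto simp: dist_norm norm_minus_commute\<close>)
 hence "norm (rr z - rr x0) <= ta * rh" by (rule order_trans[OF _ mul_l[OF z less_imp_le[OF ta]]])
 hence "abs (rr z) <= ta * rh" using r0(1) by simp
 thus "abs (rr y) <= ta * rh" using rs(1)[of y "- ((y - x0) *. e)"] by (simp add: z_def)
qed
\<comment> \<open>At level 27/64 this vanishes within distance \<open>rh / 2\<close> of the centre
  and equals 1 beyond \<open>rh\<close>; hence \<open>ty\<close> is the remainder nearby and 0 far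
  away.\<close>
let ?k = "pcut (27/64) (P x0) rh"
define ty where "ty y = (1 - ?k (P y)) * rr y" for y
have kC: "C1 (%y. 1 - ?k (P y))" "grad (%y. 1 - ?k (P y)) = (%y. - P (grad ?k (P y)))"
 using C1_diff[OF C1_const(1)[of 1] CP(1)[OF C2_C1[OF pcut_C2(1)]]] by (simp_all add: C1_const(2) CP(2)[OF C2_C1[OF pcut_C2(1)]])
have T: "C1 ty" "grad ty = (%y. (1 - ?k (P y)) *: grad rr y + rr y *: (- P (grad ?k (P y))))"
 unfolding ty_def[abs_def] using C1_mult[OF kC(1) R(1)] by (simp_all add: kC(2))
have k0: "?k w = 1 & grad ?k w = 0" if "norm (w - P x0) >= rh" for w
 using bump_bounds(3,7)[OF rh that] by (simp add: pcut_def pcut_C2(2))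
have gT: "norm (grad ty y) <= dr" for y
proof (cases "norm (P y - P x0) <= rh")
 case True
 have "norm (grad ty y) <= abs (1 - ?k (P y)) * norm (grad rr y) + abs (rr y) * norm (P (grad ?k (P y)))"
  unfolding T(2) by (rule order_trans[OF norm_triangle_ineq]) simp
 also have "... <= 1 * ta + (ta * rh) * (54 / rh)"
 proof (intro add_mono mult_mono near[OF True])
  show "abs (1 - ?k (P y)) <= 1" using pcut_bounds(1,2)[of "27/64" rh "P x0" "P y"] rh by simp
  have "18 / (27/64 * rh) <= 54 / rh" using rh by (simp add: field_simps)
  thus "norm (P (grad ?k (P y))) <= 54 / rh" using pcut_bounds(3)[of "27/64" rh "P x0" "P y"] rh Pn[of "grad ?k (P y)"] by simp
 qed (use ta rh in auto)
 also have "... = dr" using rh by (simp add: ta_def)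
 finally show ?thesis .
next
 case False
 thus ?thesis using k0[of "P y"] dr by (simp add: T(2) P_def[of 0])
qed
define s where "s = 1 / sqrt (1 + (norm a)^2)"
define n where "n = s *: (e - a)"
have s0: "s > 0" by (simp add: s_def)
have nn: "norm n = 1"
proof -
 have "(norm (e - a))^2 = 1 + (norm a)^2" unfolding power2_norm_eq_inner by (simp add: inner_diff_left inner_diff_right ae ee)
 hence "norm (e - a) = sqrt (1 + (norm a)^2)" by (metis norm_ge_zero real_sqrt_unique)
 thus ?thesis by (simp add: n_def s_def)
qed
have en: "e *. n = s" by (simp add: n_def inner_diff_right ee ae)
let ?Om = "{x. x *. n - s * c0 - ty x * (e *. n) > 0}"
have "y : ?Om \<longleftrightarrow> y *. e > pv (P y)" if y: "y : ball x0 (rh/2)" for y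
proof -
 have "norm (P y - P x0) <= rh / 2" using Pn[of "y - x0"] y by (simp add: Pd dist_norm norm_minus_commute)
 hence "bump (P x0) rh (P y) >= 27/64" by (rule bump_ge_half[OF _ rh])
 hence "?k (P y) = 0" by (simp add: pcut_def)
 hence "y *. n - s * c0 - ty y * (e *. n) = s * (y *. e - pv (P y))"
  by (simp add: ty_def en n_def rr_def inner_diff_right ee ae asimps)
 hence "y : ?Om \<longleftrightarrow> 0 < s * (y *. e - pv (P y))" by (simp only: mem_Collect_eq)
 thus ?thesis using s0 by (simp add: zero_less_mult_iff)
qed
moreover have "infsup ?Om l p q (6 * ?E)" for l
 by (rule graph_infsup[OF pq nn e T(1) _ gT dr(2,3)]) (simp add: ty_def Ps rs(1))
ultimately show ?thesis using rh unfolding P_def by (intro exI[of _ ?Om] exI[of _ "rh/2"]) auto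
qed

text \<open>The model domain and the radius at a point of S are the same for all members of the
  family, so one finite subcover of S, and with it one constant, serves every index. Away from S the
  cutoff \<open>ph0\<close> compares each member with its own model domain, for which the constant K
  is assumed.\<close>

lemma LOCal_family:
fixes Om :: "'j => 'a::euclidean_space set"
assumes pq: "conj_exp p q" and d: "q < real DIM('a)" and K: "K >= 0" and S: "compact S" "S <= cball 0 1"
 and patch: "!!x. x : S ==> EX Om' r. 0 < r & r <= 1 & (ALL l. infsup Om' l p q K) & (ALL j:J. cball x r \<inter> Om' <= Om j & cball x r \<inter> Om j <= Om')"
 and far: "cutoff A0 4 ph0" "A0 >= 0" "!!j l. j : J ==> l >= 0 ==> infsup (Om0 j) l p q K"
  "!!j pv. j : J ==> pv : C1c (Om0 j) ==> (%x. ph0 x * pv x) : C1c (Om j)" "!!j u. j : J ==> u : C1c (Om j) ==> (%x. ph0 x * u x) : C1c (Om0 j)"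
 and cov: "!!j x. j : J ==> x : Om j ==> x : S | ph0 x >= 1/4"
shows "EX C>=0. ALL j:J. LOCal (Om j) p q C 4"
proof -
obtain W r where Wr: "!!x. x : S ==> 0 < r x & r x <= 1 & (ALL l. infsup (W x) l p q K) & (ALL j:J. cball x (r x) \<inter> W x <= Om j & cball x (r x) \<inter> Om j <= W x)"
 using patch by metis
obtain F where F: "F <= S" "finite F" "S <= (\<Union>x\<in>F. ball x (r x / 2))"
proof (rule compactE_image[OF S(1), of S "%x. ball x (r x / 2)"])
 show "S <= (\<Union>x\<in>S. ball x (r x / 2))" using Wr by force
qed auto
let ?I = "insert None (Some ` F)"
define ph where "ph i = (case i of None => ph0 | Some x => bump x (r x))" for i
define A where "A = A0 + (SUM x:F. 9 * ((24 + 6 * real DIM('a)) / (r x)^2))"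
have A0: "A >= A0" unfolding A_def by (simp add: sum_nonneg)
have cph: "cutoff A 4 (ph i)" if "i : ?I" for i
proof (cases i)
 case None
 thus ?thesis using cutoff_mono[OF far(1) A0] by (simp add: ph_def)
next
 case (Some x)
 hence x: "x : F" "x : S" using that F(1) by auto
 have "9 * ((24 + 6 * real DIM('a)) / (r x)^2) <= (SUM x:F. 9 * ((24 + 6 * real DIM('a)) / (r x)^2))"
  by (rule member_le_sum[OF x(1) _ F(2)]) simp
 hence "9 * ((24 + 6 * real DIM('a)) / (r x)^2) <= A" using far(2) by (simp add: A_def)
 thus ?thesis using cutoff_mono[OF bump_cutoff[of x "r x"]] Wr[OF x(2)] x(2) S(2) Some by (auto simp: ph_def)
qed
define O' where "O' j i = (case i of None => Om0 j | Some x => W x)" for j i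
let ?C = "4 * real (card ?I) * (K * (1 + 2 * A + A * hc TYPE('a) q 4) + A)"
have "?C >= 0"
proof -
 have "hc TYPE('a) q 4 >= 0" using d conj_expD(2)[OF pq] by (auto simp: hc_def)
 thus ?thesis using K A0 far(2) by (intro mult_nonneg_nonneg add_nonneg_nonneg) auto
qed
moreover have "LOCal (Om j) p q ?C 4" if j: "j : J" for j
proof (rule LOCal_cover[OF pq d _ K _ _ _ cph, where Om'="O' j"])
 show "infsup (O' j i) l p q K" if "i : ?I" "l >= 0" for i l
  using that far(3)[OF j] Wr F(1) by (auto simp: O'_def)
 show "(%x. ph i x * pv x) : C1c (Om j)" if "i : ?I" "pv : C1c (O' j i)" for i pv
 proof (cases i)
  case None thus ?thesis using far(4)[OF j, of pv] that(2) by (simp add: ph_def O'_def)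
 next
  case (Some x)
  hence "x : S" using that F(1) by auto
  thus ?thesis using bump_transfer[of pv "W x" "r x" x "Om j"] Wr[of x] j that(2) Some by (auto simp: ph_def O'_def)
 qed
 show "(%x. ph i x * u x) : C1c (O' j i)" if "i : ?I" "u : C1c (Om j)" for i u
 proof (cases i)
  case None thus ?thesis using far(5)[OF j, of u] that(2) by (simp add: ph_def O'_def)
 next
  case (Some x)
  hence "x : S" using that F(1) by auto
  thus ?thesis using bump_transfer[of u "Om j" "r x" x "W x"] Wr[of x] j that(2) Some by (auto simp: ph_def O'_def)
 qed
 show "EX i:?I. 1/4 <= ph i x" if x: "x : Om j" for x
 proof (cases "x : S")
  case True
  then obtain y where y: "y : F" "x : ball y (r y / 2)" using F(3) by auto
  hence "bump y (r y) x >= 27/64" using Wr[of y] F(1) by (intro bump_ge_half) (auto simp: dist_norm norm_minus_commute)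
  thus ?thesis using y(1) by (intro bexI[of _ "Some y"]) (auto simp: ph_def)
 next
  case False
  thus ?thesis using cov[OF j x] by (auto simp: ph_def)
 qed
qed (use F(2) A0 far(2) in auto)
ultimately show ?thesis by blast
qed

section \<open>Perforated balls\<close>

text \<open>A family with a single member: the closed ball is covered by interior patches, modelled
  on the whole space, and by boundary charts. No far region remains, so the far cutoff is 0.\<close>

lemma ball_LOCal:
assumes pq: "conj_exp p q" and d: "q < real DIM('a::euclidean_space)"
shows "EX C>=0. LOCal (ball (0::'a) 1) p q C 4"
proof -
let ?E = "EC TYPE('a) (min p q)"
have E0: "?E >= 0" by (rule EC_nonneg) (use conj_expD(1,2)[OF pq] in simp)
have z: "grad (%x::'a. 0) = (%x. 0)" by (rule C1_const(2))
have U: "infsup (UNIV :: 'a set) l p q (6 * ?E)" for l by (rule infsup_mono[OF infsup_UNIV[OF pq]]) (use E0 in simp)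
have c0: "cutoff 0 4 (%x::'a. 0)" by (simp add: cutoff_def C2_def lap_def z C1_const)
have "EX C>=0. ALL j:UNIV::unit set. LOCal (ball (0::'a) 1) p q C 4"
proof (rule LOCal_family[OF pq d _ compact_cball order_refl _ c0, where Om="%_. ball 0 1" and Om0="%_. UNIV"])
 show "0 <= 6 * ?E" using E0 by simp
 show "(%x. 0 * pv x) : C1c S" for pv and S :: "'a set" by (simp add: C1c_zero)
 show "(%x. 0 * pv x) : C1c S" for pv and S :: "'a set" by (simp add: C1c_zero)
 fix x :: 'a assume "x : cball 0 1"
 then consider "norm x < 1" | "norm x = 1" by fastforce
 thus "EX Om' r. 0 < r & r <= 1 & (ALL l. infsup Om' l p q (6 * ?E)) & (ALL j:UNIV::unit set. cball x r \<inter> Om' <= ball 0 1 & cball x r \<inter> ball 0 1 <= Om')"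
 proof cases
  case 1
  have "y : ball 0 1" if "y : cball x ((1 - norm x) / 2)" for y
   using norm_triangle_ineq2[of y x] that 1 by (simp add: dist_norm norm_minus_commute)
  moreover have "(1 - norm x) / 2 <= 1" using order_trans[OF _ norm_ge_zero[of x], of "- 1"] by simp
  ultimately show ?thesis using 1 U by (intro exI[of _ UNIV] exI[of _ "(1 - norm x) / 2"]) auto
 next
  case 2
  define e where "e = - x"
  have e: "norm e = 1" "e *. e = 1" using 2 by (simp_all add: e_def norm_eq_1)
  let ?k = "pcut (27/64) (0::'a) (1/2)"
  \<comment> \<open>The sphere is the graph of -sqrt(1 - |y|^2). Since w equals 1 - |y|^2 for |y| <=
    1/4, equals 1 for |y| >= 1/2 and is positive throughout, its square root is C^1 on the whole
    space.\<close>
  define w where "w y = 1 - (norm (y - 0))^2 * (1 - ?k y)" for y :: 'a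
  have k: "0 <= ?k y" "?k y <= 1" for y by (rule pcut_bounds; simp)+
  have wp: "w y > 0" for y
  proof (cases "norm y < 1/2")
   case True
   hence "(norm y)^2 < 1\<^sup>2" by (intro power_strict_mono) auto
   hence "(norm y)^2 * (1 - ?k y) < 1" using k[of y] mult_left_le[of "1 - ?k y" "(norm y)^2"] by simp
   thus ?thesis by (simp add: w_def)
  next
   case False
   hence "?k y = 1" using bump_bounds(3)[of "1/2" y 0] by (simp add: pcut_def)
   thus ?thesis by (simp add: w_def)
  qed
  have wC: "C1 w" unfolding w_def[abs_def] by (intro C1_diff C1_mult C1_norm2 C1_const C2_C1 pcut_C2)
  have "C1 (%y. - sqrt (w y))"
  proof (rule C1_chain_on(1)[OF wC, of "%t. - sqrt t" "%t. - (inverse (sqrt t) / 2)"])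
   show "((%t. - sqrt t) hrd - (inverse (sqrt (w y)) / 2)) (at (w y))" for y
    using DERIV_real_sqrt[OF wp[of y]] by (rule DERIV_minus)
   show "cont UNIV (%y. - (inverse (sqrt (w y)) / 2))"
    using wp by (intro cintro C1_cont[OF wC]) (auto simp: less_imp_neq[symmetric])
  qed
  from chart[OF pq e(1) this, of x] obtain Om' r where r: "r > 0" "!!l. infsup Om' l p q (6 * ?E)"
   "!!y. y : ball x r ==> y : Om' \<longleftrightarrow> y *. e > - sqrt (w (y - (y *. e) *: e))" by blast
  \<comment> \<open>Within distance 1/4 of x the component along \<open>e\<close> is negative, which
    selects the lower sheet, and the orthogonal component has norm at most 1/4, where w is
    unmodified.\<close>
  have "y : Om' \<longleftrightarrow> y : ball 0 1" if y: "y : cball x (min (r/2) (1/4))" for y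
  proof -
   let ?P = "y - (y *. e) *: e"
   have yx: "norm (y - x) <= 1/4" "norm (y - x) <= r/2" using y by (auto simp: dist_norm norm_minus_commute)
   have ye: "y *. e < 0"
   proof -
    have "(y - x) *. e <= 1/4" using norm_cauchy_schwarz[of "y - x" e] e yx by simp
    moreover have "x *. e = - 1" using e by (simp add: e_def)
    ultimately show ?thesis by (simp add: inner_diff_left)
   qed
   have pyth: "(norm z)^2 = (norm (z - (z *. e) *: e))^2 + (z *. e)^2" for z
    unfolding power2_norm_eq_inner by (simp add: inner_diff_left inner_diff_right e inner_commute pow2)
   have "?P = (y - x) - ((y - x) *. e) *: e" using e by (simp add: e_def inner_diff_left asimps)
   hence "(norm (y - x))^2 = (norm ?P)^2 + ((y - x) *. e)^2" using pyth[of "y - x"] by (simp only:)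
   hence "(norm ?P)^2 <= (norm (y - x))^2" by simp
   hence nP: "norm ?P <= 1/4" using yx(1) power2_le_imp_le[of "norm ?P" "norm (y - x)"] by simp
   hence "bump 0 (1/2) ?P >= 27/64" by (intro bump_ge_half) auto
   hence "?k ?P = 0" by (simp add: pcut_def)
   hence wP: "w ?P = 1 - (norm ?P)^2" by (simp add: w_def)
   have "y : ball 0 1 \<longleftrightarrow> (norm y)\<^sup>2 < 1" by (simp add: abs_square_less_1)
   also have "... \<longleftrightarrow> (- (y *. e))\<^sup>2 < w ?P" unfolding wP pyth[of y] by auto
   also have "... \<longleftrightarrow> - (y *. e) < sqrt (w ?P)"
    using ye real_less_rsqrt[of "- (y *. e)" "w ?P"] real_sqrt_less_mono[of "(- (y *. e))^2" "w ?P"]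
     power_strict_mono[of "- (y *. e)" "sqrt (w ?P)" 2] wp[of ?P] by auto
   also have "... \<longleftrightarrow> y : Om'" using r(3)[of y] yx(2) r(1) by (auto simp: dist_norm norm_minus_commute)
   finally show ?thesis by simp
  qed
  thus ?thesis using r(1,2) by (intro exI[of _ Om'] exI[of _ "min (r/2) (1/4)"]) auto
 qed
qed (use U in auto)
thus ?thesis by blast
qed

text \<open>The family is indexed by the outer radius R. Every patch near the hole lies in the unit
  ball and so does not feel R, while the far model is the ball of radius R, whose constant is that
  of the unit ball by scaling.\<close>

lemma perforated_LOCal:
fixes T :: "'a::euclidean_space set"
assumes pq: "conj_exp p q" and d: "q < real DIM('a)" and T: "closed T" "C1_boundary T" "T <= ball 0 1"
 and B: "!!l. l >= 0 ==> infsup (ball (0::'a) 1) l p q KB"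
shows "EX C>=0. ALL R:{1<..}. LOCal (ball 0 R - T) p q C 4"
proof -
let ?E = "EC TYPE('a) (min p q)"
have E0: "?E >= 0" by (rule EC_nonneg) (use conj_expD(1,2)[OF pq] in simp)
define K where "K = max (6 * ?E) KB"
have K: "K >= 0" "6 * ?E <= K" "?E <= K" "KB <= K" using E0 by (auto simp: K_def)
have cT: "compact T" using T bounded_subset[OF bounded_ball] by (auto simp: compact_eq_bounded_closed)
obtain rh where rh: "0 < rh" "rh < 1" "T <= ball 0 rh"
proof (cases "T = {}")
 case False
 obtain x where x: "x : T" "!!y. y : T ==> norm y <= norm x"
  using continuous_attains_sup[OF cT False continuous_on_norm_id] by blast
 hence "norm x < 1" using T(3) by auto
 thus ?thesis using x(2) by (intro that[of "(1 + norm x) / 2"]) (fastforce simp: add_pos_nonneg)+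
qed (use that[of "1/2"] in auto)
\<comment> \<open>The value of the unit bump at radius \<open>rh\<close>. The bump exceeds it on T,
  so that the far cutoff vanishes on T.\<close>
define b where "b = (1 - rh^2) ^ 3"
have r2: "0 < 1 - rh^2" using rh power_strict_mono[of rh 1 2] by simp
have b: "b > 0" using r2 by (simp add: b_def)
have bT: "bump 0 1 x > b" if "x : T" for x
proof -
 have "norm x < rh" using that rh(3) by auto
 hence "(norm x)^2 < rh\<^sup>2" by (intro power_strict_mono) auto
 hence "1 - rh^2 < max 0 (1 - (norm (x - 0))^2 / 1\<^sup>2)" using r2 by simp
 thus ?thesis unfolding b_def bump_def using r2 by (intro power_strict_mono) auto
qed
let ?ph = "pcut b (0::'a) 1"
\<comment> \<open>The region left to the patches, without the interior of the hole. Where the bump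
  is below b/3 the far cutoff is at least (2/3)^3 = 8/27, which exceeds the threshold 1/4.\<close>
define S where "S = {x. bump 0 1 x >= b / 3} - interior T"
have cb: "cont UNIV (bump (0::'a) 1)" by (rule C1_cont[OF bump_C1(1)])
have Sb: "norm x < 1" if "bump 0 1 x >= b / 3" for x :: 'a
proof (rule ccontr)
 assume "~ norm x < 1"
 thus False using that b bump_bounds(3)[of 1 x 0] by simp
qed
have cS: "compact S"
proof -
 have "closed S" unfolding S_def by (intro closed_Diff closed_Collect_le continuous_on_const cb open_interior)
 moreover have "S <= cball 0 1" using Sb by (force simp: S_def)
 ultimately show ?thesis using bounded_subset[OF bounded_cball] by (auto simp: compact_eq_bounded_closed)
qed
define A where "A = 18 / b + (6 / b^2 * 36 + 3 / b * (24 + 6 * real DIM('a)))"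
have m: "0 <= max 0 (1 - bump (0::'a) 1 x / b)" "max 0 (1 - bump (0::'a) 1 x / b) <= 1" for x
 using b bump_bounds(1)[of 1 "0::'a" x] by auto
have A0: "A >= 0" using b by (auto simp: A_def)
have cph: "cutoff (9 * A) 4 ?ph"
proof (rule cutoffI[OF pcut_C2(1)])
 fix x :: 'a
 show "abs (?ph x) <= 1" using pcut_bounds(1,2)[OF b, of 1 0 x] by simp
 have "18 / (b * 1) <= A" using b by (simp add: A_def)
 thus "norm (grad ?ph x) <= A" using pcut_bounds(3)[OF b, of 1 0 x] by simp
 let ?m = "max 0 (1 - bump (0::'a) 1 x / b)"
 have g2: "(norm (grad (bump (0::'a) 1) x))^2 <= 36" using bump_bounds(5)[of 1 "0::'a" x] power_mono[of "norm (grad (bump (0::'a) 1) x)" 6 2] by simp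
 have "abs (lap ?ph x) <= (6 / b^2 * ?m) * (norm (grad (bump (0::'a) 1) x))^2 + (3 / b * ?m^2) * abs (lap (bump (0::'a) 1) x)"
  unfolding pcut_C2(3) using b m(1)[of x] by (intro order_trans[OF abs_triangle_ineq]) (simp add: abs_mult)
 also have "... <= (6 / b^2 * 1) * 36 + (3 / b * 1) * (24 + 6 * real DIM('a))"
  using b m[of x] g2 bump_bounds(6)[of 1 "0::'a" x] by (intro add_mono mult_mono mul_l power_le_one) auto
 also have "... <= A" using b by (simp add: A_def)
 finally show "abs (lap ?ph x) <= A" .
 assume "norm x >= 2"
 thus "grad ?ph x = 0 & lap ?ph x = 0" using bump_bounds(7,8)[of 1 x 0] by (simp add: pcut_C2(2,3))
qed
show ?thesis
proof (rule LOCal_family[OF pq d K(1) cS _ _ cph, where Om="%R. ball 0 R - T" and Om0="%R. ball 0 R"])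
 show "S <= cball 0 1" using Sb by (force simp: S_def)
 show "0 <= 9 * A" using A0 by simp
 show "infsup (ball (0::'a) R) l p q K" if R: "R : {1<..}" and l: "l >= 0" for R l
 proof -
  have "(%x. R *: x) ` ball (0::'a) 1 = ball 0 R" using R by (simp add: ball_scale)
  thus ?thesis using infsup_mono[OF infsup_scale[OF pq _ B[of "R * l"]] K(4)] R l by simp
 qed
 show "(%x. ?ph x * pv x) : C1c (ball 0 R - T)" if h: "pv : C1c (ball 0 R)" for R pv
 proof -
  obtain L where L: "compact L" "L <= ball 0 R" "!!x. x ~: L ==> pv x = 0" using h by (rule C1c_support) blast
  show ?thesis
  proof (rule C1cI[of _ "{x. bump 0 1 x <= b} \<inter> L"])
   show "C1 (%x. ?ph x * pv x)" by (rule C1_mult(1)[OF C2_C1[OF pcut_C2(1)] C1cD(1)[OF h]])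
   show "compact ({x. bump 0 1 x <= b} \<inter> L)" by (intro closed_Int_compact[OF _ L(1)] closed_Collect_le cb continuous_on_const)
   show "{x. bump 0 1 x <= b} \<inter> L <= ball 0 R - T" using L(2) bT by force
   fix x assume "x ~: {x. bump 0 1 x <= b} \<inter> L"
   thus "?ph x * pv x = 0" using L(3)[of x] b by (auto simp: pcut_def max_def le_divide_eq)
  qed
 qed
 show "(%x. ?ph x * u x) : C1c (ball 0 R)" if "u : C1c (ball 0 R - T)" for R u
  by (rule C1c_mono[OF C1c_mult[OF that C2_C1[OF pcut_C2(1)]]]) auto
 show "x : S | 1/4 <= ?ph x" if "x : ball 0 R - T" for R x
 proof (cases "bump 0 1 x >= b / 3")
  case True
  thus ?thesis using that interior_subset[of T] by (auto simp: S_def)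
 next
  case False
  hence "2/3 <= max 0 (1 - bump 0 1 x / b)" using b by (simp add: field_simps le_max_iff_disj)
  hence "(2/3)^3 <= ?ph x" unfolding pcut_def by (rule power_mono) simp
  thus ?thesis by (simp add: power3_eq_cube)
 qed
 fix x assume x: "x : S"
 have x1: "x : ball 0 1" using x Sb by (auto simp: S_def)
 show "EX Om' r. 0 < r & r <= 1 & (ALL l. infsup Om' l p q K) & (ALL R:{1<..}. cball x r \<inter> Om' <= ball 0 R - T & cball x r \<inter> (ball 0 R - T) <= Om')"
 proof (cases "x : T")
  case False
  have "open (ball 0 1 - T)" using T(1) by (intro open_Diff) auto
  then obtain s where s: "s > 0" "cball x s <= ball 0 1 - T" using False x1 open_contains_cball by blast
  have "cball x (min s 1) \<inter> UNIV <= ball 0 R - T" if "R : {1<..}" for R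
  proof -
   have "ball 0 1 <= ball (0::'a) R" using that by (intro subset_ball) auto
   thus ?thesis using s(2) by auto
  qed
  thus ?thesis using s(1) infsup_mono[OF infsup_UNIV[OF pq] K(3)] by (intro exI[of _ UNIV] exI[of _ "min s 1"]) auto
 next
  case True
  hence "x : frontier T" using x T(1) by (auto simp: S_def frontier_def)
  then obtain U e pv where U: "open U" "x : U" "norm e = 1" "Ck 1 pv" "T \<inter> U = {y : U. y *. e <= pv (y - (y *. e) *: e)}"
   using T(2) unfolding C1_boundary_def by blast
  obtain Om' r where r: "r > 0" "!!l. infsup Om' l p q (6 * ?E)" "!!y. y : ball x r ==> y : Om' \<longleftrightarrow> y *. e > pv (y - (y *. e) *: e)"
   using chart[OF pq U(3) Ck_C1[OF U(4)], of x] by blast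
  have "open (U \<inter> ball 0 1 \<inter> ball x r)" using U(1) by auto
  then obtain s where s: "s > 0" "cball x s <= U \<inter> ball 0 1 \<inter> ball x r" using U(2) x1 r(1) open_contains_cball by (metis IntI centre_in_ball)
  have "y : Om' \<longleftrightarrow> y ~: T" "y : ball 0 1" if "y : cball x (min s 1)" for y
  proof -
   have y: "y : U" "y : ball 0 1" "y : ball x r" using that s(2) by auto
   thus "y : ball 0 1" by simp
   have "y : T \<longleftrightarrow> y *. e <= pv (y - (y *. e) *: e)" using U(5) y(1) by blast
   thus "y : Om' \<longleftrightarrow> y ~: T" using r(3)[OF y(3)] by auto
  qed
  hence "cball x (min s 1) \<inter> Om' <= ball 0 R - T & cball x (min s 1) \<inter> (ball 0 R - T) <= Om'" if "R : {1<..}" for R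
   using that by (fastforce simp: less_trans[of _ 1 R])
  thus ?thesis using s(1) infsup_mono[OF r(2) K(2)] by (intro exI[of _ Om'] exI[of _ "min s 1"]) auto
 qed
qed
qed
theorem theorem1p5:
  fixes T :: "'a::euclidean_space set" and p :: real
  assumes "DIM('a) \<ge> 4"
    and "closed_C1_domain T" and "T \<subseteq> ball 0 1"
    and "real DIM('a) / (real DIM('a) - 1) < p" and "p < real DIM('a)"
  shows "\<exists>C>0. \<forall>\<epsilon>\<in>{0<..<1}. \<forall>f\<in>Lp (perforated_ball T \<epsilon>) p. \<forall>u.
           weak_solution (perforated_ball T \<epsilon>) p f u \<longrightarrow>
           Lp_norm (perforated_ball T \<epsilon>) p (weak_gradient (perforated_ball T \<epsilon>) u)
             \<le> C * Lp_norm (perforated_ball T \<epsilon>) p f"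
proof -
let ?d = "real DIM('a)"
have d: "?d >= 4" using assms(1) by simp
have p1: "p > 1" by (rule less_trans[OF _ assms(4)]) (use d in \<open>simp add: less_divide_eq\<close>)
define q where "q = p / (p - 1)"
have pq: "conj_exp p q" unfolding q_def by (rule conj_exp_conv[OF p1])
note qp = conj_exp_sym[OF pq]
\<comment> \<open>The lower bound on p is the condition q < d on the conjugate exponent, under which
  Hardy's inequality holds for the test functions.\<close>
have qd: "q < ?d" using assms(4) p1 d by (simp add: q_def field_simps)
\<comment> \<open>Local estimates are collected for both exponents, since the case p < 2 draws on
  the dual one; the radius 4 is that of \<open>cutoffI\<close>.\<close>
obtain C C' where C: "C >= 0" "LOCal (ball (0::'a) 1) p q C 4" "C' >= 0" "LOCal (ball (0::'a) 1) q p C' 4"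
 using ball_LOCal[OF pq qd] ball_LOCal[OF qp assms(5)] by blast
have "EX K. ALL l>=0. infsup (ball (0::'a) 1) l p q K" using infsup_uniform[OF pq assms(5) qd, of 4 C C'] C by auto
moreover have "EX K. ALL l>=0. infsup (ball (0::'a) 1) l q p K" using infsup_uniform[OF qp qd assms(5), of 4 C' C] C by auto
ultimately obtain KB KB' where KB: "!!l. l >= 0 ==> infsup (ball (0::'a) 1) l p q KB" "!!l. l >= 0 ==> infsup (ball (0::'a) 1) l q p KB'" by blast
have T: "closed T" "C1_boundary T" using assms(2) closed_closure[of "interior T"] by (auto simp: closed_C1_domain_def)
obtain D D' where D: "D >= 0" "!!R. R > 1 ==> LOCal (ball 0 R - T) p q D 4" "D' >= 0" "!!R. R > 1 ==> LOCal (ball 0 R - T) q p D' 4"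
 using perforated_LOCal[OF pq qd T assms(3) KB(1)] perforated_LOCal[OF qp assms(5) T assms(3) KB(2)] by (auto simp: greaterThan_iff)
obtain K where K: "K >= 0" "!!Om::'a set. bounded Om ==> LOCal Om p q D 4 ==> LOCal Om q p D' 4 ==> ALL l>=0. infsup Om l p q K"
 using infsup_uniform[OF pq assms(5) qd, of 4 D D'] D(1,3) by auto
show ?thesis
\<comment> \<open>K is only known to be nonnegative, whereas a positive constant is asked
  for.\<close>
proof (intro exI[of _ "K + 1"] conjI ballI allI impI)
 show "K + 1 > 0" using K(1) by simp
 fix ep f u assume ep: "ep : {0<..<1::real}" and f: "f : Lp (perforated_ball T ep) p" and u: "weak_solution (perforated_ball T ep) p f u"
 have e: "ep > 0" "1 / ep > 1" using ep by auto
 \<comment> \<open>The domain is rescaled by 1/ep, so the hole is T itself and the outer radius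
   exceeds 1. The equation without zero-order term is l = 0, a value fixed by dilations.\<close>
 have "infsup (ball 0 (1/ep) - T) 0 p q K" using K(2)[OF bounded_diff[OF bounded_ball] D(2)[OF e(2)] D(4)[OF e(2)]] by simp
 hence "infsup ((%x. ep *: x) ` (ball 0 (1/ep) - T)) 0 p q K" using infsup_scale[OF pq e(1), of _ 0] by simp
 moreover have "(%x. ep *: x) ` (ball 0 (1/ep) - T) = perforated_ball T ep"
 proof -
  have "(%x. ep *: x) ` ball (0::'a) (1/ep) = ball 0 1" using e by (simp add: ball_scale)
  moreover have "inj (%x::'a. ep *: x)" using e by (simp add: inj_on_def)
  ultimately show ?thesis by (simp add: perforated_ball_def image_set_diff)
 qed
 moreover have "open (perforated_ball T ep)" unfolding perforated_ball_def by (intro open_Diff closed_scaling T) auto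
 ultimately have "Lp_norm (perforated_ball T ep) p (weak_gradient (perforated_ball T ep) u) <= K * Lp_norm (perforated_ball T ep) p f"
  using K(1) by (intro weak_solution_estimate[OF _ pq _ _ f u]) auto
 also have "... <= (K + 1) * Lp_norm (perforated_ball T ep) p f" by (intro mul_r) (auto simp: Lp_norm_def)
 finally show "Lp_norm (perforated_ball T ep) p (weak_gradient (perforated_ball T ep) u) <= (K + 1) * Lp_norm (perforated_ball T ep) p f" .
qed
qed

end
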